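(* Assume that $X$ is Harris recurrent, that $f:E\to\mathbb R$ is measurable with $\langle\pi,f^2\rangle<\infty$, that there exists a solution $F$ to the Poisson equation $F-PF=f-\langle\pi,f\rangle$ such that $\langle\pi,F^2\rangle<\infty$, and that $\beta:E\times\mathcal P\times E\to\mathbb R$ is measurable and square integrable: $\int\pi(dx)\mathcal Q(x,dA)\kappa(x,A,dy)\beta(x,A,y)^2<\infty$. Then: (i) The estimator $\mathcal I_n(f,\beta)$ of $\langle\pi,f\rangle$ is consistent: almost surely, $\lim_{n\to\infty}\mathcal I_n(f,\beta)=\langle\pi,f\rangle$. (ii) The estimator $\mathcal I_n(f,\beta)$ of $\langle\pi,f\rangle$ is asymptotically normal: $$\sqrt n\,\big(\mathcal I_n(f,\beta)-\langle\pi,f\rangle\big)\xrightarrow[n\to\infty]{(d)}\mathcal N(0,\sigma(f,\beta)^2),$$ and the asymptotic variance is given by $$\sigma(f,\beta)^2=\sigma(f)^2+\int\pi(dx)\mathcal Q(x,dA)\big[\mathrm{Var}_{\kappa_{x,A}}(\beta_{x,A}-F)-\mathrm{Var}_{\kappa_{x,A}}(F)\big],$$ with $\sigma(f)^2=\langle\pi,F^2-(PF)^2\rangle$. (iii) The asymptotic variance $\sigma(f,\beta)^2$ is minimal (over such $\beta$) for $\beta_{x,A}=F$, and $$\sigma(f,F)^2=\int\pi(dx)\left(\int\mathcal Q(x,dA)\langle\kappa_{x,A},F\rangle^2-\Big(\int\mathcal Q(x,dA)\langle\kappa_{x,A},F\rangle\Big)^2\right)\le\sigma(f)^2,$$ where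 $\sigma(f,F)^2$ denotes $\sigma(f,\beta)^2$ for $\beta(x,A,y)=F(y)$.
   Context: Let $(E,\mathcal F_E)$ be a measurable space with $\{x\}\in\mathcal F_E$ for all $x\in E$, and $\pi$ a probability measure on $E$ ($E$ need not be finite). For a measure $\nu$ and a function $h$, $\langle\nu,h\rangle=\int\nu(dy)h(y)$ when well defined; $\mathrm{Var}_\nu(h)=\langle\nu,h^2\rangle-\langle\nu,h\rangle^2$. Let $\mathcal P$ be the set of finite subsets of $E$. Let $\bar E=\bigcup_{n\ge1}E^n$ with the smallest $\sigma$-field $\mathcal F_{\bar E}$ containing all $A_1\times\cdots\times A_n$, $A_i\in\mathcal F_E$, $n\ge1$. Let $\Gamma:\bar E\to\mathcal P$ map $(x_1,\dots,x_n)$ to the set $\{x_1,\dots,x_n\}$, and let $\mathcal F_{\mathcal P}$ be the $\sigma$-field on $\mathcal P$ that is the image of $\mathcal F_{\bar E}$ by $\Gamma$ (i.e. $B\in\mathcal F_{\mathcal P}$ iff $\Gamma^{-1}(B)\in\mathcal F_{\bar E}$). Proposition kernel: a measurable probability kernel $\mathcal Q:E\times\mathcal F_{\mathcal P}\to[0,1]$ with $\int_{\mathcal P}\mathcal Q(x,dA)=1$ and $\int_{\mathcal P}\mathcal Q(x,dA)\mathbf 1_{\{x\notin A\}}=0$ for all $x$. Selection kernel: a measurable probability kernel $\kappa:E\times\mathcal P\times\mathcal F_E\to[0,1]$ with $\kappa(x,A,A)=1$ for $x\in A$; one writes $\kappa(x,A,dy)=\sum_{z\in A}\kappa(x,A,z)\delta_z(dy)$.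 They are assumed to satisfy $$\pi(dx)\mathcal Q(x,dA)\kappa(x,A,dy)=\pi(dy)\mathcal Q(y,dA)\kappa(y,A,dx).$$ Notation: $\kappa_{x,A}(dy)=\kappa(x,A,dy)$, $\beta_{x,A}(\cdot)=\beta(x,A,\cdot)$. Markov chain: $X_0$ has an arbitrary distribution $\nu_0$ on $E$; given the past up to step $n$, the proposal set $A_{n+1}$ is distributed according to $\mathcal Q(X_n,\cdot)$, then $X_{n+1}$ is distributed according to $\kappa(X_n,A_{n+1},\cdot)$. Its transition kernel is $P(x,dy)=\int_{\mathcal P}\mathcal Q(x,dA)\kappa(x,A,dy)$, reversible with respect to $\pi$; $Ph(x)=\int P(x,dy)h(y)$. Harris recurrence here means: for all $B\in\mathcal F_E$ with $\pi(B)>0$ and all $x\in E$, $\mathbb P(\mathrm{Card}\{n\ge0:X_n\in B\}=\infty\mid X_0=x)=1$. Estimators: $I_n(f)=\frac1n\sum_{k=1}^nf(X_k)$, $$\mathcal J_n(\beta)=\frac1n\sum_{k=0}^{n-1}\Big(\sum_{\tilde x\in A_{k+1}}\kappa(X_k,A_{k+1},\tilde x)\beta(X_k,A_{k+1},\tilde x)-\beta(X_k,A_{k+1},X_{k+1})\Big),\quad \mathcal I_n(f,\beta)=I_n(f)+\mathcal J_n(\beta).$$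
   Formalization: The chain is also required to satisfy X_n ∈ A_{n+1} almost surely for every n; this follows from the condition on Q when {(x,A): x∈A} is product measurable, but can fail for exotic sigma-fields, and then consistency (i) can be false. *)

theory Defs
  imports "HOL-Probability.Probability"
begin

section \<open>The space of finite subsets\<close>

text \<open>
  A measurable space \<open>E\<close> is given by a measure whose underlying set and sigma-field alone are used.
  Tuples of length \<open>n\<close> are lists of length \<open>n\<close>; a box is the product of a nonempty list of
  measurable sets, and the map sending a tuple to the set of its entries is \<^const>\<open>set\<close>.
\<close>

definition tuple_space :: "'a measure \<Rightarrow> 'a list measure" where
  "tuple_space E = sigma {xs. xs \<noteq> [] \<and> set xs \<subseteq> space E}
     {listset As | As. As \<noteq> [] \<and> set As \<subseteq> sets E}"

definition finite_subsets :: "'a measure \<Rightarrow> 'a set measure" where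
  "finite_subsets E = sigma {A. finite A \<and> A \<subseteq> space E}
     {B. B \<subseteq> {A. finite A \<and> A \<subseteq> space E} \<and> set -` B \<inter> space (tuple_space E) \<in> sets (tuple_space E)}"

lemma listset_subset: "set As \<subseteq> Pow S \<Longrightarrow> xs \<in> listset As \<Longrightarrow> length xs = length As \<and> set xs \<subseteq> S"
proof (induction As arbitrary: xs)
  case (Cons B As)
  then obtain y ys where "xs = y # ys" "y \<in> B" "ys \<in> listset As"
    by (auto simp: set_Cons_def)
  with Cons show ?case by auto
qed simp

lemma sets_tuple_space:
  "sets (tuple_space E) = sigma_sets {xs. xs \<noteq> [] \<and> set xs \<subseteq> space E}
     {listset As | As. As \<noteq> [] \<and> set As \<subseteq> sets E}"
  unfolding tuple_space_def
proof (rule sets_measure_of, safe)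
  fix As xs assume As: "As \<noteq> []" "set As \<subseteq> sets E" "xs \<in> listset As"
  then have "set As \<subseteq> Pow (space E)"
    using sets.sets_into_space by blast
  note * = listset_subset[OF this As(3)]
  show "x \<in> space E" if "x \<in> set xs" for x using * that by auto
  show False if "[] \<in> listset As"
    using listset_subset[OF \<open>set As \<subseteq> Pow (space E)\<close> that] As(1) by simp
qed

lemma space_tuple_space: "space (tuple_space E) = {xs. xs \<noteq> [] \<and> set xs \<subseteq> space E}"
  by (simp add: tuple_space_def space_measure_of_conv)

lemma space_finite_subsets: "space (finite_subsets E) = {A. finite A \<and> A \<subseteq> space E}"
  by (simp add: finite_subsets_def space_measure_of_conv)

text \<open>The generating family of \<^const>\<open>finite_subsets\<close> is already a sigma-field.\<close>

lemma sets_finite_subsets: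
  "B \<in> sets (finite_subsets E) \<longleftrightarrow>
     B \<subseteq> {A. finite A \<and> A \<subseteq> space E} \<and> set -` B \<inter> space (tuple_space E) \<in> sets (tuple_space E)"
proof -
  let ?P = "{A. finite A \<and> A \<subseteq> space E}"
  let ?T = "tuple_space E"
  let ?F = "{B. B \<subseteq> ?P \<and> set -` B \<inter> space ?T \<in> sets ?T}"
  have "sigma_algebra ?P ?F"
    unfolding sigma_algebra_iff2
  proof (intro conjI ballI allI impI)
    fix B assume B: "B \<in> ?F"
    have "set -` (?P - B) \<inter> space ?T = space ?T - (set -` B \<inter> space ?T)"
      by (auto simp: space_tuple_space)
    with B show "?P - B \<in> ?F" by auto
  next
    fix B :: "nat \<Rightarrow> 'a set set" assume B: "range B \<subseteq> ?F"
    have "set -` (\<Union>i. B i) \<inter> space ?T = (\<Union>i. set -` B i \<inter> space ?T)"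
      by auto
    moreover have "\<dots> \<in> sets ?T"
      using B by (intro sets.countable_UN) auto
    moreover have "(\<Union>i. B i) \<subseteq> ?P"
      using B by blast
    ultimately show "(\<Union>i. B i) \<in> ?F"
      by simp
  qed auto
  then have "sets (finite_subsets E) = ?F"
    unfolding finite_subsets_def by (rule sigma_algebra.sets_measure_of_eq)
  then show ?thesis by simp
qed

section \<open>Kernels\<close>

definition proposition_kernel :: "'a measure \<Rightarrow> ('a \<Rightarrow> 'a set measure) \<Rightarrow> bool" where
  "proposition_kernel E Q \<longleftrightarrow>
     Q \<in> E \<rightarrow>\<^sub>M prob_algebra (finite_subsets E) \<and>
     (\<forall>x\<in>space E. (\<integral>\<^sup>+A. indicator {A. x \<notin> A} A \<partial>Q x) = 0)"

definition selection_kernel :: "'a measure \<Rightarrow> ('a \<Rightarrow> 'a set \<Rightarrow> 'a measure) \<Rightarrow> bool" where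
  "selection_kernel E \<kappa> \<longleftrightarrow>
     (\<lambda>(x, A). \<kappa> x A) \<in> E \<Otimes>\<^sub>M finite_subsets E \<rightarrow>\<^sub>M prob_algebra E \<and>
     (\<forall>A\<in>space (finite_subsets E). \<forall>x\<in>A. measure (\<kappa> x A) A = 1)"

abbreviation triple_space :: "'a measure \<Rightarrow> ('a \<times> 'a set \<times> 'a) measure" where
  "triple_space E \<equiv> E \<Otimes>\<^sub>M (finite_subsets E \<Otimes>\<^sub>M E)"

text \<open>Equality of two measures in the variables \<open>(x, A, y)\<close>.\<close>

definition detailed_balance ::
  "'a measure \<Rightarrow> ('a \<Rightarrow> 'a set measure) \<Rightarrow> ('a \<Rightarrow> 'a set \<Rightarrow> 'a measure) \<Rightarrow> bool" where
  "detailed_balance \<pi> Q \<kappa> \<longleftrightarrow>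
     \<pi> \<bind> (\<lambda>x. Q x \<bind> (\<lambda>A. \<kappa> x A \<bind> (\<lambda>y. return (triple_space \<pi>) (x, A, y)))) =
     \<pi> \<bind> (\<lambda>y. Q y \<bind> (\<lambda>A. \<kappa> y A \<bind> (\<lambda>x. return (triple_space \<pi>) (x, A, y))))"

definition transition :: "('a \<Rightarrow> 'a set measure) \<Rightarrow> ('a \<Rightarrow> 'a set \<Rightarrow> 'a measure) \<Rightarrow> 'a \<Rightarrow> 'a measure" where
  "transition Q \<kappa> x = Q x \<bind> (\<lambda>A. \<kappa> x A)"

section \<open>The Markov chain\<close>

text \<open>
  Sigma-field generated by the states with indices \<open>0, \<dots>, m\<close> and the proposal sets with
  indices \<open>1, \<dots>, n\<close>; there is no proposal set with index \<open>0\<close>, so \<open>A 0\<close> is never used.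
\<close>

definition history ::
  "'w measure \<Rightarrow> 'a measure \<Rightarrow> (nat \<Rightarrow> 'w \<Rightarrow> 'a) \<Rightarrow> (nat \<Rightarrow> 'w \<Rightarrow> 'a set) \<Rightarrow> nat \<Rightarrow> nat \<Rightarrow> 'w measure" where
  "history M E X A m n = sigma (space M)
     ({X k -` B \<inter> space M | k B. k \<le> m \<and> B \<in> sets E} \<union>
      {A k -` B \<inter> space M | k B. 1 \<le> k \<and> k \<le> n \<and> B \<in> sets (finite_subsets E)})"

text \<open>
  The last clause says that the current state almost surely belongs to the proposal set. It follows
  from the other clauses and from the defining property of a proposition kernel whenever
  \<open>{(x, A). x \<in> A}\<close> is product measurable, in particular whenever the sigma-field of \<open>E\<close> contains a
  countable family separating points. It has to be spelled out otherwise: with the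
  countable-cocountable sigma-field on an uncountable set the conditional laws alone can have
  realizations in which the proposal sets never contain the current state.
\<close>

definition proposal_chain ::
  "'w measure \<Rightarrow> 'a measure \<Rightarrow> ('a \<Rightarrow> 'a set measure) \<Rightarrow> ('a \<Rightarrow> 'a set \<Rightarrow> 'a measure) \<Rightarrow>
   (nat \<Rightarrow> 'w \<Rightarrow> 'a) \<Rightarrow> (nat \<Rightarrow> 'w \<Rightarrow> 'a set) \<Rightarrow> bool" where
  "proposal_chain M E Q \<kappa> X A \<longleftrightarrow>
     prob_space M \<and>
     (\<forall>n. X n \<in> M \<rightarrow>\<^sub>M E) \<and>
     (\<forall>n. A (Suc n) \<in> M \<rightarrow>\<^sub>M finite_subsets E) \<and>
     (\<forall>n. \<forall>B\<in>sets (finite_subsets E). AE \<omega> in M.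
        real_cond_exp M (history M E X A n n) (indicator (A (Suc n) -` B \<inter> space M)) \<omega>
          = measure (Q (X n \<omega>)) B) \<and>
     (\<forall>n. \<forall>C\<in>sets E. AE \<omega> in M.
        real_cond_exp M (history M E X A n (Suc n)) (indicator (X (Suc n) -` C \<inter> space M)) \<omega>
          = measure (\<kappa> (X n \<omega>) (A (Suc n) \<omega>)) C) \<and>
     (\<forall>n. AE \<omega> in M. X n \<omega> \<in> A (Suc n) \<omega>)"

text \<open>
  Law on path space of the Markov chain with transition kernel \<open>P\<close> started at \<open>x\<close>, given by the
  theorem of Ionescu Tulcea.
\<close>

definition path_step :: "'a measure \<Rightarrow> ('a \<Rightarrow> 'a measure) \<Rightarrow> 'a \<Rightarrow> nat \<Rightarrow> (nat \<Rightarrow> 'a) \<Rightarrow> 'a measure" where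
  "path_step E P x n \<omega> = (case n of 0 \<Rightarrow> return E x | Suc k \<Rightarrow> P (\<omega> k))"

definition path_law :: "'a measure \<Rightarrow> ('a \<Rightarrow> 'a measure) \<Rightarrow> 'a \<Rightarrow> (nat \<Rightarrow> 'a) measure" where
  "path_law E P x =
     projective_family.lim UNIV (Ionescu_Tulcea.CI (path_step E P x) (\<lambda>_. E)) (\<lambda>_. E)"

lemma Ionescu_Tulcea_path_step:
  assumes P: "P \<in> E \<rightarrow>\<^sub>M prob_algebra E" and x: "x \<in> space E"
  shows "Ionescu_Tulcea (path_step E P x) (\<lambda>_. E)"
proof (rule Ionescu_Tulcea.intro)
  have *: "path_step E P x i \<in> PiM {0..<i} (\<lambda>_. E) \<rightarrow>\<^sub>M prob_algebra E" for i
  proof (cases i)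
    case 0
    then show ?thesis
      using x by (auto simp: path_step_def[abs_def] space_prob_algebra prob_space_return
                       intro!: measurable_const)
  next
    case (Suc k)
    have "(\<lambda>\<omega>. \<omega> k) \<in> PiM {0..<i} (\<lambda>_. E) \<rightarrow>\<^sub>M E"
      using Suc by (intro measurable_component_singleton) auto
    then show ?thesis
      using Suc by (auto simp: path_step_def[abs_def] intro: measurable_compose[OF _ P])
  qed
  show "path_step E P x i \<in> PiM {0..<i} (\<lambda>_. E) \<rightarrow>\<^sub>M subprob_algebra E" for i
    using * by (rule measurable_prob_algebraD)
  show "prob_space (path_step E P x i \<omega>)" if "\<omega> \<in> space (PiM {0..<i} (\<lambda>_. E))" for i \<omega>
    using measurable_space[OF * that] by (simp add: space_prob_algebra)
qed

lemma transition_kernel: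
  assumes "proposition_kernel E Q" "selection_kernel E \<kappa>"
  shows "transition Q \<kappa> \<in> E \<rightarrow>\<^sub>M prob_algebra E"
  unfolding transition_def[abs_def]
  using assms unfolding proposition_kernel_def selection_kernel_def
  by (auto intro!: measurable_bind_prob_space2)

definition harris_recurrent :: "'a measure \<Rightarrow> ('a \<Rightarrow> 'a measure) \<Rightarrow> bool" where
  "harris_recurrent \<pi> P \<longleftrightarrow>
     (\<forall>B\<in>sets \<pi>. emeasure \<pi> B > 0 \<longrightarrow>
        (\<forall>x\<in>space \<pi>. \<P>(\<omega> in path_law \<pi> P x. infinite {n. \<omega> n \<in> B}) = 1))"

section \<open>Poisson equation, estimators and asymptotic variance\<close>

text \<open>
  The Bochner integral is \<open>0\<close> for functions that are not integrable, hence the explicit requirement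
  that \<open>PF\<close> be well defined.
\<close>

definition poisson_solution ::
  "'a measure \<Rightarrow> ('a \<Rightarrow> 'a measure) \<Rightarrow> ('a \<Rightarrow> real) \<Rightarrow> ('a \<Rightarrow> real) \<Rightarrow> bool" where
  "poisson_solution \<pi> P f F \<longleftrightarrow>
     F \<in> borel_measurable \<pi> \<and>
     (\<forall>x\<in>space \<pi>. integrable (P x) F \<and> F x - (\<integral>y. F y \<partial>P x) = f x - (\<integral>y. f y \<partial>\<pi>))"

definition control_variate ::
  "'a measure \<Rightarrow> ('a \<Rightarrow> 'a set measure) \<Rightarrow> ('a \<Rightarrow> 'a set \<Rightarrow> 'a measure) \<Rightarrow>
   ('a \<Rightarrow> 'a set \<Rightarrow> 'a \<Rightarrow> real) \<Rightarrow> bool" where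
  "control_variate \<pi> Q \<kappa> \<beta> \<longleftrightarrow>
     (\<lambda>(x, A, y). \<beta> x A y) \<in> borel_measurable (triple_space \<pi>) \<and>
     (\<integral>\<^sup>+x. (\<integral>\<^sup>+A. (\<integral>\<^sup>+y. ennreal ((\<beta> x A y)\<^sup>2) \<partial>\<kappa> x A) \<partial>Q x) \<partial>\<pi>) < \<infinity>"

definition var :: "'a measure \<Rightarrow> ('a \<Rightarrow> real) \<Rightarrow> real" where
  "var \<nu> h = (\<integral>y. (h y)\<^sup>2 \<partial>\<nu>) - (\<integral>y. h y \<partial>\<nu>)\<^sup>2"

definition empirical_mean :: "(nat \<Rightarrow> 'w \<Rightarrow> 'a) \<Rightarrow> ('a \<Rightarrow> real) \<Rightarrow> nat \<Rightarrow> 'w \<Rightarrow> real" where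
  "empirical_mean X f n \<omega> = 1 / real n * (\<Sum>k=1..n. f (X k \<omega>))"

definition correction ::
  "('a \<Rightarrow> 'a set \<Rightarrow> 'a measure) \<Rightarrow> (nat \<Rightarrow> 'w \<Rightarrow> 'a) \<Rightarrow> (nat \<Rightarrow> 'w \<Rightarrow> 'a set) \<Rightarrow>
   ('a \<Rightarrow> 'a set \<Rightarrow> 'a \<Rightarrow> real) \<Rightarrow> nat \<Rightarrow> 'w \<Rightarrow> real" where
  "correction \<kappa> X A \<beta> n \<omega> = 1 / real n * (\<Sum>k<n.
     (\<Sum>z\<in>A (Suc k) \<omega>. measure (\<kappa> (X k \<omega>) (A (Suc k) \<omega>)) {z} * \<beta> (X k \<omega>) (A (Suc k) \<omega>) z)
       - \<beta> (X k \<omega>) (A (Suc k) \<omega>) (X (Suc k) \<omega>))"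

definition estimator ::
  "('a \<Rightarrow> 'a set \<Rightarrow> 'a measure) \<Rightarrow> (nat \<Rightarrow> 'w \<Rightarrow> 'a) \<Rightarrow> (nat \<Rightarrow> 'w \<Rightarrow> 'a set) \<Rightarrow>
   ('a \<Rightarrow> real) \<Rightarrow> ('a \<Rightarrow> 'a set \<Rightarrow> 'a \<Rightarrow> real) \<Rightarrow> nat \<Rightarrow> 'w \<Rightarrow> real" where
  "estimator \<kappa> X A f \<beta> n \<omega> = empirical_mean X f n \<omega> + correction \<kappa> X A \<beta> n \<omega>"

definition sigma_sq :: "'a measure \<Rightarrow> ('a \<Rightarrow> 'a measure) \<Rightarrow> ('a \<Rightarrow> real) \<Rightarrow> real" where
  "sigma_sq \<pi> P F = (\<integral>x. (F x)\<^sup>2 - (\<integral>y. F y \<partial>P x)\<^sup>2 \<partial>\<pi>)"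

definition sigma_sq_control ::
  "'a measure \<Rightarrow> ('a \<Rightarrow> 'a set measure) \<Rightarrow> ('a \<Rightarrow> 'a set \<Rightarrow> 'a measure) \<Rightarrow>
   ('a \<Rightarrow> real) \<Rightarrow> ('a \<Rightarrow> 'a set \<Rightarrow> 'a \<Rightarrow> real) \<Rightarrow> real" where
  "sigma_sq_control \<pi> Q \<kappa> F \<beta> = sigma_sq \<pi> (transition Q \<kappa>) F +
     (\<integral>x. (\<integral>A. var (\<kappa> x A) (\<lambda>y. \<beta> x A y - F y) - var (\<kappa> x A) F \<partial>Q x) \<partial>\<pi>)"

text \<open>Centred normal law with variance \<open>v \<ge> 0\<close>, a Dirac mass when \<open>v = 0\<close>.\<close>

definition centred_normal :: "real \<Rightarrow> real measure" where
  "centred_normal v = (if v = 0 then return borel 0 else density lborel (normal_density 0 (sqrt v)))"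

text \<open>
  Convergence in distribution. The law of a variable is taken under the completed probability. This
  changes nothing for measurable variables; it matters because the finite sums over proposal sets
  in \<^const>\<open>correction\<close> need only agree almost everywhere with a measurable function when
  \<open>{(A, y). y \<in> A}\<close> is not product measurable.
\<close>

definition converges_in_law :: "'w measure \<Rightarrow> (nat \<Rightarrow> 'w \<Rightarrow> real) \<Rightarrow> real measure \<Rightarrow> bool" where
  "converges_in_law M Z \<mu> \<longleftrightarrow> weak_conv_m (\<lambda>n. distr (completion M) borel (Z n)) \<mu>"

end

(*
  Write the centred estimator as S_n + PF(X_0) - PF(X_n), where S_n = sum_{k<n} g(X_k, A_{k+1}, X_{k+1})
  and g(x,A,y) = F(y) - PF(x) + <kappa_{x,A}, beta_{x,A}> - beta(x,A,y) is centred under the law of (A,y)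
  given x; a variance decomposition shows that its second moment is sigma(f,beta)^2.

  Suppose first that the initial law is at most C pi. Then every X_n has a law at most C pi, so second
  moments grow linearly and the strong law follows along squares, the blocks between consecutive squares
  being controlled by Cauchy-Schwarz. For the central limit theorem, truncate g and follow the
  characteristic function of a S_k with the perturbed test function 1 - a^2 u(X_k) / 2, where u - Pu
  is close in L^1(pi) to the conditional variance of g minus its mean. Such u exist: by reversibility the
  numbers <v, P^{2m} v> decrease, so P^{2m} v converges in L^2, and Harris recurrence makes the P-invariant
  limit of P^{2m} (v + Pv) constant.

  For an arbitrary initial law, Harris recurrence drives the chain out of a null set carrying the singular
  parts of the laws of all X_n; hence, up to an event of small probability, some X_n has a law dominated by
  a multiple of pi, and the chain restarted at time n is of the first kind.
*)

theory Submission
  imports Defs "HOL-Library.Discrete_Functions"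
begin

section \<open>Products of a measure with a kernel, and sojourn probabilities\<close>

text \<open>No ergodic theorem is used. A martingale central limit theorem usually asks for
  convergence of the averages of the conditional variances v(X_k); replacing v - <pi,v> by a
  coboundary u - Pu turns this requirement into a telescoping correction of the characteristic
  function. The strong law is likewise needed for martingale increments alone, since the Poisson
  equation has already removed f. Periodicity shapes the coboundary argument: -1 may be an
  eigenvalue of P, so P^m v need not converge; even iterates do, and adding P v to v removes the
  part on which P acts as -1. Square integrability of F and beta under pi says nothing about an
  initial law singular to pi, hence the detour through domination. The dominated chains live under
  finite measures that are not normalised, so that restricting to an event of the past stays within
  the same setting. The proposal set is treated as an abstract mark, which confines the sigma-field
  on finite subsets to the few places where it matters.\<close>

definition kernel_prod :: "'a measure \<Rightarrow> 'b measure \<Rightarrow> ('a \<Rightarrow> 'b measure) \<Rightarrow> ('a \<times> 'b) measure" where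
  "kernel_prod M N K = M \<bind> (\<lambda>x. distr (K x) (M \<Otimes>\<^sub>M N) (Pair x))"

lemma measurable_kernel_prod_step:
  assumes [measurable]: "K \<in> M \<rightarrow>\<^sub>M subprob_algebra N"
  shows "(\<lambda>x. distr (K x) (M \<Otimes>\<^sub>M N) (Pair x)) \<in> M \<rightarrow>\<^sub>M subprob_algebra (M \<Otimes>\<^sub>M N)"
  by (rule measurable_distr2[where M=N]) auto

lemma sets_kernel_prod [measurable_cong]:
  assumes "K \<in> M \<rightarrow>\<^sub>M subprob_algebra N" "space M \<noteq> {}"
  shows "sets (kernel_prod M N K) = sets (M \<Otimes>\<^sub>M N)"
  unfolding kernel_prod_def using assms by (intro sets_bind) auto

lemma nn_integral_kernel_prod:
  assumes K[measurable]: "K \<in> M \<rightarrow>\<^sub>M subprob_algebra N"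
    and h[measurable]: "h \<in> borel_measurable (M \<Otimes>\<^sub>M N)"
  shows "(\<integral>\<^sup>+z. h z \<partial>kernel_prod M N K) = (\<integral>\<^sup>+x. (\<integral>\<^sup>+y. h (x, y) \<partial>K x) \<partial>M)"
  unfolding kernel_prod_def
proof (subst nn_integral_bind[OF h measurable_kernel_prod_step[OF K]], rule nn_integral_cong)
  fix x assume x: "x \<in> space M"
  have "Pair x \<in> K x \<rightarrow>\<^sub>M M \<Otimes>\<^sub>M N"
    by (subst measurable_cong_sets[OF subprob_measurableD(2)[OF K x] refl]) (rule measurable_Pair1'[OF x])
  then show "integral\<^sup>N (distr (K x) (M \<Otimes>\<^sub>M N) (Pair x)) h = (\<integral>\<^sup>+ y. h (x, y) \<partial>K x)"
    by (simp add: nn_integral_distr)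
qed

text \<open>Transporting \<open>K x\<close> to the product space makes the integrand independent of
  \<open>x\<close>; only the measure varies, and it does so measurably. This also covers the points
  where the section is not integrable and the integral is 0 by convention.\<close>

lemma measurable_kernel_integral:
  fixes h :: "'a \<times> 'b \<Rightarrow> real"
  assumes K[measurable]: "K \<in> M \<rightarrow>\<^sub>M subprob_algebra N"
    and h[measurable]: "h \<in> borel_measurable (M \<Otimes>\<^sub>M N)"
  shows "(\<lambda>x. \<integral>y. h (x, y) \<partial>K x) \<in> borel_measurable M"
proof -
  have eq: "(\<integral>y. h (x, y) \<partial>K x) = (\<integral>z. h z \<partial>distr (K x) (M \<Otimes>\<^sub>M N) (Pair x))" if x: "x \<in> space M" for x
  proof (subst integral_distr[OF _ h])
    show "Pair x \<in> K x \<rightarrow>\<^sub>M M \<Otimes>\<^sub>M N"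
      by (subst measurable_cong_sets[OF subprob_measurableD(2)[OF K x] refl]) (rule measurable_Pair1'[OF x])
  qed simp
  have "(\<lambda>x. \<integral>z. h z \<partial>distr (K x) (M \<Otimes>\<^sub>M N) (Pair x)) \<in> borel_measurable M"
    by (rule measurable_compose[OF measurable_kernel_prod_step[OF K] integral_measurable_subprob_algebra[OF h]])
  then show ?thesis by (simp add: eq cong: measurable_cong)
qed

text \<open>Fubini for a kernel. The positive and negative parts of \<open>h\<close> are handled by
  the nonnegative version; sections fail to be integrable on a null set only, where the default
  value 0 of the inner integral is harmless.\<close>

lemma integral_kernel_prod:
  fixes h :: "'a \<times> 'b \<Rightarrow> real"
  assumes K[measurable]: "K \<in> M \<rightarrow>\<^sub>M subprob_algebra N" and ne: "space M \<noteq> {}"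
    and int: "integrable (kernel_prod M N K) h"
  shows "AE x in M. integrable (K x) (\<lambda>y. h (x, y))"
    and "integrable M (\<lambda>x. \<integral>y. h (x, y) \<partial>K x)"
    and "(\<integral>z. h z \<partial>kernel_prod M N K) = (\<integral>x. (\<integral>y. h (x, y) \<partial>K x) \<partial>M)"
proof -
  have h[measurable]: "h \<in> borel_measurable (M \<Otimes>\<^sub>M N)"
    using borel_measurable_integrable[OF int] measurable_cong_sets[OF sets_kernel_prod[OF K ne] refl] by blast
  have meas: "(\<lambda>y. h (x, y)) \<in> borel_measurable (K x)" if x: "x \<in> space M" for x
  proof -
    show ?thesis
      by (subst measurable_cong_sets[OF subprob_measurableD(2)[OF K x] refl])
        (rule measurable_compose[OF measurable_Pair1'[OF x] h])
  qed
  let ?N = "\<lambda>x. \<integral>\<^sup>+y. ennreal (norm (h (x, y))) \<partial>K x"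
  let ?p = "\<lambda>x. \<integral>\<^sup>+y. ennreal (h (x, y)) \<partial>K x"
  let ?m = "\<lambda>x. \<integral>\<^sup>+y. ennreal (- h (x, y)) \<partial>K x"
  have N_meas: "?N \<in> borel_measurable M" "?p \<in> borel_measurable M" "?m \<in> borel_measurable M"
    by (rule nn_integral_measurable_subprob_algebra2[OF _ K]; measurable)+
  note [measurable] = this
  have "(\<integral>\<^sup>+x. ?N x \<partial>M) = (\<integral>\<^sup>+z. ennreal (norm (h z)) \<partial>kernel_prod M N K)"
    by (subst nn_integral_kernel_prod[OF K]) auto
  also have "\<dots> < \<infinity>"
    using int by (simp add: integrable_iff_bounded)
  finally have fin: "(\<integral>\<^sup>+x. ?N x \<partial>M) < \<infinity>" .
  then have AEf: "AE x in M. ?N x \<noteq> \<infinity>"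
    using nn_integral_noteq_infinite[OF N_meas(1)] by auto
  then have "AE x in M. x \<in> space M \<and> ?N x \<noteq> \<infinity>"
    by auto
  then show AEi: "AE x in M. integrable (K x) (\<lambda>y. h (x, y))"
    by eventually_elim (auto simp: integrable_iff_bounded meas less_top[symmetric])
  have le: "?p x \<le> ?N x" "?m x \<le> ?N x" for x
    by (auto intro!: nn_integral_mono simp: ennreal_leI)
  have "(\<lambda>z. ennreal (h z)) \<in> borel_measurable (M \<Otimes>\<^sub>M N)" "(\<lambda>z. ennreal (- h z)) \<in> borel_measurable (M \<Otimes>\<^sub>M N)"
    by measurable
  note nnp = this[THEN nn_integral_kernel_prod[OF K]]
  have pf: "(\<integral>\<^sup>+x. ?p x \<partial>M) < \<infinity>" "(\<integral>\<^sup>+x. ?m x \<partial>M) < \<infinity>"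
    by (rule order_le_less_trans[OF nn_integral_mono[OF le(1)] fin],
        rule order_le_less_trans[OF nn_integral_mono[OF le(2)] fin])
  \<comment> \<open>Away from a null set the inner integrals are finite, so \<open>enn2real\<close>
    loses nothing there and the real functions have the right integrals.\<close>
  have eq1: "AE x in M. ennreal (enn2real (?p x)) = ?p x"
    using nn_integral_noteq_infinite[OF N_meas(2)] pf(1)
    by (auto elim!: eventually_mono simp: less_top[symmetric])
  have eq2: "AE x in M. ennreal (enn2real (?m x)) = ?m x"
    using nn_integral_noteq_infinite[OF N_meas(3)] pf(2)
    by (auto elim!: eventually_mono simp: less_top[symmetric])
  have nn: "(\<integral>\<^sup>+x. ennreal (enn2real (?p x)) \<partial>M) = (\<integral>\<^sup>+x. ?p x \<partial>M)"
      "(\<integral>\<^sup>+x. ennreal (enn2real (?m x)) \<partial>M) = (\<integral>\<^sup>+x. ?m x \<partial>M)"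
    by (rule nn_integral_cong_AE[OF eq1], rule nn_integral_cong_AE[OF eq2])
  have i1: "integrable M (\<lambda>x. enn2real (?p x))" "integrable M (\<lambda>x. enn2real (?m x))"
    by (rule integrableI_nonneg; use pf N_meas nn in simp)+
  have AEeq: "AE x in M. (\<integral>y. h (x, y) \<partial>K x) = enn2real (?p x) - enn2real (?m x)"
    using AEi by eventually_elim (rule real_lebesgue_integral_def)
  have Km: "(\<lambda>x. \<integral>y. h (x, y) \<partial>K x) \<in> borel_measurable M"
    by (rule measurable_kernel_integral[OF K h])
  show "integrable M (\<lambda>x. \<integral>y. h (x, y) \<partial>K x)"
    using Bochner_Integration.integrable_diff[OF i1] integrable_cong_AE[OF Km _ AEeq] by auto
  have "(\<integral>x. (\<integral>y. h (x, y) \<partial>K x) \<partial>M) = (\<integral>x. enn2real (?p x) \<partial>M) - (\<integral>x. enn2real (?m x) \<partial>M)"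
    using integral_cong_AE[OF Km _ AEeq] i1 by simp
  also have "\<dots> = enn2real (\<integral>\<^sup>+x. ?p x \<partial>M) - enn2real (\<integral>\<^sup>+x. ?m x \<partial>M)"
    by (simp add: integral_eq_nn_integral nn)
  also have "\<dots> = (\<integral>z. h z \<partial>kernel_prod M N K)"
    unfolding real_lebesgue_integral_def[OF int] by (simp only: nnp)
  finally show "(\<integral>z. h z \<partial>kernel_prod M N K) = (\<integral>x. (\<integral>y. h (x, y) \<partial>K x) \<partial>M)" by simp
qed

text \<open>The taboo kernel: one step of the chain killed outside \<open>B\<close>. Applied to the
  indicator of \<open>B\<close>, its power \<open>n\<close> gives the probability of being in
  \<open>B\<close> at all times \<open>0, ..., n\<close>. Values in \<open>ennreal\<close> keep the
  iteration free of integrability conditions.\<close>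

definition stay_op :: "('a \<Rightarrow> 'a measure) \<Rightarrow> 'a set \<Rightarrow> ('a \<Rightarrow> ennreal) \<Rightarrow> 'a \<Rightarrow> ennreal" where
  "stay_op P B h x = indicator B x * (\<integral>\<^sup>+y. h y \<partial>P x)"

lemma measurable_stay_op [measurable]:
  assumes "P \<in> E \<rightarrow>\<^sub>M prob_algebra E" "B \<in> sets E" "h \<in> borel_measurable E"
  shows "stay_op P B h \<in> borel_measurable E"
proof -
  have [measurable]: "P \<in> E \<rightarrow>\<^sub>M subprob_algebra E"
    using assms by (simp add: measurable_prob_algebraD)
  note nn_integral_measurable_subprob_algebra[measurable] assms(2,3)[measurable]
  show ?thesis
    unfolding stay_op_def[abs_def] by measurable
qed

lemma measurable_stay_op_pow [measurable]:
  assumes "P \<in> E \<rightarrow>\<^sub>M prob_algebra E" "B \<in> sets E" "h \<in> borel_measurable E"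
  shows "(stay_op P B ^^ n) h \<in> borel_measurable E"
  by (induction n) (auto intro!: measurable_stay_op assms)

lemma stay_op_pow_le_1:
  assumes P: "P \<in> E \<rightarrow>\<^sub>M prob_algebra E" and x: "x \<in> space E"
  shows "(stay_op P B ^^ n) (indicator B) x \<le> 1"
  using x
proof (induction n arbitrary: x)
  case (Suc n)
  interpret prob_space "P x" using measurable_space[OF P Suc.prems] by (simp add: space_prob_algebra)
  have sp: "space (P x) = space E"
    using measurable_space[OF P Suc.prems] by (auto simp: space_prob_algebra dest: sets_eq_imp_space_eq)
  have "(\<integral>\<^sup>+y. (stay_op P B ^^ n) (indicator B) y \<partial>P x) \<le> (\<integral>\<^sup>+y. 1 \<partial>P x)"
    using Suc.IH by (intro nn_integral_mono) (simp add: sp)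
  then show ?case by (auto simp: stay_op_def[of P B "(stay_op P B ^^ n) (indicator B)"] emeasure_space_1 split: split_indicator)
qed (auto split: split_indicator)

text \<open>Integrating out the last coordinate of the finite-dimensional law turns a product of
  indicators into a power of \<open>stay_op\<close>. This is the bridge from events of path space to
  iterated kernels.\<close>

lemma path_law_stay:
  assumes P: "P \<in> E \<rightarrow>\<^sub>M prob_algebra E" and x: "x \<in> space E" and B[measurable]: "B \<in> sets E"
  shows "emeasure (path_law E P x) {\<omega> \<in> space (path_law E P x). \<forall>k\<le>n. \<omega> k \<in> B}
    = (stay_op P B ^^ n) (indicator B) x"
proof -
  interpret IT: Ionescu_Tulcea "path_step E P x" "\<lambda>_. E"
    by (rule Ionescu_Tulcea_path_step[OF P x])
  note IT.C.simps [simp del]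
  \<comment> \<open>A function \<open>h\<close> of the last state is carried along so that the
    induction closes: integrating out the newest coordinate merely replaces \<open>h\<close> by a
    kernel integral at the previous one. The law \<open>IT.C 0 (Suc n)\<close> has
    \<open>n + 1\<close> coordinates, the first being the deterministic start.\<close>
  have *: "(\<integral>\<^sup>+\<omega>. (\<Prod>k\<le>n. indicator B (\<omega> k)) * h (\<omega> n) \<partial>IT.C 0 (Suc n) (\<lambda>_. undefined))
    = (stay_op P B ^^ n) (\<lambda>y. indicator B y * h y) x" if [measurable]: "h \<in> borel_measurable E" for h n
    using that
  proof (induction n arbitrary: h)
    case 0
    note [measurable] = 0
    have u: "(\<lambda>_. undefined) \<in> space (PiM {0..<0::nat} (\<lambda>_. E))" by (simp add: space_PiM)
    have [measurable]: "(\<lambda>\<omega>. \<omega> 0) \<in> PiM {0..<Suc 0} (\<lambda>_. E) \<rightarrow>\<^sub>M E" by measurable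
    have "(\<integral>\<^sup>+\<omega>. (\<Prod>k\<le>0::nat. indicator B (\<omega> k)) * h (\<omega> 0) \<partial>IT.C 0 (Suc 0) (\<lambda>_. undefined))
       = (\<integral>\<^sup>+\<omega>. indicator B (\<omega> 0) * h (\<omega> 0) \<partial>IT.eP 0 (\<lambda>_. undefined))"
      using bind_return[OF IT.measurable_eP u] by (simp add: IT.C.simps)
    also have "\<dots> = (\<integral>\<^sup>+y. indicator B y * h y \<partial>return E x)"
      by (subst IT.nn_integral_eP[OF u]) (auto simp: path_step_def)
    also have "\<dots> = indicator B x * h x"
      using x by (subst nn_integral_return) auto
    finally show ?case by simp
  next
    case (Suc n)
    note [measurable] = Suc.prems
    have u: "(\<lambda>_. undefined) \<in> space (PiM {0..<0::nat} (\<lambda>_. E))" by (simp add: space_PiM)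
    have [measurable]: "P \<in> E \<rightarrow>\<^sub>M subprob_algebra E"
      using P by (simp add: measurable_prob_algebraD)
    have comp: "k \<le> m \<Longrightarrow> (\<lambda>\<omega>. \<omega> k) \<in> PiM {0..<Suc m} (\<lambda>_. E) \<rightarrow>\<^sub>M E" for k m :: nat
      by (rule measurable_component_singleton) auto
    have prodm: "(\<lambda>\<omega>. (\<Prod>k\<le>m. indicator B (\<omega> k)) :: ennreal) \<in> borel_measurable (PiM {0..<Suc m} (\<lambda>_. E))" for m :: nat
      by (intro borel_measurable_prod_ennreal measurable_compose[OF comp] borel_measurable_indicator) auto
    have [measurable]: "(\<lambda>y. \<integral>\<^sup>+z. indicator B z * h z \<partial>P y) \<in> borel_measurable E"
      by (rule nn_integral_measurable_subprob_algebra2[where N=E]) auto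
    have m1: "IT.C 0 (Suc n) (\<lambda>_. undefined) \<in> space (subprob_algebra (PiM {0..<Suc n} (\<lambda>_. E)))"
      using measurable_space[OF IT.measurable_C[of 0 "Suc n"] u] by simp
    then have s1: "sets (IT.C 0 (Suc n) (\<lambda>_. undefined)) = sets (PiM {0..<Suc n} (\<lambda>_. E))"
      by (simp add: space_subprob_algebra)
    then have sp1: "space (IT.C 0 (Suc n) (\<lambda>_. undefined)) = space (PiM {0..<Suc n} (\<lambda>_. E))"
      by (rule sets_eq_imp_space_eq)
    have m2: "(\<lambda>\<omega>. (\<Prod>k\<le>Suc n. indicator B (\<omega> k)) * h (\<omega> (Suc n))) \<in> borel_measurable (PiM {0..<Suc (Suc n)} (\<lambda>_. E))"
      by (intro borel_measurable_times_ennreal prodm measurable_compose[OF comp Suc.prems] order_refl)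
    have "(\<integral>\<^sup>+\<omega>. (\<Prod>k\<le>Suc n. indicator B (\<omega> k)) * h (\<omega> (Suc n)) \<partial>IT.C 0 (Suc (Suc n)) (\<lambda>_. undefined))
      = (\<integral>\<^sup>+\<omega>. (\<integral>\<^sup>+\<omega>'. (\<Prod>k\<le>Suc n. indicator B (\<omega>' k)) * h (\<omega>' (Suc n)) \<partial>IT.eP (Suc n) \<omega>) \<partial>IT.C 0 (Suc n) (\<lambda>_. undefined))"
      unfolding IT.C.simps(2)[of 0 "Suc n"]
      apply (subst nn_integral_bind[where B="PiM {0..<Suc (Suc n)} (\<lambda>_. E)"])
        apply (rule m2)
       apply (subst measurable_cong_sets[OF s1 refl])
      using IT.measurable_eP[of "Suc n"] apply simp
      apply simp
      done
    also have "\<dots> = (\<integral>\<^sup>+\<omega>. (\<Prod>k\<le>n. indicator B (\<omega> k)) * (\<integral>\<^sup>+y. indicator B y * h y \<partial>P (\<omega> n)) \<partial>IT.C 0 (Suc n) (\<lambda>_. undefined))"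
    proof (rule nn_integral_cong)
      fix \<omega> assume "\<omega> \<in> space (IT.C 0 (Suc n) (\<lambda>_. undefined))"
      then have w: "\<omega> \<in> space (PiM {0..<Suc n} (\<lambda>_. E))" by (simp add: sp1)
      have wn: "\<omega> n \<in> space E" by (rule measurable_space[OF comp[OF order_refl] w])
      have sP: "sets (P (\<omega> n)) = sets E"
        using measurable_space[OF P wn] by (simp add: space_prob_algebra)
      have "(\<integral>\<^sup>+\<omega>'. (\<Prod>k\<le>Suc n. indicator B (\<omega>' k)) * h (\<omega>' (Suc n)) \<partial>IT.eP (Suc n) \<omega>)
        = (\<integral>\<^sup>+y. (\<Prod>k\<le>Suc n. indicator B (fun_upd \<omega> (Suc n) y k)) * h y \<partial>P (\<omega> n))"
        by (subst IT.nn_integral_eP[OF w m2]) (simp add: path_step_def fun_upd_same del: prod.atMost_Suc fun_upd_apply)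
      also have "\<dots> = (\<integral>\<^sup>+y. (\<Prod>k\<le>n. indicator B (\<omega> k)) * (indicator B y * h y) \<partial>P (\<omega> n))"
      proof (rule nn_integral_cong)
        fix y
        have "(\<Prod>k\<le>n. indicator B (fun_upd \<omega> (Suc n) y k)) = (\<Prod>k\<le>n. indicator B (\<omega> k) :: ennreal)"
          by (rule prod.cong) auto
        then show "(\<Prod>k\<le>Suc n. indicator B (fun_upd \<omega> (Suc n) y k)) * h y = (\<Prod>k\<le>n. indicator B (\<omega> k)) * (indicator B y * h y)"
          by (simp only: prod.atMost_Suc mult.assoc fun_upd_same)
      qed
      also have "\<dots> = (\<Prod>k\<le>n. indicator B (\<omega> k)) * (\<integral>\<^sup>+y. indicator B y * h y \<partial>P (\<omega> n))"
        by (rule nn_integral_cmult, subst measurable_cong_sets[OF sP refl]) (use Suc.prems B in simp)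
      finally show "(\<integral>\<^sup>+\<omega>'. (\<Prod>k\<le>Suc n. indicator B (\<omega>' k)) * h (\<omega>' (Suc n)) \<partial>IT.eP (Suc n) \<omega>)
         = (\<Prod>k\<le>n. indicator B (\<omega> k)) * (\<integral>\<^sup>+y. indicator B y * h y \<partial>P (\<omega> n))" .
    qed
    also have "\<dots> = (stay_op P B ^^ n) (\<lambda>y. indicator B y * (\<integral>\<^sup>+z. indicator B z * h z \<partial>P y)) x"
      by (rule Suc.IH) measurable
    also have "(\<lambda>y. indicator B y * (\<integral>\<^sup>+z. indicator B z * h z \<partial>P y)) = stay_op P B (\<lambda>y. indicator B y * h y)"
      by (simp add: stay_op_def[abs_def])
    finally show ?case by (simp add: funpow_swap1)
  qed
  let ?I = "{0..<Suc n}"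
  let ?X = "{\<omega> \<in> space (PiM ?I (\<lambda>_. E)). \<forall>k\<le>n. \<omega> k \<in> B}"
  have comp[measurable]: "k \<le> n \<Longrightarrow> (\<lambda>\<omega>. \<omega> k) \<in> PiM ?I (\<lambda>_. E) \<rightarrow>\<^sub>M E" for k
    by (rule measurable_component_singleton) auto
  have X[measurable]: "?X \<in> sets (PiM ?I (\<lambda>_. E))"
    by measurable
  \<comment> \<open>The event is a cylinder over the coordinates \<open>0, ..., n\<close>, so the
    projective limit reduces it to the finite-dimensional law.\<close>
  have "emeasure (path_law E P x) {\<omega> \<in> space (path_law E P x). \<forall>k\<le>n. \<omega> k \<in> B}
      = emeasure IT.PF.lim (IT.PF.emb UNIV ?I ?X)"
    unfolding path_law_def
    by (rule arg_cong2[where f=emeasure])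
      (auto simp: prod_emb_def space_PiM restrict_def PiE_iff extensional_def)
  also have "\<dots> = emeasure (IT.CI ?I) ?X"
    by (rule IT.lim) auto
  also have "\<dots> = emeasure (IT.C 0 (Suc n) (\<lambda>_. undefined)) (IT.PF.emb {0..<Suc n} ?I ?X)"
    by (rule IT.emeasure_CI) auto
  also have "IT.PF.emb {0..<Suc n} ?I ?X = ?X"
    by (rule prod_emb_id) (auto simp: space_PiM)
  also have "emeasure (IT.C 0 (Suc n) (\<lambda>_. undefined)) ?X
     = (\<integral>\<^sup>+\<omega>. (\<Prod>k\<le>n. indicator B (\<omega> k)) * 1 \<partial>IT.C 0 (Suc n) (\<lambda>_. undefined))"
  proof -
    have u: "(\<lambda>_. undefined) \<in> space (PiM {0..<0::nat} (\<lambda>_. E))" by (simp add: space_PiM)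
    have s1: "sets (IT.C 0 (Suc n) (\<lambda>_. undefined)) = sets (PiM ?I (\<lambda>_. E))"
      using IT.sets_C[OF u, of "Suc n"] by simp
    have "emeasure (IT.C 0 (Suc n) (\<lambda>_. undefined)) ?X = (\<integral>\<^sup>+\<omega>. indicator ?X \<omega> \<partial>IT.C 0 (Suc n) (\<lambda>_. undefined))"
      using X s1 by simp
    also have "\<dots> = (\<integral>\<^sup>+\<omega>. (\<Prod>k\<le>n. indicator B (\<omega> k)) * 1 \<partial>IT.C 0 (Suc n) (\<lambda>_. undefined))"
      using sets_eq_imp_space_eq[OF s1]
      by (intro nn_integral_cong) (auto split: split_indicator simp: prod_zero_iff)
    finally show ?thesis .
  qed
  also have "\<dots> = (stay_op P B ^^ n) (\<lambda>y. indicator B y * 1) x"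
    by (rule *) simp
  finally show ?thesis by simp
qed

text \<open>Infinitely many visits to the complement of \<open>B\<close> exclude a path that never
  leaves \<open>B\<close>; continuity from above then makes the probability of staying up to time
  \<open>n\<close> vanish. This is the only place where Harris recurrence is unfolded, and it yields
  the limit at every starting point, not just at almost every one.\<close>

lemma harris_stay:
  assumes P: "P \<in> \<pi> \<rightarrow>\<^sub>M prob_algebra \<pi>" and H: "harris_recurrent \<pi> P"
    and B[measurable]: "B \<in> sets \<pi>" and pos: "emeasure \<pi> (space \<pi> - B) > 0" and x: "x \<in> space \<pi>"
  shows "(\<lambda>n. (stay_op P B ^^ n) (indicator B) x) \<longlonglongrightarrow> 0"
proof -
  interpret IT: Ionescu_Tulcea "path_step \<pi> P x" "\<lambda>_. \<pi>"
    by (rule Ionescu_Tulcea_path_step[OF P x])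
  let ?L = "path_law \<pi> P x"
  have sL: "sets ?L = sets (PiM UNIV (\<lambda>_. \<pi>))" unfolding path_law_def by simp
  have [measurable]: "(\<lambda>\<omega>. \<omega> k) \<in> ?L \<rightarrow>\<^sub>M \<pi>" for k
    by (subst measurable_cong_sets[OF sL refl]) simp
  let ?Z = "\<lambda>n. {\<omega> \<in> space ?L. \<forall>k\<le>n. \<omega> k \<in> B}"
  have h1: "measure ?L {\<omega> \<in> space ?L. infinite {n. \<omega> n \<in> space \<pi> - B}} = 1"
    using H pos x by (auto simp: harris_recurrent_def)
  \<comment> \<open>Total mass 1 is read off from the sojourn formula at time 0 with the whole space
    as the set.\<close>
  have spL: "emeasure ?L (space ?L) = 1"
  proof -
    have "space ?L = {\<omega> \<in> space ?L. \<forall>k\<le>(0::nat). \<omega> k \<in> space \<pi>}"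
      using sets_eq_imp_space_eq[OF sL] by (auto simp: space_PiM)
    then have "emeasure ?L (space ?L) = (stay_op P (space \<pi>) ^^ 0) (indicator (space \<pi>)) x"
      using path_law_stay[OF P x sets.top, of 0] by simp
    then show ?thesis using x by simp
  qed
  interpret L: prob_space ?L by (rule prob_spaceI) (rule spL)
  have "(\<lambda>n. emeasure ?L (?Z n)) \<longlonglongrightarrow> emeasure ?L (\<Inter>n. ?Z n)"
    by (rule Lim_emeasure_decseq) (auto simp: decseq_def)
  also have "(\<Inter>n. ?Z n) = {\<omega> \<in> space ?L. \<forall>k. \<omega> k \<in> B}"
    by auto
  also have "emeasure ?L \<dots> = 0"
  proof (rule emeasure_eq_0_AE)
    have "AE \<omega> in ?L. infinite {n. \<omega> n \<in> space \<pi> - B}"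
      using h1 by (subst (asm) L.prob_Collect_eq_1) (auto simp: infinite_nat_iff_unbounded_le)
    then show "AE \<omega> in ?L. \<not> (\<forall>k. \<omega> k \<in> B)"
    proof eventually_elim
      case (elim \<omega>)
      then obtain k where "\<omega> k \<in> space \<pi> - B"
        by (metis (mono_tags, lifting) not_finite_existsD)
      then show ?case by auto
    qed
  qed
  finally show ?thesis by (simp add: path_law_stay[OF P x B])
qed

section \<open>Self-adjoint Markov operators on bounded functions, and L1-density of the
  coboundaries among functions of mean zero\<close>

section \<open>Reversible kernels and coboundaries\<close>

locale prob_kernel = prob_space \<pi> for \<pi> :: "'a measure" +
  fixes P :: "'a \<Rightarrow> 'a measure"
  assumes kernel: "P \<in> \<pi> \<rightarrow>\<^sub>M prob_algebra \<pi>"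
begin

lemma kernel_subprob [measurable]: "P \<in> \<pi> \<rightarrow>\<^sub>M subprob_algebra \<pi>"
  using kernel by (rule measurable_prob_algebraD)

lemma prob_space_kernel: "x \<in> space \<pi> \<Longrightarrow> prob_space (P x)"
  and sets_kernel_eq: "x \<in> space \<pi> \<Longrightarrow> sets (P x) = sets \<pi>"
  using measurable_space[OF kernel] by (auto simp: space_prob_algebra)

lemma space_kernel_eq: "x \<in> space \<pi> \<Longrightarrow> space (P x) = space \<pi>"
  by (rule sets_eq_imp_space_eq[OF sets_kernel_eq])

text \<open>The bound is imposed at every point, not almost everywhere: a \<open>\<pi>\<close>-null
  set may be charged by some \<open>P x\<close>, and integrals under \<open>P x\<close> have to
  exist for each \<open>x\<close>. The constant is a parameter because the kernel preserves
  it.\<close>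

definition bdd_meas :: "real \<Rightarrow> ('a \<Rightarrow> real) \<Rightarrow> bool" where
  "bdd_meas c f \<longleftrightarrow> f \<in> borel_measurable \<pi> \<and> (\<forall>x\<in>space \<pi>. \<bar>f x\<bar> \<le> c)"

definition op :: "('a \<Rightarrow> real) \<Rightarrow> 'a \<Rightarrow> real" where
  "op f x = (\<integral>y. f y \<partial>P x)"

lemma bdd_measD [measurable_dest]: "bdd_meas c f \<Longrightarrow> f \<in> borel_measurable \<pi>"
  by (simp add: bdd_meas_def)

lemma bdd_meas_le: "bdd_meas c f \<Longrightarrow> x \<in> space \<pi> \<Longrightarrow> \<bar>f x\<bar> \<le> c"
  by (simp add: bdd_meas_def)

lemma bdd_meas_integrable: "bdd_meas c f \<Longrightarrow> integrable \<pi> f"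
  by (rule integrable_const_bound[where B=c]) (auto simp: bdd_meas_def)

lemma bdd_meas_integrable_kernel: "bdd_meas c f \<Longrightarrow> x \<in> space \<pi> \<Longrightarrow> integrable (P x) f"
proof -
  assume f: "bdd_meas c f" and x: "x \<in> space \<pi>"
  interpret K: prob_space "P x" using prob_space_kernel[OF x] .
  have "f \<in> borel_measurable (P x)"
    by (subst measurable_cong_sets[OF sets_kernel_eq[OF x] refl]) (rule bdd_measD[OF f])
  then show ?thesis
    by (rule K.integrable_const_bound[where B=c, rotated])
      (use f space_kernel_eq[OF x] in \<open>auto simp: bdd_meas_def\<close>)
qed

lemma op_measurable [measurable]:
  assumes "f \<in> borel_measurable \<pi>" shows "op f \<in> borel_measurable \<pi>"
  unfolding op_def[abs_def]
  by (rule measurable_compose[OF kernel_subprob integral_measurable_subprob_algebra[OF assms]])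

lemma bdd_meas_op: assumes f: "bdd_meas c f" shows "bdd_meas c (op f)"
  unfolding bdd_meas_def
proof (intro conjI ballI)
  show "op f \<in> borel_measurable \<pi>" using f by measurable
  fix x assume x: "x \<in> space \<pi>"
  interpret K: prob_space "P x" using prob_space_kernel[OF x] .
  have "\<bar>op f x\<bar> \<le> (\<integral>y. \<bar>f y\<bar> \<partial>P x)"
    unfolding op_def by (rule integral_abs_bound)
  also have "\<dots> \<le> (\<integral>y. c \<partial>P x)"
    using bdd_meas_integrable_kernel[OF f x] f space_kernel_eq[OF x]
    by (intro integral_mono) (auto simp: bdd_meas_def)
  finally show "\<bar>op f x\<bar> \<le> c" by (simp add: K.prob_space)
qed

lemma bdd_meas_add: "bdd_meas c f \<Longrightarrow> bdd_meas d g \<Longrightarrow> bdd_meas (c + d) (\<lambda>x. f x + g x)"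
  unfolding bdd_meas_def by (auto intro: order_trans[OF abs_triangle_ineq] add_mono)

lemma bdd_meas_cmult: "bdd_meas c f \<Longrightarrow> bdd_meas (\<bar>a\<bar> * c) (\<lambda>x. a * f x)"
  unfolding bdd_meas_def by (auto simp: abs_mult intro!: mult_left_mono)

lemma bdd_meas_diff: "bdd_meas c f \<Longrightarrow> bdd_meas d g \<Longrightarrow> bdd_meas (c + d) (\<lambda>x. f x - g x)"
  unfolding bdd_meas_def by (auto intro: order_trans[OF abs_triangle_ineq4] add_mono)

lemma bdd_meas_mult: "bdd_meas c f \<Longrightarrow> bdd_meas d g \<Longrightarrow> bdd_meas (c * d) (\<lambda>x. f x * g x)"
  unfolding bdd_meas_def abs_mult
  by (auto intro!: mult_mono' dest: bspec intro: order_trans[OF abs_ge_zero])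

lemma op_add: "bdd_meas c f \<Longrightarrow> bdd_meas d g \<Longrightarrow> x \<in> space \<pi> \<Longrightarrow> op (\<lambda>x. f x + g x) x = op f x + op g x"
  unfolding op_def by (simp add: bdd_meas_integrable_kernel)

lemma op_diff: "bdd_meas c f \<Longrightarrow> bdd_meas d g \<Longrightarrow> x \<in> space \<pi> \<Longrightarrow> op (\<lambda>x. f x - g x) x = op f x - op g x"
  unfolding op_def by (simp add: bdd_meas_integrable_kernel)

lemma op_cmult: "op (\<lambda>x. a * f x) x = a * op f x"
  unfolding op_def by simp

lemma op_cong: "(\<And>y. y \<in> space \<pi> \<Longrightarrow> f y = g y) \<Longrightarrow> x \<in> space \<pi> \<Longrightarrow> op f x = op g x"
  unfolding op_def by (rule Bochner_Integration.integral_cong) (auto simp: space_kernel_eq)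

lemma bdd_meas_op_pow: "bdd_meas c f \<Longrightarrow> bdd_meas c ((op ^^ n) f)"
  by (induction n) (auto intro: bdd_meas_op)

lemma op_pow_add: "bdd_meas c f \<Longrightarrow> bdd_meas d g \<Longrightarrow> x \<in> space \<pi> \<Longrightarrow>
  (op ^^ n) (\<lambda>x. f x + g x) x = (op ^^ n) f x + (op ^^ n) g x"
proof (induction n arbitrary: x)
  case (Suc n)
  have "op ((op ^^ n) (\<lambda>x. f x + g x)) x = op (\<lambda>x. (op ^^ n) f x + (op ^^ n) g x) x"
    using Suc by (intro op_cong) auto
  also have "\<dots> = op ((op ^^ n) f) x + op ((op ^^ n) g) x"
    using Suc.prems by (intro op_add bdd_meas_op_pow)
  finally show ?case by simp
qed simp

lemma op_pow_cmult: "x \<in> space \<pi> \<Longrightarrow> (op ^^ n) (\<lambda>x. a * f x) x = a * (op ^^ n) f x"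
proof (induction n arbitrary: x)
  case (Suc n)
  have "op ((op ^^ n) (\<lambda>x. a * f x)) x = op (\<lambda>x. a * (op ^^ n) f x) x"
    using Suc by (intro op_cong) auto
  then show ?case by (simp add: op_cmult)
qed simp

text \<open>Jensen's inequality, read off from the nonnegativity of a variance.\<close>

lemma op_sq_le: assumes f: "bdd_meas c f" and x: "x \<in> space \<pi>" shows "(op f x)\<^sup>2 \<le> op (\<lambda>y. (f y)\<^sup>2) x"
proof -
  interpret K: prob_space "P x" using prob_space_kernel[OF x] .
  have "0 \<le> K.variance f" by simp
  also have "K.variance f = op (\<lambda>y. (f y)\<^sup>2) x - (op f x)\<^sup>2"
    unfolding op_def
    using bdd_meas_integrable_kernel[OF f x] bdd_meas_integrable_kernel[OF bdd_meas_mult[OF f f] x]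
    by (intro K.variance_eq) (auto simp: power2_eq_square)
  finally show ?thesis by simp
qed

end

text \<open>Symmetry is required for nonnegative functions of the pair, the form that detailed
  balance delivers once the proposal set is integrated out; invariance of \<open>\<pi>\<close> and
  self-adjointness both follow from it.\<close>

locale reversible_kernel = prob_kernel +
  assumes reversible: "h \<in> borel_measurable (\<pi> \<Otimes>\<^sub>M \<pi>) \<Longrightarrow>
    (\<integral>\<^sup>+x. (\<integral>\<^sup>+y. h (x, y) \<partial>P x) \<partial>\<pi>) = (\<integral>\<^sup>+x. (\<integral>\<^sup>+y. h (y, x) \<partial>P x) \<partial>\<pi>)"
begin

lemma invariant:
  assumes [measurable]: "h \<in> borel_measurable \<pi>"
  shows "(\<integral>\<^sup>+x. (\<integral>\<^sup>+y. h y \<partial>P x) \<partial>\<pi>) = (\<integral>\<^sup>+x. h x \<partial>\<pi>)"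
proof -
  have "(\<integral>\<^sup>+x. (\<integral>\<^sup>+y. h y \<partial>P x) \<partial>\<pi>) = (\<integral>\<^sup>+x. (\<integral>\<^sup>+y. h x \<partial>P x) \<partial>\<pi>)"
    using reversible[of "\<lambda>(x, y). h y"] by simp
  also have "\<dots> = (\<integral>\<^sup>+x. h x \<partial>\<pi>)"
    by (intro nn_integral_cong) (simp add: prob_space.emeasure_space_1[OF prob_space_kernel])
  finally show ?thesis .
qed

abbreviation R where "R \<equiv> kernel_prod \<pi> \<pi> P"

lemma sets_R [measurable_cong]: "sets R = sets (\<pi> \<Otimes>\<^sub>M \<pi>)"
  by (rule sets_kernel_prod) (auto simp: not_empty)

lemma space_R: "space R = space \<pi> \<times> space \<pi>"
  using sets_eq_imp_space_eq[OF sets_R] by (simp add: space_pair_measure)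

lemma prob_space_R: "prob_space R"
proof
  have "emeasure R (space R) = (\<integral>\<^sup>+z. 1 \<partial>R)" by simp
  also have "\<dots> = 1"
    by (subst nn_integral_kernel_prod)
      (simp_all add: prob_space.emeasure_space_1[OF prob_space_kernel] emeasure_space_1 cong: nn_integral_cong)
  finally show "emeasure R (space R) = 1" .
qed

lemma R_swap: "distr R (\<pi> \<Otimes>\<^sub>M \<pi>) (\<lambda>(x, y). (y, x)) = R"
proof (rule measure_eqI)
  fix A assume "A \<in> sets (distr R (\<pi> \<Otimes>\<^sub>M \<pi>) (\<lambda>(x, y). (y, x)))"
  then have A[measurable]: "A \<in> sets (\<pi> \<Otimes>\<^sub>M \<pi>)" by simp
  have "emeasure (distr R (\<pi> \<Otimes>\<^sub>M \<pi>) (\<lambda>(x, y). (y, x))) A = (\<integral>\<^sup>+z. indicator A z \<partial>distr R (\<pi> \<Otimes>\<^sub>M \<pi>) (\<lambda>(x, y). (y, x)))"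
    by simp
  also have "\<dots> = (\<integral>\<^sup>+z. indicator A (case z of (x, y) \<Rightarrow> (y, x)) \<partial>R)"
    by (subst nn_integral_distr) auto
  also have "\<dots> = (\<integral>\<^sup>+x. (\<integral>\<^sup>+y. indicator A (y, x) \<partial>P x) \<partial>\<pi>)"
    by (subst nn_integral_kernel_prod) auto
  also have "\<dots> = (\<integral>\<^sup>+x. (\<integral>\<^sup>+y. indicator A (x, y) \<partial>P x) \<partial>\<pi>)"
    by (rule reversible[symmetric]) simp
  also have "\<dots> = (\<integral>\<^sup>+z. indicator A z \<partial>R)"
    by (subst nn_integral_kernel_prod) auto
  also have "\<dots> = emeasure R A" by (simp add: sets_R)
  finally show "emeasure (distr R (\<pi> \<Otimes>\<^sub>M \<pi>) (\<lambda>(x, y). (y, x))) A = emeasure R A" .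
qed (simp add: sets_R)

lemma integral_R_swap:
  assumes "h \<in> borel_measurable (\<pi> \<Otimes>\<^sub>M \<pi>)"
  shows "(\<integral>z. h z \<partial>R) = (\<integral>(x, y). (h (y, x) :: real) \<partial>R)"
proof -
  have "(\<integral>z. h z \<partial>R) = (\<integral>z. h z \<partial>distr R (\<pi> \<Otimes>\<^sub>M \<pi>) (\<lambda>(x, y). (y, x)))" by (simp add: R_swap)
  also have "\<dots> = (\<integral>(x, y). h (y, x) \<partial>R)"
    using assms by (subst integral_distr) (auto simp: case_prod_beta')
  finally show ?thesis .
qed

lemma integrable_R:
  assumes "bdd_meas c f" "bdd_meas d g" shows "integrable R (\<lambda>(x, y). f x * g y)"
proof -
  interpret R: prob_space R by (rule prob_space_R)
  note assms[THEN bdd_measD, measurable]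
  have "0 \<le> c" using assms(1) not_empty by (auto simp: bdd_meas_def intro: order_trans[OF abs_ge_zero])
  then have "\<bar>f x * g y\<bar> \<le> c * d" if "x \<in> space \<pi>" "y \<in> space \<pi>" for x y
    using bdd_meas_le[OF assms(1) that(1)] bdd_meas_le[OF assms(2) that(2)] by (simp add: abs_mult mult_mono)
  then show ?thesis
    by (intro R.integrable_const_bound[where B="c * d"] AE_I2) (auto simp: space_R)
qed

text \<open>Both sides are integrals of a product \<open>f x * g y\<close> under the symmetric law
  \<open>R\<close> of two consecutive states.\<close>

lemma op_adjoint:
  assumes f: "bdd_meas c f" and g: "bdd_meas d g"
  shows "(\<integral>x. f x * op g x \<partial>\<pi>) = (\<integral>x. op f x * g x \<partial>\<pi>)"
proof -
  note f[THEN bdd_measD, measurable] g[THEN bdd_measD, measurable]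
  have *: "(\<integral>x. f x * op g x \<partial>\<pi>) = (\<integral>(x, y). f x * g y \<partial>R)" if "bdd_meas c f" "bdd_meas d g" for c d f g
    using integral_kernel_prod(3)[OF kernel_subprob not_empty integrable_R[OF that]]
    by (simp add: op_def)
  have "(\<integral>(x, y). f x * g y \<partial>R) = (\<integral>(x, y). f y * g x \<partial>R)"
    by (subst integral_R_swap) auto
  also have "\<dots> = (\<integral>(x, y). g x * f y \<partial>R)" by (simp add: mult.commute)
  finally show ?thesis using *[OF f g] *[OF g f] by (simp add: mult.commute)
qed

lemma integral_op:
  assumes f: "bdd_meas c f"
  shows "(\<integral>x. op f x \<partial>\<pi>) = (\<integral>x. f x \<partial>\<pi>)"
proof -
  have 1: "bdd_meas 1 (\<lambda>_. 1)" by (simp add: bdd_meas_def)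
  have "(\<integral>x. 1 * op f x \<partial>\<pi>) = (\<integral>x. op (\<lambda>_. 1) x * f x \<partial>\<pi>)" by (rule op_adjoint[OF 1 f])
  also have "\<dots> = (\<integral>x. 1 * f x \<partial>\<pi>)"
    by (intro Bochner_Integration.integral_cong) (auto simp: op_def prob_space.prob_space[OF prob_space_kernel])
  finally show ?thesis by simp
qed

lemma integral_op_pow: "bdd_meas c f \<Longrightarrow> (\<integral>x. (op ^^ n) f x \<partial>\<pi>) = (\<integral>x. f x \<partial>\<pi>)"
  by (induction n) (auto simp: integral_op[OF bdd_meas_op_pow])

lemma L1_op_le:
  assumes f: "bdd_meas c f"
  shows "(\<integral>x. \<bar>op f x\<bar> \<partial>\<pi>) \<le> (\<integral>x. \<bar>f x\<bar> \<partial>\<pi>)"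
proof -
  have fa: "bdd_meas c (\<lambda>x. \<bar>f x\<bar>)" using f by (auto simp: bdd_meas_def)
  have "(\<integral>x. \<bar>op f x\<bar> \<partial>\<pi>) \<le> (\<integral>x. op (\<lambda>x. \<bar>f x\<bar>) x \<partial>\<pi>)"
    using bdd_meas_integrable[OF bdd_meas_op[OF f]] bdd_meas_integrable[OF bdd_meas_op[OF fa]]
    by (intro integral_mono integrable_abs) (auto simp: op_def[abs_def])
  then show ?thesis by (simp add: integral_op[OF fa])
qed

text \<open>Self-adjointness moves one factor at a time, so scalar products of iterates depend on
  the sum of the exponents alone.\<close>

lemma op_pow_adjoint:
  assumes f: "bdd_meas c f"
  shows "(\<integral>x. (op ^^ k) f x * (op ^^ l) f x \<partial>\<pi>) = (\<integral>x. f x * (op ^^ (k + l)) f x \<partial>\<pi>)"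
proof (induction k arbitrary: l)
  case (Suc k)
  have "(\<integral>x. op ((op ^^ k) f) x * (op ^^ l) f x \<partial>\<pi>) = (\<integral>x. (op ^^ k) f x * op ((op ^^ l) f) x \<partial>\<pi>)"
    by (rule op_adjoint[OF bdd_meas_op_pow[OF f] bdd_meas_op_pow[OF f], symmetric])
  also have "\<dots> = (\<integral>x. f x * (op ^^ (k + Suc l)) f x \<partial>\<pi>)"
    using Suc.IH[of "Suc l"] by simp
  finally show ?case by simp
qed simp

lemma L1_le_sqrt_L2:
  assumes f: "bdd_meas c f" shows "(\<integral>x. \<bar>f x\<bar> \<partial>\<pi>)\<^sup>2 \<le> (\<integral>x. (f x)\<^sup>2 \<partial>\<pi>)"
proof -
  have fa: "bdd_meas c (\<lambda>x. \<bar>f x\<bar>)" using f by (auto simp: bdd_meas_def)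
  have "0 \<le> variance (\<lambda>x. \<bar>f x\<bar>)" by simp
  also have "variance (\<lambda>x. \<bar>f x\<bar>) = (\<integral>x. \<bar>f x\<bar>\<^sup>2 \<partial>\<pi>) - (\<integral>x. \<bar>f x\<bar> \<partial>\<pi>)\<^sup>2"
    using bdd_meas_integrable[OF fa] bdd_meas_integrable[OF bdd_meas_mult[OF f f]]
    by (intro variance_eq) (auto simp: power2_eq_square)
  finally show ?thesis by simp
qed

text \<open>Expanding the square of \<open>P^{2i} v - P^{2j} v\<close> gives
  \<open>a (4i) + a (4j) - 2 a (2 (i + j))\<close>. Only even indices occur, along which
  \<open>a\<close> is decreasing and nonnegative; iterates of different parity would produce a cross
  term of odd index, where this monotonicity gives no control.\<close>

lemma even_iterates_L1_Cauchy:
  assumes v: "bdd_meas c v" and e: "0 < e"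
  shows "\<exists>N. \<forall>i\<ge>N. \<forall>j\<ge>N. (\<integral>x. norm ((op ^^ (2 * i)) v x - (op ^^ (2 * j)) v x) \<partial>\<pi>) < e"
proof -
  define a where "a m = (\<integral>x. v x * (op ^^ m) v x \<partial>\<pi>)" for m
  let ?p = "\<lambda>m. (op ^^ m) v"
  have p: "bdd_meas c (?p m)" for m by (rule bdd_meas_op_pow[OF v])
  have a: "a (k + l) = (\<integral>x. ?p k x * ?p l x \<partial>\<pi>)" for k l
    unfolding a_def by (rule op_pow_adjoint[OF v, symmetric])
  have a2: "a (2 * m) = (\<integral>x. (?p m x)\<^sup>2 \<partial>\<pi>)" for m
    using a[of m m] by (simp add: mult_2 power2_eq_square)
  have sq: "bdd_meas (c * c) (\<lambda>x. (?p m x)\<^sup>2)" for m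
    using bdd_meas_mult[OF p p] by (simp add: power2_eq_square)
  have dec: "a (2 * Suc m) \<le> a (2 * m)" for m
  proof -
    have "a (2 * Suc m) = (\<integral>x. (op (?p m) x)\<^sup>2 \<partial>\<pi>)" unfolding a2 by simp
    also have "\<dots> \<le> (\<integral>x. op (\<lambda>x. (?p m x)\<^sup>2) x \<partial>\<pi>)"
    proof (rule integral_mono)
      show "integrable \<pi> (\<lambda>x. (op (?p m) x)\<^sup>2)"
        using bdd_meas_integrable[OF sq[of "Suc m"]] by simp
    qed (auto intro!: op_sq_le[OF p] bdd_meas_integrable[OF bdd_meas_op[OF sq]])
    also have "\<dots> = a (2 * m)" unfolding a2 by (rule integral_op[OF sq])
    finally show ?thesis .
  qed
  have "decseq (\<lambda>m. a (2 * m))" using dec by (intro decseq_SucI) simp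
  moreover have "\<forall>m. 0 \<le> a (2 * m)" by (simp add: a2)
  ultimately obtain l where l: "(\<lambda>m. a (2 * m)) \<longlonglongrightarrow> l" by (rule decseq_convergent)
  \<comment> \<open>The terms of the expansion carry the weights 1, 1 and 2, hence a quarter of
    \<open>e^2\<close> for each unit of weight.\<close>
  have "0 < e\<^sup>2 / 4" using e by simp
  from LIMSEQ_D[OF l this] obtain N where N: "\<And>m. N \<le> m \<Longrightarrow> \<bar>a (2 * m) - l\<bar> < e\<^sup>2 / 4" by auto
  show ?thesis
  proof (intro exI[of _ N] allI impI)
    fix i j assume ij: "N \<le> i" "N \<le> j"
    let ?d = "\<lambda>x. ?p (2 * i) x - ?p (2 * j) x"
    have d: "bdd_meas (c + c) ?d" by (rule bdd_meas_diff[OF p p])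
    have "(\<integral>x. (?d x)\<^sup>2 \<partial>\<pi>) = (\<integral>x. (?p (2 * i) x)\<^sup>2 + (?p (2 * j) x)\<^sup>2 - 2 * (?p (2 * i) x * ?p (2 * j) x) \<partial>\<pi>)"
      by (intro Bochner_Integration.integral_cong) (auto simp: power2_eq_square algebra_simps)
    also have "\<dots> = a (2 * (2 * i)) + a (2 * (2 * j)) - 2 * a (2 * (i + j))"
      using bdd_meas_integrable[OF sq] bdd_meas_integrable[OF bdd_meas_mult[OF p p]]
        a[of "2 * i" "2 * j"] a2[of "2 * i"] a2[of "2 * j"]
      by (simp add: distrib_left)
    also have "\<dots> < e\<^sup>2"
      using N[of "2 * i"] N[of "2 * j"] N[of "i + j"] ij by linarith
    finally have "(\<integral>x. \<bar>?d x\<bar> \<partial>\<pi>)\<^sup>2 < e\<^sup>2" using L1_le_sqrt_L2[OF d] by simp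
    then show "(\<integral>x. norm (?d x) \<partial>\<pi>) < e"
      using e by (auto intro: power2_less_imp_less)
  qed
qed

text \<open>By invariance the \<open>\<pi>\<close>-average of the \<open>P x\<close>-measures of a
  null set is its \<open>\<pi>\<close>-measure, so almost all of them vanish.\<close>

lemma AE_kernel:
  assumes "AE x in \<pi>. Q x" "Measurable.pred \<pi> Q"
  shows "AE x in \<pi>. AE y in P x. Q y"
proof -
  note assms(2)[measurable]
  have "(\<integral>\<^sup>+x. (\<integral>\<^sup>+y. indicator {y\<in>space \<pi>. \<not> Q y} y \<partial>P x) \<partial>\<pi>) = (\<integral>\<^sup>+x. indicator {y\<in>space \<pi>. \<not> Q y} x \<partial>\<pi>)"
    by (rule invariant) simp
  also have "\<dots> = 0"
  proof -
    have "AE x in \<pi>. indicator {y\<in>space \<pi>. \<not> Q y} x = (0::ennreal)"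
      using assms(1) by eventually_elim simp
    then have "(\<integral>\<^sup>+x. indicator {y\<in>space \<pi>. \<not> Q y} x \<partial>\<pi>) = (\<integral>\<^sup>+x. 0 \<partial>\<pi>)" by (rule nn_integral_cong_AE)
    then show ?thesis by simp
  qed
  finally have "AE x in \<pi>. (\<integral>\<^sup>+y. indicator {y\<in>space \<pi>. \<not> Q y} y \<partial>P x) = 0"
    by (subst (asm) nn_integral_0_iff_AE) (auto intro!: nn_integral_measurable_subprob_algebra2[where N=\<pi>])
  with AE_space show ?thesis
  proof eventually_elim
    case (elim x)
    have "{y\<in>space \<pi>. \<not> Q y} \<in> sets (P x)" unfolding sets_kernel_eq[OF elim(1)] by simp
    then have "emeasure (P x) {y\<in>space \<pi>. \<not> Q y} = 0" using elim(2) by simp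
    then show ?case
      using \<open>_ \<in> sets (P x)\<close> space_kernel_eq[OF elim(1)]
      by (intro AE_I[of _ _ "{y\<in>space \<pi>. \<not> Q y}"]) auto
  qed
qed

end

text \<open>The conclusion of \<open>harris_stay\<close> is the form in which Harris recurrence is
  kept from here on.\<close>

locale ergodic_kernel = reversible_kernel +
  assumes leaves: "B \<in> sets \<pi> \<Longrightarrow> emeasure \<pi> (space \<pi> - B) > 0 \<Longrightarrow> x \<in> space \<pi> \<Longrightarrow>
    (\<lambda>n. (stay_op P B ^^ n) (indicator B) x) \<longlonglongrightarrow> 0"
begin

text \<open>Almost every point of an invariant set stays in it forever, so its probability of
  staying is constantly 1; this contradicts \<open>leaves\<close> as soon as the complement has
  positive measure. Invariance holds up to a null set only, which is why the powers of
  \<open>stay_op\<close> are identified almost everywhere, for all exponents at once.\<close>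

lemma invariant_set_trivial:
  assumes B[measurable]: "B \<in> sets \<pi>" and inv: "AE x in \<pi>. x \<in> B \<longrightarrow> (AE y in P x. y \<in> B)"
  shows "(AE x in \<pi>. x \<in> B) \<or> (AE x in \<pi>. x \<notin> B)"
proof (rule ccontr)
  assume contra: "\<not> ?thesis"
  have pos: "emeasure \<pi> (space \<pi> - B) > 0"
  proof (rule ccontr)
    assume "\<not> ?thesis"
    then have "space \<pi> - B \<in> null_sets \<pi>" by (auto simp: null_sets_def)
    then have "AE x in \<pi>. x \<notin> space \<pi> - B" by (rule AE_not_in)
    then have "AE x in \<pi>. x \<in> B" using AE_space by eventually_elim auto
    with contra show False by simp
  qed
  let ?u = "\<lambda>n. (stay_op P B ^^ n) (indicator B)"
  have [measurable]: "?u n \<in> borel_measurable \<pi>" for n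
    by (rule measurable_stay_op_pow[OF kernel B]) simp
  have u: "AE x in \<pi>. ?u n x = indicator B x" for n
  proof (induction n)
    case (Suc n)
    from AE_kernel[OF Suc] have "AE x in \<pi>. AE y in P x. ?u n y = indicator B y" by simp
    with inv AE_space show ?case
    proof eventually_elim
      case (elim x)
      interpret K: prob_space "P x" using prob_space_kernel[OF elim(2)] .
      show ?case
      proof (cases "x \<in> B")
        case True
        with elim(1) have "AE y in P x. y \<in> B" by simp
        with elim(3) have "AE y in P x. ?u n y = 1" by eventually_elim auto
        then have "(\<integral>\<^sup>+y. ?u n y \<partial>P x) = (\<integral>\<^sup>+y. 1 \<partial>P x)" by (rule nn_integral_cong_AE)
        then show ?thesis using True by (simp add: stay_op_def[of P B "?u n"] K.emeasure_space_1)
      qed (simp add: stay_op_def)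
    qed
  qed simp
  have "AE x in \<pi>. \<forall>n. ?u n x = indicator B x" using u by (simp add: AE_all_countable)
  with AE_space have "AE x in \<pi>. x \<notin> B"
  proof eventually_elim
    case (elim x)
    show ?case
    proof
      assume "x \<in> B"
      with elim(2) have "(\<lambda>n. ?u n x) = (\<lambda>_. 1)" by auto
      with leaves[OF B pos elim(1)] show False by (simp add: LIMSEQ_const_iff)
    qed
  qed
  with contra show False by simp
qed

text \<open>For an invariant \<open>z\<close> the integral of \<open>(z x - z y)^2\<close> under the
  law of two consecutive states is \<open>2 <z,z> - 2 <z, P z> = 0\<close>. Hence \<open>z\<close>
  does not change along a step, its level sets are invariant and therefore trivial, and the
  vanishing mean leaves only the value 0.\<close>

lemma invariant_function_zero:
  assumes z: "bdd_meas c z" and inv: "AE x in \<pi>. op z x = z x" and mean: "(\<integral>x. z x \<partial>\<pi>) = 0"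
  shows "AE x in \<pi>. z x = 0"
proof -
  note z[THEN bdd_measD, measurable]
  interpret R: prob_space R by (rule prob_space_R)
  have 1: "bdd_meas 1 (\<lambda>_. 1)" by (simp add: bdd_meas_def)
  have zz: "bdd_meas (c * c) (\<lambda>x. z x * z x)" by (rule bdd_meas_mult[OF z z])
  have i: "integrable R (\<lambda>w. z (fst w) * z (fst w))" "integrable R (\<lambda>w. z (snd w) * z (snd w))" "integrable R (\<lambda>w. z (fst w) * z (snd w))"
    using integrable_R[OF zz 1] integrable_R[OF 1 zz] integrable_R[OF z z] by (simp_all add: case_prod_beta')
  have e1: "(\<integral>w. z (fst w) * z (fst w) \<partial>R) = (\<integral>x. z x * z x \<partial>\<pi>)"
    using integral_kernel_prod(3)[OF kernel_subprob not_empty i(1)]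
    by (simp add: prob_space.prob_space[OF prob_space_kernel] cong: Bochner_Integration.integral_cong)
  have e2: "(\<integral>w. z (snd w) * z (snd w) \<partial>R) = (\<integral>x. z x * z x \<partial>\<pi>)"
    using integral_kernel_prod(3)[OF kernel_subprob not_empty i(2)] integral_op[OF zz] by (simp add: op_def)
  have e3: "(\<integral>w. z (fst w) * z (snd w) \<partial>R) = (\<integral>x. z x * z x \<partial>\<pi>)"
  proof -
    have "(\<integral>w. z (fst w) * z (snd w) \<partial>R) = (\<integral>x. z x * op z x \<partial>\<pi>)"
      using integral_kernel_prod(3)[OF kernel_subprob not_empty i(3)] by (simp add: op_def)
    also have "\<dots> = (\<integral>x. z x * z x \<partial>\<pi>)"
      using inv by (intro integral_cong_AE) (auto elim: eventually_mono)
    finally show ?thesis .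
  qed
  have "(\<integral>w. (z (fst w) - z (snd w))\<^sup>2 \<partial>R)
     = (\<integral>w. z (fst w) * z (fst w) + z (snd w) * z (snd w) - 2 * (z (fst w) * z (snd w)) \<partial>R)"
    by (intro Bochner_Integration.integral_cong) (auto simp: power2_eq_square algebra_simps)
  also have "\<dots> = 0" using i e1 e2 e3 by simp
  finally have zero: "(\<integral>w. (z (fst w) - z (snd w))\<^sup>2 \<partial>R) = 0" .
  have "integrable R (\<lambda>w. (z (fst w) - z (snd w))\<^sup>2)"
    using i by (simp add: power2_eq_square algebra_simps)
  then have "AE w in R. (z (fst w) - z (snd w))\<^sup>2 = 0"
    using zero by (subst (asm) integral_nonneg_eq_0_iff_AE) auto
  then have "AE w in R. z (fst w) = z (snd w)" by eventually_elim simp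
  then have "AE x in \<pi>. AE w in distr (P x) (\<pi> \<Otimes>\<^sub>M \<pi>) (Pair x). z (fst w) = z (snd w)"
    unfolding kernel_prod_def
    by (subst (asm) AE_bind[OF measurable_kernel_prod_step[OF kernel_subprob]]) auto
  with AE_space have zc: "AE x in \<pi>. AE y in P x. z x = z y"
  proof eventually_elim
    case (elim x)
    have pm: "{w\<in>space (\<pi> \<Otimes>\<^sub>M \<pi>). z (fst w) = z (snd w)} \<in> sets (\<pi> \<Otimes>\<^sub>M \<pi>)" by measurable
    have pr: "Pair x \<in> P x \<rightarrow>\<^sub>M \<pi> \<Otimes>\<^sub>M \<pi>"
      by (subst measurable_cong_sets[OF sets_kernel_eq[OF elim(1)] refl]) (rule measurable_Pair1'[OF elim(1)])
    from elim(2) show ?case unfolding AE_distr_iff[OF pr pm] by simp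
  qed
  \<comment> \<open>A step from almost every \<open>x\<close> preserves the value of
    \<open>z\<close>, so each superlevel set is invariant up to a null set.\<close>
  have triv: "(AE x in \<pi>. z x > a) \<or> (AE x in \<pi>. \<not> z x > a)" for a
  proof -
    let ?B = "{x\<in>space \<pi>. z x > a}"
    have "AE x in \<pi>. x \<in> ?B \<longrightarrow> (AE y in P x. y \<in> ?B)"
      using zc AE_space
    proof eventually_elim
      case (elim x)
      have "AE y in P x. y \<in> space \<pi>" using AE_space[of "P x"] space_kernel_eq[OF elim(2)] by simp
      with elim(1) have "AE y in P x. z x = z y \<and> y \<in> space \<pi>" by eventually_elim simp
      then show ?case by (auto elim: eventually_mono)
    qed
    from invariant_set_trivial[OF _ this] show ?thesis
      using AE_space[of \<pi>] by (auto elim: eventually_elim2)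
  qed
  have zi: "integrable \<pi> z" by (rule bdd_meas_integrable[OF z])
  \<comment> \<open>If \<open>z\<close> exceeded \<open>a > 0\<close> almost everywhere, its mean
    could not vanish; so the other alternative holds.\<close>
  have up: "AE x in \<pi>. z x \<le> a" if "0 < a" for a
  proof (rule disjE[OF triv[of a]])
    assume *: "AE x in \<pi>. z x > a"
    have "(\<integral>x. a \<partial>\<pi>) \<le> (\<integral>x. z x \<partial>\<pi>)"
      using zi * by (intro integral_mono_AE) (auto elim: eventually_mono)
    with mean that show ?thesis by (simp add: prob_space)
  qed (auto simp: not_less)
  have lo: "AE x in \<pi>. - a \<le> z x" if "0 < a" for a
  proof (rule disjE[OF triv[of "- a"]])
    assume *: "AE x in \<pi>. \<not> z x > - a"
    have "(\<integral>x. z x \<partial>\<pi>) \<le> (\<integral>x. - a \<partial>\<pi>)"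
      using zi * by (intro integral_mono_AE) (auto elim: eventually_mono)
    with mean that show ?thesis by (simp add: prob_space)
  qed (auto elim: eventually_mono)
  have "AE x in \<pi>. \<forall>n. z x \<le> 1 / real (Suc n) \<and> - (1 / real (Suc n)) \<le> z x"
    unfolding AE_all_countable
  proof
    fix n show "AE x in \<pi>. z x \<le> 1 / real (Suc n) \<and> - (1 / real (Suc n)) \<le> z x"
      using up[of "1 / real (Suc n)"] lo[of "1 / real (Suc n)"] by auto
  qed
  then show ?thesis
  proof eventually_elim
    case (elim x)
    have "(\<lambda>n. 1 / real (Suc n)) \<longlonglongrightarrow> 0" by (rule lim_1_over_n[THEN LIMSEQ_Suc])
    note L = LIMSEQ_le_const[OF this]
    have "z x \<le> 0" by (rule L) (use elim in blast)
    moreover have "- z x \<le> 0" by (rule L) (use elim in \<open>auto simp: minus_le_iff\<close>)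
    ultimately show ?case by simp
  qed
qed

text \<open>With \<open>q = (v + P v) / 2\<close> one has
  \<open>v = (I - P) (v / 2 + (\<Sum>j<2m. P\<^sup>j q)) + P\<^sup>2\<^sup>m q\<close>, and the last term is small because
  \<open>P\<^sup>2\<^sup>m v\<close> converges while the limit of \<open>P\<^sup>2\<^sup>m (v + P v)\<close> is invariant.\<close>

lemma coboundary_dense:
  assumes v: "bdd_meas c v" and mean: "(\<integral>x. v x \<partial>\<pi>) = 0" and e: "0 < e"
  shows "\<exists>d u. bdd_meas d u \<and> (\<integral>x. \<bar>v x - (u x - op u x)\<bar> \<partial>\<pi>) \<le> e"
proof -
  let ?p = "\<lambda>m. (op ^^ m) v"
  define s where "s i = ?p (2 * i)" for i
  have p: "bdd_meas c (?p m)" for m by (rule bdd_meas_op_pow[OF v])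
  have s: "bdd_meas c (s m)" for m unfolding s_def by (rule p)
  note s[THEN bdd_measD, measurable]
  have cauchy: "\<exists>N. \<forall>i\<ge>N. \<forall>j\<ge>N. (\<integral>x. norm (s i x - s j x) \<partial>\<pi>) < e" if "0 < e" for e
    unfolding s_def by (rule even_iterates_L1_Cauchy[OF v that])
  \<comment> \<open>An L1-Cauchy sequence converges almost everywhere along a subsequence, which
    produces the limit as an actual function.\<close>
  obtain r where r: "strict_mono r" and "AE x in \<pi>. Cauchy (\<lambda>i. s (r i) x)"
    by (rule cauchy_L1_AE_cauchy_subseq[of \<pi> s, OF bdd_meas_integrable[OF s] cauchy])
  \<comment> \<open>Clamping to \<open>[-c, c]\<close> changes nothing where the subsequence
    converges and keeps \<open>w\<close> bounded at the exceptional points, where \<open>lim\<close>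
    is arbitrary.\<close>
  define w where "w x = max (- c) (min c (lim (\<lambda>i. s (r i) x)))" for x
  have c0: "0 \<le> c" using v not_empty by (auto simp: bdd_meas_def intro: order_trans[OF abs_ge_zero])
  have w: "bdd_meas c w" unfolding bdd_meas_def w_def using c0 by auto
  note w[THEN bdd_measD, measurable]
  have lim: "AE x in \<pi>. (\<lambda>i. s (r i) x) \<longlonglongrightarrow> w x"
    using \<open>AE x in \<pi>. Cauchy (\<lambda>i. s (r i) x)\<close> AE_space
  proof eventually_elim
    case (elim x)
    then have L: "(\<lambda>i. s (r i) x) \<longlonglongrightarrow> lim (\<lambda>i. s (r i) x)"
      by (simp add: Cauchy_convergent_iff convergent_LIMSEQ_iff)
    have "lim (\<lambda>i. s (r i) x) \<le> c" "- c \<le> lim (\<lambda>i. s (r i) x)"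
      using bdd_meas_le[OF s elim(2)] by (auto intro!: LIMSEQ_le_const2[OF L] LIMSEQ_le_const[OF L] simp: abs_le_iff minus_le_iff)
    then have "w x = lim (\<lambda>i. s (r i) x)" by (simp add: w_def)
    with L show ?case by simp
  qed
  define d where "d i = (\<integral>x. \<bar>s (r i) x - w x\<bar> \<partial>\<pi>)" for i
  have sw: "bdd_meas (c + c) (\<lambda>x. s i x - w x)" for i by (rule bdd_meas_diff[OF s w])
  have d0: "d \<longlonglongrightarrow> 0"
  proof -
    have "(\<lambda>i. \<integral>x. \<bar>s (r i) x - w x\<bar> \<partial>\<pi>) \<longlonglongrightarrow> (\<integral>x. 0 \<partial>\<pi>)"
    proof (rule integral_dominated_convergence[where w="\<lambda>_. c + c"])
      show "AE x in \<pi>. (\<lambda>i. \<bar>s (r i) x - w x\<bar>) \<longlonglongrightarrow> 0"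
        using lim by eventually_elim (auto intro!: tendsto_rabs_zero LIM_zero)
      show "AE x in \<pi>. norm \<bar>s (r i) x - w x\<bar> \<le> c + c" for i
        using AE_space by eventually_elim (use bdd_meas_le[OF sw] in auto)
    qed auto
    then show ?thesis by (simp add: d_def[abs_def])
  qed
  have L1_op_diff: "(\<integral>x. \<bar>op (s i) x - op w x\<bar> \<partial>\<pi>) \<le> (\<integral>x. \<bar>s i x - w x\<bar> \<partial>\<pi>)" for i
  proof -
    have "(\<integral>x. \<bar>op (s i) x - op w x\<bar> \<partial>\<pi>) = (\<integral>x. \<bar>op (\<lambda>x. s i x - w x) x\<bar> \<partial>\<pi>)"
      by (intro Bochner_Integration.integral_cong) (auto simp: op_diff[OF s w])
    then show ?thesis using L1_op_le[OF sw] by simp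
  qed
  \<comment> \<open>Since \<open>s (Suc j)\<close> is \<open>P^2\<close> applied to
    \<open>s j\<close>, the limit is fixed by \<open>P^2\<close>. It need not be fixed by
    \<open>P\<close>, because of possible periodicity.\<close>
  have P2w: "AE x in \<pi>. op (op w) x = w x"
  proof -
    define D where "D = (\<integral>x. \<bar>op (op w) x - w x\<bar> \<partial>\<pi>)"
    have ow: "bdd_meas c (op w)" "bdd_meas c (op (op w))" by (intro bdd_meas_op w)+
    have iD: "integrable \<pi> (\<lambda>x. \<bar>op (op w) x - w x\<bar>)"
      by (intro integrable_abs bdd_meas_integrable[OF bdd_meas_diff[OF ow(2) w]])
    have Dle: "D \<le> e + 2 * d i" if i: "\<forall>i\<ge>N. \<forall>j\<ge>N. (\<integral>x. norm (s i x - s j x) \<partial>\<pi>) < e" "N \<le> i" for e N i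
    proof -
      let ?j = "r i"
      have ss: "s (Suc j) = op (op (s j))" for j by (simp add: s_def)
      have os: "bdd_meas c (op (s ?j))" by (rule bdd_meas_op[OF s])
      have sub: "bdd_meas (c + c) (\<lambda>x. op (s ?j) x - op w x)" by (rule bdd_meas_diff[OF os ow(1)])
      have I1: "integrable \<pi> (\<lambda>x. \<bar>s (Suc ?j) x - op (op w) x\<bar>)"
        by (intro integrable_abs bdd_meas_integrable[OF bdd_meas_diff[OF s ow(2)]])
      have I2: "integrable \<pi> (\<lambda>x. \<bar>s (Suc ?j) x - s ?j x\<bar>)"
        by (intro integrable_abs bdd_meas_integrable[OF bdd_meas_diff[OF s s]])
      have I3: "integrable \<pi> (\<lambda>x. \<bar>s ?j x - w x\<bar>)"
        by (intro integrable_abs bdd_meas_integrable[OF sw])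
      have "D \<le> (\<integral>x. \<bar>s (Suc ?j) x - op (op w) x\<bar> + \<bar>s (Suc ?j) x - s ?j x\<bar> + \<bar>s ?j x - w x\<bar> \<partial>\<pi>)"
        unfolding D_def using I1 I2 I3 iD by (intro integral_mono) auto
      also have "\<dots> = (\<integral>x. \<bar>s (Suc ?j) x - op (op w) x\<bar> \<partial>\<pi>) + (\<integral>x. \<bar>s (Suc ?j) x - s ?j x\<bar> \<partial>\<pi>) + d i"
        using I1 I2 I3 by (simp add: d_def)
      also have "(\<integral>x. \<bar>s (Suc ?j) x - op (op w) x\<bar> \<partial>\<pi>) = (\<integral>x. \<bar>op (\<lambda>x. op (s ?j) x - op w x) x\<bar> \<partial>\<pi>)"
        by (intro Bochner_Integration.integral_cong) (auto simp: op_diff[OF os ow(1)] ss)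
      also have "\<dots> \<le> (\<integral>x. \<bar>op (s ?j) x - op w x\<bar> \<partial>\<pi>)" by (rule L1_op_le[OF sub])
      also have "\<dots> \<le> d i" unfolding d_def by (rule L1_op_diff)
      also have "(\<integral>x. \<bar>s (Suc ?j) x - s ?j x\<bar> \<partial>\<pi>) < e"
        using i seq_suble[OF r, of i] by (auto dest!: spec[of _ "Suc ?j"] spec[of _ ?j])
      finally show ?thesis by simp
    qed
    have "D \<le> 0"
    proof (rule field_le_epsilon)
      fix e :: real assume e: "0 < e"
      then obtain N where N: "\<forall>i\<ge>N. \<forall>j\<ge>N. (\<integral>x. norm (s i x - s j x) \<partial>\<pi>) < e" using cauchy by blast
      have "(\<lambda>i. e + 2 * d i) \<longlonglongrightarrow> e + 2 * 0" by (intro tendsto_intros d0)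
      then have "D \<le> e + 2 * 0"
        using Dle[OF N] by (intro LIMSEQ_le_const) auto
      then show "D \<le> 0 + e" by simp
    qed
    then have "D = 0" unfolding D_def by (intro antisym) auto
    then have "AE x in \<pi>. \<bar>op (op w) x - w x\<bar> = 0"
      unfolding D_def using iD by (subst (asm) integral_nonneg_eq_0_iff_AE) auto
    then show ?thesis by eventually_elim simp
  qed
  \<comment> \<open>Symmetrising a fixed point of \<open>P^2\<close> gives a fixed point of
    \<open>P\<close>.\<close>
  define z where "z x = w x + op w x" for x
  have ow: "bdd_meas c (op w)" by (intro bdd_meas_op w)
  have z: "bdd_meas (c + c) z" unfolding z_def by (rule bdd_meas_add[OF w ow])
  have "AE x in \<pi>. op z x = z x"
    using P2w AE_space by eventually_elim (simp add: z_def[abs_def] op_add[OF w ow])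
  moreover
  have mean_s: "(\<integral>x. s i x \<partial>\<pi>) = 0" for i by (simp add: s_def integral_op_pow[OF v] mean)
  have "\<bar>\<integral>x. w x \<partial>\<pi>\<bar> \<le> d i" for i
  proof -
    have "(\<integral>x. w x \<partial>\<pi>) = - (\<integral>x. s (r i) x - w x \<partial>\<pi>)"
      using bdd_meas_integrable[OF s] bdd_meas_integrable[OF w] by (simp add: mean_s)
    then show ?thesis unfolding d_def using integral_abs_bound[of \<pi> "\<lambda>x. s (r i) x - w x"] by simp
  qed
  then have "\<bar>\<integral>x. w x \<partial>\<pi>\<bar> \<le> 0" by (intro LIMSEQ_le_const[OF d0]) auto
  then have "(\<integral>x. w x \<partial>\<pi>) = 0" by simp
  then have "(\<integral>x. z x \<partial>\<pi>) = 0"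
    unfolding z_def using bdd_meas_integrable[OF w] bdd_meas_integrable[OF ow] integral_op[OF w] by simp
  ultimately have z0: "AE x in \<pi>. z x = 0" by (rule invariant_function_zero[OF z])
  define q where "q x = (1 / 2) * (v x + op v x)" for x
  have q: "bdd_meas c q"
    unfolding q_def using bdd_meas_cmult[OF bdd_meas_add[OF v bdd_meas_op[OF v]], of "1 / 2"] by simp
  have qm: "(op ^^ m) q x = (1 / 2) * ((op ^^ m) v x + (op ^^ Suc m) v x)" if "x \<in> space \<pi>" for m x
    unfolding q_def using that
    by (simp only: op_pow_cmult op_pow_add[OF v bdd_meas_op[OF v]] funpow_swap1 funpow.simps o_apply)
  have small: "(\<integral>x. \<bar>(op ^^ (2 * r i)) q x\<bar> \<partial>\<pi>) \<le> d i" for i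
  proof -
    have os: "bdd_meas c (op (s (r i)))" by (rule bdd_meas_op[OF s])
    have I1: "integrable \<pi> (\<lambda>x. \<bar>s (r i) x - w x\<bar>)"
      by (intro integrable_abs bdd_meas_integrable[OF sw])
    have I2: "integrable \<pi> (\<lambda>x. \<bar>op (s (r i)) x - op w x\<bar>)"
      by (intro integrable_abs bdd_meas_integrable[OF bdd_meas_diff[OF os ow]])
    have I0: "integrable \<pi> (\<lambda>x. \<bar>(op ^^ (2 * r i)) q x\<bar>)"
      by (intro integrable_abs bdd_meas_integrable[OF bdd_meas_op_pow[OF q]])
    have "(\<integral>x. \<bar>(op ^^ (2 * r i)) q x\<bar> \<partial>\<pi>) \<le> (\<integral>x. (1 / 2) * (\<bar>s (r i) x - w x\<bar> + \<bar>op (s (r i)) x - op w x\<bar>) \<partial>\<pi>)"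
    proof (rule integral_mono_AE)
      show "AE x in \<pi>. \<bar>(op ^^ (2 * r i)) q x\<bar> \<le> (1 / 2) * (\<bar>s (r i) x - w x\<bar> + \<bar>op (s (r i)) x - op w x\<bar>)"
        using z0 AE_space
      proof eventually_elim
        case (elim x)
        have "op w x = - w x" using elim(1) by (simp add: z_def)
        moreover have "(op ^^ (2 * r i)) q x = (1 / 2) * (s (r i) x + op (s (r i)) x)"
          using qm[OF elim(2), of "2 * r i"] by (simp add: s_def)
        ultimately show ?case by (simp add: abs_if)
      qed
    qed (use I0 I1 I2 in auto)
    also have "\<dots> = (1 / 2) * (d i + (\<integral>x. \<bar>op (s (r i)) x - op w x\<bar> \<partial>\<pi>))"
      using I1 I2 by (simp add: d_def)
    also have "\<dots> \<le> d i" using L1_op_diff[of "r i"] by (simp add: d_def)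
    finally show ?thesis .
  qed
  from d0 e obtain i where "d i < e" by (metis LIMSEQ_D real_norm_def order_refl diff_zero abs_ge_self order_le_less_trans)
  define m where "m = 2 * r i"
  \<comment> \<open>The witness built by the induction is the telescoping sum of
    \<open>P^j q\<close> over \<open>j < m\<close>.\<close>
  have U: "\<exists>d u. bdd_meas d u \<and> (\<forall>x\<in>space \<pi>. u x - op u x = q x - (op ^^ m) q x)" for m
  proof (induction m)
    case 0
    have "bdd_meas 0 (\<lambda>_. 0)" by (simp add: bdd_meas_def)
    then show ?case by (intro exI[of _ 0] exI[of _ "\<lambda>_. 0"]) (simp add: op_def)
  next
    case (Suc m)
    then obtain d u where u: "bdd_meas d u" "\<And>x. x \<in> space \<pi> \<Longrightarrow> u x - op u x = q x - (op ^^ m) q x" by blast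
    have qm: "bdd_meas c ((op ^^ m) q)" by (rule bdd_meas_op_pow[OF q])
    show ?case
    proof (intro exI conjI ballI)
      show "bdd_meas (d + c) (\<lambda>x. u x + (op ^^ m) q x)" by (rule bdd_meas_add[OF u(1) qm])
      fix x assume x: "x \<in> space \<pi>"
      show "u x + (op ^^ m) q x - op (\<lambda>x. u x + (op ^^ m) q x) x = q x - (op ^^ Suc m) q x"
        using u(2)[OF x] by (simp add: op_add[OF u(1) qm x])
    qed
  qed
  then obtain d' u where u: "bdd_meas d' u" "\<And>x. x \<in> space \<pi> \<Longrightarrow> u x - op u x = q x - (op ^^ m) q x" by blast
  have v2: "bdd_meas (\<bar>1 / 2\<bar> * c) (\<lambda>x. (1 / 2) * v x)" by (rule bdd_meas_cmult[OF v])
  show ?thesis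
  proof (intro exI conjI)
    show "bdd_meas (\<bar>1 / 2\<bar> * c + d') (\<lambda>x. (1 / 2) * v x + u x)" by (rule bdd_meas_add[OF v2 u(1)])
    have "(\<integral>x. \<bar>v x - ((1 / 2) * v x + u x - op (\<lambda>x. (1 / 2) * v x + u x) x)\<bar> \<partial>\<pi>) = (\<integral>x. \<bar>(op ^^ m) q x\<bar> \<partial>\<pi>)"
    proof (intro Bochner_Integration.integral_cong refl arg_cong[where f=abs])
      fix x assume x: "x \<in> space \<pi>"
      have "q x = v x / 2 + op v x / 2" by (simp add: q_def)
      then show "v x - ((1 / 2) * v x + u x - op (\<lambda>x. (1 / 2) * v x + u x) x) = (op ^^ m) q x"
        unfolding op_add[OF v2 u(1) x] op_cmult using u(2)[OF x] by simp
    qed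
    also have "\<dots> \<le> e" using small[of i] \<open>d i < e\<close> by (simp add: m_def)
    finally show "(\<integral>x. \<bar>v x - ((1 / 2) * v x + u x - op (\<lambda>x. (1 / 2) * v x + u x) x)\<bar> \<partial>\<pi>) \<le> e" .
  qed
qed

end

section \<open>Integrated Markov property and second moments for increments that depend on a
  mark\<close>

section \<open>Markov chains with marks\<close>

text \<open>One step draws a mark and the next state together, because the increments depend on
  both; the mark will be the proposal set. Invariance concerns the state component.\<close>

locale mark_kernel = prob_space \<pi> for \<pi> :: "'a measure" +
  fixes Z :: "'b measure" and T :: "'a \<Rightarrow> ('b \<times> 'a) measure"
  assumes mark_kernel: "T \<in> \<pi> \<rightarrow>\<^sub>M prob_algebra (Z \<Otimes>\<^sub>M \<pi>)"
    and mark_invariant: "h \<in> borel_measurable \<pi> \<Longrightarrow>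
      (\<integral>\<^sup>+x. (\<integral>\<^sup>+w. h (snd w) \<partial>T x) \<partial>\<pi>) = (\<integral>\<^sup>+x. h x \<partial>\<pi>)"
begin

abbreviation S where "S \<equiv> Z \<Otimes>\<^sub>M \<pi>"
abbreviation \<mu> where "\<mu> \<equiv> kernel_prod \<pi> S T"

lemma mark_kernel_subprob [measurable]: "T \<in> \<pi> \<rightarrow>\<^sub>M subprob_algebra S"
  using mark_kernel by (rule measurable_prob_algebraD)

lemma prob_space_mark: "x \<in> space \<pi> \<Longrightarrow> prob_space (T x)"
  and sets_mark: "x \<in> space \<pi> \<Longrightarrow> sets (T x) = sets S"
  using measurable_space[OF mark_kernel] by (auto simp: space_prob_algebra)

lemma space_mark: "x \<in> space \<pi> \<Longrightarrow> space (T x) = space S"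
  by (rule sets_eq_imp_space_eq[OF sets_mark])

lemma sets_\<mu> [measurable_cong]: "sets \<mu> = sets (\<pi> \<Otimes>\<^sub>M S)"
  by (rule sets_kernel_prod[OF mark_kernel_subprob not_empty])

lemma space_\<mu>: "space \<mu> = space \<pi> \<times> space S"
  using sets_eq_imp_space_eq[OF sets_\<mu>] by (simp add: space_pair_measure)

lemma prob_space_\<mu>: "prob_space \<mu>"
proof
  have "emeasure \<mu> (space \<mu>) = (\<integral>\<^sup>+z. 1 \<partial>\<mu>)" by simp
  also have "\<dots> = 1"
    by (subst nn_integral_kernel_prod[OF mark_kernel_subprob])
      (simp_all add: prob_space.emeasure_space_1[OF prob_space_mark] emeasure_space_1 cong: nn_integral_cong)
  finally show "emeasure \<mu> (space \<mu>) = 1" .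
qed

lemma measurable_section:
  assumes "g \<in> N \<rightarrow>\<^sub>M L" "x \<in> space \<pi>" "N = \<pi> \<Otimes>\<^sub>M S"
  shows "(\<lambda>w. g (x, w)) \<in> T x \<rightarrow>\<^sub>M L"
  by (subst measurable_cong_sets[OF sets_mark[OF assms(2)] refl])
    (rule measurable_compose[OF measurable_Pair1'[OF assms(2)] assms(1)[unfolded assms(3)]])

lemma integrable_section_bounded:
  fixes g :: "'a \<times> ('b \<times> 'a) \<Rightarrow> real"
  assumes "g \<in> borel_measurable (\<pi> \<Otimes>\<^sub>M S)" "\<And>x w. x \<in> space \<pi> \<Longrightarrow> w \<in> space S \<Longrightarrow> \<bar>g (x, w)\<bar> \<le> c" "x \<in> space \<pi>"
  shows "integrable (T x) (\<lambda>w. g (x, w))"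
proof -
  interpret K: prob_space "T x" by (rule prob_space_mark[OF assms(3)])
  show ?thesis
    by (rule K.integrable_const_bound[where B=c])
      (use assms space_mark[OF assms(3)] measurable_section[OF assms(1,3) refl] in auto)
qed

lemma measurable_mark_integral:
  fixes g :: "'a \<times> ('b \<times> 'a) \<Rightarrow> real"
  assumes "g \<in> borel_measurable (\<pi> \<Otimes>\<^sub>M S)"
  shows "(\<lambda>x. \<integral>w. g (x, w) \<partial>T x) \<in> borel_measurable \<pi>"
  by (rule measurable_kernel_integral[OF mark_kernel_subprob assms])

lemma mark_integral_bounded:
  fixes g :: "'a \<times> ('b \<times> 'a) \<Rightarrow> real"
  assumes "g \<in> borel_measurable (\<pi> \<Otimes>\<^sub>M S)" "\<And>x w. x \<in> space \<pi> \<Longrightarrow> w \<in> space S \<Longrightarrow> \<bar>g (x, w)\<bar> \<le> c" "x \<in> space \<pi>"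
  shows "\<bar>\<integral>w. g (x, w) \<partial>T x\<bar> \<le> c"
proof -
  interpret K: prob_space "T x" by (rule prob_space_mark[OF assms(3)])
  have "\<bar>\<integral>w. g (x, w) \<partial>T x\<bar> \<le> (\<integral>w. \<bar>g (x, w)\<bar> \<partial>T x)" by (rule integral_abs_bound)
  also have "\<dots> \<le> (\<integral>w. c \<partial>T x)"
    using integrable_section_bounded[OF assms] assms(2,3) space_mark[OF assms(3)]
    by (intro integral_mono) auto
  finally show ?thesis by (simp add: K.prob_space)
qed

end

text \<open>The measure \<open>M\<close> is finite rather than a probability, so that it can be
  restricted to an event without renormalising. The Markov property is stated in integrated form for
  functions of the past and the next mark, a form that survives restriction to an event of the past.
  The mark \<open>W n\<close> leads from time \<open>n\<close> to time \<open>n + 1\<close>, hence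
  its shifted measurability.\<close>

locale marked_chain = mark_kernel \<pi> Z T + M: finite_measure M
  for \<pi> :: "'a measure" and Z :: "'b measure" and T and M :: "'w measure" +
  fixes F :: "nat \<Rightarrow> 'w measure" and X :: "nat \<Rightarrow> 'w \<Rightarrow> 'a" and W :: "nat \<Rightarrow> 'w \<Rightarrow> 'b \<times> 'a"
  assumes filtration: "subalgebra M (F n)"
    and filtration_mono: "m \<le> n \<Longrightarrow> sets (F m) \<subseteq> sets (F n)"
    and adapted_state: "X n \<in> F n \<rightarrow>\<^sub>M \<pi>"
    and adapted_mark: "W n \<in> F (Suc n) \<rightarrow>\<^sub>M S"
    and state_Suc: "\<omega> \<in> space M \<Longrightarrow> X (Suc n) \<omega> = snd (W n \<omega>)"
    and markov: "H \<in> borel_measurable (F n \<Otimes>\<^sub>M S) \<Longrightarrow>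
      (\<integral>\<^sup>+\<omega>. H (\<omega>, W n \<omega>) \<partial>M) = (\<integral>\<^sup>+\<omega>. (\<integral>\<^sup>+w. H (\<omega>, w) \<partial>T (X n \<omega>)) \<partial>M)"
begin

lemma space_filtration: "space (F n) = space M"
  using filtration by (simp add: subalgebra_def)

lemma measurable_filtration_mono: "f \<in> F m \<rightarrow>\<^sub>M N \<Longrightarrow> m \<le> n \<Longrightarrow> f \<in> F n \<rightarrow>\<^sub>M N"
  using filtration_mono[of m n] by (auto simp: measurable_def space_filtration)

lemma measurable_from_filtration: "f \<in> F n \<rightarrow>\<^sub>M N \<Longrightarrow> f \<in> M \<rightarrow>\<^sub>M N"
  by (rule measurable_from_subalg[OF filtration])

lemma measurable_state [measurable]: "X n \<in> M \<rightarrow>\<^sub>M \<pi>"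
  by (rule measurable_from_filtration[OF adapted_state])

lemma measurable_mark [measurable]: "W n \<in> M \<rightarrow>\<^sub>M S"
  by (rule measurable_from_filtration[OF adapted_mark])

lemma state_space: "\<omega> \<in> space M \<Longrightarrow> X n \<omega> \<in> space \<pi>"
  by (rule measurable_space[OF measurable_state])

lemma mark_space: "\<omega> \<in> space M \<Longrightarrow> W n \<omega> \<in> space S"
  by (rule measurable_space[OF measurable_mark])

lemma measurable_pair_filtration: "(\<lambda>\<omega>. (\<omega>, W n \<omega>)) \<in> M \<rightarrow>\<^sub>M F n \<Otimes>\<^sub>M S"
  by (intro measurable_Pair measurable_mark measurable_from_filtration[where n=n]) simp

lemma adapted_step:
  assumes "g \<in> borel_measurable (\<pi> \<Otimes>\<^sub>M S)" "n < m"
  shows "(\<lambda>\<omega>. g (X n \<omega>, W n \<omega>)) \<in> borel_measurable (F m)"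
  by (rule measurable_compose[OF measurable_Pair assms(1)])
    (use assms(2) in \<open>auto intro: measurable_filtration_mono[OF adapted_state] measurable_filtration_mono[OF adapted_mark]\<close>)

text \<open>The nonnegative Markov property says that the joint law of the past and the mark is a
  kernel product; the kernel form of Fubini then covers signed functions.\<close>

lemma markov_integral:
  fixes H :: "'w \<times> ('b \<times> 'a) \<Rightarrow> real"
  assumes H[measurable]: "H \<in> borel_measurable (F n \<Otimes>\<^sub>M S)" and int: "integrable M (\<lambda>\<omega>. H (\<omega>, W n \<omega>))"
  shows "(\<integral>\<omega>. H (\<omega>, W n \<omega>) \<partial>M) = (\<integral>\<omega>. (\<integral>w. H (\<omega>, w) \<partial>T (X n \<omega>)) \<partial>M)"
proof (cases "space M = {}")
  \<comment> \<open>A finite measure may live on the empty space, where a kernel product does not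
    have the expected sigma-field.\<close>
  case True
  have "(\<integral>\<omega>. f \<omega> \<partial>M) = (\<integral>\<omega>. 0 \<partial>M)" for f :: "'w \<Rightarrow> real"
    by (rule Bochner_Integration.integral_cong) (use True in auto)
  then show ?thesis by simp
next
  case False
  \<comment> \<open>The first component of the joint law is \<open>\<omega>\<close> itself, seen
    through the sigma-field \<open>F n\<close> only: the Markov property speaks about the past at
    time \<open>n\<close>, not about all of \<open>M\<close>.\<close>
  let ?FM = "restr_to_subalg M (F n)"
  let ?K = "\<lambda>\<omega>. T (X n \<omega>)"
  have sF: "sets ?FM = sets (F n)" by (rule sets_restr_to_subalg[OF filtration])
  have sFS: "sets (?FM \<Otimes>\<^sub>M S) = sets (F n \<Otimes>\<^sub>M S)" by (rule sets_pair_measure_cong[OF sF refl])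
  have K: "?K \<in> ?FM \<rightarrow>\<^sub>M subprob_algebra S"
    by (rule measurable_in_subalg[OF filtration measurable_compose[OF adapted_state mark_kernel_subprob]])
  have ne: "space ?FM \<noteq> {}" using False by (simp add: space_restr_to_subalg)
  have K': "?K \<in> F n \<rightarrow>\<^sub>M subprob_algebra S"
    by (rule measurable_compose[OF adapted_state mark_kernel_subprob])
  have eq: "distr M (F n \<Otimes>\<^sub>M S) (\<lambda>\<omega>. (\<omega>, W n \<omega>)) = kernel_prod ?FM S ?K"
  proof (rule measure_eqI)
    show "sets (distr M (F n \<Otimes>\<^sub>M S) (\<lambda>\<omega>. (\<omega>, W n \<omega>))) = sets (kernel_prod ?FM S ?K)"
      using sets_kernel_prod[OF K ne] sFS by simp
    fix A assume "A \<in> sets (distr M (F n \<Otimes>\<^sub>M S) (\<lambda>\<omega>. (\<omega>, W n \<omega>)))"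
    then have A: "A \<in> sets (F n \<Otimes>\<^sub>M S)" by simp
    then have A': "A \<in> sets (kernel_prod ?FM S ?K)" using sets_kernel_prod[OF K ne] sFS by simp
    have Am: "indicator A \<in> borel_measurable (F n \<Otimes>\<^sub>M S)" using A by simp
    then have Am': "indicator A \<in> borel_measurable (?FM \<Otimes>\<^sub>M S)" by (simp add: measurable_cong_sets[OF sFS refl])
    have m: "(\<lambda>\<omega>. \<integral>\<^sup>+w. indicator A (\<omega>, w) \<partial>T (X n \<omega>)) \<in> borel_measurable (F n)"
      by (rule nn_integral_measurable_subprob_algebra2[OF _ K']) (use Am in simp)
    have "emeasure (distr M (F n \<Otimes>\<^sub>M S) (\<lambda>\<omega>. (\<omega>, W n \<omega>))) A = (\<integral>\<^sup>+z. indicator A z \<partial>distr M (F n \<Otimes>\<^sub>M S) (\<lambda>\<omega>. (\<omega>, W n \<omega>)))"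
      using A by simp
    also have "\<dots> = (\<integral>\<^sup>+\<omega>. indicator A (\<omega>, W n \<omega>) \<partial>M)"
      by (subst nn_integral_distr[OF measurable_pair_filtration]) (use Am in simp_all)
    also have "\<dots> = (\<integral>\<^sup>+\<omega>. (\<integral>\<^sup>+w. indicator A (\<omega>, w) \<partial>T (X n \<omega>)) \<partial>M)"
      by (rule markov[OF Am])
    also have "\<dots> = (\<integral>\<^sup>+\<omega>. (\<integral>\<^sup>+w. indicator A (\<omega>, w) \<partial>T (X n \<omega>)) \<partial>?FM)"
      by (rule nn_integral_subalgebra2[OF filtration m, symmetric])
    also have "\<dots> = (\<integral>\<^sup>+z. indicator A z \<partial>kernel_prod ?FM S ?K)"
      by (rule nn_integral_kernel_prod[OF K Am', symmetric])
    also have "\<dots> = emeasure (kernel_prod ?FM S ?K) A" using A' by simp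
    finally show "emeasure (distr M (F n \<Otimes>\<^sub>M S) (\<lambda>\<omega>. (\<omega>, W n \<omega>))) A = emeasure (kernel_prod ?FM S ?K) A" .
  qed
  have int': "integrable (kernel_prod ?FM S ?K) H"
    unfolding eq[symmetric] using integrable_distr_eq[OF measurable_pair_filtration H] int by simp
  have m: "(\<lambda>\<omega>. \<integral>w. H (\<omega>, w) \<partial>T (X n \<omega>)) \<in> borel_measurable (F n)"
    by (rule measurable_kernel_integral[OF K' H])
  have "(\<integral>\<omega>. H (\<omega>, W n \<omega>) \<partial>M) = (\<integral>z. H z \<partial>kernel_prod ?FM S ?K)"
    unfolding eq[symmetric] by (rule integral_distr[OF measurable_pair_filtration H, symmetric])
  also have "\<dots> = (\<integral>\<omega>. (\<integral>w. H (\<omega>, w) \<partial>T (X n \<omega>)) \<partial>?FM)"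
    by (rule integral_kernel_prod(3)[OF K ne int'])
  also have "\<dots> = (\<integral>\<omega>. (\<integral>w. H (\<omega>, w) \<partial>T (X n \<omega>)) \<partial>M)"
    by (rule integral_subalgebra2[OF filtration m])
  finally show ?thesis .
qed

text \<open>For characteristic functions. Boundedness supplies all integrability, and real and
  imaginary parts reduce to the real case.\<close>

lemma markov_integral_complex:
  fixes H :: "'w \<times> ('b \<times> 'a) \<Rightarrow> complex"
  assumes H[measurable]: "H \<in> borel_measurable (F n \<Otimes>\<^sub>M S)"
    and bound: "\<And>\<omega> w. \<omega> \<in> space M \<Longrightarrow> w \<in> space S \<Longrightarrow> norm (H (\<omega>, w)) \<le> b"
  shows "(\<integral>\<omega>. H (\<omega>, W n \<omega>) \<partial>M) = (\<integral>\<omega>. (\<integral>w. H (\<omega>, w) \<partial>T (X n \<omega>)) \<partial>M)"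
proof -
  have mW: "(\<lambda>\<omega>. H (\<omega>, W n \<omega>)) \<in> borel_measurable M"
    by (rule measurable_compose[OF measurable_pair_filtration H])
  have iW: "integrable M (\<lambda>\<omega>. H (\<omega>, W n \<omega>))"
    by (rule M.integrable_const_bound[where B=b]) (use mW bound mark_space in auto)
  have iT: "integrable (T (X n \<omega>)) (\<lambda>w. H (\<omega>, w))" if w: "\<omega> \<in> space M" for \<omega>
  proof -
    note x = state_space[OF w, of n]
    interpret K: prob_space "T (X n \<omega>)" by (rule prob_space_mark[OF x])
    have "(\<lambda>w. H (\<omega>, w)) \<in> borel_measurable (T (X n \<omega>))"
      using w by (subst measurable_cong_sets[OF sets_mark[OF x] refl])
        (auto intro!: measurable_compose[OF measurable_Pair1' H] simp: space_filtration)
    then show ?thesis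
      by (intro K.integrable_const_bound[where B=b]) (use w bound space_mark[OF x] in auto)
  qed
  have K': "(\<lambda>\<omega>. T (X n \<omega>)) \<in> F n \<rightarrow>\<^sub>M subprob_algebra S"
    by (rule measurable_compose[OF adapted_state mark_kernel_subprob])
  define I where "I \<omega> = (\<integral>w. H (\<omega>, w) \<partial>T (X n \<omega>))" for \<omega>
  have R: "Re (I \<omega>) = (\<integral>w. Re (H (\<omega>, w)) \<partial>T (X n \<omega>))" "Im (I \<omega>) = (\<integral>w. Im (H (\<omega>, w)) \<partial>T (X n \<omega>))"
    if "\<omega> \<in> space M" for \<omega>
    using iT[OF that] by (simp_all add: I_def)
  have mR: "(\<lambda>\<omega>. \<integral>w. Re (H (\<omega>, w)) \<partial>T (X n \<omega>)) \<in> borel_measurable M"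
    "(\<lambda>\<omega>. \<integral>w. Im (H (\<omega>, w)) \<partial>T (X n \<omega>)) \<in> borel_measurable M"
    using measurable_kernel_integral[OF K', of "\<lambda>z. Re (H z)", THEN measurable_from_filtration]
      measurable_kernel_integral[OF K', of "\<lambda>z. Im (H z)", THEN measurable_from_filtration]
    by auto
  have Ieq: "I \<omega> = complex_of_real (\<integral>w. Re (H (\<omega>, w)) \<partial>T (X n \<omega>)) + \<i> * complex_of_real (\<integral>w. Im (H (\<omega>, w)) \<partial>T (X n \<omega>))"
    if "\<omega> \<in> space M" for \<omega>
    by (rule complex_eqI) (simp_all add: R[OF that])
  have mI: "I \<in> borel_measurable M"
    by (subst measurable_cong[OF Ieq]) (use mR in measurable)
  have nI: "norm (I \<omega>) \<le> b" if w: "\<omega> \<in> space M" for \<omega>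
  proof -
    note x = state_space[OF w, of n]
    interpret K: prob_space "T (X n \<omega>)" by (rule prob_space_mark[OF x])
    have "norm (I \<omega>) \<le> (\<integral>w. norm (H (\<omega>, w)) \<partial>T (X n \<omega>))" unfolding I_def by (rule integral_norm_bound)
    also have "\<dots> \<le> (\<integral>w. b \<partial>T (X n \<omega>))"
      using iT[OF w] bound[OF w] space_mark[OF x] by (intro integral_mono) auto
    finally show ?thesis by (simp add: K.prob_space)
  qed
  have iI: "integrable M I"
    by (rule M.integrable_const_bound[where B=b]) (use mI nI in auto)
  show ?thesis
    unfolding I_def[symmetric]
  proof (rule complex_eqI)
    have "Re (\<integral>\<omega>. H (\<omega>, W n \<omega>) \<partial>M) = (\<integral>\<omega>. Re (H (\<omega>, W n \<omega>)) \<partial>M)" using iW by simp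
    also have "\<dots> = (\<integral>\<omega>. (\<integral>w. Re (H (\<omega>, w)) \<partial>T (X n \<omega>)) \<partial>M)"
      using iW by (intro markov_integral[of "\<lambda>z. Re (H z)"]) auto
    also have "\<dots> = (\<integral>\<omega>. Re (I \<omega>) \<partial>M)" by (intro Bochner_Integration.integral_cong) (auto simp: R)
    finally show "Re (\<integral>\<omega>. H (\<omega>, W n \<omega>) \<partial>M) = Re (\<integral>\<omega>. I \<omega> \<partial>M)" using iI by simp
    have "Im (\<integral>\<omega>. H (\<omega>, W n \<omega>) \<partial>M) = (\<integral>\<omega>. Im (H (\<omega>, W n \<omega>)) \<partial>M)" using iW by simp
    also have "\<dots> = (\<integral>\<omega>. (\<integral>w. Im (H (\<omega>, w)) \<partial>T (X n \<omega>)) \<partial>M)"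
      using iW by (intro markov_integral[of "\<lambda>z. Im (H z)"]) auto
    also have "\<dots> = (\<integral>\<omega>. Im (I \<omega>) \<partial>M)" by (intro Bochner_Integration.integral_cong) (auto simp: R)
    finally show "Im (\<integral>\<omega>. H (\<omega>, W n \<omega>) \<partial>M) = Im (\<integral>\<omega>. I \<omega> \<partial>M)" using iI by simp
  qed
qed

end

locale dominated_chain = marked_chain +
  fixes C :: real
  assumes C_nonneg: "0 \<le> C"
    and dominated: "h \<in> borel_measurable \<pi> \<Longrightarrow> (\<integral>\<^sup>+\<omega>. h (X 0 \<omega>) \<partial>M) \<le> C * (\<integral>\<^sup>+x. h x \<partial>\<pi>)"
begin

text \<open>Invariance of \<open>\<pi>\<close> propagates the initial bound: one step maps a law
  below \<open>C \<pi>\<close> to a law below \<open>C \<pi>\<close>, with the same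
  constant.\<close>

lemma nn_integral_state_le:
  "h \<in> borel_measurable \<pi> \<Longrightarrow> (\<integral>\<^sup>+\<omega>. h (X n \<omega>) \<partial>M) \<le> C * (\<integral>\<^sup>+x. h x \<partial>\<pi>)"
proof (induction n arbitrary: h)
  case (Suc n)
  have hm: "(\<lambda>x. \<integral>\<^sup>+w. h (snd w) \<partial>T x) \<in> borel_measurable \<pi>"
    by (rule nn_integral_measurable_subprob_algebra2[OF _ mark_kernel_subprob]) (use Suc.prems in measurable)
  have "(\<integral>\<^sup>+\<omega>. h (X (Suc n) \<omega>) \<partial>M) = (\<integral>\<^sup>+\<omega>. h (snd (W n \<omega>)) \<partial>M)"
    by (intro nn_integral_cong) (simp add: state_Suc)
  also have "\<dots> = (\<integral>\<^sup>+\<omega>. (\<integral>\<^sup>+w. h (snd w) \<partial>T (X n \<omega>)) \<partial>M)"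
    using markov[of "\<lambda>(\<omega>, w). h (snd w)" n] Suc.prems by simp
  also have "\<dots> \<le> C * (\<integral>\<^sup>+x. (\<integral>\<^sup>+w. h (snd w) \<partial>T x) \<partial>\<pi>)"
    by (rule Suc.IH[OF hm])
  also have "\<dots> = C * (\<integral>\<^sup>+x. h x \<partial>\<pi>)" by (simp add: mark_invariant[OF Suc.prems])
  finally show ?case .
qed (rule dominated)

lemma nn_integral_step_le:
  assumes H: "H \<in> borel_measurable (\<pi> \<Otimes>\<^sub>M S)"
  shows "(\<integral>\<^sup>+\<omega>. H (X n \<omega>, W n \<omega>) \<partial>M) \<le> C * (\<integral>\<^sup>+z. H z \<partial>\<mu>)"
proof -
  have hm: "(\<lambda>x. \<integral>\<^sup>+w. H (x, w) \<partial>T x) \<in> borel_measurable \<pi>"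
    by (rule nn_integral_measurable_subprob_algebra2[OF _ mark_kernel_subprob]) (use H in simp)
  have "(\<lambda>(\<omega>, w). H (X n \<omega>, w)) \<in> borel_measurable (F n \<Otimes>\<^sub>M S)"
    unfolding case_prod_beta'
    by (intro measurable_compose[OF _ H] measurable_Pair measurable_snd measurable_compose[OF measurable_fst adapted_state])
  from markov[OF this] have "(\<integral>\<^sup>+\<omega>. H (X n \<omega>, W n \<omega>) \<partial>M) = (\<integral>\<^sup>+\<omega>. (\<integral>\<^sup>+w. H (X n \<omega>, w) \<partial>T (X n \<omega>)) \<partial>M)"
    by simp
  also have "\<dots> \<le> C * (\<integral>\<^sup>+x. (\<integral>\<^sup>+w. H (x, w) \<partial>T x) \<partial>\<pi>)"
    by (rule nn_integral_state_le[OF hm])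
  also have "\<dots> = C * (\<integral>\<^sup>+z. H z \<partial>\<mu>)" by (simp add: nn_integral_kernel_prod[OF mark_kernel_subprob H])
  finally show ?thesis .
qed

text \<open>Domination sends every \<open>\<pi>\<close>-null set to a null event; this is what
  allows facts known only almost everywhere to be used along the chain.\<close>

lemma AE_state:
  assumes "AE x in \<pi>. Q x" shows "AE \<omega> in M. Q (X n \<omega>)"
proof -
  obtain N where N: "{x\<in>space \<pi>. \<not> Q x} \<subseteq> N" "N \<in> sets \<pi>" "emeasure \<pi> N = 0"
    using assms by (auto elim: AE_E)
  have "(\<integral>\<^sup>+\<omega>. indicator N (X n \<omega>) \<partial>M) \<le> C * (\<integral>\<^sup>+x. indicator N x \<partial>\<pi>)"
    by (rule nn_integral_state_le) (use N in simp)
  then have "(\<integral>\<^sup>+\<omega>. indicator N (X n \<omega>) \<partial>M) = 0" using N by simp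
  moreover have "(\<lambda>\<omega>. indicator N (X n \<omega>) :: ennreal) \<in> borel_measurable M" using N by simp
  ultimately have "AE \<omega> in M. indicator N (X n \<omega>) = (0::ennreal)"
    by (simp add: nn_integral_0_iff_AE)
  with AE_space show ?thesis
    by eventually_elim (use N(1) state_space in \<open>auto simp: indicator_def split: if_splits\<close>)
qed

lemma integrable_state:
  fixes h :: "'a \<Rightarrow> real"
  assumes h: "integrable \<pi> h"
  shows "integrable M (\<lambda>\<omega>. h (X n \<omega>))" "(\<integral>\<omega>. \<bar>h (X n \<omega>)\<bar> \<partial>M) \<le> C * (\<integral>x. \<bar>h x\<bar> \<partial>\<pi>)"
proof -
  have hm[measurable]: "h \<in> borel_measurable \<pi>" using h by auto
  have le: "(\<integral>\<^sup>+\<omega>. ennreal \<bar>h (X n \<omega>)\<bar> \<partial>M) \<le> C * (\<integral>\<^sup>+x. ennreal \<bar>h x\<bar> \<partial>\<pi>)"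
    by (rule nn_integral_state_le) simp
  also have "\<dots> = ennreal (C * (\<integral>x. \<bar>h x\<bar> \<partial>\<pi>))"
    using h by (subst nn_integral_eq_integral) (auto simp: ennreal_mult C_nonneg)
  finally have le: "(\<integral>\<^sup>+\<omega>. ennreal \<bar>h (X n \<omega>)\<bar> \<partial>M) \<le> ennreal (C * (\<integral>x. \<bar>h x\<bar> \<partial>\<pi>))" .
  then show i: "integrable M (\<lambda>\<omega>. h (X n \<omega>))"
    by (intro integrableI_bounded) (auto intro: order_le_less_trans)
  have "ennreal (\<integral>\<omega>. \<bar>h (X n \<omega>)\<bar> \<partial>M) \<le> ennreal (C * (\<integral>x. \<bar>h x\<bar> \<partial>\<pi>))"
    using le i by (subst nn_integral_eq_integral[symmetric]) auto
  then show "(\<integral>\<omega>. \<bar>h (X n \<omega>)\<bar> \<partial>M) \<le> C * (\<integral>x. \<bar>h x\<bar> \<partial>\<pi>)"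
    using C_nonneg by (subst (asm) ennreal_le_iff) auto
qed

lemma integrable_step:
  fixes g :: "'a \<times> ('b \<times> 'a) \<Rightarrow> real"
  assumes g: "integrable \<mu> g"
  shows "integrable M (\<lambda>\<omega>. g (X n \<omega>, W n \<omega>))" "(\<integral>\<omega>. \<bar>g (X n \<omega>, W n \<omega>)\<bar> \<partial>M) \<le> C * (\<integral>z. \<bar>g z\<bar> \<partial>\<mu>)"
proof -
  have gm[measurable]: "g \<in> borel_measurable (\<pi> \<Otimes>\<^sub>M S)"
    using borel_measurable_integrable[OF g] measurable_cong_sets[OF sets_\<mu> refl] by blast
  have le: "(\<integral>\<^sup>+\<omega>. ennreal \<bar>g (X n \<omega>, W n \<omega>)\<bar> \<partial>M) \<le> C * (\<integral>\<^sup>+z. ennreal \<bar>g z\<bar> \<partial>\<mu>)"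
    by (rule nn_integral_step_le) simp
  also have "\<dots> = ennreal (C * (\<integral>z. \<bar>g z\<bar> \<partial>\<mu>))"
    using g by (subst nn_integral_eq_integral) (auto simp: ennreal_mult C_nonneg)
  finally have le: "(\<integral>\<^sup>+\<omega>. ennreal \<bar>g (X n \<omega>, W n \<omega>)\<bar> \<partial>M) \<le> ennreal (C * (\<integral>z. \<bar>g z\<bar> \<partial>\<mu>))" .
  then show i: "integrable M (\<lambda>\<omega>. g (X n \<omega>, W n \<omega>))"
    by (intro integrableI_bounded) (auto intro: order_le_less_trans)
  have "ennreal (\<integral>\<omega>. \<bar>g (X n \<omega>, W n \<omega>)\<bar> \<partial>M) \<le> ennreal (C * (\<integral>z. \<bar>g z\<bar> \<partial>\<mu>))"
    using le i by (subst nn_integral_eq_integral[symmetric]) auto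
  then show "(\<integral>\<omega>. \<bar>g (X n \<omega>, W n \<omega>)\<bar> \<partial>M) \<le> C * (\<integral>z. \<bar>g z\<bar> \<partial>\<mu>)"
    using C_nonneg by (subst (asm) ennreal_le_iff) auto
qed

text \<open>Increments centred given the past are orthogonal: the mixed term contains the
  conditional mean at \<open>X n\<close>, which vanishes almost surely because the law of
  \<open>X n\<close> does not charge \<open>\<pi>\<close>-null sets. Each diagonal term costs at
  most \<open>C\<close> times the stationary second moment.\<close>

lemma martingale_second_moment:
  fixes g :: "'a \<times> ('b \<times> 'a) \<Rightarrow> real"
  assumes g[measurable]: "g \<in> borel_measurable (\<pi> \<Otimes>\<^sub>M S)" and sq: "integrable \<mu> (\<lambda>z. (g z)\<^sup>2)"
    and centred: "AE x in \<pi>. (\<integral>w. g (x, w) \<partial>T x) = 0"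
  shows "integrable M (\<lambda>\<omega>. (\<Sum>k<n. g (X k \<omega>, W k \<omega>))\<^sup>2) \<and>
    (\<integral>\<omega>. (\<Sum>k<n. g (X k \<omega>, W k \<omega>))\<^sup>2 \<partial>M) \<le> real n * (C * (\<integral>z. (g z)\<^sup>2 \<partial>\<mu>))"
proof (induction n)
  case (Suc n)
  let ?S = "\<lambda>\<omega>. \<Sum>k<n. g (X k \<omega>, W k \<omega>)"
  let ?D = "\<lambda>\<omega>. g (X n \<omega>, W n \<omega>)"
  have SF: "?S \<in> borel_measurable (F n)"
    by (intro borel_measurable_sum adapted_step[OF g]) auto
  have SM: "?S \<in> borel_measurable M" by (rule measurable_from_filtration[OF SF])
  have DM: "?D \<in> borel_measurable M"
    by (rule measurable_from_filtration[OF adapted_step[OF g lessI]])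
  have iS: "integrable M (\<lambda>\<omega>. (?S \<omega>)\<^sup>2)" using Suc by simp
  have iD: "integrable M (\<lambda>\<omega>. (?D \<omega>)\<^sup>2)" using integrable_step(1)[OF sq] by simp
  have iSD: "integrable M (\<lambda>\<omega>. ?S \<omega> * ?D \<omega>)"
  proof (rule Bochner_Integration.integrable_bound[OF Bochner_Integration.integrable_add[OF iS iD]])
    have "\<bar>a * b\<bar> \<le> a\<^sup>2 + b\<^sup>2" for a b :: real
    proof -
      have "2 * \<bar>a * b\<bar> \<le> a\<^sup>2 + b\<^sup>2"
        using sum_squares_bound[of "\<bar>a\<bar>" "\<bar>b\<bar>"] by (simp add: abs_mult mult.assoc)
      then show ?thesis using abs_ge_zero[of "a * b"] by linarith
    qed
    then show "AE \<omega> in M. norm (?S \<omega> * ?D \<omega>) \<le> norm ((?S \<omega>)\<^sup>2 + (?D \<omega>)\<^sup>2)" by simp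
  qed (use SM DM in measurable)
  have "(\<integral>\<omega>. ?S \<omega> * ?D \<omega> \<partial>M) = (\<integral>\<omega>. (\<integral>w. ?S \<omega> * g (X n \<omega>, w) \<partial>T (X n \<omega>)) \<partial>M)"
  proof -
    have "(\<lambda>z. ?S (fst z) * g (X n (fst z), snd z)) \<in> borel_measurable (F n \<Otimes>\<^sub>M S)"
      by (intro borel_measurable_times measurable_compose[OF measurable_fst SF] measurable_compose[OF _ g]
          measurable_Pair measurable_snd measurable_compose[OF measurable_fst adapted_state])
    from markov_integral[OF this] iSD show ?thesis by simp
  qed
  also have "\<dots> = (\<integral>\<omega>. ?S \<omega> * (\<integral>w. g (X n \<omega>, w) \<partial>T (X n \<omega>)) \<partial>M)" by simp
  also have "\<dots> = (\<integral>\<omega>. 0 \<partial>M)"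
  proof (rule integral_cong_AE)
    have "(\<lambda>\<omega>. \<integral>w. g (X n \<omega>, w) \<partial>T (X n \<omega>)) \<in> borel_measurable M"
      by (rule measurable_compose[OF measurable_state measurable_mark_integral[OF g]])
    then show "(\<lambda>\<omega>. ?S \<omega> * (\<integral>w. g (X n \<omega>, w) \<partial>T (X n \<omega>))) \<in> borel_measurable M" using SM by simp
    show "AE \<omega> in M. ?S \<omega> * (\<integral>w. g (X n \<omega>, w) \<partial>T (X n \<omega>)) = 0"
      using AE_state[OF centred, of n] by eventually_elim simp
  qed simp
  finally have SD: "(\<integral>\<omega>. ?S \<omega> * ?D \<omega> \<partial>M) = 0" by simp
  have eq: "(\<Sum>k<Suc n. g (X k \<omega>, W k \<omega>))\<^sup>2 = (?S \<omega>)\<^sup>2 + 2 * (?S \<omega> * ?D \<omega>) + (?D \<omega>)\<^sup>2" for \<omega>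
    by (simp add: power2_eq_square algebra_simps)
  have "(\<integral>\<omega>. (?D \<omega>)\<^sup>2 \<partial>M) \<le> C * (\<integral>z. (g z)\<^sup>2 \<partial>\<mu>)"
    using integrable_step(2)[OF sq] by simp
  then show ?case
    unfolding eq using Suc iS iD iSD SD by (simp add: algebra_simps)
qed simp

end

section \<open>Second-order expansion of a corrected characteristic function along one step of the
  chain\<close>

section \<open>The perturbed test function\<close>

lemma norm_iexp_diff_le: "norm (iexp x - iexp y) \<le> \<bar>x - y\<bar>"
proof -
  have "iexp x - iexp y = iexp y * (iexp (x - y) - 1)"
    by (simp add: algebra_simps flip: exp_add)
  then have "norm (iexp x - iexp y) = norm (iexp (x - y) - 1)"
    by (simp add: norm_mult)
  also have "\<dots> \<le> \<bar>x - y\<bar>" using iexp_approx1[of "x - y" 0] by simp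
  finally show ?thesis .
qed

lemma abs_exp_minus_le: assumes "0 \<le> (x::real)" shows "\<bar>1 - x - exp (- x)\<bar> \<le> x\<^sup>2"
proof -
  have 1: "1 - x \<le> exp (- x)" using exp_ge_add_one_self[of "- x"] by simp
  have "exp (- x) \<le> 1 / (1 + x)"
    using exp_ge_add_one_self[of x] assms by (simp add: exp_minus field_simps)
  also have "\<dots> \<le> 1 - x + x\<^sup>2"
  proof -
    have "(1 - x + x\<^sup>2) * (1 + x) = 1 + x ^ 3" by (simp add: power2_eq_square power3_eq_cube algebra_simps)
    then have "1 \<le> (1 - x + x\<^sup>2) * (1 + x)" using assms by simp
    then show ?thesis using assms by (simp add: divide_le_eq)
  qed
  finally show ?thesis using 1 by simp
qed

text \<open>The scale is any sequence with \<open>n a_n^2\<close> convergent instead of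
  \<open>t / sqrt n\<close>, because a chain restarted at a fixed time is still normalised by the
  original clock. With \<open>x = a_n^2 s\<close>, the comparison with \<open>exp (- x) ^ n\<close>
  costs at most \<open>n x^2\<close>, which tends to 0.\<close>

lemma tendsto_power_exp:
  fixes a :: "nat \<Rightarrow> real"
  assumes a: "(\<lambda>n. real n * (a n)\<^sup>2) \<longlonglongrightarrow> q" and s: "0 \<le> s"
  shows "(\<lambda>n. (1 - (a n)\<^sup>2 * s) ^ n) \<longlonglongrightarrow> exp (- q * s)" and "a \<longlonglongrightarrow> 0"
proof -
  have "(\<lambda>n. (real n * (a n)\<^sup>2) * (1 / real n)) \<longlonglongrightarrow> q * 0"
    by (intro tendsto_mult a lim_1_over_n)
  then have *: "(\<lambda>n. (real n * (a n)\<^sup>2) * (1 / real n)) \<longlonglongrightarrow> 0" by simp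
  have a20: "(\<lambda>n. (a n)\<^sup>2) \<longlonglongrightarrow> 0"
    by (rule Lim_transform_eventually[OF *])
      (rule eventually_mono[OF eventually_gt_at_top[of "0::nat"]], simp)
  then have "(\<lambda>n. sqrt ((a n)\<^sup>2)) \<longlonglongrightarrow> sqrt 0" by (rule tendsto_real_sqrt)
  then show a0: "a \<longlonglongrightarrow> 0" by (simp add: tendsto_rabs_zero_iff)
  have "(\<lambda>n. (a n)\<^sup>2 * s) \<longlonglongrightarrow> 0 * s" by (intro tendsto_mult a20 tendsto_const)
  then have ev: "\<forall>\<^sub>F n in sequentially. (a n)\<^sup>2 * s < 1" by (rule order_tendstoD) simp
  have "(\<lambda>n. (real n * (a n)\<^sup>2) * ((a n)\<^sup>2 * s\<^sup>2)) \<longlonglongrightarrow> q * (0 * s\<^sup>2)"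
    by (intro tendsto_mult a a20 tendsto_const)
  then have lim0: "(\<lambda>n. (real n * (a n)\<^sup>2) * ((a n)\<^sup>2 * s\<^sup>2)) \<longlonglongrightarrow> 0" by simp
  have d: "(\<lambda>n. (1 - (a n)\<^sup>2 * s) ^ n - exp (- ((a n)\<^sup>2 * s)) ^ n) \<longlonglongrightarrow> 0"
  proof (rule Lim_null_comparison[OF _ lim0])
    show "\<forall>\<^sub>F n in sequentially. norm ((1 - (a n)\<^sup>2 * s) ^ n - exp (- ((a n)\<^sup>2 * s)) ^ n)
        \<le> (real n * (a n)\<^sup>2) * ((a n)\<^sup>2 * s\<^sup>2)"
      using ev
    proof eventually_elim
      case (elim n)
      let ?x = "(a n)\<^sup>2 * s"
      have x: "0 \<le> ?x" using s by simp
      have "norm ((1 - ?x) ^ n - exp (- ?x) ^ n) \<le> real n * norm ((1 - ?x) - exp (- ?x))"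
        by (rule norm_power_diff) (use x elim in auto)
      also have "\<dots> \<le> real n * ?x\<^sup>2"
        using abs_exp_minus_le[OF x] by (intro mult_left_mono) auto
      finally show ?case by (simp add: power2_eq_square algebra_simps)
    qed
  qed
  have e: "(\<lambda>n. exp (- ((a n)\<^sup>2 * s)) ^ n) \<longlonglongrightarrow> exp (- q * s)"
  proof -
    have "(\<lambda>n. exp (- (real n * (a n)\<^sup>2) * s)) \<longlonglongrightarrow> exp (- q * s)"
      by (intro tendsto_intros a)
    then show ?thesis by (simp add: exp_of_nat_mult[symmetric] algebra_simps)
  qed
  show "(\<lambda>n. (1 - (a n)\<^sup>2 * s) ^ n) \<longlonglongrightarrow> exp (- q * s)"
    using tendsto_add[OF d e] by simp
qed

text \<open>A multiplier of modulus at most 1 does not amplify earlier errors, so they merely add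
  up.\<close>

lemma recursion_bound:
  fixes \<psi> :: "nat \<Rightarrow> complex"
  assumes step: "\<And>k. norm (\<psi> (Suc k) - r * \<psi> k) \<le> \<delta>" and r: "norm r \<le> 1" and \<delta>: "0 \<le> \<delta>"
  shows "norm (\<psi> n - r ^ n * \<psi> 0) \<le> real n * \<delta>"
proof (induction n)
  case (Suc n)
  have "\<psi> (Suc n) - r ^ Suc n * \<psi> 0 = (\<psi> (Suc n) - r * \<psi> n) + r * (\<psi> n - r ^ n * \<psi> 0)"
    by (simp add: algebra_simps)
  then have "norm (\<psi> (Suc n) - r ^ Suc n * \<psi> 0) \<le> norm (\<psi> (Suc n) - r * \<psi> n) + norm r * norm (\<psi> n - r ^ n * \<psi> 0)"
    by (metis norm_triangle_ineq norm_mult)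
  also have "\<dots> \<le> \<delta> + 1 * (real n * \<delta>)"
    by (intro add_mono step mult_mono r Suc.IH) auto
  finally show ?case by (simp add: algebra_simps)
qed simp

lemma (in finite_measure) norm_integral_le_const:
  fixes f :: "'a \<Rightarrow> complex"
  assumes "f \<in> borel_measurable M" "\<And>x. x \<in> space M \<Longrightarrow> norm (f x) \<le> B"
  shows "integrable M f" "norm (\<integral>x. f x \<partial>M) \<le> B * measure M (space M)"
proof -
  show i: "integrable M f" by (rule integrable_const_bound[where B=B]) (use assms in auto)
  have "norm (\<integral>x. f x \<partial>M) \<le> (\<integral>x. norm (f x) \<partial>M)" by (rule integral_norm_bound)
  also have "\<dots> \<le> (\<integral>x. B \<partial>M)" using i assms by (intro integral_mono) auto
  finally show "norm (\<integral>x. f x \<partial>M) \<le> B * measure M (space M)" by (simp add: mult.commute)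
qed

text \<open>Summable expectations make the series itself finite almost surely, so its terms vanish;
  this takes the place of a Borel-Cantelli argument.\<close>

lemma AE_tendsto_zero_if_summable:
  fixes f :: "nat \<Rightarrow> 'a \<Rightarrow> real"
  assumes f: "\<And>n. integrable M (f n)" "\<And>n x. 0 \<le> f n x" and s: "summable B" "\<And>n. (\<integral>x. f n x \<partial>M) \<le> B n"
  shows "AE x in M. (\<lambda>n. f n x) \<longlonglongrightarrow> 0"
proof -
  note f(1)[THEN borel_measurable_integrable, measurable]
  have B0: "0 \<le> B n" for n using order_trans[OF integral_nonneg_AE s(2)] f(2) by simp
  have "(\<integral>\<^sup>+x. (\<Sum>n. ennreal (f n x)) \<partial>M) = (\<Sum>n. \<integral>\<^sup>+x. ennreal (f n x) \<partial>M)"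
    by (rule nn_integral_suminf) measurable
  also have "\<dots> \<le> (\<Sum>n. ennreal (B n))"
    using f s(2) by (intro suminf_le) (auto simp: nn_integral_eq_integral ennreal_leI)
  also have "\<dots> = ennreal (\<Sum>n. B n)" by (rule suminf_ennreal2[OF B0 s(1)])
  also have "\<dots> < \<infinity>" by simp
  finally have "(\<integral>\<^sup>+x. (\<Sum>n. ennreal (f n x)) \<partial>M) \<noteq> \<infinity>" by simp
  then have "AE x in M. (\<Sum>n. ennreal (f n x)) \<noteq> \<infinity>"
    by (rule nn_integral_noteq_infinite[rotated]) measurable
  then show ?thesis
  proof eventually_elim
    case (elim x)
    have "summable (\<lambda>n. f n x)"
      by (rule summable_suminf_not_top[OF f(2)]) (use elim in auto)
    then show ?case by (rule summable_LIMSEQ_zero)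
  qed
qed

context dominated_chain
begin

text \<open>Expand \<open>iexp (a g)\<close> to second order. Centring removes the linear term and
  leaves \<open>1 - a^2 v / 2\<close>, up to a Taylor remainder with constant
  \<open>c^3 / 6\<close>. Keeping the old exponential in front of \<open>u (X (Suc k))\<close> costs
  \<open>c d / 2\<close>, after which the conditional mean of \<open>u\<close> is \<open>Pu\<close>.
  There remain \<open>(v - s) - (u - Pu)\<close>, small in L1, and a product of two corrections,
  with constant \<open>s d / 4\<close>. Everything except the coboundary error is of order
  \<open>\<bar>a\<bar> ^ 3\<close>, hence negligible over \<open>n\<close> steps when
  \<open>n a^2\<close> stays bounded and \<open>a\<close> tends to 0.\<close>

lemma bounded_clt_step:
  fixes g :: "'a \<times> ('b \<times> 'a) \<Rightarrow> real" and u :: "'a \<Rightarrow> real" and a :: real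
  defines "v \<equiv> \<lambda>x. \<integral>w. (g (x, w))\<^sup>2 \<partial>T x" and "m \<equiv> measure M (space M)"
    and "Pu \<equiv> \<lambda>x. \<integral>w. u (snd w) \<partial>T x"
  defines "\<psi> \<equiv> \<lambda>k. (\<integral>\<omega>. iexp (a * (\<Sum>j<k. g (X j \<omega>, W j \<omega>))) * (1 - complex_of_real (a\<^sup>2 / 2 * u (X k \<omega>))) \<partial>M)"
  assumes g: "g \<in> borel_measurable (\<pi> \<Otimes>\<^sub>M S)"
    and gb: "\<And>x w. x \<in> space \<pi> \<Longrightarrow> w \<in> space S \<Longrightarrow> \<bar>g (x, w)\<bar> \<le> c"
    and centred: "\<And>x. x \<in> space \<pi> \<Longrightarrow> (\<integral>w. g (x, w) \<partial>T x) = 0"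
    and u: "u \<in> borel_measurable \<pi>" "\<And>x. x \<in> space \<pi> \<Longrightarrow> \<bar>u x\<bar> \<le> d"
    and e: "(\<integral>x. \<bar>(v x - s) - (u x - Pu x)\<bar> \<partial>\<pi>) \<le> e"
    and s: "0 \<le> s" and a: "\<bar>a\<bar> \<le> 1" and c: "0 \<le> c" and d: "0 \<le> d"
  shows "norm (\<psi> (Suc k) - complex_of_real (1 - a\<^sup>2 * (s / 2)) * \<psi> k)
    \<le> \<bar>a\<bar> ^ 3 * (c ^ 3 / 6 + c * d / 2 + s * d / 4) * m + a\<^sup>2 / 2 * (C * e)"
proof -
  let ?S = "\<lambda>k \<omega>. \<Sum>j<k. g (X j \<omega>, W j \<omega>)"
  let ?E = "\<lambda>k \<omega>. iexp (a * ?S k \<omega>)"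
  have SF: "?S k \<in> borel_measurable (F k)" for k
    by (intro borel_measurable_sum adapted_step[OF g]) auto
  have SM[measurable]: "?S k \<in> borel_measurable M" for k by (rule measurable_from_filtration[OF SF])
  have EF: "?E k \<in> borel_measurable (F k)" for k using SF by measurable
  have EM[measurable]: "?E k \<in> borel_measurable M" for k by measurable
  have u1[measurable]: "u \<in> borel_measurable \<pi>" by (rule u)
  have vm[measurable]: "v \<in> borel_measurable \<pi>"
    unfolding v_def by (rule measurable_mark_integral[of "\<lambda>z. (g z)\<^sup>2"]) (use g in simp)
  have g2b: "\<bar>(g (x, w))\<^sup>2\<bar> \<le> c\<^sup>2" if "x \<in> space \<pi>" "w \<in> space S" for x w
    using power_mono[OF gb[OF that] abs_ge_zero, of 2] by simp
  have vb: "\<bar>v x\<bar> \<le> c\<^sup>2" if "x \<in> space \<pi>" for x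
    unfolding v_def by (rule mark_integral_bounded[of "\<lambda>z. (g z)\<^sup>2"]) (use g g2b that in auto)
  have usm: "(\<lambda>z. u (snd (snd z))) \<in> borel_measurable (\<pi> \<Otimes>\<^sub>M S)" by measurable
  have usb: "\<bar>u (snd w)\<bar> \<le> d" if "w \<in> space S" for w
    using u(2)[of "snd w"] that by (auto simp: space_pair_measure)
  have Pum[measurable]: "Pu \<in> borel_measurable \<pi>"
    unfolding Pu_def using measurable_mark_integral[OF usm] by simp
  have Pub: "\<bar>Pu x\<bar> \<le> d" if "x \<in> space \<pi>" for x
    unfolding Pu_def using mark_integral_bounded[OF usm, of d x] usb that by simp
  \<comment> \<open>Error from replacing the conditional characteristic function of the increment by
    its second-order expansion.\<close>
  define err1 where "err1 = (\<integral>\<omega>. ?E k \<omega> * (\<integral>w. iexp (a * g (X k \<omega>, w)) \<partial>T (X k \<omega>)) \<partial>M) - (\<integral>\<omega>. ?E k \<omega> * (1 - complex_of_real (a\<^sup>2 / 2 * v (X k \<omega>))) \<partial>M)"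
  have inner: "norm ((\<integral>w. iexp (a * g (x, w)) \<partial>T x) - (1 - complex_of_real (a\<^sup>2 / 2 * v x))) \<le> \<bar>a\<bar> ^ 3 * (c ^ 3 / 6)"
    if x: "x \<in> space \<pi>" for x
  proof -
    interpret K: prob_space "T x" by (rule prob_space_mark[OF x])
    have gx[measurable]: "(\<lambda>w. g (x, w)) \<in> borel_measurable (T x)" by (rule measurable_section[OF g x refl])
    have i1: "integrable (T x) (\<lambda>w. g (x, w))" by (rule integrable_section_bounded[OF g gb x])
    have i2: "integrable (T x) (\<lambda>w. (g (x, w))\<^sup>2)"
      by (rule integrable_section_bounded[of "\<lambda>z. (g z)\<^sup>2", OF _ g2b x]) (use g in auto)
    have i0: "integrable (T x) (\<lambda>w. iexp (a * g (x, w)))"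
      by (rule K.integrable_const_bound[where B=1]) auto
    let ?q = "\<lambda>w. 1 + \<i> * complex_of_real (a * g (x, w)) - complex_of_real (a\<^sup>2 / 2 * (g (x, w))\<^sup>2)"
    have iq: "integrable (T x) ?q"
      by (intro Bochner_Integration.integrable_diff Bochner_Integration.integrable_add integrable_mult_right
          integrable_of_real K.integrable_const i1 i2)
    have "(\<integral>w. ?q w \<partial>T x) = 1 - complex_of_real (a\<^sup>2 / 2 * v x)"
      using i1 i2 centred[OF x] by (simp add: v_def K.prob_space del: of_real_mult of_real_divide)
    then have "norm ((\<integral>w. iexp (a * g (x, w)) \<partial>T x) - (1 - complex_of_real (a\<^sup>2 / 2 * v x))) = norm (\<integral>w. iexp (a * g (x, w)) - ?q w \<partial>T x)"
      using i0 iq by simp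
    also have "\<dots> \<le> (\<bar>a\<bar> ^ 3 * (c ^ 3 / 6)) * measure (T x) (space (T x))"
    proof (rule K.norm_integral_le_const(2))
      fix w assume "w \<in> space (T x)"
      then have gw: "\<bar>g (x, w)\<bar> \<le> c" using gb[OF x] space_mark[OF x] by simp
      have "iexp (a * g (x, w)) - ?q w = iexp (a * g (x, w)) - (\<Sum>k\<le>2. (\<i> * complex_of_real (a * g (x, w))) ^ k / fact k)"
        by (simp add: numeral_2_eq_2 power2_eq_square algebra_simps)
      then have "norm (iexp (a * g (x, w)) - ?q w) = norm (iexp (a * g (x, w)) - (\<Sum>k\<le>2. (\<i> * complex_of_real (a * g (x, w))) ^ k / fact k))"
        by (rule arg_cong)
      also have "\<dots> \<le> \<bar>a * g (x, w)\<bar> ^ Suc 2 / fact (Suc 2)" by (rule iexp_approx1)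
      also have "\<dots> = \<bar>a * g (x, w)\<bar> ^ 3 / fact 3" by (simp only: eval_nat_numeral)
      also have "\<dots> \<le> \<bar>a\<bar> ^ 3 * (c ^ 3 / 6)"
        using power_mono[OF gw abs_ge_zero, of 3]
        by (simp add: abs_mult power_mult_distrib fact_numeral mult_left_mono)
      finally show "norm (iexp (a * g (x, w)) - ?q w) \<le> \<bar>a\<bar> ^ 3 * (c ^ 3 / 6)" .
    qed measurable
    finally show ?thesis by (simp add: K.prob_space)
  qed
  have Xm: "(\<lambda>z. X k (fst z)) \<in> F k \<Otimes>\<^sub>M S \<rightarrow>\<^sub>M \<pi>"
    by (rule measurable_compose[OF measurable_fst adapted_state])
  have gXm: "(\<lambda>z. g (X k (fst z), snd z)) \<in> borel_measurable (F k \<Otimes>\<^sub>M S)"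
    by (rule measurable_compose[OF measurable_Pair[OF Xm measurable_snd] g])
  have EFm: "(\<lambda>z. ?E k (fst z)) \<in> borel_measurable (F k \<Otimes>\<^sub>M S)"
    by (rule measurable_compose[OF measurable_fst EF])
  have I1: "(\<integral>\<omega>. ?E (Suc k) \<omega> \<partial>M) = (\<integral>\<omega>. ?E k \<omega> * (\<integral>w. iexp (a * g (X k \<omega>, w)) \<partial>T (X k \<omega>)) \<partial>M)"
  proof -
    have "(\<lambda>z. ?E k (fst z) * iexp (a * g (X k (fst z), snd z))) \<in> borel_measurable (F k \<Otimes>\<^sub>M S)"
      using EFm gXm by measurable
    from markov_integral_complex[OF this, of 1]
    have "(\<integral>\<omega>. ?E k \<omega> * iexp (a * g (X k \<omega>, W k \<omega>)) \<partial>M) = (\<integral>\<omega>. (\<integral>w. ?E k \<omega> * iexp (a * g (X k \<omega>, w)) \<partial>T (X k \<omega>)) \<partial>M)"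
      by (simp add: norm_mult)
    then show ?thesis by (simp add: distrib_left exp_add)
  qed
  have J: "(\<integral>\<omega>. ?E k \<omega> * complex_of_real (u (X (Suc k) \<omega>)) \<partial>M) = (\<integral>\<omega>. ?E k \<omega> * complex_of_real (Pu (X k \<omega>)) \<partial>M)"
  proof -
    have "(\<lambda>z. ?E k (fst z) * complex_of_real (u (snd (snd z)))) \<in> borel_measurable (F k \<Otimes>\<^sub>M S)"
      using EFm by measurable
    from markov_integral_complex[OF this, of d]
    have "(\<integral>\<omega>. ?E k \<omega> * complex_of_real (u (snd (W k \<omega>))) \<partial>M) = (\<integral>\<omega>. (\<integral>w. ?E k \<omega> * complex_of_real (u (snd w)) \<partial>T (X k \<omega>)) \<partial>M)"
      using usb by (simp add: norm_mult)
    moreover have "(\<integral>\<omega>. ?E k \<omega> * complex_of_real (u (X (Suc k) \<omega>)) \<partial>M) = (\<integral>\<omega>. ?E k \<omega> * complex_of_real (u (snd (W k \<omega>))) \<partial>M)"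
      by (intro Bochner_Integration.integral_cong) (auto simp: state_Suc)
    ultimately show ?thesis by (simp add: Pu_def)
  qed
  have cm: "(\<lambda>\<omega>. complex_of_real (f \<omega>)) \<in> borel_measurable M" if "f \<in> borel_measurable M" for f
    using that by measurable
  have nrm: "norm (?E i \<omega> * complex_of_real y) = \<bar>y\<bar>" for i \<omega> y
    unfolding norm_mult norm_exp_i_times by simp
  define err2 where "err2 = (\<integral>\<omega>. ?E (Suc k) \<omega> * complex_of_real (u (X (Suc k) \<omega>)) \<partial>M) - (\<integral>\<omega>. ?E k \<omega> * complex_of_real (u (X (Suc k) \<omega>)) \<partial>M)"
  have uX: "\<bar>u (X j \<omega>)\<bar> \<le> d" if "\<omega> \<in> space M" for j \<omega> using u(2) state_space[OF that] by simp
  have uXm: "(\<lambda>\<omega>. u (X j \<omega>)) \<in> borel_measurable M" for j by measurable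
  have iEu: "integrable M (\<lambda>\<omega>. ?E i \<omega> * complex_of_real (u (X j \<omega>)))" for i j
    by (rule M.norm_integral_le_const(1)[where B=d],
        rule borel_measurable_times[OF EM cm[OF uXm]], unfold nrm, erule uX)
  have iE: "integrable M (?E i)" for i
    by (rule M.norm_integral_le_const(1)[where B=1], rule EM, unfold norm_exp_i_times, simp)
  have err2: "norm err2 \<le> (\<bar>a\<bar> * c * d) * m"
  proof -
    have "err2 = (\<integral>\<omega>. (?E (Suc k) \<omega> - ?E k \<omega>) * complex_of_real (u (X (Suc k) \<omega>)) \<partial>M)"
      unfolding err2_def left_diff_distrib by (rule Bochner_Integration.integral_diff[OF iEu iEu, symmetric])
    also have "norm \<dots> \<le> (\<bar>a\<bar> * c * d) * m"
      unfolding m_def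
    proof (rule M.norm_integral_le_const(2))
      show "(\<lambda>\<omega>. (?E (Suc k) \<omega> - ?E k \<omega>) * complex_of_real (u (X (Suc k) \<omega>))) \<in> borel_measurable M"
        by (intro borel_measurable_times borel_measurable_diff EM cm[OF uXm])
      fix \<omega> assume w: "\<omega> \<in> space M"
      have "norm (?E (Suc k) \<omega> - ?E k \<omega>) \<le> \<bar>a * ?S (Suc k) \<omega> - a * ?S k \<omega>\<bar>" by (rule norm_iexp_diff_le)
      also have "\<dots> = \<bar>a\<bar> * \<bar>g (X k \<omega>, W k \<omega>)\<bar>" by (simp add: algebra_simps abs_mult)
      also have "\<dots> \<le> \<bar>a\<bar> * c" using gb[OF state_space[OF w] mark_space[OF w]] by (simp add: mult_left_mono)
      finally have "norm (?E (Suc k) \<omega> - ?E k \<omega>) \<le> \<bar>a\<bar> * c" .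
      from mult_mono[OF this uX[OF w]] c show "norm ((?E (Suc k) \<omega> - ?E k \<omega>) * complex_of_real (u (X (Suc k) \<omega>))) \<le> \<bar>a\<bar> * c * d"
        by (simp add: norm_mult)
    qed
    finally show ?thesis .
  qed
  have vXm: "(\<lambda>\<omega>. v (X k \<omega>)) \<in> borel_measurable M" by measurable
  have vX: "\<bar>v (X k \<omega>)\<bar> \<le> c\<^sup>2" if "\<omega> \<in> space M" for \<omega> using vb state_space[OF that] by simp
  have PuXm: "(\<lambda>\<omega>. Pu (X k \<omega>)) \<in> borel_measurable M" by measurable
  have PuX: "\<bar>Pu (X k \<omega>)\<bar> \<le> d" if "\<omega> \<in> space M" for \<omega> using Pub state_space[OF that] by simp
  have iEv: "integrable M (\<lambda>\<omega>. ?E k \<omega> * complex_of_real (v (X k \<omega>)))"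
    by (rule M.norm_integral_le_const(1)[where B="c\<^sup>2"],
        rule borel_measurable_times[OF EM cm[OF vXm]], unfold nrm, erule vX)
  have iEPu: "integrable M (\<lambda>\<omega>. ?E k \<omega> * complex_of_real (Pu (X k \<omega>)))"
    by (rule M.norm_integral_le_const(1)[where B=d],
        rule borel_measurable_times[OF EM cm[OF PuXm]], unfold nrm, erule PuX)
  define L where "L x = (\<integral>w. iexp (a * g (x, w)) \<partial>T x)" for x
  have K': "(\<lambda>\<omega>. T (X k \<omega>)) \<in> M \<rightarrow>\<^sub>M subprob_algebra S"
    by (rule measurable_compose[OF measurable_state mark_kernel_subprob])
  have Lm: "(\<lambda>\<omega>. L (X k \<omega>)) \<in> borel_measurable M"
  proof -
    have *: "(\<lambda>x. \<integral>w. cos (a * g (x, w)) \<partial>T x) \<in> borel_measurable \<pi>" "(\<lambda>x. \<integral>w. sin (a * g (x, w)) \<partial>T x) \<in> borel_measurable \<pi>"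
      using measurable_mark_integral[of "\<lambda>z. cos (a * g z)"] measurable_mark_integral[of "\<lambda>z. sin (a * g z)"] g by simp_all
    have eq: "L x = complex_of_real (\<integral>w. cos (a * g (x, w)) \<partial>T x) + \<i> * complex_of_real (\<integral>w. sin (a * g (x, w)) \<partial>T x)"
      if x: "x \<in> space \<pi>" for x
    proof -
      interpret K: prob_space "T x" by (rule prob_space_mark[OF x])
      have gx[measurable]: "(\<lambda>w. g (x, w)) \<in> borel_measurable (T x)" by (rule measurable_section[OF g x refl])
      have i0: "integrable (T x) (\<lambda>w. iexp (a * g (x, w)))"
        by (rule K.integrable_const_bound[where B=1]) auto
      have "Re (L x) = (\<integral>w. Re (iexp (a * g (x, w))) \<partial>T x)" "Im (L x) = (\<integral>w. Im (iexp (a * g (x, w))) \<partial>T x)"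
        unfolding L_def using i0 by simp_all
      then show ?thesis by (intro complex_eqI) (simp_all add: Re_exp Im_exp)
    qed
    have "L \<in> borel_measurable \<pi>" by (subst measurable_cong[OF eq]) (use * in measurable)
    then show ?thesis by measurable
  qed
  have inner': "norm (L x - (1 - complex_of_real (a\<^sup>2 / 2 * v x))) \<le> \<bar>a\<bar> ^ 3 * (c ^ 3 / 6)" if "x \<in> space \<pi>" for x
    unfolding L_def by (rule inner[OF that])
  have Lb: "norm (L x) \<le> 1" if x: "x \<in> space \<pi>" for x
  proof -
    interpret K: prob_space "T x" by (rule prob_space_mark[OF x])
    have gx[measurable]: "(\<lambda>w. g (x, w)) \<in> borel_measurable (T x)" by (rule measurable_section[OF g x refl])
    have "norm (L x) \<le> 1 * measure (T x) (space (T x))"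
      unfolding L_def by (rule K.norm_integral_le_const(2)) auto
    then show ?thesis by (simp add: K.prob_space)
  qed
  have iEL: "integrable M (\<lambda>\<omega>. ?E k \<omega> * L (X k \<omega>))"
    by (rule M.norm_integral_le_const(1)[where B=1], intro borel_measurable_times EM Lm,
        unfold norm_mult norm_exp_i_times, use Lb state_space in simp)
  have iEv': "integrable M (\<lambda>\<omega>. ?E k \<omega> * (1 - complex_of_real (a\<^sup>2 / 2 * v (X k \<omega>))))"
  proof -
    have "integrable M (\<lambda>\<omega>. ?E k \<omega> - complex_of_real (a\<^sup>2 / 2) * (?E k \<omega> * complex_of_real (v (X k \<omega>))))"
      by (intro Bochner_Integration.integrable_diff integrable_mult_right iE iEv)
    then show ?thesis by (simp add: algebra_simps)
  qed
  have err1: "norm err1 \<le> (\<bar>a\<bar> ^ 3 * (c ^ 3 / 6)) * m"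
  proof -
    have "err1 = (\<integral>\<omega>. ?E k \<omega> * (L (X k \<omega>) - (1 - complex_of_real (a\<^sup>2 / 2 * v (X k \<omega>)))) \<partial>M)"
      unfolding err1_def L_def[symmetric] using iEL iEv' by (simp only: right_diff_distrib' Bochner_Integration.integral_diff)
    also have "norm \<dots> \<le> (\<bar>a\<bar> ^ 3 * (c ^ 3 / 6)) * m"
      unfolding m_def
    proof (rule M.norm_integral_le_const(2))
      show "(\<lambda>\<omega>. ?E k \<omega> * (L (X k \<omega>) - (1 - complex_of_real (a\<^sup>2 / 2 * v (X k \<omega>))))) \<in> borel_measurable M"
        using Lm vXm by measurable
      fix \<omega> assume "\<omega> \<in> space M"
      then show "norm (?E k \<omega> * (L (X k \<omega>) - (1 - complex_of_real (a\<^sup>2 / 2 * v (X k \<omega>))))) \<le> \<bar>a\<bar> ^ 3 * (c ^ 3 / 6)"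
        using inner'[OF state_space] by (simp only: norm_mult norm_exp_i_times mult_1_left)
    qed
    finally show ?thesis .
  qed
  define r where "r = 1 - a\<^sup>2 * (s / 2)"
  \<comment> \<open>What is left at time \<open>k\<close> once the two errors are set aside. The
    terms of order \<open>a^2\<close> combine into the coboundary defect; the term in
    \<open>a ^ 4\<close> is the product of \<open>a^2 s / 2\<close> and
    \<open>a^2 u / 2\<close>.\<close>
  define b where "b x = - (a\<^sup>2 / 2) * ((v x - s) - (u x - Pu x)) - a ^ 4 * s / 4 * u x" for x
  have bX: "b x = (1 - a\<^sup>2 / 2 * v x) - a\<^sup>2 / 2 * Pu x - r * (1 - a\<^sup>2 / 2 * u x)" for x
    unfolding b_def r_def by (simp add: power2_eq_square power4_eq_xxxx field_simps)
  have iEu': "integrable M (\<lambda>\<omega>. ?E j \<omega> * (1 - complex_of_real (a\<^sup>2 / 2 * u (X j \<omega>))))" for j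
  proof -
    have "integrable M (\<lambda>\<omega>. ?E j \<omega> - complex_of_real (a\<^sup>2 / 2) * (?E j \<omega> * complex_of_real (u (X j \<omega>))))"
      by (intro Bochner_Integration.integrable_diff integrable_mult_right iE iEu)
    then show ?thesis by (simp add: algebra_simps)
  qed
  have psi: "\<psi> (Suc k) = (\<integral>\<omega>. ?E (Suc k) \<omega> \<partial>M) - complex_of_real (a\<^sup>2 / 2) * (\<integral>\<omega>. ?E (Suc k) \<omega> * complex_of_real (u (X (Suc k) \<omega>)) \<partial>M)"
  proof -
    have "\<psi> (Suc k) = (\<integral>\<omega>. ?E (Suc k) \<omega> - complex_of_real (a\<^sup>2 / 2) * (?E (Suc k) \<omega> * complex_of_real (u (X (Suc k) \<omega>))) \<partial>M)"
      unfolding \<psi>_def by (intro Bochner_Integration.integral_cong) (simp_all only: of_real_mult right_diff_distrib mult_1_right mult.left_commute)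
    also have "\<dots> = (\<integral>\<omega>. ?E (Suc k) \<omega> \<partial>M) - (\<integral>\<omega>. complex_of_real (a\<^sup>2 / 2) * (?E (Suc k) \<omega> * complex_of_real (u (X (Suc k) \<omega>))) \<partial>M)"
      by (rule Bochner_Integration.integral_diff[OF iE integrable_mult_right[OF iEu]])
    finally show ?thesis by (simp only: integral_mult_right_zero)
  qed
  have main: "\<psi> (Suc k) - complex_of_real r * \<psi> k = err1 - complex_of_real (a\<^sup>2 / 2) * err2 + (\<integral>\<omega>. ?E k \<omega> * complex_of_real (b (X k \<omega>)) \<partial>M)"
  proof -
    have "(\<integral>\<omega>. ?E k \<omega> * complex_of_real (b (X k \<omega>)) \<partial>M)
      = (\<integral>\<omega>. ?E k \<omega> * (1 - complex_of_real (a\<^sup>2 / 2 * v (X k \<omega>))) - complex_of_real (a\<^sup>2 / 2) * (?E k \<omega> * complex_of_real (Pu (X k \<omega>)))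
          - complex_of_real r * (?E k \<omega> * (1 - complex_of_real (a\<^sup>2 / 2 * u (X k \<omega>)))) \<partial>M)"
    proof (rule Bochner_Integration.integral_cong[OF refl])
      fix \<omega>
      have alg: "E * (p - q * P - R * t) = E * p - q * (E * P) - R * (E * t)" for E p q P R t :: complex
        by (simp add: algebra_simps)
      show "?E k \<omega> * complex_of_real (b (X k \<omega>)) = ?E k \<omega> * (1 - complex_of_real (a\<^sup>2 / 2 * v (X k \<omega>))) - complex_of_real (a\<^sup>2 / 2) * (?E k \<omega> * complex_of_real (Pu (X k \<omega>)))
          - complex_of_real r * (?E k \<omega> * (1 - complex_of_real (a\<^sup>2 / 2 * u (X k \<omega>))))"
        unfolding bX alg[symmetric] by (simp only: of_real_diff of_real_mult of_real_1)
    qed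
    also have "\<dots> = (\<integral>\<omega>. ?E k \<omega> * (1 - complex_of_real (a\<^sup>2 / 2 * v (X k \<omega>))) \<partial>M)
      - complex_of_real (a\<^sup>2 / 2) * (\<integral>\<omega>. ?E k \<omega> * complex_of_real (Pu (X k \<omega>)) \<partial>M) - complex_of_real r * \<psi> k"
      unfolding \<psi>_def
      by (simp only: Bochner_Integration.integral_diff[OF Bochner_Integration.integrable_diff[OF iEv' integrable_mult_right[OF iEPu]] integrable_mult_right[OF iEu']]
          Bochner_Integration.integral_diff[OF iEv' integrable_mult_right[OF iEPu]] integral_mult_right_zero)
    finally show ?thesis
      unfolding psi err1_def err2_def J I1 by (simp only: right_diff_distrib) (simp only: algebra_simps)
  qed
  have int1: "integrable \<pi> (\<lambda>x. (v x - s) - (u x - Pu x))"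
  proof (rule integrable_const_bound[where B="c\<^sup>2 + s + 2 * d"])
    show "AE x in \<pi>. norm (v x - s - (u x - Pu x)) \<le> c\<^sup>2 + s + 2 * d"
    proof (rule AE_I2)
      fix x assume x: "x \<in> space \<pi>"
      show "norm (v x - s - (u x - Pu x)) \<le> c\<^sup>2 + s + 2 * d"
        using vb[OF x] u(2)[OF x] Pub[OF x] s by (simp add: abs_if split: if_splits)
    qed
  qed measurable
  have last: "norm (\<integral>\<omega>. ?E k \<omega> * complex_of_real (b (X k \<omega>)) \<partial>M) \<le> a\<^sup>2 / 2 * (C * e) + (\<bar>a\<bar> ^ 3 * s / 4 * d) * m"
  proof -
    let ?h = "\<lambda>x. (v x - s) - (u x - Pu x)"
    have ih: "integrable M (\<lambda>\<omega>. \<bar>?h (X k \<omega>)\<bar>)" by (rule integrable_abs[OF integrable_state(1)[OF int1]])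
    have "norm (\<integral>\<omega>. ?E k \<omega> * complex_of_real (b (X k \<omega>)) \<partial>M) \<le> (\<integral>\<omega>. norm (?E k \<omega> * complex_of_real (b (X k \<omega>))) \<partial>M)"
      by (rule integral_norm_bound)
    also have "\<dots> = (\<integral>\<omega>. \<bar>b (X k \<omega>)\<bar> \<partial>M)" unfolding nrm ..
    also have "\<dots> \<le> (\<integral>\<omega>. a\<^sup>2 / 2 * \<bar>?h (X k \<omega>)\<bar> + \<bar>a\<bar> ^ 3 * s / 4 * d \<partial>M)"
    proof (rule integral_mono')
      show "integrable M (\<lambda>\<omega>. a\<^sup>2 / 2 * \<bar>?h (X k \<omega>)\<bar> + \<bar>a\<bar> ^ 3 * s / 4 * d)" using ih by simp
      fix \<omega> assume w: "\<omega> \<in> space M"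
      \<comment> \<open>The restriction of \<open>a\<close> to \<open>[-1, 1]\<close> serves to
        absorb the fourth order into the third.\<close>
      have a4: "a ^ 4 \<le> \<bar>a\<bar> ^ 3" using power_decreasing[of 3 4 "\<bar>a\<bar>"] a by simp
      have "\<bar>b (X k \<omega>)\<bar> \<le> \<bar>(a\<^sup>2 / 2) * ?h (X k \<omega>)\<bar> + \<bar>a ^ 4 * s / 4 * u (X k \<omega>)\<bar>"
        unfolding b_def by simp
      also have "\<bar>(a\<^sup>2 / 2) * ?h (X k \<omega>)\<bar> = a\<^sup>2 / 2 * \<bar>?h (X k \<omega>)\<bar>" by (simp add: abs_mult)
      also have "\<bar>a ^ 4 * s / 4 * u (X k \<omega>)\<bar> = a ^ 4 * s / 4 * \<bar>u (X k \<omega>)\<bar>" using s by (simp add: abs_mult)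
      also have "\<dots> \<le> \<bar>a\<bar> ^ 3 * s / 4 * d" using a4 s uX[OF w] by (intro mult_mono) (auto intro: mult_right_mono)
      finally show "\<bar>b (X k \<omega>)\<bar> \<le> a\<^sup>2 / 2 * \<bar>?h (X k \<omega>)\<bar> + \<bar>a\<bar> ^ 3 * s / 4 * d" by simp
    qed (use s d in auto)
    also have "\<dots> = a\<^sup>2 / 2 * (\<integral>\<omega>. \<bar>?h (X k \<omega>)\<bar> \<partial>M) + (\<bar>a\<bar> ^ 3 * s / 4 * d) * m"
      using ih by (simp add: m_def mult.commute)
    also have "\<dots> \<le> a\<^sup>2 / 2 * (C * e) + (\<bar>a\<bar> ^ 3 * s / 4 * d) * m"
      using order_trans[OF integrable_state(2)[OF int1] mult_left_mono[OF e C_nonneg]]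
      by (intro add_right_mono mult_left_mono) auto
    finally show ?thesis .
  qed
  have "norm (\<psi> (Suc k) - complex_of_real r * \<psi> k) \<le> norm err1 + norm (complex_of_real (a\<^sup>2 / 2) * err2) + norm (\<integral>\<omega>. ?E k \<omega> * complex_of_real (b (X k \<omega>)) \<partial>M)"
    unfolding main by (meson norm_triangle_ineq norm_triangle_ineq4 order_trans add_mono order_refl)
  also have "norm (complex_of_real (a\<^sup>2 / 2) * err2) = a\<^sup>2 / 2 * norm err2" by (simp add: norm_mult norm_power)
  also have "\<dots> \<le> a\<^sup>2 / 2 * ((\<bar>a\<bar> * c * d) * m)" by (rule mult_left_mono[OF err2]) simp
  also have "\<dots> = (\<bar>a\<bar> ^ 3 * (c * d / 2)) * m" by (simp add: power2_eq_square power3_eq_cube)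
  finally show ?thesis
    using err1 last unfolding r_def[symmetric] by (simp add: algebra_simps)
qed

end

section \<open>Central limit theorem for bounded increments, and the strong law by second
  moments\<close>

section \<open>Bounded increments and the strong law\<close>

text \<open>The approximation by coboundaries is formulated through \<open>\<pi>\<close> and
  \<open>T\<close> alone, so it passes unchanged to every restarted and restricted chain.\<close>

locale ergodic_dominated_chain = dominated_chain \<pi> Z T M F X W C
  for \<pi> :: "'a measure" and Z :: "'b measure" and T and M :: "'w measure" and F X W C +
  assumes coboundary: "\<lbrakk>(v :: 'a \<Rightarrow> real) \<in> borel_measurable \<pi>; \<And>x. x \<in> space \<pi> \<Longrightarrow> \<bar>v x\<bar> \<le> c; (\<integral>x. v x \<partial>\<pi>) = 0; 0 < e\<rbrakk> \<Longrightarrow>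
    \<exists>d (u :: 'a \<Rightarrow> real). u \<in> borel_measurable \<pi> \<and> (\<forall>x\<in>space \<pi>. \<bar>u x\<bar> \<le> d) \<and> (\<integral>x. \<bar>v x - (u x - (\<integral>w. u (snd w) \<partial>T x))\<bar> \<partial>\<pi>) \<le> e"
begin

text \<open>Iterating the one-step estimate gives an error
  \<open>n (\<bar>a\<bar>^3 K + a^2 C e / 2)\<close>, whose limit \<open>q C e / 2\<close> can be
  made small. The order of choices matters: first \<open>e\<close>, then \<open>u\<close> with its
  bound \<open>d\<close>, and only then \<open>n\<close>, since \<open>d\<close> is not controlled
  in terms of \<open>e\<close>.\<close>

lemma bounded_clt:
  fixes g :: "'a \<times> ('b \<times> 'a) \<Rightarrow> real" and a :: "nat \<Rightarrow> real"
  defines "s \<equiv> \<integral>x. (\<integral>w. (g (x, w))\<^sup>2 \<partial>T x) \<partial>\<pi>" and "m \<equiv> measure M (space M)"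
  assumes g: "g \<in> borel_measurable (\<pi> \<Otimes>\<^sub>M S)"
    and gb: "\<And>x w. x \<in> space \<pi> \<Longrightarrow> w \<in> space S \<Longrightarrow> \<bar>g (x, w)\<bar> \<le> c"
    and centred: "\<And>x. x \<in> space \<pi> \<Longrightarrow> (\<integral>w. g (x, w) \<partial>T x) = 0"
    and a: "(\<lambda>n. real n * (a n)\<^sup>2) \<longlonglongrightarrow> q"
  shows "(\<lambda>n. \<integral>\<omega>. iexp (a n * (\<Sum>j<n. g (X j \<omega>, W j \<omega>))) \<partial>M) \<longlonglongrightarrow> complex_of_real (m * exp (- q * (s / 2)))"
proof -
  define v where "v = (\<lambda>x. \<integral>w. (g (x, w))\<^sup>2 \<partial>T x)"
  define \<phi> where "\<phi> n = (\<integral>\<omega>. iexp (a n * (\<Sum>j<n. g (X j \<omega>, W j \<omega>))) \<partial>M)" for n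
  define r where "r n = 1 - (a n)\<^sup>2 * (s / 2)" for n
  have q0: "0 \<le> q" by (rule LIMSEQ_le_const[OF a]) auto
  have m0: "0 \<le> m" by (simp add: m_def)
  obtain x0 where x0: "x0 \<in> space \<pi>" using not_empty by auto
  have c0: "0 \<le> c"
  proof -
    interpret K: prob_space "T x0" by (rule prob_space_mark[OF x0])
    obtain w where "w \<in> space S" using K.not_empty space_mark[OF x0] by auto
    from gb[OF x0 this] show ?thesis by linarith
  qed
  have vm: "v \<in> borel_measurable \<pi>"
    unfolding v_def by (rule measurable_mark_integral[of "\<lambda>z. (g z)\<^sup>2"]) (use g in simp)
  have g2b: "\<bar>(g (x, w))\<^sup>2\<bar> \<le> c\<^sup>2" if "x \<in> space \<pi>" "w \<in> space S" for x w
    using power_mono[OF gb[OF that] abs_ge_zero, of 2] by simp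
  have vb: "\<bar>v x\<bar> \<le> c\<^sup>2" if "x \<in> space \<pi>" for x
    unfolding v_def by (rule mark_integral_bounded[of "\<lambda>z. (g z)\<^sup>2"]) (use g g2b that in auto)
  have iv: "integrable \<pi> v" by (rule integrable_const_bound[where B="c\<^sup>2"]) (use vb vm in auto)
  have s_v: "s = (\<integral>x. v x \<partial>\<pi>)" by (simp add: s_def v_def)
  have s0: "0 \<le> s" unfolding s_def by simp
  have r_lim: "(\<lambda>n. r n ^ n) \<longlonglongrightarrow> exp (- q * (s / 2))" and a0: "a \<longlonglongrightarrow> 0"
    unfolding r_def using tendsto_power_exp[OF a, of "s / 2"] s0 by auto
  have diff: "(\<lambda>n. \<phi> n - complex_of_real (m * r n ^ n)) \<longlonglongrightarrow> 0"
  proof (rule tendstoI)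
    fix \<epsilon> :: real assume \<epsilon>: "0 < \<epsilon>"
    \<comment> \<open>The limiting error is \<open>q C e / 2\<close>; the added 1 keeps the
      denominator positive when \<open>q\<close> or \<open>C\<close> vanishes.\<close>
    define e where "e = \<epsilon> / (q * C + 1)"
    have qC: "0 < q * C + 1" using q0 C_nonneg by (simp add: add_nonneg_pos)
    have e: "0 < e" using \<epsilon> qC by (simp add: e_def)
    have "(\<integral>x. v x - s \<partial>\<pi>) = 0" using iv by (simp add: s_v prob_space)
    moreover have "\<bar>v x - s\<bar> \<le> c\<^sup>2 + s" if "x \<in> space \<pi>" for x using vb[OF that] s0 by linarith
    ultimately obtain d' u where u: "u \<in> borel_measurable \<pi>" "\<And>x. x \<in> space \<pi> \<Longrightarrow> \<bar>u x\<bar> \<le> d'"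
      and ue: "(\<integral>x. \<bar>v x - s - (u x - (\<integral>w. u (snd w) \<partial>T x))\<bar> \<partial>\<pi>) \<le> e"
      using coboundary[of "\<lambda>x. v x - s" "c\<^sup>2 + s" e] vm e by auto
    define d where "d = \<bar>d'\<bar>"
    have d: "\<bar>u x\<bar> \<le> d" if "x \<in> space \<pi>" for x using u(2)[OF that] by (simp add: d_def)
    have d0: "0 \<le> d" by (simp add: d_def)
    define K where "K = (c ^ 3 / 6 + c * d / 2 + s * d / 4) * m"
    define f where "f n = real n * (\<bar>a n\<bar> ^ 3 * K + (a n)\<^sup>2 / 2 * (C * e)) + (a n)\<^sup>2 * (d * m)" for n
    have K0: "0 \<le> K" using c0 d0 s0 m0 by (simp add: K_def)
    have f_lim: "f \<longlonglongrightarrow> q / 2 * (C * e)"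
    proof -
      have "(\<lambda>n. (real n * (a n)\<^sup>2) * (\<bar>a n\<bar> * K) + (real n * (a n)\<^sup>2) / 2 * (C * e) + (a n)\<^sup>2 * (d * m)) \<longlonglongrightarrow> q * (\<bar>0\<bar> * K) + q / 2 * (C * e) + 0\<^sup>2 * (d * m)"
        by (intro tendsto_intros a a0) simp
      moreover have "f = (\<lambda>n. (real n * (a n)\<^sup>2) * (\<bar>a n\<bar> * K) + (real n * (a n)\<^sup>2) / 2 * (C * e) + (a n)\<^sup>2 * (d * m))"
        by (simp add: f_def[abs_def] power3_eq_cube power2_eq_square algebra_simps)
      ultimately show ?thesis by simp
    qed
    have "q / 2 * (C * e) < \<epsilon>"
    proof -
      have "q / 2 * (C * e) \<le> (q * C) * e" using q0 C_nonneg e by (simp add: field_simps)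
      also have "\<dots> < (q * C + 1) * e" using e by simp
      also have "\<dots> = \<epsilon>" using qC by (simp add: e_def)
      finally show ?thesis .
    qed
    then have ev1: "\<forall>\<^sub>F n in sequentially. f n < \<epsilon>" by (rule order_tendstoD(2)[OF f_lim])
    have "(\<lambda>n. \<bar>a n\<bar>) \<longlonglongrightarrow> \<bar>0\<bar>" by (intro tendsto_intros a0)
    then have ev2: "\<forall>\<^sub>F n in sequentially. \<bar>a n\<bar> < 1" by (rule order_tendstoD(2)) simp
    have "(\<lambda>n. (a n)\<^sup>2 * (s / 2)) \<longlonglongrightarrow> 0\<^sup>2 * (s / 2)" by (intro tendsto_intros a0)
    then have ev3: "\<forall>\<^sub>F n in sequentially. (a n)\<^sup>2 * (s / 2) < 1" by (rule order_tendstoD(2)) simp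
    show "\<forall>\<^sub>F n in sequentially. dist (\<phi> n - complex_of_real (m * r n ^ n)) 0 < \<epsilon>"
      using ev1 ev2 ev3
    proof eventually_elim
      case (elim n)
      define \<psi> where "\<psi> k = (\<integral>\<omega>. iexp (a n * (\<Sum>j<k. g (X j \<omega>, W j \<omega>))) * (1 - complex_of_real ((a n)\<^sup>2 / 2 * u (X k \<omega>))) \<partial>M)" for k
      have Sm: "(\<lambda>\<omega>. \<Sum>j<k. g (X j \<omega>, W j \<omega>)) \<in> borel_measurable M" for k
        by (intro borel_measurable_sum measurable_from_filtration[OF adapted_step[OF g lessI]])
      have Em: "(\<lambda>\<omega>. iexp (a n * (\<Sum>j<k. g (X j \<omega>, W j \<omega>)))) \<in> borel_measurable M" for k
        using Sm by measurable
      have uXm: "(\<lambda>\<omega>. u (X k \<omega>)) \<in> borel_measurable M" for k using u(1) by measurable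
      have step: "norm (\<psi> (Suc k) - complex_of_real (r n) * \<psi> k) \<le> \<bar>a n\<bar> ^ 3 * K + (a n)\<^sup>2 / 2 * (C * e)" for k
        unfolding \<psi>_def r_def K_def m_def
        using bounded_clt_step[OF g gb centred u(1) d ue[unfolded v_def] s0 _ c0 d0, where a="a n" and k=k] elim(2)
        by (simp only: less_imp_le mult.assoc)
      have r1: "norm (complex_of_real (r n)) \<le> 1"
        unfolding norm_of_real r_def using elim(3) s0 by (simp add: abs_le_iff)
      have del: "0 \<le> \<bar>a n\<bar> ^ 3 * K + (a n)\<^sup>2 / 2 * (C * e)" using K0 C_nonneg e by simp
      have rec: "norm (\<psi> n - complex_of_real (r n) ^ n * \<psi> 0) \<le> real n * (\<bar>a n\<bar> ^ 3 * K + (a n)\<^sup>2 / 2 * (C * e))"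
        by (rule recursion_bound[of \<psi> "complex_of_real (r n)", OF step r1 del])
      \<comment> \<open>Dropping the perturbation changes the characteristic function by at most
        \<open>(a n)^2 d m / 2\<close>; this is paid once at time 0 and once at time
        \<open>n\<close>.\<close>
      have near: "norm ((\<integral>\<omega>. iexp (a n * (\<Sum>j<k. g (X j \<omega>, W j \<omega>))) \<partial>M) - \<psi> k) \<le> (a n)\<^sup>2 / 2 * d * m" for k
      proof -
        let ?E = "\<lambda>\<omega>. iexp (a n * (\<Sum>j<k. g (X j \<omega>, W j \<omega>)))"
        have b: "(\<lambda>\<omega>. ?E \<omega> * complex_of_real ((a n)\<^sup>2 / 2 * u (X k \<omega>))) \<in> borel_measurable M"
          using Em uXm by measurable
        have bb: "norm (?E \<omega> * complex_of_real ((a n)\<^sup>2 / 2 * u (X k \<omega>))) \<le> (a n)\<^sup>2 / 2 * d" if "\<omega> \<in> space M" for \<omega>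
          using mult_left_mono[OF d[OF state_space[OF that, of k]], of "(a n)\<^sup>2 / 2"]
          unfolding norm_mult norm_exp_i_times norm_of_real by (simp add: abs_mult)
        note i = M.norm_integral_le_const[OF b bb]
        have iE: "integrable M ?E" by (rule M.norm_integral_le_const(1)[OF Em, of _ 1]) simp
        have "\<psi> k = (\<integral>\<omega>. ?E \<omega> - ?E \<omega> * complex_of_real ((a n)\<^sup>2 / 2 * u (X k \<omega>)) \<partial>M)"
          unfolding \<psi>_def by (simp only: right_diff_distrib mult_1_right)
        also have "\<dots> = (\<integral>\<omega>. ?E \<omega> \<partial>M) - (\<integral>\<omega>. ?E \<omega> * complex_of_real ((a n)\<^sup>2 / 2 * u (X k \<omega>)) \<partial>M)"
          by (rule Bochner_Integration.integral_diff[OF iE i(1)])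
        finally show ?thesis using i(2) by (simp add: m_def)
      qed
      have n0: "norm (complex_of_real m - \<psi> 0) \<le> (a n)\<^sup>2 / 2 * d * m"
        using near[of 0] by (simp add: m_def scaleR_conv_of_real)
      have rn: "norm (complex_of_real (r n) ^ n) \<le> 1"
        unfolding norm_power using r1 by (intro power_le_one) auto
      have "\<phi> n - complex_of_real (m * r n ^ n) = (\<phi> n - \<psi> n) + (\<psi> n - complex_of_real (r n) ^ n * \<psi> 0) + complex_of_real (r n) ^ n * (\<psi> 0 - complex_of_real m)"
        by (simp add: algebra_simps)
      also have "norm \<dots> \<le> norm (\<phi> n - \<psi> n) + norm (\<psi> n - complex_of_real (r n) ^ n * \<psi> 0) + norm (complex_of_real (r n) ^ n * (\<psi> 0 - complex_of_real m))"
        by (meson norm_triangle_ineq order_trans add_mono order_refl)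
      also have "norm (complex_of_real (r n) ^ n * (\<psi> 0 - complex_of_real m)) \<le> 1 * ((a n)\<^sup>2 / 2 * d * m)"
        unfolding norm_mult using n0 rn by (intro mult_mono) (auto simp: norm_minus_commute)
      also have "norm (\<phi> n - \<psi> n) \<le> (a n)\<^sup>2 / 2 * d * m" unfolding \<phi>_def by (rule near)
      also note rec
      finally have "norm (\<phi> n - complex_of_real (m * r n ^ n)) \<le> f n"
        by (simp add: f_def algebra_simps)
      then show ?case using elim(1) by simp
    qed
  qed
  have "(\<lambda>n. complex_of_real (m * r n ^ n)) \<longlonglongrightarrow> complex_of_real (m * exp (- q * (s / 2)))"
    by (intro tendsto_intros r_lim)
  from tendsto_add[OF diff this] show ?thesis by (simp add: \<phi>_def)
qed

end

context dominated_chain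
begin

text \<open>At time \<open>(k + 1)^2\<close> the normalised sum has second moment at most
  \<open>A / (k + 1)^2\<close>, which is summable. The block up to the next square has
  \<open>2 k + 3\<close> increments, so the sum of their absolute values has second moment at most
  \<open>(3 (k + 1))^2 A\<close>, and division by \<open>(k + 1)^4\<close> gives the same
  order.\<close>

lemma martingale_strong_law:
  fixes g :: "'a \<times> ('b \<times> 'a) \<Rightarrow> real"
  assumes g[measurable]: "g \<in> borel_measurable (\<pi> \<Otimes>\<^sub>M S)" and sq: "integrable \<mu> (\<lambda>z. (g z)\<^sup>2)"
    and centred: "AE x in \<pi>. (\<integral>w. g (x, w) \<partial>T x) = 0"
  shows "AE \<omega> in M. (\<lambda>n. (\<Sum>k<n. g (X k \<omega>, W k \<omega>)) / real n) \<longlonglongrightarrow> 0"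
proof -
  let ?S = "\<lambda>n \<omega>. \<Sum>k<n. g (X k \<omega>, W k \<omega>)"
  define A where "A = C * (\<integral>z. (g z)\<^sup>2 \<partial>\<mu>)"
  note mom = martingale_second_moment[OF g sq centred, folded A_def]
  have A0: "0 \<le> A" using C_nonneg by (simp add: A_def)
  have step: "integrable M (\<lambda>\<omega>. (g (X k \<omega>, W k \<omega>))\<^sup>2)" "(\<integral>\<omega>. (g (X k \<omega>, W k \<omega>))\<^sup>2 \<partial>M) \<le> A" for k
    using integrable_step[OF sq, of k] by (simp_all add: A_def)
  have gm: "(\<lambda>\<omega>. g (X k \<omega>, W k \<omega>)) \<in> borel_measurable M" for k
    by (rule measurable_from_filtration[OF adapted_step[OF g lessI]])
  \<comment> \<open>One majorant for both sequences; 9 is the square of the 3 in the bound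
    \<open>3 (k + 1)\<close> for the length of a block.\<close>
  have sum2: "summable (\<lambda>k. 9 * A * (1 / (real (Suc k))\<^sup>2))"
  proof (rule summable_mult)
    have "summable (\<lambda>k. 1 / (real k)\<^sup>2)" using inverse_power_summable[of 2, where 'a=real] by (simp add: divide_inverse)
    then show "summable (\<lambda>k. 1 / (real (Suc k))\<^sup>2)" by (subst summable_Suc_iff)
  qed
  have fr: "x\<^sup>2 * B / x ^ 4 = B * (1 / x\<^sup>2)" if "x \<noteq> 0" for x B :: real
    using that by (simp add: power2_eq_square power4_eq_xxxx)
  define p where "p k \<omega> = (?S ((Suc k)\<^sup>2) \<omega> / (real (Suc k))\<^sup>2)\<^sup>2" for k \<omega>
  define D where "D k \<omega> = (\<Sum>j\<in>{(Suc k)\<^sup>2..<(Suc (Suc k))\<^sup>2}. \<bar>g (X j \<omega>, W j \<omega>)\<bar>)" for k \<omega>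
  define b where "b k \<omega> = (D k \<omega> / (real (Suc k))\<^sup>2)\<^sup>2" for k \<omega>
  have p_lim: "AE \<omega> in M. (\<lambda>k. p k \<omega>) \<longlonglongrightarrow> 0"
  proof (rule AE_tendsto_zero_if_summable[OF _ _ sum2])
    fix k
    have eq: "p k \<omega> = (?S ((Suc k)\<^sup>2) \<omega>)\<^sup>2 / (real (Suc k)) ^ 4" for \<omega>
      by (simp add: p_def power_divide flip: power_mult)
    show "integrable M (p k)" unfolding eq[abs_def] using mom by simp
    have "(\<integral>\<omega>. p k \<omega> \<partial>M) = (\<integral>\<omega>. (?S ((Suc k)\<^sup>2) \<omega>)\<^sup>2 \<partial>M) / (real (Suc k)) ^ 4"
      unfolding eq by (rule integral_divide_zero)
    also have "\<dots> \<le> real ((Suc k)\<^sup>2) * A / (real (Suc k)) ^ 4" by (rule divide_right_mono[OF conjunct2[OF mom]]) simp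
    also have "\<dots> = A * (1 / (real (Suc k))\<^sup>2)"
      using fr[of "real (Suc k)" A] by (simp only: of_nat_power)
    also have "\<dots> \<le> 9 * A * (1 / (real (Suc k))\<^sup>2)" using A0 by (intro mult_right_mono) auto
    finally show "(\<integral>\<omega>. p k \<omega> \<partial>M) \<le> 9 * A * (1 / (real (Suc k))\<^sup>2)" .
  qed (simp add: p_def)
  have b_lim: "AE \<omega> in M. (\<lambda>k. b k \<omega>) \<longlonglongrightarrow> 0"
  proof (rule AE_tendsto_zero_if_summable[OF _ _ sum2])
    fix k
    let ?I = "{(Suc k)\<^sup>2..<(Suc (Suc k))\<^sup>2}"
    have cI: "real (card ?I) = 2 * real k + 3" by (simp add: power2_eq_square)
    have c3: "real (card ?I) \<le> 3 * real (Suc k)" unfolding cI by simp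
    have eq: "b k \<omega> = (D k \<omega>)\<^sup>2 / (real (Suc k)) ^ 4" for \<omega>
      by (simp add: b_def power_divide flip: power_mult)
    have Dm: "D k \<in> borel_measurable M" unfolding D_def[abs_def] using gm by (intro borel_measurable_sum) measurable
    \<comment> \<open>Absolute values destroy orthogonality, so the length of the block enters
      twice: once here through Cauchy-Schwarz, once through the sum of second moments.\<close>
    have D_le: "(D k \<omega>)\<^sup>2 \<le> real (card ?I) * (\<Sum>j\<in>?I. (g (X j \<omega>, W j \<omega>))\<^sup>2)" for \<omega>
      using Cauchy_Schwarz_ineq_sum[of "\<lambda>_. 1" "\<lambda>j. \<bar>g (X j \<omega>, W j \<omega>)\<bar>" ?I]
      by (simp add: D_def)
    have i: "integrable M (\<lambda>\<omega>. real (card ?I) * (\<Sum>j\<in>?I. (g (X j \<omega>, W j \<omega>))\<^sup>2))"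
      using step(1) by (intro integrable_mult_right Bochner_Integration.integrable_sum) auto
    have iD: "integrable M (\<lambda>\<omega>. (D k \<omega>)\<^sup>2)"
      by (rule Bochner_Integration.integrable_bound[OF i]) (use Dm D_le in \<open>auto simp: sum_nonneg\<close>)
    then show "integrable M (b k)" unfolding eq[abs_def] by simp
    have "(\<integral>\<omega>. (D k \<omega>)\<^sup>2 \<partial>M) \<le> (\<integral>\<omega>. real (card ?I) * (\<Sum>j\<in>?I. (g (X j \<omega>, W j \<omega>))\<^sup>2) \<partial>M)"
      by (rule integral_mono[OF iD i D_le])
    also have "\<dots> = real (card ?I) * (\<Sum>j\<in>?I. \<integral>\<omega>. (g (X j \<omega>, W j \<omega>))\<^sup>2 \<partial>M)"
      using step(1) by simp
    also have "\<dots> \<le> real (card ?I) * (\<Sum>j\<in>?I. A)"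
      using step(2) by (intro mult_left_mono sum_mono) auto
    also have "\<dots> = (real (card ?I))\<^sup>2 * A" by (simp add: power2_eq_square)
    also have "\<dots> \<le> (3 * real (Suc k))\<^sup>2 * A" using c3 A0 by (intro mult_right_mono power_mono) auto
    finally have "(\<integral>\<omega>. (D k \<omega>)\<^sup>2 \<partial>M) \<le> (3 * real (Suc k))\<^sup>2 * A" .
    then have "(\<integral>\<omega>. b k \<omega> \<partial>M) \<le> (3 * real (Suc k))\<^sup>2 * A / (real (Suc k)) ^ 4"
      unfolding eq integral_divide_zero by (rule divide_right_mono) simp
    also have "\<dots> = 9 * A * (1 / (real (Suc k))\<^sup>2)"
      using fr[of "real (Suc k)" "9 * A"] by (simp only: power_mult_distrib) (simp add: mult.assoc mult.commute mult.left_commute)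
    finally show "(\<integral>\<omega>. b k \<omega> \<partial>M) \<le> 9 * A * (1 / (real (Suc k))\<^sup>2)" .
  qed (simp add: b_def)
  show ?thesis
    using p_lim b_lim
  proof eventually_elim
    case (elim \<omega>)
    \<comment> \<open>Bounds the normalised sum throughout the block that starts at
      \<open>(k + 1)^2\<close>; the block containing \<open>n\<close> therefore has the number
      \<open>floor_sqrt n - 1\<close>.\<close>
    define \<alpha> where "\<alpha> k = sqrt (p k \<omega>) + sqrt (b k \<omega>)" for k
    have \<alpha>: "\<alpha> \<longlonglongrightarrow> 0"
      unfolding \<alpha>_def using tendsto_add[OF tendsto_real_sqrt[OF elim(1)] tendsto_real_sqrt[OF elim(2)]] by simp
    show ?case
    proof (rule Lim_null_comparison)
      show "(\<lambda>n. \<alpha> (floor_sqrt n - 1)) \<longlonglongrightarrow> 0"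
      proof (rule filterlim_compose[OF \<alpha>])
        show "filterlim (\<lambda>n. floor_sqrt n - 1) at_top sequentially"
          unfolding filterlim_at_top
        proof
          fix Z :: nat
          show "\<forall>\<^sub>F n in sequentially. Z \<le> floor_sqrt n - 1"
            using eventually_ge_at_top[of "(Suc Z)\<^sup>2"]
          proof eventually_elim
            case (elim n)
            then have "floor_sqrt ((Suc Z)\<^sup>2) \<le> floor_sqrt n" by (rule mono_floor_sqrt')
            then show ?case by simp
          qed
        qed
      qed
      show "\<forall>\<^sub>F n in sequentially. norm (?S n \<omega> / real n) \<le> \<alpha> (floor_sqrt n - 1)"
        using eventually_ge_at_top[of 1]
      proof eventually_elim
        case (elim n)
        define k where "k = floor_sqrt n - 1"
        have "1 \<le> floor_sqrt n" using mono_floor_sqrt'[OF elim] by simp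
        then have k: "Suc k = floor_sqrt n" by (simp add: k_def)
        have lo: "(Suc k)\<^sup>2 \<le> n" unfolding k by simp
        have lo': "(real (Suc k))\<^sup>2 \<le> real n" using lo by (metis of_nat_le_iff of_nat_power)
        have hi: "n < (Suc (Suc k))\<^sup>2" unfolding k by (rule Suc_floor_sqrt_power2_gt)
        have "?S n \<omega> = ?S ((Suc k)\<^sup>2) \<omega> + (\<Sum>j\<in>{(Suc k)\<^sup>2..<n}. g (X j \<omega>, W j \<omega>))"
          using sum.atLeastLessThan_concat[of 0 "(Suc k)\<^sup>2" n "\<lambda>j. g (X j \<omega>, W j \<omega>)"] lo
          by (simp add: lessThan_atLeast0)
        moreover have "\<bar>\<Sum>j\<in>{(Suc k)\<^sup>2..<n}. g (X j \<omega>, W j \<omega>)\<bar> \<le> D k \<omega>"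
        proof -
          have "\<bar>\<Sum>j\<in>{(Suc k)\<^sup>2..<n}. g (X j \<omega>, W j \<omega>)\<bar> \<le> (\<Sum>j\<in>{(Suc k)\<^sup>2..<n}. \<bar>g (X j \<omega>, W j \<omega>)\<bar>)" by (rule sum_abs)
          also have "\<dots> \<le> D k \<omega>" unfolding D_def using hi by (intro sum_mono2) auto
          finally show ?thesis .
        qed
        ultimately have "\<bar>?S n \<omega>\<bar> \<le> \<bar>?S ((Suc k)\<^sup>2) \<omega>\<bar> + D k \<omega>" by linarith
        then have "norm (?S n \<omega> / real n) \<le> (\<bar>?S ((Suc k)\<^sup>2) \<omega>\<bar> + D k \<omega>) / real n"
          by (simp add: divide_right_mono)
        also have "\<dots> \<le> (\<bar>?S ((Suc k)\<^sup>2) \<omega>\<bar> + D k \<omega>) / (real (Suc k))\<^sup>2"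
          using lo' elim by (intro divide_left_mono add_nonneg_nonneg mult_pos_pos) (auto simp: D_def sum_nonneg simp del: of_nat_Suc)
        also have "\<dots> = \<alpha> k"
          by (simp add: \<alpha>_def p_def b_def add_divide_distrib abs_divide D_def sum_nonneg)
        finally show ?case by (simp add: k_def)
      qed
    qed
  qed
qed

text \<open>Second moments are bounded along the chain, so those of \<open>h (X n) / n\<close> are
  summable. This disposes of the boundary terms of the martingale decomposition.\<close>

lemma scaled_state_AE:
  fixes h :: "'a \<Rightarrow> real"
  assumes h: "h \<in> borel_measurable \<pi>" "integrable \<pi> (\<lambda>x. (h x)\<^sup>2)"
  shows "AE \<omega> in M. (\<lambda>n. h (X n \<omega>) / real n) \<longlonglongrightarrow> 0"
proof -
  define A where "A = C * (\<integral>x. (h x)\<^sup>2 \<partial>\<pi>)"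
  have st: "integrable M (\<lambda>\<omega>. (h (X n \<omega>))\<^sup>2)" "(\<integral>\<omega>. (h (X n \<omega>))\<^sup>2 \<partial>M) \<le> A" for n
    using integrable_state[OF h(2), of n] by (simp_all add: A_def)
  have "summable (\<lambda>k. 1 / (real k)\<^sup>2)" using inverse_power_summable[of 2, where 'a=real] by (simp add: divide_inverse)
  then have s: "summable (\<lambda>k. A * (1 / (real k)\<^sup>2))" by (rule summable_mult)
  have "AE \<omega> in M. (\<lambda>n. (h (X n \<omega>) / real n)\<^sup>2) \<longlonglongrightarrow> 0"
  proof (rule AE_tendsto_zero_if_summable[OF _ _ s])
    fix n
    show "integrable M (\<lambda>\<omega>. (h (X n \<omega>) / real n)\<^sup>2)" using st by (simp add: power_divide)
    show "(\<integral>\<omega>. (h (X n \<omega>) / real n)\<^sup>2 \<partial>M) \<le> A * (1 / (real n)\<^sup>2)"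
      using divide_right_mono[OF st(2)[of n], of "(real n)\<^sup>2"] by (simp add: power_divide)
  qed simp
  then show ?thesis
  proof eventually_elim
    case (elim \<omega>)
    from tendsto_real_sqrt[OF this] have "(\<lambda>n. \<bar>h (X n \<omega>) / real n\<bar>) \<longlonglongrightarrow> 0"
      by (simp only: real_sqrt_abs real_sqrt_zero)
    then show ?case by (rule tendsto_rabs_zero_cancel)
  qed
qed

end

section \<open>L2-approximation by bounded centred increments\<close>

section \<open>Square integrable increments\<close>

definition truncate :: "nat \<Rightarrow> real \<Rightarrow> real" where
  "truncate N y = max (- real N) (min (real N) y)"

lemma truncate_bound: "\<bar>truncate N y\<bar> \<le> real N"
  by (auto simp: truncate_def)

lemma truncate_le: "\<bar>truncate N y\<bar> \<le> \<bar>y\<bar>"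
  by (auto simp: truncate_def)

lemma truncate_diff_le: "\<bar>y - truncate N y\<bar> \<le> \<bar>y\<bar>"
  by (auto simp: truncate_def)

lemma measurable_truncate [measurable]: "truncate N \<in> borel_measurable borel"
  unfolding truncate_def[abs_def] by measurable

lemma truncate_tendsto: "(\<lambda>N. truncate N y) \<longlonglongrightarrow> y"
proof (rule tendsto_eventually)
  obtain K :: nat where K: "\<bar>y\<bar> \<le> real K" using real_arch_simple by blast
  show "\<forall>\<^sub>F N in sequentially. truncate N y = y"
    using eventually_ge_at_top[of K]
    by eventually_elim (use K in \<open>auto simp: truncate_def\<close>)
qed

lemma square_le_square: "\<bar>x\<bar> \<le> \<bar>y\<bar> \<Longrightarrow> x\<^sup>2 \<le> (y::real)\<^sup>2"
  by (simp add: abs_le_square_iff)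

lemma (in prob_space) square_integral_le:
  fixes f :: "'a \<Rightarrow> real"
  assumes "f \<in> borel_measurable M" "integrable M (\<lambda>x. (f x)\<^sup>2)"
  shows "integrable M f" "(expectation f)\<^sup>2 \<le> (\<integral>x. (f x)\<^sup>2 \<partial>M)"
proof -
  show i: "integrable M f"
  proof (rule Bochner_Integration.integrable_bound[OF Bochner_Integration.integrable_add[OF integrable_const[of 1] assms(2)] assms(1)])
    have "\<bar>y\<bar> \<le> 1 + y\<^sup>2" for y :: real
      using sum_squares_bound[of 1 "\<bar>y\<bar>"] abs_ge_zero[of y] by (simp add: power2_eq_square)
    then show "AE x in M. norm (f x) \<le> norm (1 + (f x)\<^sup>2)" by simp
  qed
  have "0 \<le> variance f" by simp
  also have "variance f = (\<integral>x. (f x)\<^sup>2 \<partial>M) - (expectation f)\<^sup>2" by (rule variance_eq[OF i assms(2)])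
  finally show "(expectation f)\<^sup>2 \<le> (\<integral>x. (f x)\<^sup>2 \<partial>M)" by simp
qed

text \<open>Truncation destroys centring, so the conditional mean is subtracted again; the result is
  centred at every point although \<open>g\<close> is so only almost everywhere. The subtracted mean
  tends to the conditional mean of \<open>g\<close>, which is 0, and its square is dominated by the
  conditional second moment of \<open>g\<close>, so it disappears in L2.\<close>

lemma (in mark_kernel) centred_truncation:
  fixes g :: "'a \<times> ('b \<times> 'a) \<Rightarrow> real"
  assumes g[measurable]: "g \<in> borel_measurable (\<pi> \<Otimes>\<^sub>M S)" and sq: "integrable \<mu> (\<lambda>z. (g z)\<^sup>2)"
    and centred: "AE x in \<pi>. (\<integral>w. g (x, w) \<partial>T x) = 0"
  defines "h \<equiv> \<lambda>N z. truncate N (g z) - (\<integral>w. truncate N (g (fst z, w)) \<partial>T (fst z))"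
  shows "h N \<in> borel_measurable (\<pi> \<Otimes>\<^sub>M S)"
    and "x \<in> space \<pi> \<Longrightarrow> w \<in> space S \<Longrightarrow> \<bar>h N (x, w)\<bar> \<le> 2 * real N"
    and "x \<in> space \<pi> \<Longrightarrow> (\<integral>w. h N (x, w) \<partial>T x) = 0"
    and "integrable \<mu> (\<lambda>z. (g z - h N z)\<^sup>2)"
    and "AE x in \<pi>. (\<integral>w. g (x, w) - h N (x, w) \<partial>T x) = 0"
    and "(\<lambda>N. \<integral>z. (g z - h N z)\<^sup>2 \<partial>\<mu>) \<longlonglongrightarrow> 0"
    and "(\<lambda>N. \<integral>x. (\<integral>w. (h N (x, w))\<^sup>2 \<partial>T x) \<partial>\<pi>) \<longlonglongrightarrow> (\<integral>z. (g z)\<^sup>2 \<partial>\<mu>)"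
proof -
  interpret mu: prob_space \<mu> by (rule prob_space_\<mu>)
  define G where "G N x = (\<integral>w. truncate N (g (x, w)) \<partial>T x)" for N x
  have tm[measurable]: "(\<lambda>z. truncate N (g z)) \<in> borel_measurable (\<pi> \<Otimes>\<^sub>M S)" for N by measurable
  have Gm[measurable]: "G N \<in> borel_measurable \<pi>" for N
    unfolding G_def by (rule measurable_mark_integral[OF tm])
  have h: "h N z = truncate N (g z) - G N (fst z)" for N z by (simp add: h_def G_def)
  show hm[measurable]: "h N \<in> borel_measurable (\<pi> \<Otimes>\<^sub>M S)" for N
    unfolding h[abs_def] by measurable
  have Gb: "\<bar>G N x\<bar> \<le> real N" if "x \<in> space \<pi>" for N x
    unfolding G_def by (rule mark_integral_bounded[OF tm _ that]) (rule truncate_bound)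
  show hb: "\<bar>h N (x, w)\<bar> \<le> 2 * real N" if "x \<in> space \<pi>" "w \<in> space S" for N x w
    using truncate_bound[of N "g (x, w)"] Gb[OF that(1), of N] by (simp add: h)
  have it: "integrable (T x) (\<lambda>w. truncate N (g (x, w)))" if "x \<in> space \<pi>" for N x
    by (rule integrable_section_bounded[OF tm _ that]) (rule truncate_bound)
  have it2: "integrable (T x) (\<lambda>w. (truncate N (g (x, w)))\<^sup>2)" if "x \<in> space \<pi>" for N x
    by (rule integrable_section_bounded[of "\<lambda>z. (truncate N (g z))\<^sup>2" "(real N)\<^sup>2", OF _ _ that])
      (use truncate_bound in \<open>auto simp: abs_le_square_iff[symmetric]\<close>)
  show hc: "(\<integral>w. h N (x, w) \<partial>T x) = 0" if x: "x \<in> space \<pi>" for N x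
  proof -
    interpret K: prob_space "T x" by (rule prob_space_mark[OF x])
    show ?thesis using it[OF x, of N] by (simp add: h K.prob_space G_def[symmetric])
  qed
  have gsq: "AE x in \<pi>. integrable (T x) (\<lambda>w. (g (x, w))\<^sup>2)"
    and gV: "integrable \<pi> (\<lambda>x. \<integral>w. (g (x, w))\<^sup>2 \<partial>T x)"
    using integral_kernel_prod[OF mark_kernel_subprob not_empty sq] by auto
  have G_le: "AE x in \<pi>. (G N x)\<^sup>2 \<le> (\<integral>w. (g (x, w))\<^sup>2 \<partial>T x)" for N
    using gsq AE_space
  proof eventually_elim
    case (elim x)
    interpret K: prob_space "T x" by (rule prob_space_mark[OF elim(2)])
    have "(G N x)\<^sup>2 \<le> (\<integral>w. (truncate N (g (x, w)))\<^sup>2 \<partial>T x)"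
      unfolding G_def
      by (rule K.square_integral_le(2)[OF measurable_section[OF tm elim(2) refl] it2[OF elim(2)]])
    also have "\<dots> \<le> (\<integral>w. (g (x, w))\<^sup>2 \<partial>T x)"
      by (rule integral_mono[OF it2[OF elim(2)] elim(1)]) (rule square_le_square[OF truncate_le])
    finally show ?case .
  qed
  have G_lim: "AE x in \<pi>. (\<lambda>N. G N x) \<longlonglongrightarrow> 0"
    using gsq centred AE_space
  proof eventually_elim
    case (elim x)
    interpret K: prob_space "T x" by (rule prob_space_mark[OF elim(3)])
    have gx: "(\<lambda>w. g (x, w)) \<in> borel_measurable (T x)" by (rule measurable_section[OF g elim(3) refl])
    have ig: "integrable (T x) (\<lambda>w. g (x, w))" by (rule K.square_integral_le(1)[OF gx elim(1)])
    have "(\<lambda>N. G N x) \<longlonglongrightarrow> (\<integral>w. g (x, w) \<partial>T x)"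
      unfolding G_def
    proof (rule integral_dominated_convergence[where w="\<lambda>w. \<bar>g (x, w)\<bar>"])
      show "AE w in T x. (\<lambda>N. truncate N (g (x, w))) \<longlonglongrightarrow> g (x, w)" by (simp add: truncate_tendsto)
      show "(\<lambda>w. truncate N (g (x, w))) \<in> borel_measurable (T x)" for N
        by (rule measurable_section[OF tm elim(3) refl])
    qed (use gx ig truncate_le in auto)
    then show ?case using elim(2) by simp
  qed
  have G2i: "integrable \<pi> (\<lambda>x. (G N x)\<^sup>2)" for N
    by (rule integrable_const_bound[where B="(real N)\<^sup>2"])
      (use Gb in \<open>auto simp: abs_le_square_iff[symmetric]\<close>)
  have G2: "(\<lambda>N. \<integral>x. (G N x)\<^sup>2 \<partial>\<pi>) \<longlonglongrightarrow> 0"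
  proof -
    have "(\<lambda>N. \<integral>x. (G N x)\<^sup>2 \<partial>\<pi>) \<longlonglongrightarrow> (\<integral>x. 0 \<partial>\<pi>)"
    proof (rule integral_dominated_convergence[where w="\<lambda>x. \<integral>w. (g (x, w))\<^sup>2 \<partial>T x"])
      show "AE x in \<pi>. (\<lambda>N. (G N x)\<^sup>2) \<longlonglongrightarrow> 0"
        using G_lim by eventually_elim (auto intro: tendsto_eq_intros)
    qed (use gV G_le in auto)
    then show ?thesis by simp
  qed
  have t2i: "integrable \<mu> (\<lambda>z. (truncate N (g z))\<^sup>2)" for N
    by (rule mu.integrable_const_bound[where B="(real N)\<^sup>2"])
      (use truncate_bound in \<open>auto simp: abs_le_square_iff[symmetric]\<close>)
  have t2: "(\<lambda>N. \<integral>z. (truncate N (g z))\<^sup>2 \<partial>\<mu>) \<longlonglongrightarrow> (\<integral>z. (g z)\<^sup>2 \<partial>\<mu>)"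
  proof (rule integral_dominated_convergence[where w="\<lambda>z. (g z)\<^sup>2"])
    show "AE z in \<mu>. (\<lambda>N. (truncate N (g z))\<^sup>2) \<longlonglongrightarrow> (g z)\<^sup>2"
      by (intro AE_I2 tendsto_power truncate_tendsto)
    show "AE z in \<mu>. norm ((truncate N (g z))\<^sup>2) \<le> (g z)\<^sup>2" for N
      using square_le_square[OF truncate_le] by simp
  qed (use sq in auto)
  have d2i: "integrable \<mu> (\<lambda>z. (g z - truncate N (g z))\<^sup>2)" for N
    by (rule Bochner_Integration.integrable_bound[OF sq])
      (use square_le_square[OF truncate_diff_le] in auto)
  have d2: "(\<lambda>N. \<integral>z. (g z - truncate N (g z))\<^sup>2 \<partial>\<mu>) \<longlonglongrightarrow> 0"
  proof -
    have "(\<lambda>N. \<integral>z. (g z - truncate N (g z))\<^sup>2 \<partial>\<mu>) \<longlonglongrightarrow> (\<integral>z. 0 \<partial>\<mu>)"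
    proof (rule integral_dominated_convergence[where w="\<lambda>z. (g z)\<^sup>2"])
      show "AE z in \<mu>. (\<lambda>N. (g z - truncate N (g z))\<^sup>2) \<longlonglongrightarrow> 0"
        by (intro AE_I2) (auto intro!: tendsto_eq_intros truncate_tendsto)
      show "AE z in \<mu>. norm ((g z - truncate N (g z))\<^sup>2) \<le> (g z)\<^sup>2" for N
        using square_le_square[OF truncate_diff_le] by simp
    qed (use sq in auto)
    then show ?thesis by simp
  qed
  have Gfi: "integrable \<mu> (\<lambda>z. (G N (fst z))\<^sup>2)" for N
    by (rule mu.integrable_const_bound[where B="(real N)\<^sup>2"])
      (use Gb in \<open>auto simp: abs_le_square_iff[symmetric] space_\<mu> intro!: AE_I2\<close>)
  have Gf: "(\<integral>z. (G N (fst z))\<^sup>2 \<partial>\<mu>) = (\<integral>x. (G N x)\<^sup>2 \<partial>\<pi>)" for N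
    using integral_kernel_prod(3)[OF mark_kernel_subprob not_empty Gfi[of N]]
    by (simp add: prob_space.prob_space[OF prob_space_mark] cong: Bochner_Integration.integral_cong)
  have le: "(g z - h N z)\<^sup>2 \<le> 2 * (g z - truncate N (g z))\<^sup>2 + 2 * (G N (fst z))\<^sup>2" for N z
    using sum_squares_bound[of "g z - truncate N (g z)" "G N (fst z)"]
    by (simp add: h power2_eq_square algebra_simps)
  show ghi: "integrable \<mu> (\<lambda>z. (g z - h N z)\<^sup>2)" for N
    by (rule Bochner_Integration.integrable_bound[where f="\<lambda>z. 2 * (g z - truncate N (g z))\<^sup>2 + 2 * (G N (fst z))\<^sup>2"])
      (use d2i Gfi le in auto)
  show "AE x in \<pi>. (\<integral>w. g (x, w) - h N (x, w) \<partial>T x) = 0" for N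
    using gsq centred AE_space
  proof eventually_elim
    case (elim x)
    interpret K: prob_space "T x" by (rule prob_space_mark[OF elim(3)])
    have gx: "(\<lambda>w. g (x, w)) \<in> borel_measurable (T x)" by (rule measurable_section[OF g elim(3) refl])
    have ig: "integrable (T x) (\<lambda>w. g (x, w))" by (rule K.square_integral_le(1)[OF gx elim(1)])
    have ih: "integrable (T x) (\<lambda>w. h N (x, w))" by (rule integrable_section_bounded[OF hm hb elim(3)])
    show ?case using ig ih elim(2) hc[OF elim(3)] by simp
  qed
  show "(\<lambda>N. \<integral>z. (g z - h N z)\<^sup>2 \<partial>\<mu>) \<longlonglongrightarrow> 0"
  proof (rule tendsto_sandwich)
    show "\<forall>\<^sub>F N in sequentially. 0 \<le> (\<integral>z. (g z - h N z)\<^sup>2 \<partial>\<mu>)" by simp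
    have "(\<integral>z. (g z - h N z)\<^sup>2 \<partial>\<mu>) \<le> (\<integral>z. 2 * (g z - truncate N (g z))\<^sup>2 + 2 * (G N (fst z))\<^sup>2 \<partial>\<mu>)" for N
      by (rule integral_mono[OF ghi _ le]) (use d2i Gfi in simp)
    also have "\<dots> N = 2 * (\<integral>z. (g z - truncate N (g z))\<^sup>2 \<partial>\<mu>) + 2 * (\<integral>x. (G N x)\<^sup>2 \<partial>\<pi>)" for N
      using d2i Gfi by (simp add: Gf)
    finally show "\<forall>\<^sub>F N in sequentially. (\<integral>z. (g z - h N z)\<^sup>2 \<partial>\<mu>) \<le> 2 * (\<integral>z. (g z - truncate N (g z))\<^sup>2 \<partial>\<mu>) + 2 * (\<integral>x. (G N x)\<^sup>2 \<partial>\<pi>)"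
      by simp
    show "(\<lambda>N. 2 * (\<integral>z. (g z - truncate N (g z))\<^sup>2 \<partial>\<mu>) + 2 * (\<integral>x. (G N x)\<^sup>2 \<partial>\<pi>)) \<longlonglongrightarrow> 0"
      using tendsto_add[OF tendsto_mult_left[OF d2, of 2] tendsto_mult_left[OF G2, of 2]] by simp
  qed simp
  \<comment> \<open>Given \<open>x\<close>, the second moment of the recentred truncation is a
    variance: the second moment of the truncation minus \<open>(G N x)^2\<close>.\<close>
  have eq: "(\<integral>x. (\<integral>w. (h N (x, w))\<^sup>2 \<partial>T x) \<partial>\<pi>) = (\<integral>z. (truncate N (g z))\<^sup>2 \<partial>\<mu>) - (\<integral>x. (G N x)\<^sup>2 \<partial>\<pi>)" for N
  proof -
    note K3 = integral_kernel_prod[OF mark_kernel_subprob not_empty t2i[of N]]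
    have "(\<integral>x. (\<integral>w. (h N (x, w))\<^sup>2 \<partial>T x) \<partial>\<pi>) = (\<integral>x. (\<integral>w. (truncate N (g (x, w)))\<^sup>2 \<partial>T x) - (G N x)\<^sup>2 \<partial>\<pi>)"
    proof (rule Bochner_Integration.integral_cong[OF refl])
      fix x assume x: "x \<in> space \<pi>"
      interpret K: prob_space "T x" by (rule prob_space_mark[OF x])
      have "(\<integral>w. (h N (x, w))\<^sup>2 \<partial>T x) = K.variance (\<lambda>w. truncate N (g (x, w)))"
        by (simp add: h G_def)
      also have "\<dots> = (\<integral>w. (truncate N (g (x, w)))\<^sup>2 \<partial>T x) - (G N x)\<^sup>2"
        unfolding G_def by (rule K.variance_eq[OF it[OF x] it2[OF x]])
      finally show "(\<integral>w. (h N (x, w))\<^sup>2 \<partial>T x) = (\<integral>w. (truncate N (g (x, w)))\<^sup>2 \<partial>T x) - (G N x)\<^sup>2" .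
    qed
    also have "\<dots> = (\<integral>z. (truncate N (g z))\<^sup>2 \<partial>\<mu>) - (\<integral>x. (G N x)\<^sup>2 \<partial>\<pi>)"
      using K3 G2i by simp
    finally show ?thesis .
  qed
  show "(\<lambda>N. \<integral>x. (\<integral>w. (h N (x, w))\<^sup>2 \<partial>T x) \<partial>\<pi>) \<longlonglongrightarrow> (\<integral>z. (g z)\<^sup>2 \<partial>\<mu>)"
    unfolding eq using tendsto_diff[OF t2 G2] by simp
qed

context ergodic_dominated_chain
begin

text \<open>The remainder \<open>g - h N\<close> is again a centred increment, so its sum over
  \<open>n\<close> steps has second moment at most \<open>n C \<delta> N\<close>; multiplied by
  \<open>(a n)^2\<close> this stays below \<open>(q + 1) C \<delta> N\<close> for all large
  \<open>n\<close>. The truncation level can therefore be fixed before \<open>n\<close>.\<close>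

lemma martingale_clt:
  fixes g :: "'a \<times> ('b \<times> 'a) \<Rightarrow> real" and a :: "nat \<Rightarrow> real"
  defines "s \<equiv> \<integral>z. (g z)\<^sup>2 \<partial>\<mu>" and "m \<equiv> measure M (space M)"
  assumes g: "g \<in> borel_measurable (\<pi> \<Otimes>\<^sub>M S)" and sq: "integrable \<mu> (\<lambda>z. (g z)\<^sup>2)"
    and centred: "AE x in \<pi>. (\<integral>w. g (x, w) \<partial>T x) = 0"
    and a: "(\<lambda>n. real n * (a n)\<^sup>2) \<longlonglongrightarrow> q"
  shows "(\<lambda>n. \<integral>\<omega>. iexp (a n * (\<Sum>j<n. g (X j \<omega>, W j \<omega>))) \<partial>M) \<longlonglongrightarrow> complex_of_real (m * exp (- q * (s / 2)))"
proof (rule tendstoI)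
  fix \<epsilon> :: real assume \<epsilon>: "0 < \<epsilon>"
  define h where "h N z = truncate N (g z) - (\<integral>w. truncate N (g (fst z, w)) \<partial>T (fst z))" for N z
  note tr = centred_truncation[OF g sq centred, folded h_def]
  define \<delta> where "\<delta> N = (\<integral>z. (g z - h N z)\<^sup>2 \<partial>\<mu>)" for N
  define s' where "s' N = (\<integral>x. (\<integral>w. (h N (x, w))\<^sup>2 \<partial>T x) \<partial>\<pi>)" for N
  have m0: "0 \<le> m" by (simp add: m_def)
  \<comment> \<open>Chosen so that \<open>\<eta> m / 2\<close> stays below a quarter of
    \<open>\<epsilon>\<close>; the added 1 guards against \<open>m = 0\<close>.\<close>
  define \<eta> where "\<eta> = \<epsilon> / (2 * (m + 1))"
  have \<eta>: "0 < \<eta>" "\<eta> * m / 2 < \<epsilon> / 4"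
    using \<epsilon> m0 by (auto simp: \<eta>_def field_simps)
  have lim1: "(\<lambda>N. (q + 1) * (C * \<delta> N) / \<eta> / 2) \<longlonglongrightarrow> (q + 1) * (C * 0) / \<eta> / 2"
    unfolding \<delta>_def by (intro tendsto_intros tr(6)) (use \<eta> in auto)
  have lim2: "(\<lambda>N. m * exp (- q * (s' N / 2))) \<longlonglongrightarrow> m * exp (- q * (s / 2))"
    unfolding s'_def s_def by (intro tendsto_intros tr(7)) auto
  have "\<forall>\<^sub>F N in sequentially. (q + 1) * (C * \<delta> N) / \<eta> / 2 < \<epsilon> / 4"
    by (rule order_tendstoD(2)[OF lim1]) (use \<epsilon> in simp)
  moreover have "\<forall>\<^sub>F N in sequentially. dist (m * exp (- q * (s' N / 2))) (m * exp (- q * (s / 2))) < \<epsilon> / 4"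
    by (rule tendstoD[OF lim2]) (use \<epsilon> in simp)
  ultimately obtain N where N1: "(q + 1) * (C * \<delta> N) / \<eta> / 2 < \<epsilon> / 4"
    and N2: "dist (m * exp (- q * (s' N / 2))) (m * exp (- q * (s / 2))) < \<epsilon> / 4"
    using eventually_conj eventually_happens'[OF sequentially_bot] by (metis (no_types, lifting))
  have clt: "(\<lambda>n. \<integral>\<omega>. iexp (a n * (\<Sum>j<n. h N (X j \<omega>, W j \<omega>))) \<partial>M) \<longlonglongrightarrow> complex_of_real (m * exp (- q * (s' N / 2)))"
    unfolding s'_def m_def by (rule bounded_clt[OF tr(1,2,3) a])
  have ev1: "\<forall>\<^sub>F n in sequentially. dist (\<integral>\<omega>. iexp (a n * (\<Sum>j<n. h N (X j \<omega>, W j \<omega>))) \<partial>M) (complex_of_real (m * exp (- q * (s' N / 2)))) < \<epsilon> / 4"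
    by (rule tendstoD[OF clt]) (use \<epsilon> in simp)
  have ev2: "\<forall>\<^sub>F n in sequentially. real n * (a n)\<^sup>2 < q + 1"
    by (rule order_tendstoD(2)[OF a]) simp
  show "\<forall>\<^sub>F n in sequentially. dist (\<integral>\<omega>. iexp (a n * (\<Sum>j<n. g (X j \<omega>, W j \<omega>))) \<partial>M) (complex_of_real (m * exp (- q * (s / 2)))) < \<epsilon>"
    using ev1 ev2
  proof eventually_elim
    case (elim n)
    let ?S = "\<lambda>\<omega>. \<Sum>j<n. g (X j \<omega>, W j \<omega>)" and ?H = "\<lambda>\<omega>. \<Sum>j<n. h N (X j \<omega>, W j \<omega>)"
    let ?D = "\<lambda>\<omega>. \<Sum>j<n. g (X j \<omega>, W j \<omega>) - h N (X j \<omega>, W j \<omega>)"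
    have Sm: "?S \<in> borel_measurable M" and Hm: "?H \<in> borel_measurable M"
      by (intro borel_measurable_sum measurable_from_filtration[OF adapted_step[OF g lessI]]
          measurable_from_filtration[OF adapted_step[OF tr(1) lessI]])+
    have D: "?S \<omega> - ?H \<omega> = ?D \<omega>" for \<omega> by (simp add: sum_subtractf)
    have gh: "(\<lambda>z. g z - h N z) \<in> borel_measurable (\<pi> \<Otimes>\<^sub>M S)" using g tr(1) by measurable
    from martingale_second_moment[OF gh tr(4,5), of n]
    have D2: "integrable M (\<lambda>\<omega>. (?D \<omega>)\<^sup>2)" "(\<integral>\<omega>. (?D \<omega>)\<^sup>2 \<partial>M) \<le> real n * (C * \<delta> N)"
      by (simp_all add: \<delta>_def)
    have ES: "(\<lambda>\<omega>. iexp (a n * ?S \<omega>)) \<in> borel_measurable M" using Sm by measurable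
    have EH: "(\<lambda>\<omega>. iexp (a n * ?H \<omega>)) \<in> borel_measurable M" using Hm by measurable
    have iS: "integrable M (\<lambda>\<omega>. iexp (a n * ?S \<omega>))"
      by (rule M.norm_integral_le_const(1)[OF ES, where B=1]) (unfold norm_exp_i_times, simp)
    have iH: "integrable M (\<lambda>\<omega>. iexp (a n * ?H \<omega>))"
      by (rule M.norm_integral_le_const(1)[OF EH, where B=1]) (unfold norm_exp_i_times, simp)
    have "dist (\<integral>\<omega>. iexp (a n * ?S \<omega>) \<partial>M) (\<integral>\<omega>. iexp (a n * ?H \<omega>) \<partial>M) = norm (\<integral>\<omega>. iexp (a n * ?S \<omega>) - iexp (a n * ?H \<omega>) \<partial>M)"
      unfolding dist_norm Bochner_Integration.integral_diff[OF iS iH] ..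
    also have "\<dots> \<le> (\<integral>\<omega>. norm (iexp (a n * ?S \<omega>) - iexp (a n * ?H \<omega>)) \<partial>M)" by (rule integral_norm_bound)
    also have "\<dots> \<le> (\<integral>\<omega>. \<eta> / 2 + (a n)\<^sup>2 / \<eta> / 2 * (?D \<omega>)\<^sup>2 \<partial>M)"
    proof (rule integral_mono')
      show "integrable M (\<lambda>\<omega>. \<eta> / 2 + (a n)\<^sup>2 / \<eta> / 2 * (?D \<omega>)\<^sup>2)"
        by (intro Bochner_Integration.integrable_add integrable_mult_right D2(1) M.integrable_const)
      fix \<omega>
      have "norm (iexp (a n * ?S \<omega>) - iexp (a n * ?H \<omega>)) \<le> \<bar>a n * ?S \<omega> - a n * ?H \<omega>\<bar>" by (rule norm_iexp_diff_le)
      also have "a n * ?S \<omega> - a n * ?H \<omega> = a n * ?D \<omega>" unfolding D[symmetric] by (simp only: right_diff_distrib)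
      also have "\<bar>a n * ?D \<omega>\<bar> \<le> \<eta> / 2 + (a n)\<^sup>2 / \<eta> / 2 * (?D \<omega>)\<^sup>2"
      proof -
        \<comment> \<open>Young's inequality: it trades the first absolute moment for the second
          moment without a square root.\<close>
        have "\<bar>y\<bar> \<le> \<eta> / 2 + y\<^sup>2 / \<eta> / 2" for y
        proof -
          have "\<eta> * (\<bar>y\<bar> * 2) \<le> \<eta> * \<eta> + y * y"
            using sum_squares_bound[of \<eta> "\<bar>y\<bar>"] by (simp add: power2_eq_square mult_ac)
          then show ?thesis using \<eta>(1) by (simp add: field_simps power2_eq_square)
        qed
        from this[of "a n * ?D \<omega>"] show ?thesis by (simp only: power_mult_distrib) simp
      qed
      finally show "norm (iexp (a n * ?S \<omega>) - iexp (a n * ?H \<omega>)) \<le> \<eta> / 2 + (a n)\<^sup>2 / \<eta> / 2 * (?D \<omega>)\<^sup>2" .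
    qed (use \<eta> in auto)
    also have "\<dots> = \<eta> * m / 2 + (a n)\<^sup>2 / \<eta> / 2 * (\<integral>\<omega>. (?D \<omega>)\<^sup>2 \<partial>M)"
      using D2(1) by (simp add: m_def mult.commute)
    also have "(a n)\<^sup>2 / \<eta> / 2 * (\<integral>\<omega>. (?D \<omega>)\<^sup>2 \<partial>M) \<le> (a n)\<^sup>2 / \<eta> / 2 * (real n * (C * \<delta> N))"
      using \<eta> D2(2) by (intro mult_left_mono) auto
    also have "\<dots> = (real n * (a n)\<^sup>2) * (C * \<delta> N) / \<eta> / 2" by simp
    also have "\<dots> \<le> (q + 1) * (C * \<delta> N) / \<eta> / 2"
      using elim(2) C_nonneg \<eta> by (intro divide_right_mono mult_right_mono) (auto simp: \<delta>_def)
    finally have "dist (\<integral>\<omega>. iexp (a n * ?S \<omega>) \<partial>M) (\<integral>\<omega>. iexp (a n * ?H \<omega>) \<partial>M) < \<epsilon> / 4 + \<epsilon> / 4"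
      using N1 \<eta>(2) by linarith
    moreover have "dist (complex_of_real (m * exp (- q * (s' N / 2)))) (complex_of_real (m * exp (- q * (s / 2)))) < \<epsilon> / 4"
      using N2 by (simp only: dist_of_real)
    ultimately show ?case
      using elim(1) dist_triangle[of "\<integral>\<omega>. iexp (a n * ?S \<omega>) \<partial>M" "complex_of_real (m * exp (- q * (s / 2)))" "\<integral>\<omega>. iexp (a n * ?H \<omega>) \<partial>M"]
        dist_triangle[of "\<integral>\<omega>. iexp (a n * ?H \<omega>) \<partial>M" "complex_of_real (m * exp (- q * (s / 2)))" "complex_of_real (m * exp (- q * (s' N / 2)))"]
      by linarith
  qed
qed

text \<open>By domination the boundary terms are bounded in mean uniformly in time, and they are
  multiplied by \<open>a n\<close>, which tends to 0.\<close>

lemma martingale_clt_boundary: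
  fixes g :: "'a \<times> ('b \<times> 'a) \<Rightarrow> real" and a :: "nat \<Rightarrow> real" and h :: "'a \<Rightarrow> real"
  defines "s \<equiv> \<integral>z. (g z)\<^sup>2 \<partial>\<mu>" and "m \<equiv> measure M (space M)"
  assumes g: "g \<in> borel_measurable (\<pi> \<Otimes>\<^sub>M S)" and sq: "integrable \<mu> (\<lambda>z. (g z)\<^sup>2)"
    and centred: "AE x in \<pi>. (\<integral>w. g (x, w) \<partial>T x) = 0"
    and a: "(\<lambda>n. real n * (a n)\<^sup>2) \<longlonglongrightarrow> q" and h: "integrable \<pi> h"
  shows "(\<lambda>n. \<integral>\<omega>. iexp (a n * ((\<Sum>j<n. g (X j \<omega>, W j \<omega>)) + h (X 0 \<omega>) - h (X n \<omega>))) \<partial>M)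
    \<longlonglongrightarrow> complex_of_real (m * exp (- q * (s / 2)))"
proof -
  let ?S = "\<lambda>n \<omega>. \<Sum>j<n. g (X j \<omega>, W j \<omega>)"
  define A where "A = C * (\<integral>x. \<bar>h x\<bar> \<partial>\<pi>)"
  note hX = integrable_state[OF h, folded A_def]
  have Sm: "?S n \<in> borel_measurable M" for n
    by (intro borel_measurable_sum measurable_from_filtration[OF adapted_step[OF g lessI]])
  have hm: "(\<lambda>\<omega>. h (X n \<omega>)) \<in> borel_measurable M" for n using hX(1) by auto
  have a0: "a \<longlonglongrightarrow> 0" by (rule tendsto_power_exp(2)[OF a order_refl])
  have "(\<lambda>n. (\<integral>\<omega>. iexp (a n * (?S n \<omega> + h (X 0 \<omega>) - h (X n \<omega>))) \<partial>M) - (\<integral>\<omega>. iexp (a n * ?S n \<omega>) \<partial>M)) \<longlonglongrightarrow> 0"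
  proof (rule Lim_null_comparison)
    have "(\<lambda>n. \<bar>a n\<bar> * (2 * A)) \<longlonglongrightarrow> \<bar>0\<bar> * (2 * A)" by (intro tendsto_intros a0)
    then show "(\<lambda>n. \<bar>a n\<bar> * (2 * A)) \<longlonglongrightarrow> 0" by simp
    show "\<forall>\<^sub>F n in sequentially. norm ((\<integral>\<omega>. iexp (a n * (?S n \<omega> + h (X 0 \<omega>) - h (X n \<omega>))) \<partial>M) - (\<integral>\<omega>. iexp (a n * ?S n \<omega>) \<partial>M)) \<le> \<bar>a n\<bar> * (2 * A)"
    proof (rule always_eventually, rule allI)
      fix n
      have m1: "(\<lambda>\<omega>. iexp (a n * ?S n \<omega>)) \<in> borel_measurable M" using Sm by measurable
      have m2: "(\<lambda>\<omega>. iexp (a n * (?S n \<omega> + h (X 0 \<omega>) - h (X n \<omega>)))) \<in> borel_measurable M" using Sm hm by measurable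
      have i1: "integrable M (\<lambda>\<omega>. iexp (a n * ?S n \<omega>))"
        by (rule M.norm_integral_le_const(1)[OF m1, where B=1]) (unfold norm_exp_i_times, simp)
      have i2: "integrable M (\<lambda>\<omega>. iexp (a n * (?S n \<omega> + h (X 0 \<omega>) - h (X n \<omega>))))"
        by (rule M.norm_integral_le_const(1)[OF m2, where B=1]) (unfold norm_exp_i_times, simp)
      have "norm ((\<integral>\<omega>. iexp (a n * (?S n \<omega> + h (X 0 \<omega>) - h (X n \<omega>))) \<partial>M) - (\<integral>\<omega>. iexp (a n * ?S n \<omega>) \<partial>M))
        = norm (\<integral>\<omega>. iexp (a n * (?S n \<omega> + h (X 0 \<omega>) - h (X n \<omega>))) - iexp (a n * ?S n \<omega>) \<partial>M)"
        unfolding Bochner_Integration.integral_diff[OF i2 i1] ..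
      also have "\<dots> \<le> (\<integral>\<omega>. norm (iexp (a n * (?S n \<omega> + h (X 0 \<omega>) - h (X n \<omega>))) - iexp (a n * ?S n \<omega>)) \<partial>M)"
        by (rule integral_norm_bound)
      also have "\<dots> \<le> (\<integral>\<omega>. \<bar>a n\<bar> * (\<bar>h (X 0 \<omega>)\<bar> + \<bar>h (X n \<omega>)\<bar>) \<partial>M)"
      proof (rule integral_mono')
        show "integrable M (\<lambda>\<omega>. \<bar>a n\<bar> * (\<bar>h (X 0 \<omega>)\<bar> + \<bar>h (X n \<omega>)\<bar>))" using hX(1) by simp
        fix \<omega>
        have "norm (iexp (a n * (?S n \<omega> + h (X 0 \<omega>) - h (X n \<omega>))) - iexp (a n * ?S n \<omega>)) \<le> \<bar>a n * (?S n \<omega> + h (X 0 \<omega>) - h (X n \<omega>)) - a n * ?S n \<omega>\<bar>"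
          by (rule norm_iexp_diff_le)
        also have "a n * (?S n \<omega> + h (X 0 \<omega>) - h (X n \<omega>)) - a n * ?S n \<omega> = a n * (h (X 0 \<omega>) - h (X n \<omega>))"
          by (simp only: algebra_simps)
        also have "\<bar>a n * (h (X 0 \<omega>) - h (X n \<omega>))\<bar> \<le> \<bar>a n\<bar> * (\<bar>h (X 0 \<omega>)\<bar> + \<bar>h (X n \<omega>)\<bar>)"
          by (simp add: abs_mult mult_left_mono)
        finally show "norm (iexp (a n * (?S n \<omega> + h (X 0 \<omega>) - h (X n \<omega>))) - iexp (a n * ?S n \<omega>)) \<le> \<bar>a n\<bar> * (\<bar>h (X 0 \<omega>)\<bar> + \<bar>h (X n \<omega>)\<bar>)" .
      qed simp
      also have "\<dots> = \<bar>a n\<bar> * ((\<integral>\<omega>. \<bar>h (X 0 \<omega>)\<bar> \<partial>M) + (\<integral>\<omega>. \<bar>h (X n \<omega>)\<bar> \<partial>M))" using hX(1) by simp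
      also have "\<dots> \<le> \<bar>a n\<bar> * (2 * A)" using hX(2)[of 0] hX(2)[of n] by (intro mult_left_mono) auto
      finally show "norm ((\<integral>\<omega>. iexp (a n * (?S n \<omega> + h (X 0 \<omega>) - h (X n \<omega>))) \<partial>M) - (\<integral>\<omega>. iexp (a n * ?S n \<omega>) \<partial>M)) \<le> \<bar>a n\<bar> * (2 * A)" .
    qed
  qed
  from tendsto_add[OF this martingale_clt[OF g sq centred a]] show ?thesis
    by (simp add: s_def m_def)
qed

end

section \<open>Absolute continuity after leaving a null set, and restarting the chain\<close>

section \<open>Arbitrary initial laws\<close>

lemma inverse_shift_tendsto: "(\<lambda>k. 1 / real (n + k)) \<longlonglongrightarrow> 0"
  using LIMSEQ_ignore_initial_segment[OF lim_1_over_n, of n] by (simp add: add.commute)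

lemma ratio_shift_tendsto: "(\<lambda>k. real k / real (n + k)) \<longlonglongrightarrow> 1"
proof (rule Lim_transform_eventually)
  show "(\<lambda>k. 1 - real n * (1 / real (n + k))) \<longlonglongrightarrow> 1"
    using tendsto_diff[OF tendsto_const[of 1] tendsto_mult_left[OF inverse_shift_tendsto[of n], of "real n"]] by simp
  show "\<forall>\<^sub>F k in sequentially. 1 - real n * (1 / real (n + k)) = real k / real (n + k)"
    using eventually_gt_at_top[of "0::nat"] by eventually_elim (simp add: field_simps)
qed

text \<open>Here \<open>M\<close> is a probability and the law of \<open>X 0\<close> is
  unrestricted. The ergodic properties are those of \<open>P\<close>, the state marginal of
  \<open>T\<close>.\<close>

locale harris_chain = marked_chain \<pi> Z T M F X W + ergodic_kernel \<pi> P + MP: prob_space M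
  for \<pi> :: "'a measure" and Z :: "'b measure" and T and M :: "'w measure" and F X W and P +
  assumes kernel_eq: "x \<in> space \<pi> \<Longrightarrow> P x = distr (T x) \<pi> snd"
begin

lemma nn_integral_kernel_eq:
  assumes x: "x \<in> space \<pi>" and h: "h \<in> borel_measurable \<pi>"
  shows "(\<integral>\<^sup>+y. h y \<partial>P x) = (\<integral>\<^sup>+w. h (snd w) \<partial>T x)"
proof -
  have "snd \<in> T x \<rightarrow>\<^sub>M \<pi>" by (subst measurable_cong_sets[OF sets_mark[OF x] refl]) (rule measurable_snd)
  then show ?thesis unfolding kernel_eq[OF x] by (subst nn_integral_distr) (use h in auto)
qed

lemma integral_kernel_eq:
  fixes h :: "'a \<Rightarrow> real"
  assumes x: "x \<in> space \<pi>" and h: "h \<in> borel_measurable \<pi>"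
  shows "(\<integral>y. h y \<partial>P x) = (\<integral>w. h (snd w) \<partial>T x)"
proof -
  have "snd \<in> T x \<rightarrow>\<^sub>M \<pi>" by (subst measurable_cong_sets[OF sets_mark[OF x] refl]) (rule measurable_snd)
  then show ?thesis unfolding kernel_eq[OF x] by (subst integral_distr) (use h in auto)
qed

lemma markov_state:
  assumes Y: "Y \<in> borel_measurable (F n)" and h: "h \<in> borel_measurable \<pi>"
  shows "(\<integral>\<^sup>+\<omega>. Y \<omega> * h (X (Suc n) \<omega>) \<partial>M) = (\<integral>\<^sup>+\<omega>. Y \<omega> * (\<integral>\<^sup>+y. h y \<partial>P (X n \<omega>)) \<partial>M)"
proof -
  have H: "(\<lambda>z. Y (fst z) * h (snd (snd z))) \<in> borel_measurable (F n \<Otimes>\<^sub>M S)"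
    by (intro borel_measurable_times_ennreal measurable_compose[OF measurable_fst Y]
        measurable_compose[OF measurable_compose[OF measurable_snd measurable_snd] h])
  have "(\<integral>\<^sup>+\<omega>. Y \<omega> * h (X (Suc n) \<omega>) \<partial>M) = (\<integral>\<^sup>+\<omega>. Y \<omega> * h (snd (W n \<omega>)) \<partial>M)"
    by (intro nn_integral_cong) (simp add: state_Suc)
  also have "\<dots> = (\<integral>\<^sup>+\<omega>. (\<integral>\<^sup>+w. Y \<omega> * h (snd w) \<partial>T (X n \<omega>)) \<partial>M)"
    using markov[OF H] by simp
  also have "\<dots> = (\<integral>\<^sup>+\<omega>. Y \<omega> * (\<integral>\<^sup>+y. h y \<partial>P (X n \<omega>)) \<partial>M)"
  proof (rule nn_integral_cong)
    fix \<omega> assume w: "\<omega> \<in> space M"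
    note x = state_space[OF w, of n]
    have "(\<lambda>w. h (snd w)) \<in> borel_measurable (T (X n \<omega>))"
      by (subst measurable_cong_sets[OF sets_mark[OF x] refl]) (rule measurable_compose[OF measurable_snd h])
    then show "(\<integral>\<^sup>+w. Y \<omega> * h (snd w) \<partial>T (X n \<omega>)) = Y \<omega> * (\<integral>\<^sup>+y. h y \<partial>P (X n \<omega>))"
      by (simp add: nn_integral_cmult nn_integral_kernel_eq[OF x h])
  qed
  finally show ?thesis .
qed

text \<open>The counterpart, for a chain on its own probability space, of the sojourn formula on
  path space; \<open>h\<close> again carries the induction on the last step.\<close>

lemma nn_integral_stay:
  assumes B: "B \<in> sets \<pi>" and h: "h \<in> borel_measurable \<pi>"
  shows "(\<integral>\<^sup>+\<omega>. (\<Prod>k\<le>n. indicator B (X k \<omega>)) * h (X n \<omega>) \<partial>M)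
    = (\<integral>\<^sup>+\<omega>. (stay_op P B ^^ n) (\<lambda>y. indicator B y * h y) (X 0 \<omega>) \<partial>M)"
  using h
proof (induction n arbitrary: h)
  case (Suc n)
  let ?Y = "\<lambda>\<omega>. (\<Prod>k\<le>n. indicator B (X k \<omega>)) :: ennreal"
  have Y: "?Y \<in> borel_measurable (F n)"
    by (intro borel_measurable_prod_ennreal measurable_compose[OF measurable_filtration_mono[OF adapted_state]]
        borel_measurable_indicator B) auto
  have Bh: "(\<lambda>y. indicator B y * h y) \<in> borel_measurable \<pi>" using B Suc.prems by simp
  have m: "(\<lambda>x. \<integral>\<^sup>+y. indicator B y * h y \<partial>P x) \<in> borel_measurable \<pi>"
    by (rule nn_integral_measurable_subprob_algebra2[OF _ kernel_subprob]) (use Bh in measurable)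
  have "(\<integral>\<^sup>+\<omega>. (\<Prod>k\<le>Suc n. indicator B (X k \<omega>)) * h (X (Suc n) \<omega>) \<partial>M)
    = (\<integral>\<^sup>+\<omega>. ?Y \<omega> * (indicator B (X (Suc n) \<omega>) * h (X (Suc n) \<omega>)) \<partial>M)"
    by (simp add: mult.assoc)
  also have "\<dots> = (\<integral>\<^sup>+\<omega>. ?Y \<omega> * (\<integral>\<^sup>+y. indicator B y * h y \<partial>P (X n \<omega>)) \<partial>M)"
    by (rule markov_state[OF Y Bh])
  also have "\<dots> = (\<integral>\<^sup>+\<omega>. (stay_op P B ^^ n) (\<lambda>x. indicator B x * (\<integral>\<^sup>+y. indicator B y * h y \<partial>P x)) (X 0 \<omega>) \<partial>M)"
    by (rule Suc.IH[OF m])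
  also have "(\<lambda>x. indicator B x * (\<integral>\<^sup>+y. indicator B y * h y \<partial>P x)) = stay_op P B (\<lambda>y. indicator B y * h y)"
    by (simp add: stay_op_def[abs_def])
  finally show ?case by (simp add: funpow_swap1)
qed simp

lemma AE_kernel_null:
  assumes N: "N \<in> null_sets \<pi>"
  shows "AE x in \<pi>. (\<integral>\<^sup>+y. indicator N y \<partial>P x) = 0"
proof -
  have m: "indicator N \<in> borel_measurable \<pi>" using N by auto
  have "(\<integral>\<^sup>+x. (\<integral>\<^sup>+y. indicator N y \<partial>P x) \<partial>\<pi>) = 0"
    using invariant[OF m] N by (simp add: null_sets_def)
  then show ?thesis
    by (subst (asm) nn_integral_0_iff_AE)
      (use N in \<open>auto intro!: nn_integral_measurable_subprob_algebra2[where N=\<pi>]\<close>)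
qed

text \<open>A path that has left a null set \<open>N\<close> carrying the singular parts of the laws
  has an absolutely continuous law from then on.\<close>

lemma null_visits:
  assumes N: "N \<in> null_sets \<pi>"
    and ac: "\<And>n K. K \<in> null_sets \<pi> \<Longrightarrow> (\<integral>\<^sup>+\<omega>. indicator (K - N) (X n \<omega>) \<partial>M) = 0"
  shows "(\<lambda>n. \<integral>\<^sup>+\<omega>. indicator N (X n \<omega>) \<partial>M) \<longlonglongrightarrow> 0"
proof -
  have Ns[measurable]: "N \<in> sets \<pi>" using N by auto
  let ?b = "indicator N :: 'a \<Rightarrow> ennreal"
  \<comment> \<open>Entering \<open>N\<close> from outside has probability 0: the points from which
    \<open>N\<close> is reached with positive probability form a null set, and off \<open>N\<close>
    the law of \<open>X n\<close> does not charge null sets.\<close>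
  have step: "AE \<omega> in M. X (Suc n) \<omega> \<in> N \<longrightarrow> X n \<omega> \<in> N" for n
  proof -
    let ?K = "{x\<in>space \<pi>. (\<integral>\<^sup>+y. ?b y \<partial>P x) \<noteq> 0}"
    have m: "(\<lambda>x. \<integral>\<^sup>+y. ?b y \<partial>P x) \<in> borel_measurable \<pi>"
      by (rule nn_integral_measurable_subprob_algebra2[OF _ kernel_subprob]) measurable
    then have Ks[measurable]: "?K \<in> sets \<pi>" by measurable
    have "AE x in \<pi>. x \<notin> ?K" using AE_kernel_null[OF N] by eventually_elim simp
    then have K: "?K \<in> null_sets \<pi>" using AE_iff_null_sets[OF Ks] by simp
    let ?Y = "\<lambda>\<omega>. indicator (space \<pi> - N) (X n \<omega>) :: ennreal"
    have Y: "?Y \<in> borel_measurable (F n)"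
      by (rule measurable_compose[OF adapted_state]) simp
    have bm: "?b \<in> borel_measurable \<pi>" by simp
    have "AE \<omega> in M. indicator (?K - N) (X n \<omega>) = (0::ennreal)"
      using ac[OF K, of n] by (subst (asm) nn_integral_0_iff_AE) auto
    with AE_space have z: "AE \<omega> in M. ?Y \<omega> * (\<integral>\<^sup>+y. ?b y \<partial>P (X n \<omega>)) = 0"
      by eventually_elim (use state_space in \<open>auto simp: indicator_def split: if_splits\<close>)
    have "(\<integral>\<^sup>+\<omega>. ?Y \<omega> * ?b (X (Suc n) \<omega>) \<partial>M) = (\<integral>\<^sup>+\<omega>. ?Y \<omega> * (\<integral>\<^sup>+y. ?b y \<partial>P (X n \<omega>)) \<partial>M)"
      by (rule markov_state[OF Y bm])
    also have "\<dots> = (\<integral>\<^sup>+\<omega>. 0 \<partial>M)" by (rule nn_integral_cong_AE[OF z])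
    finally have "(\<integral>\<^sup>+\<omega>. ?Y \<omega> * ?b (X (Suc n) \<omega>) \<partial>M) = 0" by simp
    then have "AE \<omega> in M. ?Y \<omega> * ?b (X (Suc n) \<omega>) = 0"
      by (subst (asm) nn_integral_0_iff_AE) auto
    with AE_space show ?thesis
      by eventually_elim (use state_space in \<open>auto simp: indicator_def split: if_splits\<close>)
  qed
  \<comment> \<open>Read backwards: a path found in \<open>N\<close> at time \<open>n\<close> has
    never been outside it.\<close>
  have all: "AE \<omega> in M. X n \<omega> \<in> N \<longrightarrow> (\<forall>k\<le>n. X k \<omega> \<in> N)" for n
  proof (induction n)
    case (Suc n)
    from step[of n] Suc show ?case
    proof eventually_elim
      case (elim \<omega>)
      show ?case
      proof (intro impI allI)
        fix k assume "X (Suc n) \<omega> \<in> N" "k \<le> Suc n"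
        with elim show "X k \<omega> \<in> N" by (cases "k = Suc n") simp_all
      qed
    qed
  qed simp
  have eq: "(\<integral>\<^sup>+\<omega>. ?b (X n \<omega>) \<partial>M) = (\<integral>\<^sup>+\<omega>. (stay_op P N ^^ n) ?b (X 0 \<omega>) \<partial>M)" for n
  proof -
    have "(\<integral>\<^sup>+\<omega>. ?b (X n \<omega>) \<partial>M) = (\<integral>\<^sup>+\<omega>. (\<Prod>k\<le>n. ?b (X k \<omega>)) * 1 \<partial>M)"
    proof (rule nn_integral_cong_AE)
      show "AE \<omega> in M. ?b (X n \<omega>) = (\<Prod>k\<le>n. ?b (X k \<omega>)) * 1"
        using all[of n]
      proof eventually_elim
        case (elim \<omega>)
        show ?case
        proof (cases "X n \<omega> \<in> N")
          case True with elim show ?thesis by simp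
        next
          case False
          then have "(\<Prod>k\<le>n. ?b (X k \<omega>)) = 0" by (intro prod_zero bexI[of _ n]) auto
          with False show ?thesis by simp
        qed
      qed
    qed
    also have "\<dots> = (\<integral>\<^sup>+\<omega>. (stay_op P N ^^ n) (\<lambda>y. ?b y * 1) (X 0 \<omega>) \<partial>M)"
      by (rule nn_integral_stay[OF Ns]) simp
    finally show ?thesis by simp
  qed
  have pos: "emeasure \<pi> (space \<pi> - N) > 0"
    using N emeasure_space_1 by (simp add: emeasure_Diff_null_set)
  \<comment> \<open>The complement of a null set has positive measure, so the chain leaves
    \<open>N\<close> from every starting point, including those in \<open>N\<close>.\<close>
  have "(\<lambda>n. \<integral>\<^sup>+\<omega>. (stay_op P N ^^ n) ?b (X 0 \<omega>) \<partial>M) \<longlonglongrightarrow> (\<integral>\<^sup>+\<omega>. 0 \<partial>M)"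
  proof (rule nn_integral_dominated_convergence[where w="\<lambda>_. 1"])
    show "(\<lambda>\<omega>. (stay_op P N ^^ n) ?b (X 0 \<omega>)) \<in> borel_measurable M" for n
      by (rule measurable_compose[OF measurable_state measurable_stay_op_pow[OF kernel Ns]]) simp
    show "AE \<omega> in M. (stay_op P N ^^ n) ?b (X 0 \<omega>) \<le> 1" for n
      using AE_space by eventually_elim (rule stay_op_pow_le_1[OF kernel state_space])
    show "AE \<omega> in M. (\<lambda>n. (stay_op P N ^^ n) ?b (X 0 \<omega>)) \<longlonglongrightarrow> 0"
      using AE_space by eventually_elim (rule leaves[OF Ns pos state_space])
  qed (auto simp: MP.emeasure_space_1)
  then show ?thesis unfolding eq by simp
qed

text \<open>One mixture \<open>L\<close> of \<open>\<pi>\<close> and the laws of all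
  \<open>X n\<close> dominates everything at once. With \<open>p\<close> the density of
  \<open>\<pi>\<close> with respect to \<open>L\<close>, the set \<open>p = 0\<close> is
  \<open>\<pi>\<close>-null and carries every singular part, while \<open>L\<close> is at most
  \<open>(j + 1) \<pi>\<close> where \<open>p\<close> is at least \<open>1 / (j + 1)\<close>.
  Choosing first the time and then the level makes the excluded probability small.\<close>

lemma exists_dominated_event:
  assumes e: "0 < e"
  shows "\<exists>n B c. B \<in> sets \<pi> \<and> 0 \<le> c \<and> (\<integral>\<^sup>+\<omega>. indicator (space \<pi> - B) (X n \<omega>) \<partial>M) < ennreal e \<and>
    (\<forall>h\<in>borel_measurable \<pi>. (\<integral>\<^sup>+\<omega>. indicator B (X n \<omega>) * h (X n \<omega>) \<partial>M) \<le> ennreal c * (\<integral>\<^sup>+x. h x \<partial>\<pi>))"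
proof -
  \<comment> \<open>Index 0 is reserved for \<open>\<pi>\<close>, so the law of \<open>X n\<close>
    has index \<open>n + 1\<close>.\<close>
  define \<nu> where "\<nu> k = (case k of 0 \<Rightarrow> \<pi> | Suc n \<Rightarrow> distr M \<pi> (X n))" for k
  \<comment> \<open>The geometric law is chosen because it gives every index a positive
    weight.\<close>
  define G where "G = measure_pmf (geometric_pmf (1 / 2))"
  have \<nu>s: "\<nu> k \<in> space (prob_algebra \<pi>)" for k
    by (cases k) (auto simp: \<nu>_def space_prob_algebra prob_space_axioms MP.prob_space_distr)
  have \<nu>m: "\<nu> \<in> G \<rightarrow>\<^sub>M subprob_algebra \<pi>"
    using \<nu>s by (auto simp: G_def space_prob_algebra space_subprob_algebra prob_space_imp_subprob_space)
  have sets_\<nu>: "sets (\<nu> k) = sets \<pi>" for k using \<nu>s[of k] by (simp add: space_prob_algebra)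
  define L where "L = G \<bind> \<nu>"
  have sL: "sets L = sets \<pi>" unfolding L_def by (rule sets_bind[OF _]) (use sets_\<nu> in \<open>auto simp: G_def\<close>)
  have L_le: "ennreal (pmf (geometric_pmf (1 / 2)) k) * (\<integral>\<^sup>+x. h x \<partial>\<nu> k) \<le> (\<integral>\<^sup>+x. h x \<partial>L)" if h: "h \<in> borel_measurable \<pi>" for h k
  proof -
    have "ennreal (pmf (geometric_pmf (1 / 2)) k) * (\<integral>\<^sup>+x. h x \<partial>\<nu> k) = (\<integral>\<^sup>+j. (\<integral>\<^sup>+x. h x \<partial>\<nu> j) * indicator {k} j \<partial>G)"
      by (simp add: G_def emeasure_pmf_single mult.commute)
    also have "\<dots> \<le> (\<integral>\<^sup>+j. (\<integral>\<^sup>+x. h x \<partial>\<nu> j) \<partial>G)"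
      by (intro nn_integral_mono) (auto split: split_indicator)
    also have "\<dots> = (\<integral>\<^sup>+x. h x \<partial>L)" unfolding L_def by (rule nn_integral_bind[OF h \<nu>m, symmetric])
    finally show ?thesis .
  qed
  have pmf_pos: "0 < pmf (geometric_pmf (1 / 2)) k" for k by (simp add: pmf_geometric)
  interpret L: prob_space L
    unfolding L_def
    by (rule prob_space.prob_space_bind[OF _ _ \<nu>m])
      (use \<nu>s in \<open>auto simp: G_def measure_pmf.prob_space_axioms space_prob_algebra\<close>)
  have ac: "absolutely_continuous L \<pi>"
    unfolding absolutely_continuous_def
  proof
    fix K assume K: "K \<in> null_sets L"
    then have Ks: "K \<in> sets \<pi>" using sL by auto
    have "ennreal (pmf (geometric_pmf (1 / 2)) 0) * (\<integral>\<^sup>+x. indicator K x \<partial>\<nu> 0) \<le> (\<integral>\<^sup>+x. indicator K x \<partial>L)"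
      by (rule L_le) (use Ks in simp)
    also have "\<dots> = 0" using K by (auto simp: null_sets_def)
    finally show "K \<in> null_sets \<pi>" using pmf_pos[of 0] Ks by (auto simp: \<nu>_def null_sets_def)
  qed
  define p where "p = RN_deriv L \<pi>"
  have pm[measurable]: "p \<in> borel_measurable \<pi>"
    unfolding p_def using borel_measurable_RN_deriv[of L \<pi>] measurable_cong_sets[OF sL refl] by blast
  have dens: "density L p = \<pi>" unfolding p_def by (rule L.density_RN_deriv[OF ac]) (simp add: sL)
  have \<pi>_int: "(\<integral>\<^sup>+x. h x \<partial>\<pi>) = (\<integral>\<^sup>+x. p x * h x \<partial>L)" if h: "h \<in> borel_measurable \<pi>" for h
    unfolding dens[symmetric] using h pm by (subst nn_integral_density) (simp_all add: measurable_cong_sets[OF sL refl])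
  define N where "N = {x\<in>space \<pi>. p x = 0}"
  have Ns[measurable]: "N \<in> sets \<pi>" unfolding N_def by measurable
  have N: "N \<in> null_sets \<pi>"
  proof -
    have "emeasure \<pi> N = (\<integral>\<^sup>+x. p x * indicator N x \<partial>L)"
      using \<pi>_int[of "indicator N"] Ns by simp
    also have "\<dots> = (\<integral>\<^sup>+x. 0 \<partial>L)" by (intro nn_integral_cong) (auto simp: N_def indicator_def)
    finally show ?thesis using Ns by auto
  qed
  have \<nu>X: "(\<integral>\<^sup>+x. h x \<partial>\<nu> (Suc n)) = (\<integral>\<^sup>+\<omega>. h (X n \<omega>) \<partial>M)" if "h \<in> borel_measurable \<pi>" for h n
    unfolding \<nu>_def using that by (simp add: nn_integral_distr)
  have acX: "(\<integral>\<^sup>+\<omega>. indicator (K - N) (X n \<omega>) \<partial>M) = 0" if K: "K \<in> null_sets \<pi>" for n K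
  proof -
    have Ks[measurable]: "K \<in> sets \<pi>" using K by auto
    have "(\<integral>\<^sup>+x. p x * indicator K x \<partial>L) = 0" using \<pi>_int[of "indicator K"] K by (simp add: null_sets_def)
    then have "AE x in L. p x * indicator K x = 0"
      by (subst (asm) nn_integral_0_iff_AE) (simp_all add: measurable_cong_sets[OF sL refl])
    \<comment> \<open>Off \<open>N\<close> the density \<open>p\<close> is positive, so a
      \<open>\<pi>\<close>-null set has no \<open>L\<close>-mass there.\<close>
    then have "AE x in L. indicator (K - N) x = (0::ennreal)"
      using AE_space by eventually_elim (auto simp: N_def indicator_def sets_eq_imp_space_eq[OF sL] split: if_splits)
    then have "(\<integral>\<^sup>+x. indicator (K - N) x \<partial>L) = (\<integral>\<^sup>+x. 0 \<partial>L)" by (rule nn_integral_cong_AE)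
    then have "ennreal (pmf (geometric_pmf (1 / 2)) (Suc n)) * (\<integral>\<^sup>+x. indicator (K - N) x \<partial>\<nu> (Suc n)) \<le> 0"
      using L_le[of "indicator (K - N)" "Suc n"] by simp
    then have "(\<integral>\<^sup>+x. indicator (K - N) x \<partial>\<nu> (Suc n)) = 0" using pmf_pos[of "Suc n"] by simp
    then show ?thesis by (subst (asm) \<nu>X) auto
  qed
  have "(\<lambda>n. \<integral>\<^sup>+\<omega>. indicator N (X n \<omega>) \<partial>M) \<longlonglongrightarrow> 0" by (rule null_visits[OF N acX])
  then have "\<forall>\<^sub>F n in sequentially. (\<integral>\<^sup>+\<omega>. indicator N (X n \<omega>) \<partial>M) < ennreal e"
    by (rule order_tendstoD) (use e in simp)
  then obtain n where n: "(\<integral>\<^sup>+\<omega>. indicator N (X n \<omega>) \<partial>M) < ennreal e"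
    using eventually_happens'[OF sequentially_bot] by blast
  define B where "B j = {x\<in>space \<pi>. ennreal (1 / real (Suc j)) \<le> p x}" for j
  have Bs[measurable]: "B j \<in> sets \<pi>" for j unfolding B_def by measurable
  have "(\<lambda>j. \<integral>\<^sup>+\<omega>. indicator (space \<pi> - B j) (X n \<omega>) \<partial>M) \<longlonglongrightarrow> (\<integral>\<^sup>+\<omega>. indicator N (X n \<omega>) \<partial>M)"
  proof (rule nn_integral_dominated_convergence[where w="\<lambda>_. 1"])
    show "AE \<omega> in M. (\<lambda>j. indicator (space \<pi> - B j) (X n \<omega>)) \<longlonglongrightarrow> (indicator N (X n \<omega>) :: ennreal)"
    proof (rule AE_I2)
      fix \<omega> assume "\<omega> \<in> space M"
      note x = state_space[OF this, of n]
      show "(\<lambda>j. indicator (space \<pi> - B j) (X n \<omega>)) \<longlonglongrightarrow> (indicator N (X n \<omega>) :: ennreal)"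
      proof (cases "p (X n \<omega>) = 0")
        case True
        then have "X n \<omega> \<in> N" "\<And>j. X n \<omega> \<notin> B j" using x by (auto simp: N_def B_def)
        then show ?thesis using x by simp
      next
        case False
        have "(\<lambda>j. 1 / real (Suc j)) \<longlonglongrightarrow> 0" by (rule lim_1_over_n[THEN LIMSEQ_Suc])
        then have "(\<lambda>j. ennreal (1 / real (Suc j))) \<longlonglongrightarrow> ennreal 0" by (rule tendsto_ennrealI)
        then have "\<forall>\<^sub>F j in sequentially. ennreal (1 / real (Suc j)) < p (X n \<omega>)"
          by (rule order_tendstoD) (use False in \<open>simp add: zero_less_iff_neq_zero\<close>)
        then have "\<forall>\<^sub>F j in sequentially. indicator (space \<pi> - B j) (X n \<omega>) = (indicator N (X n \<omega>) :: ennreal)"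
          by eventually_elim (use x False in \<open>auto simp: B_def N_def indicator_def\<close>)
        then show ?thesis by (rule tendsto_eventually)
      qed
    qed
  qed (auto simp: MP.emeasure_space_1 split: split_indicator)
  then have "\<forall>\<^sub>F j in sequentially. (\<integral>\<^sup>+\<omega>. indicator (space \<pi> - B j) (X n \<omega>) \<partial>M) < ennreal e"
    by (rule order_tendstoD) (rule n)
  then obtain j where j: "(\<integral>\<^sup>+\<omega>. indicator (space \<pi> - B j) (X n \<omega>) \<partial>M) < ennreal e"
    using eventually_happens'[OF sequentially_bot] by blast
  \<comment> \<open>The numerator bounds \<open>L\<close> by \<open>\<pi>\<close> on
    \<open>B j\<close>; the weight in the denominator bounds the law of \<open>X n\<close> by
    \<open>L\<close>.\<close>
  define c where "c = real (Suc j) / pmf (geometric_pmf (1 / 2)) (Suc n)"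
  let ?w = "pmf (geometric_pmf (1 / 2)) (Suc n)"
  have dom: "(\<integral>\<^sup>+\<omega>. indicator (B j) (X n \<omega>) * h (X n \<omega>) \<partial>M) \<le> ennreal c * (\<integral>\<^sup>+x. h x \<partial>\<pi>)"
    if h[measurable]: "h \<in> borel_measurable \<pi>" for h
  proof -
    have hL: "(\<lambda>x. p x * h x) \<in> borel_measurable L" by (subst measurable_cong_sets[OF sL refl]) measurable
    have "ennreal ?w * (\<integral>\<^sup>+x. indicator (B j) x * h x \<partial>\<nu> (Suc n)) \<le> (\<integral>\<^sup>+x. indicator (B j) x * h x \<partial>L)"
      by (rule L_le) measurable
    also have "\<dots> \<le> (\<integral>\<^sup>+x. ennreal (real (Suc j)) * (p x * h x) \<partial>L)"
    proof (rule nn_integral_mono)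
      fix x
      show "indicator (B j) x * h x \<le> ennreal (real (Suc j)) * (p x * h x)"
      proof (cases "x \<in> B j")
        case True
        then have "ennreal (1 / real (Suc j)) \<le> p x" by (simp add: B_def)
        from mult_left_mono[OF this, of "ennreal (real (Suc j))"]
        have "1 \<le> ennreal (real (Suc j)) * p x" by (simp add: ennreal_mult[symmetric] del: of_nat_Suc)
        from mult_right_mono[OF this, of "h x"] show ?thesis using True by (simp add: mult.assoc)
      qed simp
    qed
    also have "\<dots> = ennreal (real (Suc j)) * (\<integral>\<^sup>+x. h x \<partial>\<pi>)"
      using hL by (simp only: nn_integral_cmult \<pi>_int[OF h])
    finally have *: "ennreal ?w * (\<integral>\<^sup>+\<omega>. indicator (B j) (X n \<omega>) * h (X n \<omega>) \<partial>M) \<le> ennreal (real (Suc j)) * (\<integral>\<^sup>+x. h x \<partial>\<pi>)"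
      by (subst (asm) \<nu>X) auto
    have w1: "ennreal (1 / ?w) * ennreal ?w = 1"
      using pmf_pos[of "Suc n"] by (simp add: ennreal_mult[symmetric])
    have "(\<integral>\<^sup>+\<omega>. indicator (B j) (X n \<omega>) * h (X n \<omega>) \<partial>M)
      = ennreal (1 / ?w) * (ennreal ?w * (\<integral>\<^sup>+\<omega>. indicator (B j) (X n \<omega>) * h (X n \<omega>) \<partial>M))"
      by (simp only: mult.assoc[symmetric] w1 mult_1_left)
    also have "\<dots> \<le> ennreal (1 / ?w) * (ennreal (real (Suc j)) * (\<integral>\<^sup>+x. h x \<partial>\<pi>))"
      by (rule mult_left_mono[OF *]) simp
    also have "\<dots> = ennreal c * (\<integral>\<^sup>+x. h x \<partial>\<pi>)"
      unfolding c_def mult.assoc[symmetric]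
      using pmf_pos[of "Suc n"] by (subst ennreal_mult[symmetric]) (auto simp: field_simps)
    finally show ?thesis .
  qed
  have "0 \<le> c" using pmf_pos[of "Suc n"] by (simp add: c_def)
  with j dom Bs[of j] show ?thesis by blast
qed

text \<open>The event that \<open>X n\<close> lies in \<open>B\<close> belongs to the past at time
  \<open>n\<close>, so weighting by its indicator leaves the Markov property at later times intact,
  while the law at the new time 0 becomes dominated.\<close>

lemma shifted_dominated:
  assumes B: "B \<in> sets \<pi>" and c: "0 \<le> c"
    and dom: "\<And>h. h \<in> borel_measurable \<pi> \<Longrightarrow> (\<integral>\<^sup>+\<omega>. indicator B (X n \<omega>) * h (X n \<omega>) \<partial>M) \<le> ennreal c * (\<integral>\<^sup>+x. h x \<partial>\<pi>)"
  shows "ergodic_dominated_chain \<pi> Z T (density M (\<lambda>\<omega>. indicator B (X n \<omega>)))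
    (\<lambda>k. F (n + k)) (\<lambda>k. X (n + k)) (\<lambda>k. W (n + k)) c"
proof -
  let ?d = "\<lambda>\<omega>. indicator B (X n \<omega>) :: ennreal"
  let ?M = "density M ?d"
  have dF: "?d \<in> borel_measurable (F (n + k))" for k
    by (rule measurable_compose[OF measurable_filtration_mono[OF adapted_state]]) (use B in auto)
  have dM[measurable]: "?d \<in> borel_measurable M" by (rule measurable_from_filtration[OF dF])
  have fin: "finite_measure ?M"
  proof
    have "emeasure ?M (space ?M) = (\<integral>\<^sup>+\<omega>. ?d \<omega> * indicator (space M) \<omega> \<partial>M)"
      by (simp add: emeasure_density)
    also have "\<dots> \<le> (\<integral>\<^sup>+\<omega>. 1 \<partial>M)" by (intro nn_integral_mono) (auto split: split_indicator)
    finally show "emeasure ?M (space ?M) \<noteq> \<infinity>" by (auto simp: MP.emeasure_space_1 top_unique)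
  qed
  have mk: "(\<integral>\<^sup>+\<omega>. H (\<omega>, W (n + k) \<omega>) \<partial>?M) = (\<integral>\<^sup>+\<omega>. (\<integral>\<^sup>+w. H (\<omega>, w) \<partial>T (X (n + k) \<omega>)) \<partial>?M)"
    if H: "H \<in> borel_measurable (F (n + k) \<Otimes>\<^sub>M S)" for H k
  proof -
    have K': "(\<lambda>\<omega>. T (X (n + k) \<omega>)) \<in> F (n + k) \<rightarrow>\<^sub>M subprob_algebra S"
      by (rule measurable_compose[OF adapted_state mark_kernel_subprob])
    have m1: "(\<lambda>\<omega>. H (\<omega>, W (n + k) \<omega>)) \<in> borel_measurable M"
      by (rule measurable_compose[OF measurable_pair_filtration H])
    have m2: "(\<lambda>\<omega>. \<integral>\<^sup>+w. H (\<omega>, w) \<partial>T (X (n + k) \<omega>)) \<in> borel_measurable M"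
      by (rule measurable_from_filtration[OF nn_integral_measurable_subprob_algebra2[OF _ K']]) (use H in simp)
    have H': "(\<lambda>z. ?d (fst z) * H z) \<in> borel_measurable (F (n + k) \<Otimes>\<^sub>M S)"
      by (intro borel_measurable_times_ennreal measurable_compose[OF measurable_fst dF] H)
    have "(\<integral>\<^sup>+\<omega>. H (\<omega>, W (n + k) \<omega>) \<partial>?M) = (\<integral>\<^sup>+\<omega>. ?d \<omega> * H (\<omega>, W (n + k) \<omega>) \<partial>M)"
      by (rule nn_integral_density[OF dM m1])
    also have "\<dots> = (\<integral>\<^sup>+\<omega>. (\<integral>\<^sup>+w. ?d \<omega> * H (\<omega>, w) \<partial>T (X (n + k) \<omega>)) \<partial>M)"
      using markov[OF H'] by simp
    also have "\<dots> = (\<integral>\<^sup>+\<omega>. ?d \<omega> * (\<integral>\<^sup>+w. H (\<omega>, w) \<partial>T (X (n + k) \<omega>)) \<partial>M)"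
    proof (rule nn_integral_cong)
      fix \<omega> assume w: "\<omega> \<in> space M"
      have "(\<lambda>w. H (\<omega>, w)) \<in> borel_measurable (T (X (n + k) \<omega>))"
        by (subst measurable_cong_sets[OF sets_mark[OF state_space[OF w]] refl])
          (rule measurable_compose[OF measurable_Pair1' H], use w in \<open>simp add: space_filtration\<close>)
      then show "(\<integral>\<^sup>+w. ?d \<omega> * H (\<omega>, w) \<partial>T (X (n + k) \<omega>)) = ?d \<omega> * (\<integral>\<^sup>+w. H (\<omega>, w) \<partial>T (X (n + k) \<omega>))"
        by (rule nn_integral_cmult)
    qed
    also have "\<dots> = (\<integral>\<^sup>+\<omega>. (\<integral>\<^sup>+w. H (\<omega>, w) \<partial>T (X (n + k) \<omega>)) \<partial>?M)"
      by (rule nn_integral_density[OF dM m2, symmetric])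
    finally show ?thesis .
  qed
  show ?thesis
  proof (intro ergodic_dominated_chain.intro dominated_chain.intro marked_chain.intro
      mark_kernel_axioms fin marked_chain_axioms.intro dominated_chain_axioms.intro ergodic_dominated_chain_axioms.intro)
    show "subalgebra ?M (F (n + k))" for k using filtration by (simp add: subalgebra_def)
    show "sets (F (n + k)) \<subseteq> sets (F (n + l))" if "k \<le> l" for k l
      by (rule filtration_mono) (use that in simp)
    show "X (n + k) \<in> F (n + k) \<rightarrow>\<^sub>M \<pi>" for k by (rule adapted_state)
    show "W (n + k) \<in> F (n + Suc k) \<rightarrow>\<^sub>M S" for k using adapted_mark[of "n + k"] by simp
    show "X (n + Suc k) \<omega> = snd (W (n + k) \<omega>)" if "\<omega> \<in> space ?M" for \<omega> k using state_Suc[of \<omega> "n + k"] that by simp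
    show "(\<integral>\<^sup>+\<omega>. H (\<omega>, W (n + k) \<omega>) \<partial>?M) = (\<integral>\<^sup>+\<omega>. (\<integral>\<^sup>+w. H (\<omega>, w) \<partial>T (X (n + k) \<omega>)) \<partial>?M)"
      if "H \<in> borel_measurable (F (n + k) \<Otimes>\<^sub>M S)" for H k by (rule mk[OF that])
    show "0 \<le> c" by (rule c)
    show "(\<integral>\<^sup>+\<omega>. h (X (n + 0) \<omega>) \<partial>?M) \<le> ennreal c * (\<integral>\<^sup>+x. h x \<partial>\<pi>)" if h: "h \<in> borel_measurable \<pi>" for h
      using dom[OF h] by (subst nn_integral_density) (use h in auto)
    fix v :: "'a \<Rightarrow> real" and b e :: real
    assume v: "v \<in> borel_measurable \<pi>" "\<And>x. x \<in> space \<pi> \<Longrightarrow> \<bar>v x\<bar> \<le> b" "(\<integral>x. v x \<partial>\<pi>) = 0" "0 < e"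
    then have "bdd_meas b v" by (simp add: bdd_meas_def)
    from coboundary_dense[OF this v(3,4)] obtain d u where u: "bdd_meas d u" "(\<integral>x. \<bar>v x - (u x - op u x)\<bar> \<partial>\<pi>) \<le> e" by blast
    have um: "u \<in> borel_measurable \<pi>" by (rule bdd_measD[OF u(1)])
    have eq: "(\<integral>x. \<bar>v x - (u x - (\<integral>w. u (snd w) \<partial>T x))\<bar> \<partial>\<pi>) = (\<integral>x. \<bar>v x - (u x - op u x)\<bar> \<partial>\<pi>)"
      by (intro Bochner_Integration.integral_cong) (auto simp: op_def integral_kernel_eq[OF _ um])
    show "\<exists>d u. u \<in> borel_measurable \<pi> \<and> (\<forall>x\<in>space \<pi>. \<bar>u x\<bar> \<le> d) \<and> (\<integral>x. \<bar>v x - (u x - (\<integral>w. u (snd w) \<partial>T x))\<bar> \<partial>\<pi>) \<le> e"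
      by (rule exI[of _ d], rule exI[of _ u]) (use u um eq in \<open>auto simp: bdd_meas_def\<close>)
  qed
qed

context
  fixes g :: "'a \<times> ('b \<times> 'a) \<Rightarrow> real" and h :: "'a \<Rightarrow> real"
  assumes g: "g \<in> borel_measurable (\<pi> \<Otimes>\<^sub>M S)" and sq: "integrable \<mu> (\<lambda>z. (g z)\<^sup>2)"
    and centred: "AE x in \<pi>. (\<integral>w. g (x, w) \<partial>T x) = 0"
    and h: "h \<in> borel_measurable \<pi>" and h_sq: "integrable \<pi> (\<lambda>x. (h x)\<^sup>2)"
begin

text \<open>With the martingale increment for \<open>g\<close> and \<open>PF\<close> for
  \<open>h\<close> this will be \<open>n\<close> times the centred estimator. Including both
  boundary terms makes the sum additive under restarts.\<close>

definition path_sum :: "nat \<Rightarrow> 'w \<Rightarrow> real" where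
  "path_sum n \<omega> = (\<Sum>j<n. g (X j \<omega>, W j \<omega>)) + h (X 0 \<omega>) - h (X n \<omega>)"

lemma measurable_path_sum [measurable]: "path_sum n \<in> borel_measurable M"
proof -
  have "(\<lambda>\<omega>. \<Sum>j<n. g (X j \<omega>, W j \<omega>)) \<in> borel_measurable M"
    by (intro borel_measurable_sum measurable_from_filtration[OF adapted_step[OF g lessI]])
  moreover have "(\<lambda>\<omega>. h (X k \<omega>)) \<in> borel_measurable M" for k by (rule measurable_compose[OF measurable_state h])
  ultimately show ?thesis unfolding path_sum_def[abs_def] by measurable
qed

lemma path_sum_shift:
  "path_sum (n + k) \<omega> = path_sum n \<omega> + ((\<Sum>j<k. g (X (n + j) \<omega>, W (n + j) \<omega>)) + h (X (n + 0) \<omega>) - h (X (n + k) \<omega>))"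
proof -
  have "(\<Sum>j<n + k. g (X j \<omega>, W j \<omega>)) = (\<Sum>j<n. g (X j \<omega>, W j \<omega>)) + (\<Sum>j<k. g (X (n + j) \<omega>, W (n + j) \<omega>))"
    by (induction k) auto
  then show ?thesis by (simp add: path_sum_def)
qed

text \<open>Countably many restarts, with exceptional probabilities below
  \<open>1 / (i + 1)\<close>, cover almost every path. On each of them the strong law for dominated
  chains applies from time \<open>n i\<close> on, and the finite initial segment does not affect the
  limit.\<close>

lemma path_sum_lln: "AE \<omega> in M. (\<lambda>n. path_sum n \<omega> / real n) \<longlonglongrightarrow> 0"
proof -
  \<comment> \<open>The triple collects a time, a set and a constant, so that one application of
    choice selects all of them.\<close>
  define good where "good i p \<longleftrightarrow> fst (snd p) \<in> sets \<pi> \<and> 0 \<le> snd (snd p) \<and>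
    (\<integral>\<^sup>+\<omega>. indicator (space \<pi> - fst (snd p)) (X (fst p) \<omega>) \<partial>M) < ennreal (1 / real (Suc i)) \<and>
    (\<forall>h\<in>borel_measurable \<pi>. (\<integral>\<^sup>+\<omega>. indicator (fst (snd p)) (X (fst p) \<omega>) * h (X (fst p) \<omega>) \<partial>M)
      \<le> ennreal (snd (snd p)) * (\<integral>\<^sup>+x. h x \<partial>\<pi>))" for i :: nat and p :: "nat \<times> 'a set \<times> real"
  have "\<exists>p. good i p" for i
  proof -
    have "0 < 1 / real (Suc i)" by simp
    from exists_dominated_event[OF this] obtain n B c where "good i (n, B, c)"
      unfolding good_def fst_conv snd_conv by blast
    then show ?thesis ..
  qed
  then have "\<forall>i. \<exists>p. good i p" ..
  from choice[OF this] obtain p where p: "\<And>i. good i (p i)" by blast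
  define n B c where "n i = fst (p i)" and "B i = fst (snd (p i))" and "c i = snd (snd (p i))" for i
  note p = p[unfolded good_def, folded n_def B_def c_def]
  have Bs: "B i \<in> sets \<pi>" and c: "0 \<le> c i"
    and small: "(\<integral>\<^sup>+\<omega>. indicator (space \<pi> - B i) (X (n i) \<omega>) \<partial>M) < ennreal (1 / real (Suc i))" for i
    using p[of i] by blast+
  have dom: "(\<integral>\<^sup>+\<omega>. indicator (B i) (X (n i) \<omega>) * h (X (n i) \<omega>) \<partial>M) \<le> ennreal (c i) * (\<integral>\<^sup>+x. h x \<partial>\<pi>)"
    if "h \<in> borel_measurable \<pi>" for h i
    using p[of i] that by blast
  have conv: "AE \<omega> in M. X (n i) \<omega> \<in> B i \<longrightarrow> (\<lambda>k. path_sum k \<omega> / real k) \<longlonglongrightarrow> 0" for i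
  proof -
    let ?d = "\<lambda>\<omega>. indicator (B i) (X (n i) \<omega>) :: ennreal"
    let ?T = "\<lambda>k \<omega>. (\<Sum>j<k. g (X (n i + j) \<omega>, W (n i + j) \<omega>)) + h (X (n i + 0) \<omega>) - h (X (n i + k) \<omega>)"
    interpret D: ergodic_dominated_chain \<pi> Z T "density M ?d" "\<lambda>k. F (n i + k)" "\<lambda>k. X (n i + k)" "\<lambda>k. W (n i + k)" "c i"
      by (rule shifted_dominated[OF Bs c dom])
    have dm: "?d \<in> borel_measurable M" by (rule measurable_compose[OF measurable_state]) (use Bs in simp)
    have "AE \<omega> in density M ?d. (\<lambda>k. ?T k \<omega> / real k) \<longlonglongrightarrow> 0"
      using D.martingale_strong_law[OF g sq centred] D.scaled_state_AE[OF h h_sq]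
    proof eventually_elim
      case (elim \<omega>)
      have "(\<lambda>k. h (X (n i + 0) \<omega>) * (1 / real k)) \<longlonglongrightarrow> h (X (n i + 0) \<omega>) * 0"
        by (intro tendsto_mult tendsto_const lim_1_over_n)
      from tendsto_diff[OF tendsto_add[OF elim(1) this] elim(2)] show ?case
        by (simp add: add_divide_distrib diff_divide_distrib)
    qed
    then have "AE \<omega> in M. 0 < ?d \<omega> \<longrightarrow> (\<lambda>k. ?T k \<omega> / real k) \<longlonglongrightarrow> 0"
      by (simp only: AE_density[OF dm])
    then show ?thesis
    proof eventually_elim
      case (elim \<omega>)
      show ?case
      proof
        assume "X (n i) \<omega> \<in> B i"
        with elim have T: "(\<lambda>k. ?T k \<omega> / real k) \<longlonglongrightarrow> 0" by simp
        note r1 = ratio_shift_tendsto[of "n i"] and r0 = inverse_shift_tendsto[of "n i"]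
        \<comment> \<open>The restarted sum is normalised by its own length \<open>k\<close>, the
          original one by \<open>n i + k\<close>; their ratio tends to 1.\<close>
        have "(\<lambda>k. path_sum (n i) \<omega> * (1 / real (n i + k)) + ?T k \<omega> / real k * (real k / real (n i + k))) \<longlonglongrightarrow> path_sum (n i) \<omega> * 0 + 0 * 1"
          by (intro tendsto_add tendsto_mult tendsto_const r0 r1 T)
        then have "(\<lambda>k. path_sum (n i) \<omega> * (1 / real (n i + k)) + ?T k \<omega> / real k * (real k / real (n i + k))) \<longlonglongrightarrow> 0" by simp
        then have "(\<lambda>k. path_sum (n i + k) \<omega> / real (n i + k)) \<longlonglongrightarrow> 0"
        proof (rule Lim_transform_eventually)
          show "\<forall>\<^sub>F k in sequentially. path_sum (n i) \<omega> * (1 / real (n i + k)) + ?T k \<omega> / real k * (real k / real (n i + k)) = path_sum (n i + k) \<omega> / real (n i + k)"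
            using eventually_gt_at_top[of 0]
            by eventually_elim (simp add: path_sum_shift[of "n i"] add_divide_distrib)
        qed
        then have "(\<lambda>k. path_sum (k + n i) \<omega> / real (k + n i)) \<longlonglongrightarrow> 0"
          by (simp only: add.commute[of _ "n i"])
        then show "(\<lambda>k. path_sum k \<omega> / real k) \<longlonglongrightarrow> 0" by (rule LIMSEQ_offset)
      qed
    qed
  qed
  have "AE \<omega> in M. \<exists>i. X (n i) \<omega> \<in> B i"
  proof -
    let ?N = "{\<omega>\<in>space M. \<forall>i. X (n i) \<omega> \<in> space \<pi> - B i}"
    have Nm: "?N \<in> sets M" using Bs by measurable
    have "emeasure M ?N \<le> ennreal (1 / real (Suc i))" for i
    proof -
      have "emeasure M ?N = (\<integral>\<^sup>+\<omega>. indicator ?N \<omega> \<partial>M)" using Nm by simp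
      also have "\<dots> \<le> (\<integral>\<^sup>+\<omega>. indicator (space \<pi> - B i) (X (n i) \<omega>) \<partial>M)"
        by (intro nn_integral_mono) (auto split: split_indicator)
      finally show ?thesis using small[of i] by simp
    qed
    moreover have "(\<lambda>i. ennreal (1 / real (Suc i))) \<longlonglongrightarrow> ennreal 0"
      by (intro tendsto_ennrealI lim_1_over_n[THEN LIMSEQ_Suc])
    ultimately have "emeasure M ?N \<le> ennreal 0" by (intro LIMSEQ_le_const) auto
    then have "?N \<in> null_sets M" using Nm by auto
    then have "AE \<omega> in M. \<omega> \<notin> ?N" by (rule AE_not_in)
    with AE_space show ?thesis by eventually_elim (use state_space in auto)
  qed
  moreover have "AE \<omega> in M. \<forall>i. X (n i) \<omega> \<in> B i \<longrightarrow> (\<lambda>k. path_sum k \<omega> / real k) \<longlonglongrightarrow> 0"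
    unfolding AE_all_countable using conv by blast
  ultimately show ?thesis by eventually_elim auto
qed

text \<open>Convergence of characteristic functions is not a pathwise statement, so one restart is
  fixed for each \<open>\<epsilon>\<close>. The event kept has mass
  \<open>m > 1 - \<epsilon> / 4\<close> and yields the limit \<open>m E\<close>; the discarded event
  contributes less than \<open>\<epsilon> / 4\<close>.\<close>

lemma path_sum_clt:
  "(\<lambda>n. \<integral>\<omega>. iexp (t / sqrt (real n) * path_sum n \<omega>) \<partial>M) \<longlonglongrightarrow> complex_of_real (exp (- t\<^sup>2 * ((\<integral>z. (g z)\<^sup>2 \<partial>\<mu>) / 2)))"
proof (rule tendstoI)
  fix \<epsilon> :: real assume \<epsilon>: "0 < \<epsilon>"
  define E where "E = exp (- t\<^sup>2 * ((\<integral>z. (g z)\<^sup>2 \<partial>\<mu>) / 2))"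
  have E1: "0 \<le> E" "E \<le> 1" by (auto simp: E_def)
  from exists_dominated_event[of "\<epsilon> / 4"] \<epsilon> obtain n B c where Bs: "B \<in> sets \<pi>" and c: "0 \<le> c"
    and small: "(\<integral>\<^sup>+\<omega>. indicator (space \<pi> - B) (X n \<omega>) \<partial>M) < ennreal (\<epsilon> / 4)"
    and dom: "\<And>h. h \<in> borel_measurable \<pi> \<Longrightarrow> (\<integral>\<^sup>+\<omega>. indicator B (X n \<omega>) * h (X n \<omega>) \<partial>M) \<le> ennreal c * (\<integral>\<^sup>+x. h x \<partial>\<pi>)"
    by auto
  let ?d = "\<lambda>\<omega>. indicator B (X n \<omega>) :: ennreal"
  let ?r = "\<lambda>\<omega>. indicator B (X n \<omega>) :: real"
  let ?D = "density M ?d"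
  let ?T = "\<lambda>k \<omega>. (\<Sum>j<k. g (X (n + j) \<omega>, W (n + j) \<omega>)) + h (X (n + 0) \<omega>) - h (X (n + k) \<omega>)"
  interpret D: ergodic_dominated_chain \<pi> Z T ?D "\<lambda>k. F (n + k)" "\<lambda>k. X (n + k)" "\<lambda>k. W (n + k)" c
    by (rule shifted_dominated[OF Bs c dom])
  have rm[measurable]: "?r \<in> borel_measurable M" by (rule measurable_compose[OF measurable_state]) (use Bs in simp)
  have dr: "?d = (\<lambda>\<omega>. ennreal (?r \<omega>))" by (auto simp: indicator_def)
  have hi: "integrable \<pi> h" by (rule square_integral_le(1)[OF h h_sq])
  \<comment> \<open>There are \<open>k\<close> increments after the restart while the clock shows
    \<open>k + n\<close>; still \<open>k (a k)^2\<close> tends to \<open>t^2\<close>.\<close>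
  define a where "a k = t / sqrt (real (k + n))" for k
  have a: "(\<lambda>k. real k * (a k)\<^sup>2) \<longlonglongrightarrow> t\<^sup>2"
  proof -
    have "(\<lambda>k. t\<^sup>2 * (real k / real (k + n))) \<longlonglongrightarrow> t\<^sup>2 * 1"
      using ratio_shift_tendsto[of n] by (intro tendsto_mult tendsto_const) (simp add: add.commute)
    moreover have "real k * (a k)\<^sup>2 = t\<^sup>2 * (real k / real (k + n))" for k
      by (simp add: a_def power_divide)
    ultimately show ?thesis by simp
  qed
  have a0: "a \<longlonglongrightarrow> 0" by (rule tendsto_power_exp(2)[OF a order_refl])
  define m where "m = measure ?D (space ?D)"
  have Tm: "?T k \<in> borel_measurable M" for k
  proof -
    have "?T k = (\<lambda>\<omega>. path_sum (n + k) \<omega> - path_sum n \<omega>)" by (rule ext) (simp add: path_sum_shift[of n k])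
    then show ?thesis by simp
  qed
  have clt: "(\<lambda>k. \<integral>\<omega>. iexp (a k * ?T k \<omega>) \<partial>?D) \<longlonglongrightarrow> complex_of_real (m * E)"
    unfolding m_def E_def by (rule D.martingale_clt_boundary[OF g sq centred a hi])
  \<comment> \<open>The segment before the restart is a fixed random variable multiplied by
    \<open>a k\<close>. No moment of it is known under an arbitrary initial law, so dominated
    convergence of the bounded exponentials is used.\<close>
  have clt': "(\<lambda>k. (\<integral>\<omega>. iexp (a k * path_sum (k + n) \<omega>) \<partial>?D) - (\<integral>\<omega>. iexp (a k * ?T k \<omega>) \<partial>?D)) \<longlonglongrightarrow> 0"
  proof -
    have m1: "(\<lambda>\<omega>. iexp (a k * ?T k \<omega>)) \<in> borel_measurable ?D" for k using Tm by measurable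
    have m2: "(\<lambda>\<omega>. iexp (a k * path_sum (k + n) \<omega>)) \<in> borel_measurable ?D" for k by measurable
    have i1: "integrable ?D (\<lambda>\<omega>. iexp (a k * ?T k \<omega>))" for k
      by (rule D.M.norm_integral_le_const(1)[OF m1, where B=1]) (unfold norm_exp_i_times, simp)
    have i2: "integrable ?D (\<lambda>\<omega>. iexp (a k * path_sum (k + n) \<omega>))" for k
      by (rule D.M.norm_integral_le_const(1)[OF m2, where B=1]) (unfold norm_exp_i_times, simp)
    have "(\<lambda>k. \<integral>\<omega>. iexp (a k * path_sum (k + n) \<omega>) - iexp (a k * ?T k \<omega>) \<partial>?D) \<longlonglongrightarrow> (\<integral>\<omega>. 0 \<partial>?D)"
    proof (rule integral_dominated_convergence[where w="\<lambda>_. 2"])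
      show "AE \<omega> in ?D. (\<lambda>k. iexp (a k * path_sum (k + n) \<omega>) - iexp (a k * ?T k \<omega>)) \<longlonglongrightarrow> 0"
      proof (rule AE_I2, rule Lim_null_comparison)
        fix \<omega>
        have "(\<lambda>k. \<bar>a k * path_sum n \<omega>\<bar>) \<longlonglongrightarrow> \<bar>0 * path_sum n \<omega>\<bar>" by (intro tendsto_intros a0)
        then show "(\<lambda>k. \<bar>a k * path_sum n \<omega>\<bar>) \<longlonglongrightarrow> 0" by simp
        have "norm (iexp (a k * path_sum (k + n) \<omega>) - iexp (a k * ?T k \<omega>)) \<le> \<bar>a k * path_sum n \<omega>\<bar>" for k
        proof -
          have "path_sum (k + n) \<omega> = path_sum n \<omega> + ?T k \<omega>"
            unfolding add.commute[of k n] by (rule path_sum_shift)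
          then have "a k * path_sum (k + n) \<omega> - a k * ?T k \<omega> = a k * path_sum n \<omega>"
            by (simp only: distrib_left add_diff_cancel_right')
          then show ?thesis using norm_iexp_diff_le[of "a k * path_sum (k + n) \<omega>" "a k * ?T k \<omega>"] by (simp only:)
        qed
        then show "\<forall>\<^sub>F k in sequentially. norm (iexp (a k * path_sum (k + n) \<omega>) - iexp (a k * ?T k \<omega>)) \<le> \<bar>a k * path_sum n \<omega>\<bar>"
          by (intro always_eventually allI)
      qed
      show "AE \<omega> in ?D. norm (iexp (a k * path_sum (k + n) \<omega>) - iexp (a k * ?T k \<omega>)) \<le> 2" for k
      proof (rule AE_I2)
        fix \<omega>
        show "norm (iexp (a k * path_sum (k + n) \<omega>) - iexp (a k * ?T k \<omega>)) \<le> 2"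
          using norm_triangle_ineq4[of "iexp (a k * path_sum (k + n) \<omega>)" "iexp (a k * ?T k \<omega>)"]
          unfolding norm_exp_i_times by simp
      qed
      show "(\<lambda>\<omega>. iexp (a k * path_sum (k + n) \<omega>) - iexp (a k * ?T k \<omega>)) \<in> borel_measurable ?D" for k
        by (intro borel_measurable_diff m1 m2)
    qed auto
    then show ?thesis unfolding Bochner_Integration.integral_diff[OF i2 i1] by simp
  qed
  from tendsto_add[OF clt' clt] have "(\<lambda>k. \<integral>\<omega>. iexp (a k * path_sum (k + n) \<omega>) \<partial>?D) \<longlonglongrightarrow> complex_of_real (m * E)"
    by simp
  then have "(\<lambda>k. \<integral>\<omega>. iexp (t / sqrt (real (k + n)) * path_sum (k + n) \<omega>) \<partial>?D) \<longlonglongrightarrow> complex_of_real (m * E)"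
    by (simp only: a_def)
  then have "(\<lambda>k. \<integral>\<omega>. iexp (t / sqrt (real k) * path_sum k \<omega>) \<partial>?D) \<longlonglongrightarrow> complex_of_real (m * E)"
    by (rule LIMSEQ_offset[where k=n])
  then have ev: "\<forall>\<^sub>F k in sequentially. dist (\<integral>\<omega>. iexp (t / sqrt (real k) * path_sum k \<omega>) \<partial>?D) (complex_of_real (m * E)) < \<epsilon> / 4"
    by (rule tendstoD) (use \<epsilon> in simp)
  have out: "(\<integral>\<omega>. 1 - ?r \<omega> \<partial>M) < \<epsilon> / 4"
  proof -
    have i: "integrable M (\<lambda>\<omega>. 1 - ?r \<omega>)"
      by (rule M.integrable_const_bound[where B=1]) (use rm in \<open>auto split: split_indicator\<close>)
    have "ennreal (\<integral>\<omega>. 1 - ?r \<omega> \<partial>M) = (\<integral>\<^sup>+\<omega>. ennreal (1 - ?r \<omega>) \<partial>M)"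
      by (rule nn_integral_eq_integral[OF i, symmetric]) (auto simp: indicator_def)
    also have "\<dots> = (\<integral>\<^sup>+\<omega>. indicator (space \<pi> - B) (X n \<omega>) \<partial>M)"
      by (intro nn_integral_cong) (use state_space in \<open>auto simp: indicator_def\<close>)
    finally have "ennreal (\<integral>\<omega>. 1 - ?r \<omega> \<partial>M) < ennreal (\<epsilon> / 4)" using small by (simp only:)
    moreover have "0 \<le> (\<integral>\<omega>. 1 - ?r \<omega> \<partial>M)" by (rule integral_nonneg_AE) (auto simp: indicator_def)
    ultimately show ?thesis by (simp only: ennreal_less_iff)
  qed
  have ri: "integrable M ?r"
    by (rule M.integrable_const_bound[where B=1]) (use rm in \<open>auto split: split_indicator\<close>)
  have mE: "m = (\<integral>\<omega>. ?r \<omega> \<partial>M)"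
  proof -
    have "m = (\<integral>\<omega>. 1 \<partial>?D)" by (simp add: m_def)
    also have "\<dots> = (\<integral>\<omega>. ?r \<omega> *\<^sub>R 1 \<partial>M)" unfolding dr by (rule integral_density[OF _ rm]) (auto simp: indicator_def)
    finally show ?thesis by simp
  qed
  show "\<forall>\<^sub>F k in sequentially. dist (\<integral>\<omega>. iexp (t / sqrt (real k) * path_sum k \<omega>) \<partial>M) (complex_of_real (exp (- t\<^sup>2 * ((\<integral>z. (g z)\<^sup>2 \<partial>\<mu>) / 2)))) < \<epsilon>"
    using ev unfolding E_def[symmetric]
  proof eventually_elim
    case (elim k)
    let ?e = "\<lambda>\<omega>. iexp (t / sqrt (real k) * path_sum k \<omega>)"
    have em: "?e \<in> borel_measurable M" by measurable
    have ei: "integrable M ?e" by (rule M.norm_integral_le_const(1)[OF em, where B=1]) (unfold norm_exp_i_times, simp)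
    have rem: "(\<lambda>\<omega>. ?r \<omega> *\<^sub>R ?e \<omega>) \<in> borel_measurable M" using em by measurable
    have rei: "integrable M (\<lambda>\<omega>. ?r \<omega> *\<^sub>R ?e \<omega>)"
      by (rule M.norm_integral_le_const(1)[OF rem, where B=1]) (unfold norm_scaleR norm_exp_i_times, auto simp: indicator_def)
    have De: "(\<integral>\<omega>. ?e \<omega> \<partial>?D) = (\<integral>\<omega>. ?r \<omega> *\<^sub>R ?e \<omega> \<partial>M)"
      unfolding dr by (rule integral_density[OF em rm]) (auto simp: indicator_def)
    have "norm ((\<integral>\<omega>. ?e \<omega> \<partial>M) - (\<integral>\<omega>. ?e \<omega> \<partial>?D)) = norm (\<integral>\<omega>. ?e \<omega> - ?r \<omega> *\<^sub>R ?e \<omega> \<partial>M)"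
      unfolding De Bochner_Integration.integral_diff[OF ei rei] ..
    also have "\<dots> \<le> (\<integral>\<omega>. norm (?e \<omega> - ?r \<omega> *\<^sub>R ?e \<omega>) \<partial>M)" by (rule integral_norm_bound)
    also have "\<dots> = (\<integral>\<omega>. 1 - ?r \<omega> \<partial>M)"
    proof (rule Bochner_Integration.integral_cong[OF refl])
      fix \<omega>
      have "norm (z - ?r \<omega> *\<^sub>R z) = (1 - ?r \<omega>) * norm z" for z :: complex by (auto simp: indicator_def)
      then show "norm (?e \<omega> - ?r \<omega> *\<^sub>R ?e \<omega>) = 1 - ?r \<omega>" unfolding norm_exp_i_times by simp
    qed
    finally have 1: "dist (\<integral>\<omega>. ?e \<omega> \<partial>M) (\<integral>\<omega>. ?e \<omega> \<partial>?D) < \<epsilon> / 4" using out by (simp only: dist_norm)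
    have "(\<integral>\<omega>. 1 - ?r \<omega> \<partial>M) = 1 - m" using ri by (simp add: mE MP.prob_space)
    with out have m1: "1 - m < \<epsilon> / 4" by simp
    have "0 \<le> (\<integral>\<omega>. 1 - ?r \<omega> \<partial>M)" by (rule integral_nonneg_AE) (auto simp: indicator_def)
    then have m2: "m \<le> 1" using \<open>(\<integral>\<omega>. 1 - ?r \<omega> \<partial>M) = 1 - m\<close> by simp
    have "dist (complex_of_real (m * E)) (complex_of_real E) = \<bar>m * E - E\<bar>" by (simp only: dist_of_real dist_real_def)
    also have "\<dots> = (1 - m) * E"
    proof -
      have "0 \<le> (1 - m) * E" using m2 E1 by simp
      then show ?thesis by (simp add: left_diff_distrib)
    qed
    also have "\<dots> \<le> (1 - m) * 1" using m2 E1 by (intro mult_left_mono) auto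
    finally have 2: "dist (complex_of_real (m * E)) (complex_of_real E) < \<epsilon> / 4" using m1 by simp
    show ?case
      using 1 2 elim dist_triangle[of "\<integral>\<omega>. ?e \<omega> \<partial>M" "complex_of_real E" "\<integral>\<omega>. ?e \<omega> \<partial>?D"]
        dist_triangle[of "\<integral>\<omega>. ?e \<omega> \<partial>?D" "complex_of_real E" "complex_of_real (m * E)"] \<epsilon> by linarith
  qed
qed

end

end

section \<open>The marked chain generated by the conditional laws of proposal and selection\<close>

section \<open>The chain of proposals and selections\<close>

text \<open>The hypothesis provides one null event for each set \<open>B\<close>, but the kernel
  \<open>K\<close> is given beforehand, so it is enough to match two joint laws on rectangles.
  Conditional probabilities thus become identities between integrals, with no regularity of the
  space involved.\<close>

lemma cond_law_nn_integral:
  fixes M G :: "'w measure" and Y :: "'w \<Rightarrow> 'c" and K :: "'w \<Rightarrow> 'c measure"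
  assumes pM: "prob_space M" and G: "subalgebra M G" and Y: "Y \<in> M \<rightarrow>\<^sub>M N" and K: "K \<in> G \<rightarrow>\<^sub>M prob_algebra N"
    and law: "\<And>B. B \<in> sets N \<Longrightarrow> AE \<omega> in M. real_cond_exp M G (indicator (Y -` B \<inter> space M)) \<omega> = measure (K \<omega>) B"
    and H: "H \<in> borel_measurable (G \<Otimes>\<^sub>M N)"
  shows "(\<integral>\<^sup>+\<omega>. H (\<omega>, Y \<omega>) \<partial>M) = (\<integral>\<^sup>+\<omega>. (\<integral>\<^sup>+y. H (\<omega>, y) \<partial>K \<omega>) \<partial>M)"
proof -
  interpret prob_space M by (rule pM)
  interpret C: finite_measure_subalgebra M G by standard (rule G)
  let ?M' = "restr_to_subalg M G"
  have spG: "space G = space M" using G by (simp add: subalgebra_def)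
  have sF: "sets ?M' = sets G" by (rule sets_restr_to_subalg[OF G])
  have sFN: "sets (?M' \<Otimes>\<^sub>M N) = sets (G \<Otimes>\<^sub>M N)" by (rule sets_pair_measure_cong[OF sF refl])
  have KG: "K \<in> G \<rightarrow>\<^sub>M subprob_algebra N" by (rule measurable_prob_algebraD[OF K])
  have K': "K \<in> ?M' \<rightarrow>\<^sub>M subprob_algebra N" by (rule measurable_in_subalg[OF G KG])
  have ne: "space ?M' \<noteq> {}" using not_empty by (simp add: space_restr_to_subalg)
  have id: "(\<lambda>\<omega>. \<omega>) \<in> M \<rightarrow>\<^sub>M G" by (rule measurable_from_subalg[OF G]) simp
  have pair: "(\<lambda>\<omega>. (\<omega>, Y \<omega>)) \<in> M \<rightarrow>\<^sub>M G \<Otimes>\<^sub>M N" by (rule measurable_Pair[OF id Y])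
  have sK: "sets (kernel_prod ?M' N K) = sets (G \<Otimes>\<^sub>M N)" using sets_kernel_prod[OF K' ne] sFN by simp
  have emK: "(\<lambda>\<omega>. emeasure (K \<omega>) B) \<in> borel_measurable G" if "B \<in> sets N" for B
    by (rule measurable_compose[OF KG measurable_emeasure_subprob_algebra[OF that]])
  have mK: "(\<lambda>\<omega>. measure (K \<omega>) B) \<in> borel_measurable M" if "B \<in> sets N" for B
    by (rule measurable_from_subalg[OF G measurable_compose[OF KG measurable_measure_subprob_algebra[OF that]]])
  have eq: "distr M (G \<Otimes>\<^sub>M N) (\<lambda>\<omega>. (\<omega>, Y \<omega>)) = kernel_prod ?M' N K"
  proof (rule measure_eqI_generator_eq[where \<Omega>="space G \<times> space N" and E="{a \<times> b | a b. a \<in> sets G \<and> b \<in> sets N}"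
        and A="\<lambda>_. space G \<times> space N"])
    show "Int_stable {a \<times> b | a b. a \<in> sets G \<and> b \<in> sets N}" by (rule Int_stable_pair_measure_generator)
    show "{a \<times> b | a b. a \<in> sets G \<and> b \<in> sets N} \<subseteq> Pow (space G \<times> space N)" by (rule pair_measure_closed)
    show "sets (distr M (G \<Otimes>\<^sub>M N) (\<lambda>\<omega>. (\<omega>, Y \<omega>))) = sigma_sets (space G \<times> space N) {a \<times> b | a b. a \<in> sets G \<and> b \<in> sets N}"
      by (simp add: sets_pair_measure)
    show "sets (kernel_prod ?M' N K) = sigma_sets (space G \<times> space N) {a \<times> b | a b. a \<in> sets G \<and> b \<in> sets N}"
      by (simp add: sK sets_pair_measure)
    show "range (\<lambda>_. space G \<times> space N) \<subseteq> {a \<times> b | a b. a \<in> sets G \<and> b \<in> sets N}" by auto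
    show "(\<Union>i::nat. space G \<times> space N) = space G \<times> space N" by simp
    interpret D: prob_space "distr M (G \<Otimes>\<^sub>M N) (\<lambda>\<omega>. (\<omega>, Y \<omega>))" by (rule prob_space_distr[OF pair])
    show "emeasure (distr M (G \<Otimes>\<^sub>M N) (\<lambda>\<omega>. (\<omega>, Y \<omega>))) (space G \<times> space N) \<noteq> \<infinity>" by simp
    fix R assume "R \<in> {a \<times> b | a b. a \<in> sets G \<and> b \<in> sets N}"
    then obtain a b where R: "R = a \<times> b" and a: "a \<in> sets G" and b: "b \<in> sets N" by blast
    have aM: "a \<in> sets M" using a G by (auto simp: subalgebra_def)
    have bM: "Y -` b \<inter> space M \<in> sets M" by (rule measurable_sets[OF Y b])
    have RG: "R \<in> sets (G \<Otimes>\<^sub>M N)" unfolding R using a b by simp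
    have fin: "emeasure (K \<omega>) b = ennreal (measure (K \<omega>) b)" if "\<omega> \<in> space M" for \<omega>
    proof -
      interpret K: prob_space "K \<omega>" using measurable_space[OF K, of \<omega>] that by (simp add: spG space_prob_algebra)
      show ?thesis by (rule K.emeasure_eq_measure)
    qed
    have ii: "integrable M (indicator (Y -` b \<inter> space M) :: 'w \<Rightarrow> real)"
      using bM by (intro integrable_const_bound[where B=1]) (auto simp: indicator_def)
    have mi: "integrable M (\<lambda>\<omega>. indicator a \<omega> * measure (K \<omega>) b)"
    proof (rule integrable_const_bound[where B=1])
      show "AE \<omega> in M. norm (indicator a \<omega> * measure (K \<omega>) b) \<le> 1"
      proof (rule AE_I2)
        fix \<omega> assume "\<omega> \<in> space M"
        then interpret K: prob_space "K \<omega>" using measurable_space[OF K, of \<omega>] by (simp add: spG space_prob_algebra)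
        show "norm (indicator a \<omega> * measure (K \<omega>) b) \<le> 1" by (simp add: indicator_def)
      qed
    qed (use aM mK[OF b] in simp)
    have "emeasure (distr M (G \<Otimes>\<^sub>M N) (\<lambda>\<omega>. (\<omega>, Y \<omega>))) R = emeasure M ((\<lambda>\<omega>. (\<omega>, Y \<omega>)) -` R \<inter> space M)"
      by (rule emeasure_distr[OF pair RG])
    also have "(\<lambda>\<omega>. (\<omega>, Y \<omega>)) -` R \<inter> space M = a \<inter> (Y -` b \<inter> space M)" unfolding R by auto
    also have "emeasure M \<dots> = ennreal (measure M (a \<inter> (Y -` b \<inter> space M)))" by (rule emeasure_eq_measure)
    also have "measure M (a \<inter> (Y -` b \<inter> space M)) = (\<integral>\<omega>. indicator a \<omega> * indicator (Y -` b \<inter> space M) \<omega> \<partial>M)"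
      using aM bM by (simp add: indicator_inter_arith[symmetric])
    \<comment> \<open>The defining property of conditional expectation, \<open>a\<close> being an
      event of \<open>G\<close>.\<close>
    also have "\<dots> = (\<integral>\<omega>. indicator a \<omega> * real_cond_exp M G (indicator (Y -` b \<inter> space M)) \<omega> \<partial>M)"
      using C.real_cond_exp_intA[OF ii a] by (simp add: set_lebesgue_integral_def)
    also have "\<dots> = (\<integral>\<omega>. indicator a \<omega> * measure (K \<omega>) b \<partial>M)"
      using law[OF b] aM mK[OF b] by (intro integral_cong_AE) (auto elim: eventually_mono)
    also have "ennreal \<dots> = (\<integral>\<^sup>+\<omega>. ennreal (indicator a \<omega> * measure (K \<omega>) b) \<partial>M)"
      by (rule nn_integral_eq_integral[OF mi, symmetric]) simp
    also have "\<dots> = (\<integral>\<^sup>+\<omega>. indicator a \<omega> * emeasure (K \<omega>) b \<partial>M)"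
      by (intro nn_integral_cong) (auto simp: fin indicator_def)
    also have "\<dots> = (\<integral>\<^sup>+\<omega>. indicator a \<omega> * emeasure (K \<omega>) b \<partial>?M')"
      by (rule nn_integral_subalgebra2[OF G, symmetric]) (intro borel_measurable_times_ennreal emK[OF b] borel_measurable_indicator a)
    also have "\<dots> = (\<integral>\<^sup>+\<omega>. (\<integral>\<^sup>+y. indicator R (\<omega>, y) \<partial>K \<omega>) \<partial>?M')"
    proof (rule nn_integral_cong)
      fix \<omega> assume "\<omega> \<in> space ?M'"
      then have "b \<in> sets (K \<omega>)" using measurable_space[OF K, of \<omega>] b by (simp add: spG space_restr_to_subalg space_prob_algebra)
      then have "(\<integral>\<^sup>+y. indicator a \<omega> * indicator b y \<partial>K \<omega>) = indicator a \<omega> * emeasure (K \<omega>) b"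
        by (subst nn_integral_cmult) auto
      then show "indicator a \<omega> * emeasure (K \<omega>) b = (\<integral>\<^sup>+y. indicator R (\<omega>, y) \<partial>K \<omega>)"
        by (simp add: R indicator_times)
    qed
    also have "\<dots> = (\<integral>\<^sup>+z. indicator R z \<partial>kernel_prod ?M' N K)"
      by (rule nn_integral_kernel_prod[OF K', symmetric], rule borel_measurable_indicator) (use RG sFN in simp)
    also have "\<dots> = emeasure (kernel_prod ?M' N K) R" using RG sK by simp
    finally show "emeasure (distr M (G \<Otimes>\<^sub>M N) (\<lambda>\<omega>. (\<omega>, Y \<omega>))) R = emeasure (kernel_prod ?M' N K) R" .
  qed
  have HG: "H \<in> borel_measurable (?M' \<Otimes>\<^sub>M N)" using H measurable_cong_sets[OF sFN refl] by blast
  have mI: "(\<lambda>\<omega>. \<integral>\<^sup>+y. H (\<omega>, y) \<partial>K \<omega>) \<in> borel_measurable G"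
    by (rule nn_integral_measurable_subprob_algebra2[OF _ KG]) (use H in simp)
  have "(\<integral>\<^sup>+\<omega>. H (\<omega>, Y \<omega>) \<partial>M) = (\<integral>\<^sup>+z. H z \<partial>distr M (G \<Otimes>\<^sub>M N) (\<lambda>\<omega>. (\<omega>, Y \<omega>)))"
    by (subst nn_integral_distr[OF pair]) (use H in simp_all)
  also have "\<dots> = (\<integral>\<^sup>+\<omega>. (\<integral>\<^sup>+y. H (\<omega>, y) \<partial>K \<omega>) \<partial>?M')"
    unfolding eq by (rule nn_integral_kernel_prod[OF K' HG])
  also have "\<dots> = (\<integral>\<^sup>+\<omega>. (\<integral>\<^sup>+y. H (\<omega>, y) \<partial>K \<omega>) \<partial>M)" by (rule nn_integral_subalgebra2[OF G mI])
  finally show ?thesis .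
qed

lemma space_history: "space (history M E X A m n) = space M"
  by (simp add: history_def space_measure_of_conv)

lemma sets_history: "sets (history M E X A m n) = sigma_sets (space M)
     ({X k -` B \<inter> space M | k B. k \<le> m \<and> B \<in> sets E} \<union>
      {A k -` B \<inter> space M | k B. 1 \<le> k \<and> k \<le> n \<and> B \<in> sets (finite_subsets E)})"
  unfolding history_def by (rule sets_measure_of) auto

lemma sets_history_mono:
  assumes "m \<le> m'" "n \<le> n'" shows "sets (history M E X A m n) \<subseteq> sets (history M E X A m' n')"
  unfolding sets_history by (rule sigma_sets_mono', rule Un_mono) (use assms in \<open>blast intro: order_trans\<close>)+

lemma measurable_history_state:
  assumes "X k \<in> M \<rightarrow>\<^sub>M E" "k \<le> m" shows "X k \<in> history M E X A m n \<rightarrow>\<^sub>M E"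
proof (rule measurableI)
  show "X k \<omega> \<in> space E" if "\<omega> \<in> space (history M E X A m n)" for \<omega>
    using that measurable_space[OF assms(1)] by (simp add: space_history)
  show "X k -` B \<inter> space (history M E X A m n) \<in> sets (history M E X A m n)" if "B \<in> sets E" for B
    unfolding space_history sets_history by (rule sigma_sets.Basic) (use that assms in auto)
qed

lemma measurable_history_proposal:
  assumes "A k \<in> M \<rightarrow>\<^sub>M finite_subsets E" "1 \<le> k" "k \<le> n" shows "A k \<in> history M E X A m n \<rightarrow>\<^sub>M finite_subsets E"
proof (rule measurableI)
  show "A k \<omega> \<in> space (finite_subsets E)" if "\<omega> \<in> space (history M E X A m n)" for \<omega>
    using that measurable_space[OF assms(1)] by (simp add: space_history)
  show "A k -` B \<inter> space (history M E X A m n) \<in> sets (history M E X A m n)" if "B \<in> sets (finite_subsets E)" for B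
    unfolding space_history sets_history by (rule sigma_sets.Basic) (use that assms in auto)
qed

lemma subalgebra_history:
  assumes "\<And>k. X k \<in> M \<rightarrow>\<^sub>M E" "\<And>k. 1 \<le> k \<Longrightarrow> A k \<in> M \<rightarrow>\<^sub>M finite_subsets E"
  shows "subalgebra M (history M E X A m n)"
  unfolding subalgebra_def
proof (intro conjI)
  show "sets (history M E X A m n) \<subseteq> sets M"
    unfolding sets_history by (rule sets.sigma_sets_subset) (use assms in \<open>auto intro: measurable_sets\<close>)
qed (simp add: space_history)

locale proposal_selection = prob_space E for E :: "'a measure" +
  fixes Q :: "'a \<Rightarrow> 'a set measure" and \<kappa> :: "'a \<Rightarrow> 'a set \<Rightarrow> 'a measure"
  assumes singletons: "\<And>x. x \<in> space E \<Longrightarrow> {x} \<in> sets E"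
    and proposition_law: "proposition_kernel E Q" and selection_law: "selection_kernel E \<kappa>"
    and balance: "detailed_balance E Q \<kappa>"
begin

abbreviation FS where "FS \<equiv> finite_subsets E"

definition mark_law :: "'a \<Rightarrow> ('a set \<times> 'a) measure" where
  "mark_law x = kernel_prod (Q x) E (\<kappa> x)"

lemma Q_kernel: "Q \<in> E \<rightarrow>\<^sub>M prob_algebra FS"
  using proposition_law by (simp add: proposition_kernel_def)

lemma \<kappa>_kernel: "(\<lambda>(x, A). \<kappa> x A) \<in> E \<Otimes>\<^sub>M FS \<rightarrow>\<^sub>M prob_algebra E"
  using selection_law by (simp add: selection_kernel_def)

lemma prob_space_Q: "x \<in> space E \<Longrightarrow> prob_space (Q x)"
  and sets_Q: "x \<in> space E \<Longrightarrow> sets (Q x) = sets FS"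
  using measurable_space[OF Q_kernel] by (auto simp: space_prob_algebra)

lemma \<kappa>_section: "x \<in> space E \<Longrightarrow> \<kappa> x \<in> FS \<rightarrow>\<^sub>M prob_algebra E"
  using measurable_compose[OF measurable_Pair1' \<kappa>_kernel, of x] by simp

lemma \<kappa>_section_Q: "x \<in> space E \<Longrightarrow> \<kappa> x \<in> Q x \<rightarrow>\<^sub>M subprob_algebra E"
  by (subst measurable_cong_sets[OF sets_Q refl]) (auto intro: measurable_prob_algebraD[OF \<kappa>_section])

lemma prob_space_\<kappa>: "x \<in> space E \<Longrightarrow> A \<in> space FS \<Longrightarrow> prob_space (\<kappa> x A)"
  and sets_\<kappa>: "x \<in> space E \<Longrightarrow> A \<in> space FS \<Longrightarrow> sets (\<kappa> x A) = sets E"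
  using measurable_space[OF \<kappa>_section] by (auto simp: space_prob_algebra)

lemma sets_mark_law: "x \<in> space E \<Longrightarrow> sets (mark_law x) = sets (FS \<Otimes>\<^sub>M E)"
  unfolding mark_law_def
  using sets_kernel_prod[OF \<kappa>_section_Q prob_space.not_empty[OF prob_space_Q]] sets_pair_measure_cong[OF sets_Q refl]
  by metis

lemma mark_law_kernel: "mark_law \<in> E \<rightarrow>\<^sub>M prob_algebra (FS \<Otimes>\<^sub>M E)"
proof -
  have eq: "mark_law x = Q x \<bind> (\<lambda>A. distr (\<kappa> x A) (FS \<Otimes>\<^sub>M E) (Pair A))" if x: "x \<in> space E" for x
    unfolding mark_law_def kernel_prod_def
    by (intro bind_cong refl distr_cong sets_pair_measure_cong sets_Q[OF x])
  have "(\<lambda>z. distr (\<kappa> (fst z) (snd z)) (FS \<Otimes>\<^sub>M E) (Pair (snd z))) \<in> E \<Otimes>\<^sub>M FS \<rightarrow>\<^sub>M prob_algebra (FS \<Otimes>\<^sub>M E)"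
  proof (rule measurable_distr_prob_space2[where M=E])
    show "(\<lambda>z. \<kappa> (fst z) (snd z)) \<in> E \<Otimes>\<^sub>M FS \<rightarrow>\<^sub>M prob_algebra E"
      using \<kappa>_kernel by (simp add: case_prod_beta')
    show "(\<lambda>(z, y). (snd z, y)) \<in> (E \<Otimes>\<^sub>M FS) \<Otimes>\<^sub>M E \<rightarrow>\<^sub>M FS \<Otimes>\<^sub>M E"
      unfolding case_prod_beta' by measurable
  qed
  then have "(\<lambda>x. Q x \<bind> (\<lambda>A. distr (\<kappa> x A) (FS \<Otimes>\<^sub>M E) (Pair A))) \<in> E \<rightarrow>\<^sub>M prob_algebra (FS \<Otimes>\<^sub>M E)"
    by (intro measurable_bind_prob_space2[OF Q_kernel]) (simp add: case_prod_beta')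
  then show ?thesis by (subst measurable_cong[OF eq])
qed

lemma nn_integral_mark_law:
  assumes x: "x \<in> space E" and h: "h \<in> borel_measurable (FS \<Otimes>\<^sub>M E)"
  shows "(\<integral>\<^sup>+w. h w \<partial>mark_law x) = (\<integral>\<^sup>+A. (\<integral>\<^sup>+y. h (A, y) \<partial>\<kappa> x A) \<partial>Q x)"
  unfolding mark_law_def
  by (rule nn_integral_kernel_prod[OF \<kappa>_section_Q[OF x]])
    (subst measurable_cong_sets[OF sets_pair_measure_cong[OF sets_Q[OF x] refl] refl], rule h)

lemma transition_eq_distr:
  assumes x: "x \<in> space E"
  shows "transition Q \<kappa> x = distr (mark_law x) E snd"
proof (rule measure_eqI)
  have ms: "snd \<in> mark_law x \<rightarrow>\<^sub>M E"
    by (subst measurable_cong_sets[OF sets_mark_law[OF x] refl]) (rule measurable_snd)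
  have st: "sets (transition Q \<kappa> x) = sets E"
    using measurable_space[OF transition_kernel[OF proposition_law selection_law] x] by (simp add: space_prob_algebra)
  then show "sets (transition Q \<kappa> x) = sets (distr (mark_law x) E snd)" by simp
  fix B assume "B \<in> sets (transition Q \<kappa> x)"
  then have B: "B \<in> sets E" using st by simp
  have "emeasure (transition Q \<kappa> x) B = (\<integral>\<^sup>+A. emeasure (\<kappa> x A) B \<partial>Q x)"
    unfolding transition_def
    by (rule emeasure_bind[OF prob_space.not_empty[OF prob_space_Q[OF x]] \<kappa>_section_Q[OF x] B])
  also have "\<dots> = (\<integral>\<^sup>+A. (\<integral>\<^sup>+y. indicator B (snd (A, y)) \<partial>\<kappa> x A) \<partial>Q x)"
  proof (rule nn_integral_cong)
    fix A assume "A \<in> space (Q x)"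
    then have "A \<in> space FS" using sets_eq_imp_space_eq[OF sets_Q[OF x]] by simp
    then show "emeasure (\<kappa> x A) B = (\<integral>\<^sup>+y. indicator B (snd (A, y)) \<partial>\<kappa> x A)" using sets_\<kappa>[OF x] B by simp
  qed
  also have "\<dots> = (\<integral>\<^sup>+w. indicator B (snd w) \<partial>mark_law x)"
    by (rule nn_integral_mark_law[OF x, symmetric]) (use B in measurable)
  also have "\<dots> = (\<integral>\<^sup>+y. indicator B y \<partial>distr (mark_law x) E snd)"
    by (subst nn_integral_distr[OF ms]) (use B in simp_all)
  also have "\<dots> = emeasure (distr (mark_law x) E snd) B" using B by simp
  finally show "emeasure (transition Q \<kappa> x) B = emeasure (distr (mark_law x) E snd) B" .
qed

text \<open>The map \<open>\<phi>\<close> lets one computation serve both sides of detailed balance: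
  the identity for one, the exchange of the two states for the other.\<close>

lemma nn_integral_iterated_bind:
  assumes \<phi>: "(\<lambda>(x, A, y). \<phi> x A y) \<in> triple_space E \<rightarrow>\<^sub>M triple_space E" and h: "h \<in> borel_measurable (triple_space E)"
  shows "(\<integral>\<^sup>+z. h z \<partial>(E \<bind> (\<lambda>x. Q x \<bind> (\<lambda>A. \<kappa> x A \<bind> (\<lambda>y. return (triple_space E) (\<phi> x A y))))))
    = (\<integral>\<^sup>+x. (\<integral>\<^sup>+A. (\<integral>\<^sup>+y. h (\<phi> x A y) \<partial>\<kappa> x A) \<partial>Q x) \<partial>E)"
proof -
  let ?T = "triple_space E"
  have \<phi>2: "(\<lambda>z. \<phi> (fst (fst z)) (snd (fst z)) (snd z)) \<in> (E \<Otimes>\<^sub>M FS) \<Otimes>\<^sub>M E \<rightarrow>\<^sub>M ?T"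
  proof -
    have "(\<lambda>z. (fst (fst z), snd (fst z), snd z)) \<in> (E \<Otimes>\<^sub>M FS) \<Otimes>\<^sub>M E \<rightarrow>\<^sub>M ?T" by measurable
    from measurable_compose[OF this \<phi>] show ?thesis by simp
  qed
  have k3: "(\<lambda>z. \<kappa> (fst z) (snd z) \<bind> (\<lambda>y. return ?T (\<phi> (fst z) (snd z) y))) \<in> E \<Otimes>\<^sub>M FS \<rightarrow>\<^sub>M prob_algebra ?T"
    by (rule measurable_bind_prob_space2[where N=E])
      (use \<kappa>_kernel measurable_compose[OF \<phi>2 measurable_return_prob_space] in \<open>simp_all add: case_prod_beta'\<close>)
  have k2: "(\<lambda>x. Q x \<bind> (\<lambda>A. \<kappa> x A \<bind> (\<lambda>y. return ?T (\<phi> x A y)))) \<in> E \<rightarrow>\<^sub>M prob_algebra ?T"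
    by (rule measurable_bind_prob_space2[OF Q_kernel]) (use k3 in \<open>simp add: case_prod_beta'\<close>)
  have "(\<integral>\<^sup>+z. h z \<partial>(E \<bind> (\<lambda>x. Q x \<bind> (\<lambda>A. \<kappa> x A \<bind> (\<lambda>y. return ?T (\<phi> x A y))))))
    = (\<integral>\<^sup>+x. (\<integral>\<^sup>+z. h z \<partial>(Q x \<bind> (\<lambda>A. \<kappa> x A \<bind> (\<lambda>y. return ?T (\<phi> x A y))))) \<partial>E)"
    by (rule nn_integral_bind[OF h measurable_prob_algebraD[OF k2]])
  also have "\<dots> = (\<integral>\<^sup>+x. (\<integral>\<^sup>+A. (\<integral>\<^sup>+y. h (\<phi> x A y) \<partial>\<kappa> x A) \<partial>Q x) \<partial>E)"
  proof (rule nn_integral_cong)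
    fix x assume x: "x \<in> space E"
    have k3x: "(\<lambda>A. \<kappa> x A \<bind> (\<lambda>y. return ?T (\<phi> x A y))) \<in> Q x \<rightarrow>\<^sub>M subprob_algebra ?T"
      by (subst measurable_cong_sets[OF sets_Q[OF x] refl])
        (use measurable_prob_algebraD[OF measurable_compose[OF measurable_Pair1'[OF x] k3]] in simp)
    have "(\<integral>\<^sup>+z. h z \<partial>(Q x \<bind> (\<lambda>A. \<kappa> x A \<bind> (\<lambda>y. return ?T (\<phi> x A y)))))
      = (\<integral>\<^sup>+A. (\<integral>\<^sup>+z. h z \<partial>(\<kappa> x A \<bind> (\<lambda>y. return ?T (\<phi> x A y)))) \<partial>Q x)"
      by (rule nn_integral_bind[OF h k3x])
    also have "\<dots> = (\<integral>\<^sup>+A. (\<integral>\<^sup>+y. h (\<phi> x A y) \<partial>\<kappa> x A) \<partial>Q x)"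
    proof (rule nn_integral_cong)
      fix A assume "A \<in> space (Q x)"
      then have A: "A \<in> space FS" using sets_eq_imp_space_eq[OF sets_Q[OF x]] by simp
      have xA: "(x, A) \<in> space (E \<Otimes>\<^sub>M FS)" using x A by (simp add: space_pair_measure)
      have m: "(\<lambda>y. \<phi> x A y) \<in> E \<rightarrow>\<^sub>M ?T" using measurable_compose[OF measurable_Pair1'[OF xA] \<phi>2] by simp
      have k: "(\<lambda>y. return ?T (\<phi> x A y)) \<in> \<kappa> x A \<rightarrow>\<^sub>M subprob_algebra ?T"
        by (subst measurable_cong_sets[OF sets_\<kappa>[OF x A] refl]) (rule measurable_compose[OF m return_measurable])
      have "(\<integral>\<^sup>+z. h z \<partial>(\<kappa> x A \<bind> (\<lambda>y. return ?T (\<phi> x A y)))) = (\<integral>\<^sup>+y. (\<integral>\<^sup>+z. h z \<partial>return ?T (\<phi> x A y)) \<partial>\<kappa> x A)"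
        by (rule nn_integral_bind[OF h k])
      also have "\<dots> = (\<integral>\<^sup>+y. h (\<phi> x A y) \<partial>\<kappa> x A)"
      proof (rule nn_integral_cong)
        fix y assume "y \<in> space (\<kappa> x A)"
        then have "y \<in> space E" using sets_eq_imp_space_eq[OF sets_\<kappa>[OF x A]] by simp
        then show "(\<integral>\<^sup>+z. h z \<partial>return ?T (\<phi> x A y)) = h (\<phi> x A y)"
          by (intro nn_integral_return measurable_space[OF m] h)
      qed
      finally show "(\<integral>\<^sup>+z. h z \<partial>(\<kappa> x A \<bind> (\<lambda>y. return ?T (\<phi> x A y)))) = (\<integral>\<^sup>+y. h (\<phi> x A y) \<partial>\<kappa> x A)" .
    qed
    finally show "(\<integral>\<^sup>+z. h z \<partial>(Q x \<bind> (\<lambda>A. \<kappa> x A \<bind> (\<lambda>y. return ?T (\<phi> x A y))))) = (\<integral>\<^sup>+A. (\<integral>\<^sup>+y. h (\<phi> x A y) \<partial>\<kappa> x A) \<partial>Q x)" .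
  qed
  finally show ?thesis .
qed

lemma nn_integral_balance:
  assumes h: "h \<in> borel_measurable (triple_space E)"
  shows "(\<integral>\<^sup>+x. (\<integral>\<^sup>+A. (\<integral>\<^sup>+y. h (x, A, y) \<partial>\<kappa> x A) \<partial>Q x) \<partial>E) = (\<integral>\<^sup>+x. (\<integral>\<^sup>+A. (\<integral>\<^sup>+y. h (y, A, x) \<partial>\<kappa> x A) \<partial>Q x) \<partial>E)"
proof -
  have m1: "(\<lambda>(x, A, y). (x, A, y)) \<in> triple_space E \<rightarrow>\<^sub>M triple_space E" by measurable
  have m2: "(\<lambda>(x, A, y). (y, A, x)) \<in> triple_space E \<rightarrow>\<^sub>M triple_space E" by measurable
  show ?thesis
    unfolding nn_integral_iterated_bind[OF m1 h, symmetric] nn_integral_iterated_bind[OF m2 h, symmetric]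
    using balance by (simp add: detailed_balance_def)
qed

lemma nn_integral_transition:
  assumes x: "x \<in> space E" and h: "h \<in> borel_measurable E"
  shows "(\<integral>\<^sup>+y. h y \<partial>transition Q \<kappa> x) = (\<integral>\<^sup>+A. (\<integral>\<^sup>+y. h y \<partial>\<kappa> x A) \<partial>Q x)"
  unfolding transition_def by (rule nn_integral_bind[OF h \<kappa>_section_Q[OF x]])

text \<open>Detailed balance tested on functions of the two states alone, with the proposal set
  integrated out.\<close>

lemma reversible_kernel_transition: "reversible_kernel E (transition Q \<kappa>)"
proof unfold_locales
  show "transition Q \<kappa> \<in> E \<rightarrow>\<^sub>M prob_algebra E" by (rule transition_kernel[OF proposition_law selection_law])
  fix h :: "'a \<times> 'a \<Rightarrow> ennreal" assume h: "h \<in> borel_measurable (E \<Otimes>\<^sub>M E)"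
  have hx: "(\<lambda>y. h (x, y)) \<in> borel_measurable E" "(\<lambda>y. h (y, x)) \<in> borel_measurable E" if "x \<in> space E" for x
    using measurable_compose[OF measurable_Pair1'[OF that] h] measurable_compose[OF measurable_Pair2'[OF that] h] by auto
  have h3: "(\<lambda>z. h (fst z, snd (snd z))) \<in> borel_measurable (triple_space E)"
    by (rule measurable_compose[OF _ h]) measurable
  have "(\<integral>\<^sup>+x. (\<integral>\<^sup>+y. h (x, y) \<partial>transition Q \<kappa> x) \<partial>E) = (\<integral>\<^sup>+x. (\<integral>\<^sup>+A. (\<integral>\<^sup>+y. h (x, y) \<partial>\<kappa> x A) \<partial>Q x) \<partial>E)"
    by (intro nn_integral_cong nn_integral_transition hx)
  also have "\<dots> = (\<integral>\<^sup>+x. (\<integral>\<^sup>+A. (\<integral>\<^sup>+y. h (y, x) \<partial>\<kappa> x A) \<partial>Q x) \<partial>E)"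
    using nn_integral_balance[OF h3] by simp
  also have "\<dots> = (\<integral>\<^sup>+x. (\<integral>\<^sup>+y. h (y, x) \<partial>transition Q \<kappa> x) \<partial>E)"
    by (intro nn_integral_cong nn_integral_transition[symmetric] hx)
  finally show "(\<integral>\<^sup>+x. (\<integral>\<^sup>+y. h (x, y) \<partial>transition Q \<kappa> x) \<partial>E) = (\<integral>\<^sup>+x. (\<integral>\<^sup>+y. h (y, x) \<partial>transition Q \<kappa> x) \<partial>E)" .
qed

lemma mark_kernel_mark_law: "mark_kernel E FS mark_law"
proof unfold_locales
  show "mark_law \<in> E \<rightarrow>\<^sub>M prob_algebra (FS \<Otimes>\<^sub>M E)" by (rule mark_law_kernel)
  interpret reversible_kernel E "transition Q \<kappa>" by (rule reversible_kernel_transition)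
  fix h :: "'a \<Rightarrow> ennreal" assume h: "h \<in> borel_measurable E"
  have "(\<integral>\<^sup>+x. (\<integral>\<^sup>+w. h (snd w) \<partial>mark_law x) \<partial>E) = (\<integral>\<^sup>+x. (\<integral>\<^sup>+y. h y \<partial>transition Q \<kappa> x) \<partial>E)"
  proof (rule nn_integral_cong)
    fix x assume x: "x \<in> space E"
    show "(\<integral>\<^sup>+w. h (snd w) \<partial>mark_law x) = (\<integral>\<^sup>+y. h y \<partial>transition Q \<kappa> x)"
      unfolding nn_integral_transition[OF x h]
      using nn_integral_mark_law[OF x measurable_compose[OF measurable_snd h]] by simp
  qed
  also have "\<dots> = (\<integral>\<^sup>+x. h x \<partial>E)" by (rule invariant[OF h])
  finally show "(\<integral>\<^sup>+x. (\<integral>\<^sup>+w. h (snd w) \<partial>mark_law x) \<partial>E) = (\<integral>\<^sup>+x. h x \<partial>E)" .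
qed

text \<open>Two conditionings in succession: first on the history including the new proposal set, to
  integrate the selected state, then on the history without it, to integrate the proposal set.
  Together they amount to one draw from \<open>mark_law\<close>.\<close>

lemma harris_chain_proposal_chain:
  assumes chain: "proposal_chain M E Q \<kappa> X A" and harris: "harris_recurrent E (transition Q \<kappa>)"
  shows "harris_chain E FS mark_law M (\<lambda>n. history M E X A n n) X (\<lambda>n \<omega>. (A (Suc n) \<omega>, X (Suc n) \<omega>)) (transition Q \<kappa>)"
proof -
  have pM: "prob_space M" and X: "\<And>n. X n \<in> M \<rightarrow>\<^sub>M E" and A: "\<And>n. A (Suc n) \<in> M \<rightarrow>\<^sub>M FS"
    and lawA: "\<And>n B. B \<in> sets FS \<Longrightarrow> AE \<omega> in M.
        real_cond_exp M (history M E X A n n) (indicator (A (Suc n) -` B \<inter> space M)) \<omega> = measure (Q (X n \<omega>)) B"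
    and lawX: "\<And>n C. C \<in> sets E \<Longrightarrow> AE \<omega> in M.
        real_cond_exp M (history M E X A n (Suc n)) (indicator (X (Suc n) -` C \<inter> space M)) \<omega> = measure (\<kappa> (X n \<omega>) (A (Suc n) \<omega>)) C"
    using chain unfolding proposal_chain_def by blast+
  have A1: "A k \<in> M \<rightarrow>\<^sub>M FS" if "1 \<le> k" for k using A[of "k - 1"] that by simp
  note sub = subalgebra_history[OF X A1]
  have mk: "(\<integral>\<^sup>+\<omega>. H (\<omega>, (A (Suc n) \<omega>, X (Suc n) \<omega>)) \<partial>M) = (\<integral>\<^sup>+\<omega>. (\<integral>\<^sup>+w. H (\<omega>, w) \<partial>mark_law (X n \<omega>)) \<partial>M)"
    if H: "H \<in> borel_measurable (history M E X A n n \<Otimes>\<^sub>M (FS \<Otimes>\<^sub>M E))" for H n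
  proof -
    let ?F = "history M E X A n n" and ?G = "history M E X A n (Suc n)"
    have idF: "(\<lambda>\<omega>. \<omega>) \<in> ?G \<rightarrow>\<^sub>M ?F"
      using sets_history_mono[of n n n "Suc n" M E X A] by (auto simp: measurable_def space_history)
    have XF: "X n \<in> ?F \<rightarrow>\<^sub>M E" by (rule measurable_history_state[of X n, OF X]) simp
    have XG: "X n \<in> ?G \<rightarrow>\<^sub>M E" by (rule measurable_history_state[of X n, OF X]) simp
    have AG: "A (Suc n) \<in> ?G \<rightarrow>\<^sub>M FS" by (rule measurable_history_proposal[of A "Suc n", OF A]) auto
    have KG: "(\<lambda>\<omega>. \<kappa> (X n \<omega>) (A (Suc n) \<omega>)) \<in> ?G \<rightarrow>\<^sub>M prob_algebra E"
      using measurable_compose[OF measurable_Pair[OF XG AG] \<kappa>_kernel] by simp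
    have KF: "(\<lambda>\<omega>. Q (X n \<omega>)) \<in> ?F \<rightarrow>\<^sub>M prob_algebra FS" by (rule measurable_compose[OF XF Q_kernel])
    \<comment> \<open>For the first conditioning the new proposal set counts as part of the
      past.\<close>
    have H1: "(\<lambda>z. H (fst z, (A (Suc n) (fst z), snd z))) \<in> borel_measurable (?G \<Otimes>\<^sub>M E)"
      by (rule measurable_compose[OF _ H])
        (intro measurable_Pair measurable_compose[OF measurable_fst idF] measurable_compose[OF measurable_fst AG] measurable_snd)
    have KP: "(\<lambda>z. \<kappa> (X n (fst z)) (snd z)) \<in> ?F \<Otimes>\<^sub>M FS \<rightarrow>\<^sub>M subprob_algebra E"
      using measurable_prob_algebraD[OF measurable_compose[OF measurable_Pair[OF measurable_compose[OF measurable_fst XF] measurable_snd] \<kappa>_kernel]] by simp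
    have H2: "(\<lambda>z. \<integral>\<^sup>+y. H (fst z, (snd z, y)) \<partial>\<kappa> (X n (fst z)) (snd z)) \<in> borel_measurable (?F \<Otimes>\<^sub>M FS)"
    proof (rule nn_integral_measurable_subprob_algebra2[OF _ KP])
      have "(\<lambda>u. H (fst (fst u), (snd (fst u), snd u))) \<in> borel_measurable ((?F \<Otimes>\<^sub>M FS) \<Otimes>\<^sub>M E)"
        by (rule measurable_compose[OF _ H]) measurable
      then show "(\<lambda>(x, y). H (fst x, snd x, y)) \<in> borel_measurable ((?F \<Otimes>\<^sub>M FS) \<Otimes>\<^sub>M E)" by (simp add: case_prod_beta')
    qed
    have "(\<integral>\<^sup>+\<omega>. H (\<omega>, (A (Suc n) \<omega>, X (Suc n) \<omega>)) \<partial>M) = (\<integral>\<^sup>+\<omega>. (\<integral>\<^sup>+y. H (\<omega>, (A (Suc n) \<omega>, y)) \<partial>\<kappa> (X n \<omega>) (A (Suc n) \<omega>)) \<partial>M)"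
      using cond_law_nn_integral[OF pM sub X KG lawX H1] by simp
    also have "\<dots> = (\<integral>\<^sup>+\<omega>. (\<integral>\<^sup>+B. (\<integral>\<^sup>+y. H (\<omega>, (B, y)) \<partial>\<kappa> (X n \<omega>) B) \<partial>Q (X n \<omega>)) \<partial>M)"
      using cond_law_nn_integral[OF pM sub A KF lawA H2] by simp
    also have "\<dots> = (\<integral>\<^sup>+\<omega>. (\<integral>\<^sup>+w. H (\<omega>, w) \<partial>mark_law (X n \<omega>)) \<partial>M)"
    proof (rule nn_integral_cong)
      fix \<omega> assume w: "\<omega> \<in> space M"
      have "(\<lambda>w. H (\<omega>, w)) \<in> borel_measurable (FS \<Otimes>\<^sub>M E)"
        by (rule measurable_compose[OF measurable_Pair1' H]) (simp add: space_history w)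
      from nn_integral_mark_law[OF measurable_space[OF X w] this]
      show "(\<integral>\<^sup>+B. (\<integral>\<^sup>+y. H (\<omega>, (B, y)) \<partial>\<kappa> (X n \<omega>) B) \<partial>Q (X n \<omega>)) = (\<integral>\<^sup>+w. H (\<omega>, w) \<partial>mark_law (X n \<omega>))" by simp
    qed
    finally show ?thesis .
  qed
  interpret M: prob_space M by (rule pM)
  have erg: "ergodic_kernel E (transition Q \<kappa>)"
  proof (intro ergodic_kernel.intro reversible_kernel_transition ergodic_kernel_axioms.intro)
    fix B x assume "B \<in> sets E" "0 < emeasure E (space E - B)" "x \<in> space E"
    then show "(\<lambda>n. (stay_op (transition Q \<kappa>) B ^^ n) (indicator B) x) \<longlonglongrightarrow> 0"
      by (rule harris_stay[OF transition_kernel[OF proposition_law selection_law] harris])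
  qed
  show ?thesis
  proof (intro harris_chain.intro marked_chain.intro mark_kernel_mark_law erg pM M.finite_measure_axioms
      marked_chain_axioms.intro harris_chain_axioms.intro)
    show "subalgebra M (history M E X A n n)" for n by (rule sub)
    show "sets (history M E X A m m) \<subseteq> sets (history M E X A n n)" if "m \<le> n" for m n
      by (rule sets_history_mono[OF that that])
    show "X n \<in> history M E X A n n \<rightarrow>\<^sub>M E" for n by (rule measurable_history_state[of X n, OF X order_refl])
    show "(\<lambda>\<omega>. (A (Suc n) \<omega>, X (Suc n) \<omega>)) \<in> history M E X A (Suc n) (Suc n) \<rightarrow>\<^sub>M FS \<Otimes>\<^sub>M E" for n
      by (intro measurable_Pair measurable_history_state[of X "Suc n", OF X] measurable_history_proposal[of A "Suc n", OF A]) auto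
    show "X (Suc n) \<omega> = snd (A (Suc n) \<omega>, X (Suc n) \<omega>)" for n \<omega> by simp
    show "(\<integral>\<^sup>+\<omega>. H (\<omega>, (A (Suc n) \<omega>, X (Suc n) \<omega>)) \<partial>M) = (\<integral>\<^sup>+\<omega>. (\<integral>\<^sup>+w. H (\<omega>, w) \<partial>mark_law (X n \<omega>)) \<partial>M)"
      if "H \<in> borel_measurable (history M E X A n n \<Otimes>\<^sub>M (FS \<Otimes>\<^sub>M E))" for H n by (rule mk[OF that])
    show "transition Q \<kappa> x = distr (mark_law x) E snd" if "x \<in> space E" for x by (rule transition_eq_distr[OF that])
  qed
qed

end

section \<open>Characteristic functions, completion, and conditioning on state and proposal in
  L2\<close>

section \<open>Conditional variances\<close>

lemma char_centred_normal:
  assumes v: "0 \<le> v"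
  shows "char (centred_normal v) t = complex_of_real (exp (- t\<^sup>2 * (v / 2)))"
proof (cases "v = 0")
  case True
  then show ?thesis by (simp add: centred_normal_def char_def integral_return)
next
  case False
  define \<sigma> where "\<sigma> = sqrt v"
  have \<sigma>: "0 < \<sigma>" using False v by (simp add: \<sigma>_def)
  let ?N = "density lborel (\<lambda>x. ennreal (normal_density 0 \<sigma> x))"
  interpret N: prob_space ?N by (rule prob_space_normal_density[OF \<sigma>])
  have "distributed ?N lborel (\<lambda>x. x) (\<lambda>x. ennreal (normal_density 0 \<sigma> x))"
    by (simp add: distributed_def distr_id2)
  then have "distributed ?N lborel (\<lambda>x. (x - 0) / \<sigma>) (\<lambda>x. ennreal (std_normal_density x))"
    using N.normal_standard_normal_convert[OF \<sigma>, of "\<lambda>x. x" 0] by simp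
  then have d: "distr ?N lborel (\<lambda>x. x / \<sigma>) = std_normal_distribution" by (simp add: distributed_def)
  have "char (centred_normal v) t = (\<integral>x. iexp (t * x) \<partial>?N)"
    using False by (simp add: centred_normal_def char_def \<sigma>_def)
  also have "\<dots> = (\<integral>x. iexp ((t * \<sigma>) * (x / \<sigma>)) \<partial>?N)"
    using \<sigma> by (intro Bochner_Integration.integral_cong) auto
  also have "\<dots> = (\<integral>x. iexp ((t * \<sigma>) * x) \<partial>distr ?N lborel (\<lambda>x. x / \<sigma>))"
    by (subst integral_distr) auto
  also have "\<dots> = char std_normal_distribution (t * \<sigma>)" unfolding d char_def ..
  also have "\<dots> = complex_of_real (exp (- t\<^sup>2 * (v / 2)))"
    using v by (simp add: char_std_normal_distribution \<sigma>_def power_mult_distrib)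
  finally show ?thesis .
qed

lemma real_distribution_centred_normal:
  assumes "0 \<le> v" shows "real_distribution (centred_normal v)"
proof -
  have "prob_space (centred_normal v)"
    using assms prob_space_normal_density[of "sqrt v" 0] by (auto simp: centred_normal_def prob_space_return)
  then show ?thesis
    by (auto simp: real_distribution_def real_distribution_axioms_def centred_normal_def)
qed

text \<open>In the completion, preimages that differ by a null set are measurable together, so any
  function almost surely equal to a measurable one has a law there. The estimator needs this,
  because its sums over proposal sets may fail to be measurable.\<close>

lemma distr_completion_AE:
  assumes Y: "Y \<in> M \<rightarrow>\<^sub>M borel" and eq: "AE \<omega> in M. Z \<omega> = (Y \<omega> :: real)"
  shows "distr (completion M) borel Z = distr M borel Y"
proof -
  have Yc: "Y \<in> completion M \<rightarrow>\<^sub>M borel" by (rule measurable_completion[OF Y])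
  have ae: "AE \<omega> in completion M. Z \<omega> = Y \<omega>" by (rule AE_completion[OF eq])
  have Zc: "Z \<in> completion M \<rightarrow>\<^sub>M borel"
  proof (rule measurableI)
    fix B :: "real set" assume B: "B \<in> sets borel"
    show "Z -` B \<inter> space (completion M) \<in> sets (completion M)"
    proof (rule completion.in_sets_AE)
      show "AE \<omega> in completion M. \<omega> \<in> Y -` B \<inter> space (completion M) \<longleftrightarrow> \<omega> \<in> Z -` B \<inter> space (completion M)"
        using ae by eventually_elim auto
      show "Y -` B \<inter> space (completion M) \<in> sets (completion M)" by (rule measurable_sets[OF Yc B])
    qed auto
  qed simp
  have "distr (completion M) borel Z = distr (completion M) borel Y"
    by (rule distr_cong_AE) (use Zc Yc ae in auto)
  then show ?thesis by (simp add: distr_completion[OF Y])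
qed

text \<open>The predicate \<open>R\<close> may fail to be measurable, so the argument passes through
  a measurable null set that contains its failures.\<close>

lemma AE_kernel_prodD:
  assumes K: "K \<in> M \<rightarrow>\<^sub>M subprob_algebra N" and ne: "space M \<noteq> {}"
    and AE: "AE z in kernel_prod M N K. R z"
  shows "AE x in M. AE y in K x. R (x, y)"
proof -
  have s: "sets (kernel_prod M N K) = sets (M \<Otimes>\<^sub>M N)" by (rule sets_kernel_prod[OF K ne])
  from AE obtain U where U: "{z\<in>space (kernel_prod M N K). \<not> R z} \<subseteq> U" "emeasure (kernel_prod M N K) U = 0" "U \<in> sets (kernel_prod M N K)"
    by (rule AE_E)
  have Us: "U \<in> sets (M \<Otimes>\<^sub>M N)" using U(3) s by simp
  have "(\<integral>\<^sup>+x. (\<integral>\<^sup>+y. indicator U (x, y) \<partial>K x) \<partial>M) = (\<integral>\<^sup>+z. indicator U z \<partial>kernel_prod M N K)"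
    by (rule nn_integral_kernel_prod[OF K, symmetric]) (use Us in simp)
  also have "\<dots> = 0" using U by simp
  finally have "AE x in M. (\<integral>\<^sup>+y. indicator U (x, y) \<partial>K x) = 0"
    by (subst (asm) nn_integral_0_iff_AE) (use Us in \<open>auto intro!: nn_integral_measurable_subprob_algebra2[OF _ K]\<close>)
  with AE_space show ?thesis
  proof eventually_elim
    case (elim x)
    have m: "(\<lambda>y. indicator U (x, y) :: ennreal) \<in> borel_measurable (K x)"
      by (subst measurable_cong_sets[OF subprob_measurableD(2)[OF K elim(1)] refl])
        (rule measurable_compose[OF measurable_Pair1'[OF elim(1)]], use Us in simp)
    have "AE y in K x. indicator U (x, y) = (0::ennreal)"
      using elim(2) m by (simp add: nn_integral_0_iff_AE)
    with AE_space show ?case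
    proof eventually_elim
      case (elim y)
      have "(x, y) \<in> space (kernel_prod M N K)"
        using elim(1) \<open>x \<in> space M\<close> subprob_measurableD(1)[OF K \<open>x \<in> space M\<close>] sets_eq_imp_space_eq[OF s]
        by (simp add: space_pair_measure)
      then show ?case using elim(2) U(1) by (auto simp: indicator_def split: if_splits)
    qed
  qed
qed

lemma distr_kernel_prod_fst:
  assumes K: "K \<in> M \<rightarrow>\<^sub>M prob_algebra N" and ne: "space M \<noteq> {}"
  shows "distr (kernel_prod M N K) M fst = M"
proof (rule measure_eqI)
  note K' = measurable_prob_algebraD[OF K]
  have f: "fst \<in> kernel_prod M N K \<rightarrow>\<^sub>M M"
    by (subst measurable_cong_sets[OF sets_kernel_prod[OF K' ne] refl]) (rule measurable_fst)
  fix B assume "B \<in> sets (distr (kernel_prod M N K) M fst)"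
  then have B: "B \<in> sets M" by simp
  have "emeasure (distr (kernel_prod M N K) M fst) B = (\<integral>\<^sup>+x. indicator B x \<partial>distr (kernel_prod M N K) M fst)"
    using B by simp
  also have "\<dots> = (\<integral>\<^sup>+z. indicator B (fst z) \<partial>kernel_prod M N K)" by (rule nn_integral_distr[OF f]) (use B in simp)
  also have "\<dots> = (\<integral>\<^sup>+x. (\<integral>\<^sup>+y. indicator B x \<partial>K x) \<partial>M)"
    by (subst nn_integral_kernel_prod[OF K']) (use measurable_compose[OF measurable_fst borel_measurable_indicator[OF B]] in auto)
  also have "\<dots> = (\<integral>\<^sup>+x. indicator B x \<partial>M)"
  proof (rule nn_integral_cong)
    fix x assume "x \<in> space M"
    then interpret Kx: prob_space "K x" using measurable_space[OF K] by (simp add: space_prob_algebra)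
    show "(\<integral>\<^sup>+y. indicator B x \<partial>K x) = (indicator B x :: ennreal)" by (simp add: Kx.emeasure_space_1)
  qed
  finally show "emeasure (distr (kernel_prod M N K) M fst) B = emeasure M B" using B by simp
qed simp

lemma integral_kernel_prod_fst:
  fixes \<phi> :: "'a \<Rightarrow> real"
  assumes K: "K \<in> M \<rightarrow>\<^sub>M prob_algebra N" and ne: "space M \<noteq> {}" and \<phi>: "integrable M \<phi>"
  shows "integrable (kernel_prod M N K) (\<lambda>z. \<phi> (fst z))" "(\<integral>z. \<phi> (fst z) \<partial>kernel_prod M N K) = (\<integral>x. \<phi> x \<partial>M)"
proof -
  have f: "fst \<in> kernel_prod M N K \<rightarrow>\<^sub>M M"
    by (subst measurable_cong_sets[OF sets_kernel_prod[OF measurable_prob_algebraD[OF K] ne] refl]) (rule measurable_fst)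
  have m: "\<phi> \<in> borel_measurable M" using \<phi> by auto
  note d = distr_kernel_prod_fst[OF K ne]
  show "integrable (kernel_prod M N K) (\<lambda>z. \<phi> (fst z))" using integrable_distr_eq[OF f m] \<phi> by (simp add: d)
  show "(\<integral>z. \<phi> (fst z) \<partial>kernel_prod M N K) = (\<integral>x. \<phi> x \<partial>M)" using integral_distr[OF f m] by (simp add: d)
qed

lemma prob_space_kernel_prod:
  assumes K: "K \<in> M \<rightarrow>\<^sub>M prob_algebra N" and M: "prob_space M"
  shows "prob_space (kernel_prod M N K)"
proof
  interpret prob_space M by (rule M)
  have "emeasure (kernel_prod M N K) (space (kernel_prod M N K)) = (\<integral>\<^sup>+z. 1 \<partial>kernel_prod M N K)" by simp
  also have "\<dots> = (\<integral>\<^sup>+x. 1 \<partial>M)"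
  proof (subst nn_integral_kernel_prod[OF measurable_prob_algebraD[OF K]], simp, rule nn_integral_cong)
    fix x assume "x \<in> space M"
    then interpret Kx: prob_space "K x" using measurable_space[OF K] by (simp add: space_prob_algebra)
    show "(\<integral>\<^sup>+y. 1 \<partial>K x) = (1::ennreal)" by (simp add: Kx.emeasure_space_1)
  qed
  finally show "emeasure (kernel_prod M N K) (space (kernel_prod M N K)) = 1" by (simp add: emeasure_space_1)
qed

lemma integrable_square_add:
  fixes f g :: "'a \<Rightarrow> real"
  assumes "f \<in> borel_measurable M" "g \<in> borel_measurable M" "integrable M (\<lambda>x. (f x)\<^sup>2)" "integrable M (\<lambda>x. (g x)\<^sup>2)"
  shows "integrable M (\<lambda>x. (f x + g x)\<^sup>2)" "integrable M (\<lambda>x. f x * g x)"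
proof -
  have i: "integrable M (\<lambda>x. 2 * (f x)\<^sup>2 + 2 * (g x)\<^sup>2)" using assms by simp
  have b: "(a + b)\<^sup>2 \<le> 2 * a\<^sup>2 + 2 * b\<^sup>2" for a b :: real
    using sum_squares_bound[of a b] by (simp add: power2_sum)
  have c: "\<bar>a * b\<bar> \<le> 2 * a\<^sup>2 + 2 * b\<^sup>2" for a b :: real
  proof -
    have "2 * \<bar>a * b\<bar> \<le> a\<^sup>2 + b\<^sup>2"
      using sum_squares_bound[of "\<bar>a\<bar>" "\<bar>b\<bar>"] by (simp add: abs_mult mult.assoc)
    then show ?thesis using zero_le_power2[of a] zero_le_power2[of b] abs_ge_zero[of "a * b"] by linarith
  qed
  show "integrable M (\<lambda>x. (f x + g x)\<^sup>2)"
    by (rule Bochner_Integration.integrable_bound[OF i]) (use assms b in auto)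
  show "integrable M (\<lambda>x. f x * g x)"
    by (rule Bochner_Integration.integrable_bound[OF i]) (use assms c in auto)
qed

context proposal_selection
begin

text \<open>Nesting the triple as \<open>((x, A), y)\<close> presents its law as two successive
  kernel products, so that conditioning on state and proposal is a single kernel integral.\<close>

definition \<kappa>' :: "'a \<times> 'a set \<Rightarrow> 'a measure" where "\<kappa>' z = \<kappa> (fst z) (snd z)"

abbreviation \<mu>2 where "\<mu>2 \<equiv> kernel_prod E FS Q"
abbreviation \<mu>3 where "\<mu>3 \<equiv> kernel_prod \<mu>2 E \<kappa>'"

lemma Q_sub: "Q \<in> E \<rightarrow>\<^sub>M subprob_algebra FS" by (rule measurable_prob_algebraD[OF Q_kernel])

lemma prob_space_\<mu>2: "prob_space \<mu>2" by (rule prob_space_kernel_prod[OF Q_kernel prob_space_axioms])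

lemma ne2: "space \<mu>2 \<noteq> {}" by (rule prob_space.not_empty[OF prob_space_\<mu>2])

lemma sets_\<mu>2: "sets \<mu>2 = sets (E \<Otimes>\<^sub>M FS)" by (rule sets_kernel_prod[OF Q_sub not_empty])

lemma space_\<mu>2: "space \<mu>2 = space E \<times> space FS"
  using sets_eq_imp_space_eq[OF sets_\<mu>2] by (simp add: space_pair_measure)

lemma \<kappa>'_kernel: "\<kappa>' \<in> \<mu>2 \<rightarrow>\<^sub>M prob_algebra E"
  by (subst measurable_cong_sets[OF sets_\<mu>2 refl]) (use \<kappa>_kernel in \<open>simp add: \<kappa>'_def[abs_def] case_prod_beta'\<close>)

lemma \<kappa>'_sub: "\<kappa>' \<in> \<mu>2 \<rightarrow>\<^sub>M subprob_algebra E" by (rule measurable_prob_algebraD[OF \<kappa>'_kernel])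

lemma sets_\<mu>3: "sets \<mu>3 = sets ((E \<Otimes>\<^sub>M FS) \<Otimes>\<^sub>M E)"
  using sets_kernel_prod[OF \<kappa>'_sub ne2] sets_pair_measure_cong[OF sets_\<mu>2 refl] by metis

lemma prob_space_\<kappa>': "z \<in> space \<mu>2 \<Longrightarrow> prob_space (\<kappa>' z)"
  and sets_\<kappa>': "z \<in> space \<mu>2 \<Longrightarrow> sets (\<kappa>' z) = sets E"
  using measurable_space[OF \<kappa>'_kernel] by (auto simp: space_prob_algebra)

lemma nn_integral_\<mu>3:
  assumes h: "h \<in> borel_measurable ((E \<Otimes>\<^sub>M FS) \<Otimes>\<^sub>M E)"
  shows "(\<integral>\<^sup>+z. h z \<partial>\<mu>3) = (\<integral>\<^sup>+x. (\<integral>\<^sup>+A. (\<integral>\<^sup>+y. h ((x, A), y) \<partial>\<kappa> x A) \<partial>Q x) \<partial>E)"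
proof -
  have h2: "h \<in> borel_measurable (\<mu>2 \<Otimes>\<^sub>M E)"
    by (subst measurable_cong_sets[OF sets_pair_measure_cong[OF sets_\<mu>2 refl] refl]) (rule h)
  have m: "(\<lambda>z. \<integral>\<^sup>+y. h (z, y) \<partial>\<kappa>' z) \<in> borel_measurable (E \<Otimes>\<^sub>M FS)"
    using nn_integral_measurable_subprob_algebra2[OF _ \<kappa>'_sub, of "\<lambda>z y. h (z, y)"] h2
    by (simp add: measurable_cong_sets[OF sets_\<mu>2 refl])
  have "(\<integral>\<^sup>+z. h z \<partial>\<mu>3) = (\<integral>\<^sup>+z. (\<integral>\<^sup>+y. h (z, y) \<partial>\<kappa>' z) \<partial>\<mu>2)"
    by (rule nn_integral_kernel_prod[OF \<kappa>'_sub h2])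
  also have "\<dots> = (\<integral>\<^sup>+x. (\<integral>\<^sup>+A. (\<integral>\<^sup>+y. h ((x, A), y) \<partial>\<kappa>' (x, A)) \<partial>Q x) \<partial>E)"
    by (rule nn_integral_kernel_prod[OF Q_sub m])
  finally show ?thesis by (simp add: \<kappa>'_def)
qed

definition cmean :: "(('a \<times> 'a set) \<times> 'a \<Rightarrow> real) \<Rightarrow> 'a \<times> 'a set \<Rightarrow> real" where
  "cmean h z = (\<integral>y. h (z, y) \<partial>\<kappa>' z)"

definition cvar :: "(('a \<times> 'a set) \<times> 'a \<Rightarrow> real) \<Rightarrow> 'a \<times> 'a set \<Rightarrow> real" where
  "cvar h z = var (\<kappa>' z) (\<lambda>y. h (z, y))"

definition square_int :: "(('a \<times> 'a set) \<times> 'a \<Rightarrow> real) \<Rightarrow> bool" where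
  "square_int h \<longleftrightarrow> h \<in> borel_measurable ((E \<Otimes>\<^sub>M FS) \<Otimes>\<^sub>M E) \<and> integrable \<mu>3 (\<lambda>z. (h z)\<^sup>2)"

lemma square_int_measurable: "square_int h \<Longrightarrow> h \<in> borel_measurable \<mu>3"
  by (subst measurable_cong_sets[OF sets_\<mu>3 refl]) (simp add: square_int_def)

lemma square_int_add: "square_int f \<Longrightarrow> square_int g \<Longrightarrow> square_int (\<lambda>z. f z + g z)"
  using integrable_square_add(1)[OF square_int_measurable square_int_measurable, of f g]
  by (auto simp: square_int_def)

lemma square_int_minus: "square_int f \<Longrightarrow> square_int (\<lambda>z. - f z)"
  by (simp add: square_int_def)

lemma square_int_diff: "square_int f \<Longrightarrow> square_int g \<Longrightarrow> square_int (\<lambda>z. f z - g z)"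
  using square_int_add[OF _ square_int_minus, of f g] by simp

lemma square_int_fst:
  assumes "\<phi> \<in> borel_measurable (E \<Otimes>\<^sub>M FS)" "integrable \<mu>2 (\<lambda>z. (\<phi> z)\<^sup>2)"
  shows "square_int (\<lambda>z. \<phi> (fst z))"
  using integral_kernel_prod_fst(1)[OF \<kappa>'_kernel ne2 assms(2)] measurable_compose[OF measurable_fst assms(1)]
  by (simp add: square_int_def)

lemma section_measurable:
  assumes "h \<in> borel_measurable ((E \<Otimes>\<^sub>M FS) \<Otimes>\<^sub>M E)" "z \<in> space \<mu>2"
  shows "(\<lambda>y. h (z, y)) \<in> borel_measurable (\<kappa>' z)"
  by (subst measurable_cong_sets[OF sets_\<kappa>'[OF assms(2)] refl])
    (rule measurable_compose[OF measurable_Pair1' assms(1)], use assms(2) in \<open>simp add: space_\<mu>2 space_pair_measure\<close>)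

lemma measurable_cond_integral:
  assumes h: "h \<in> borel_measurable ((E \<Otimes>\<^sub>M FS) \<Otimes>\<^sub>M E)"
  shows "(\<lambda>z. \<integral>y. (h (z, y) :: real) \<partial>\<kappa>' z) \<in> borel_measurable (E \<Otimes>\<^sub>M FS)"
proof -
  have "h \<in> borel_measurable (\<mu>2 \<Otimes>\<^sub>M E)"
    by (subst measurable_cong_sets[OF sets_pair_measure_cong[OF sets_\<mu>2 refl] refl]) (rule h)
  from measurable_kernel_integral[OF \<kappa>'_sub this] show ?thesis
    by (simp add: measurable_cong_sets[OF sets_\<mu>2 refl])
qed

lemma cmean_measurable: "square_int h \<Longrightarrow> cmean h \<in> borel_measurable (E \<Otimes>\<^sub>M FS)"
  unfolding cmean_def[abs_def] by (rule measurable_cond_integral) (simp add: square_int_def)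

text \<open>Conditional Jensen: the square of a conditional mean is at most the conditional mean of
  the square. The first clause collects the almost sure facts that guard later computations, since
  at the remaining points the integrals may be 0 by mere convention.\<close>

lemma square_int_cond:
  assumes h: "square_int h"
  shows "AE z in \<mu>2. z \<in> space \<mu>2 \<and> integrable (\<kappa>' z) (\<lambda>y. (h (z, y))\<^sup>2) \<and> integrable (\<kappa>' z) (\<lambda>y. h (z, y)) \<and> 0 \<le> cvar h z"
    and "integrable \<mu>2 (\<lambda>z. \<integral>y. (h (z, y))\<^sup>2 \<partial>\<kappa>' z)"
    and "(\<integral>z. (h z)\<^sup>2 \<partial>\<mu>3) = (\<integral>z. (\<integral>y. (h (z, y))\<^sup>2 \<partial>\<kappa>' z) \<partial>\<mu>2)"
    and "integrable \<mu>2 (\<lambda>z. (cmean h z)\<^sup>2)"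
    and "integrable \<mu>2 (cvar h)"
proof -
  have hm: "h \<in> borel_measurable ((E \<Otimes>\<^sub>M FS) \<Otimes>\<^sub>M E)" and i: "integrable \<mu>3 (\<lambda>z. (h z)\<^sup>2)"
    using h by (auto simp: square_int_def)
  note K = integral_kernel_prod[OF \<kappa>'_sub ne2 i]
  show q: "integrable \<mu>2 (\<lambda>z. \<integral>y. (h (z, y))\<^sup>2 \<partial>\<kappa>' z)" by (rule K(2))
  show "(\<integral>z. (h z)\<^sup>2 \<partial>\<mu>3) = (\<integral>z. (\<integral>y. (h (z, y))\<^sup>2 \<partial>\<kappa>' z) \<partial>\<mu>2)" by (rule K(3))
  show ae: "AE z in \<mu>2. z \<in> space \<mu>2 \<and> integrable (\<kappa>' z) (\<lambda>y. (h (z, y))\<^sup>2) \<and> integrable (\<kappa>' z) (\<lambda>y. h (z, y)) \<and> 0 \<le> cvar h z"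
    using K(1) AE_space
  proof eventually_elim
    case (elim z)
    interpret K: prob_space "\<kappa>' z" by (rule prob_space_\<kappa>'[OF elim(2)])
    show ?case
      using K.square_integral_le[OF section_measurable[OF hm elim(2)] elim(1)] elim by (simp add: cvar_def var_def)
  qed
  have m2: "(\<lambda>z. (cmean h z)\<^sup>2) \<in> borel_measurable \<mu>2"
    by (subst measurable_cong_sets[OF sets_\<mu>2 refl]) (use cmean_measurable[OF h] in measurable)
  show c: "integrable \<mu>2 (\<lambda>z. (cmean h z)\<^sup>2)"
  proof (rule Bochner_Integration.integrable_bound[OF q m2])
    show "AE z in \<mu>2. norm ((cmean h z)\<^sup>2) \<le> norm (\<integral>y. (h (z, y))\<^sup>2 \<partial>\<kappa>' z)"
      using ae by eventually_elim (simp add: cvar_def var_def cmean_def)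
  qed
  show "integrable \<mu>2 (cvar h)"
    using Bochner_Integration.integrable_diff[OF q c] by (simp add: cvar_def[abs_def] var_def cmean_def)
qed

lemma control_variate_square_int:
  "control_variate E Q \<kappa> \<beta> \<longleftrightarrow> square_int (\<lambda>z. \<beta> (fst (fst z)) (snd (fst z)) (snd z))"
proof -
  let ?b = "\<lambda>z. \<beta> (fst (fst z)) (snd (fst z)) (snd z)"
  have meas: "(\<lambda>(x, A, y). \<beta> x A y) \<in> borel_measurable (triple_space E) \<longleftrightarrow> ?b \<in> borel_measurable ((E \<Otimes>\<^sub>M FS) \<Otimes>\<^sub>M E)"
  proof
    assume m: "(\<lambda>(x, A, y). \<beta> x A y) \<in> borel_measurable (triple_space E)"
    have "(\<lambda>z. (fst (fst z), snd (fst z), snd z)) \<in> (E \<Otimes>\<^sub>M FS) \<Otimes>\<^sub>M E \<rightarrow>\<^sub>M triple_space E" by measurable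
    from measurable_compose[OF this m] show "?b \<in> borel_measurable ((E \<Otimes>\<^sub>M FS) \<Otimes>\<^sub>M E)" by simp
  next
    assume m: "?b \<in> borel_measurable ((E \<Otimes>\<^sub>M FS) \<Otimes>\<^sub>M E)"
    have "(\<lambda>z. ((fst z, fst (snd z)), snd (snd z))) \<in> triple_space E \<rightarrow>\<^sub>M (E \<Otimes>\<^sub>M FS) \<Otimes>\<^sub>M E" by measurable
    from measurable_compose[OF this m] show "(\<lambda>(x, A, y). \<beta> x A y) \<in> borel_measurable (triple_space E)"
      by (simp add: case_prod_beta')
  qed
  have "integrable \<mu>3 (\<lambda>z. (?b z)\<^sup>2) \<longleftrightarrow> (\<integral>\<^sup>+x. (\<integral>\<^sup>+A. (\<integral>\<^sup>+y. ennreal ((\<beta> x A y)\<^sup>2) \<partial>\<kappa> x A) \<partial>Q x) \<partial>E) < \<infinity>"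
    if m: "?b \<in> borel_measurable ((E \<Otimes>\<^sub>M FS) \<Otimes>\<^sub>M E)"
  proof -
    have m3: "(\<lambda>z. (?b z)\<^sup>2) \<in> borel_measurable \<mu>3"
      by (subst measurable_cong_sets[OF sets_\<mu>3 refl]) (use m in measurable)
    have "(\<integral>\<^sup>+z. ennreal ((?b z)\<^sup>2) \<partial>\<mu>3) = (\<integral>\<^sup>+x. (\<integral>\<^sup>+A. (\<integral>\<^sup>+y. ennreal ((\<beta> x A y)\<^sup>2) \<partial>\<kappa> x A) \<partial>Q x) \<partial>E)"
      by (subst nn_integral_\<mu>3) (use m in auto)
    then show ?thesis using m3 by (simp add: integrable_iff_bounded)
  qed
  then show ?thesis unfolding control_variate_def square_int_def meas by blast
qed

text \<open>In a stationary step the selected state again has law \<open>\<pi>\<close>; this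
  transfers integrability of a function of one state to the triple.\<close>

lemma distr_\<mu>3_snd: "distr \<mu>3 E snd = E"
proof (rule measure_eqI)
  interpret mk: mark_kernel E FS mark_law by (rule mark_kernel_mark_law)
  have f: "snd \<in> \<mu>3 \<rightarrow>\<^sub>M E" by (subst measurable_cong_sets[OF sets_\<mu>3 refl]) (rule measurable_snd)
  fix B assume "B \<in> sets (distr \<mu>3 E snd)"
  then have B: "B \<in> sets E" by simp
  have "emeasure (distr \<mu>3 E snd) B = (\<integral>\<^sup>+x. indicator B x \<partial>distr \<mu>3 E snd)" using B by simp
  also have "\<dots> = (\<integral>\<^sup>+z. indicator B (snd z) \<partial>\<mu>3)" by (rule nn_integral_distr[OF f]) (use B in simp)
  also have "\<dots> = (\<integral>\<^sup>+x. (\<integral>\<^sup>+A. (\<integral>\<^sup>+y. indicator B y \<partial>\<kappa> x A) \<partial>Q x) \<partial>E)"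
    by (subst nn_integral_\<mu>3) (use measurable_compose[OF measurable_snd borel_measurable_indicator[OF B]] in auto)
  also have "\<dots> = (\<integral>\<^sup>+x. (\<integral>\<^sup>+w. indicator B (snd w) \<partial>mark_law x) \<partial>E)"
    by (intro nn_integral_cong, subst nn_integral_mark_law)
      (use measurable_compose[OF measurable_snd borel_measurable_indicator[OF B]] in auto)
  also have "\<dots> = (\<integral>\<^sup>+x. indicator B x \<partial>E)" by (rule mk.mark_invariant) (use B in simp)
  finally show "emeasure (distr \<mu>3 E snd) B = emeasure E B" using B by simp
qed simp

lemma integral_\<mu>3_snd:
  fixes \<phi> :: "'a \<Rightarrow> real"
  assumes m: "\<phi> \<in> borel_measurable E"
  shows "integrable \<mu>3 (\<lambda>z. \<phi> (snd z)) \<longleftrightarrow> integrable E \<phi>" "(\<integral>z. \<phi> (snd z) \<partial>\<mu>3) = (\<integral>x. \<phi> x \<partial>E)"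
proof -
  have f: "snd \<in> \<mu>3 \<rightarrow>\<^sub>M E" by (subst measurable_cong_sets[OF sets_\<mu>3 refl]) (rule measurable_snd)
  show "integrable \<mu>3 (\<lambda>z. \<phi> (snd z)) \<longleftrightarrow> integrable E \<phi>" using integrable_distr_eq[OF f m] by (simp add: distr_\<mu>3_snd)
  show "(\<integral>z. \<phi> (snd z) \<partial>\<mu>3) = (\<integral>x. \<phi> x \<partial>E)" using integral_distr[OF f m] by (simp add: distr_\<mu>3_snd)
qed

text \<open>\<open>\<kappa> x A\<close> is concentrated on the finite set \<open>A\<close>, where a
  function is a finite combination of indicators of singletons. This identifies the computable sum
  in the estimator with a conditional mean. It requires \<open>x\<close> in \<open>A\<close>, the
  case in which concentration on \<open>A\<close> is guaranteed.\<close>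

lemma \<kappa>_integral_sum:
  fixes \<phi> :: "'a \<Rightarrow> real"
  assumes A: "A \<in> space FS" and x: "x \<in> A" and \<phi>: "\<phi> \<in> borel_measurable E"
  shows "(\<integral>y. \<phi> y \<partial>\<kappa> x A) = (\<Sum>z\<in>A. measure (\<kappa> x A) {z} * \<phi> z)"
proof -
  have fin: "finite A" and AE: "A \<subseteq> space E" using A by (auto simp: space_finite_subsets)
  have xE: "x \<in> space E" using x AE by auto
  interpret K: prob_space "\<kappa> x A" by (rule prob_space_\<kappa>[OF xE A])
  have sK: "sets (\<kappa> x A) = sets E" by (rule sets_\<kappa>[OF xE A])
  have sing: "{z} \<in> sets (\<kappa> x A)" if "z \<in> A" for z using singletons[of z] that AE sK by auto
  have one: "measure (\<kappa> x A) A = 1" using selection_law A x by (simp add: selection_kernel_def)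
  have "AE y in \<kappa> x A. y \<in> A" by (rule K.AE_prob_1[OF one])
  then have ae: "AE y in \<kappa> x A. \<phi> y = (\<Sum>z\<in>A. indicator {z} y * \<phi> z)"
  proof eventually_elim
    case (elim y)
    have "(\<Sum>z\<in>A. indicator {z} y * \<phi> z) = (\<Sum>z\<in>A. if z = y then \<phi> z else 0)"
      by (intro sum.cong) (auto simp: indicator_def)
    then show ?case using elim fin by simp
  qed
  have "(\<integral>y. \<phi> y \<partial>\<kappa> x A) = (\<integral>y. (\<Sum>z\<in>A. indicator {z} y * \<phi> z) \<partial>\<kappa> x A)"
  proof (rule integral_cong_AE[OF _ _ ae])
    show "\<phi> \<in> borel_measurable (\<kappa> x A)" by (subst measurable_cong_sets[OF sK refl]) (rule \<phi>)
    show "(\<lambda>y. \<Sum>z\<in>A. indicator {z} y * \<phi> z) \<in> borel_measurable (\<kappa> x A)"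
      by (intro borel_measurable_sum borel_measurable_times borel_measurable_indicator sing) auto
  qed
  also have "\<dots> = (\<Sum>z\<in>A. \<integral>y. indicator {z} y * \<phi> z \<partial>\<kappa> x A)"
  proof (rule Bochner_Integration.integral_sum)
    fix z assume "z \<in> A"
    then show "integrable (\<kappa> x A) (\<lambda>y. indicator {z} y * \<phi> z)"
      using sing by (intro integrable_mult_left) (auto simp: K.emeasure_eq_measure)
  qed
  also have "\<dots> = (\<Sum>z\<in>A. measure (\<kappa> x A) {z} * \<phi> z)"
    using sing by (intro sum.cong) auto
  finally show ?thesis .
qed

end

section \<open>Orthogonal decomposition of the increment and the minimisation of its second
  moment\<close>

section \<open>The asymptotic variance\<close>

locale poisson_setting = proposal_selection E Q \<kappa> for E :: "'a measure" and Q \<kappa> +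
  fixes F :: "'a \<Rightarrow> real"
  assumes F: "F \<in> borel_measurable E" and F_sq: "integrable E (\<lambda>x. (F x)\<^sup>2)"
    and F_int: "\<And>x. x \<in> space E \<Longrightarrow> integrable (transition Q \<kappa> x) F"
begin

definition PF :: "'a \<Rightarrow> real" where "PF x = (\<integral>y. F y \<partial>transition Q \<kappa> x)"

abbreviation Fs :: "('a \<times> 'a set) \<times> 'a \<Rightarrow> real" where "Fs \<equiv> \<lambda>z. F (snd z)"

lemma square_int_F: "square_int Fs"
  using integral_\<mu>3_snd(1)[of "\<lambda>x. (F x)\<^sup>2"] F F_sq measurable_compose[OF measurable_snd F]
  by (simp add: square_int_def)

lemma PF_measurable: "PF \<in> borel_measurable E"
  unfolding PF_def[abs_def]
  by (rule measurable_compose[OF measurable_prob_algebraD[OF transition_kernel[OF proposition_law selection_law]]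
        integral_measurable_subprob_algebra[OF F]])

lemma PF_eq:
  assumes x: "x \<in> space E"
  shows "integrable (Q x) (\<lambda>A. cmean Fs (x, A))" "PF x = (\<integral>A. cmean Fs (x, A) \<partial>Q x)"
proof -
  have ms: "snd \<in> mark_law x \<rightarrow>\<^sub>M E"
    by (subst measurable_cong_sets[OF sets_mark_law[OF x] refl]) (rule measurable_snd)
  have i: "integrable (mark_law x) (\<lambda>w. F (snd w))"
    using F_int[OF x] integrable_distr_eq[OF ms F] by (simp add: transition_eq_distr[OF x])
  note K = integral_kernel_prod[OF \<kappa>_section_Q[OF x] prob_space.not_empty[OF prob_space_Q[OF x]] i[unfolded mark_law_def]]
  show "integrable (Q x) (\<lambda>A. cmean Fs (x, A))" using K(2) by (simp add: cmean_def \<kappa>'_def)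
  have "PF x = (\<integral>w. F (snd w) \<partial>mark_law x)"
    unfolding PF_def transition_eq_distr[OF x] by (rule integral_distr[OF ms F])
  also have "\<dots> = (\<integral>A. cmean Fs (x, A) \<partial>Q x)" unfolding mark_law_def K(3) by (simp add: cmean_def \<kappa>'_def)
  finally show "PF x = (\<integral>A. cmean Fs (x, A) \<partial>Q x)" .
qed

text \<open>\<open>PF x\<close> is the mean over \<open>A\<close> of the conditional mean of
  \<open>F\<close>, so the cross term integrates to the square of \<open>PF\<close>, and the
  difference is the averaged variance under \<open>Q x\<close> of that conditional mean.\<close>

lemma PF_square:
  shows "integrable E (\<lambda>x. (PF x)\<^sup>2)"
    and "(\<integral>z. (cmean Fs z - PF (fst z))\<^sup>2 \<partial>\<mu>2) = (\<integral>z. (cmean Fs z)\<^sup>2 \<partial>\<mu>2) - (\<integral>x. (PF x)\<^sup>2 \<partial>E)"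
    and "integrable \<mu>2 (\<lambda>z. (cmean Fs z - PF (fst z))\<^sup>2)"
proof -
  note a2 = square_int_cond(4)[OF square_int_F]
  note K = integral_kernel_prod[OF Q_sub not_empty a2]
  show P2: "integrable E (\<lambda>x. (PF x)\<^sup>2)"
  proof (rule Bochner_Integration.integrable_bound[OF K(2)])
    show "AE x in E. norm ((PF x)\<^sup>2) \<le> norm (\<integral>A. (cmean Fs (x, A))\<^sup>2 \<partial>Q x)"
      using K(1) AE_space
    proof eventually_elim
      case (elim x)
      interpret Qx: prob_space "Q x" by (rule prob_space_Q[OF elim(2)])
      have "(PF x)\<^sup>2 \<le> (\<integral>A. (cmean Fs (x, A))\<^sup>2 \<partial>Q x)"
        unfolding PF_eq(2)[OF elim(2)]
        by (rule Qx.square_integral_le(2)[OF borel_measurable_integrable[OF PF_eq(1)[OF elim(2)]] elim(1)])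
      then show ?case by simp
    qed
  qed (use PF_measurable in simp)
  have am: "cmean Fs \<in> borel_measurable \<mu>2"
    by (subst measurable_cong_sets[OF sets_\<mu>2 refl]) (rule cmean_measurable[OF square_int_F])
  have Pm: "(\<lambda>z. PF (fst z)) \<in> borel_measurable \<mu>2"
    by (subst measurable_cong_sets[OF sets_\<mu>2 refl]) (rule measurable_compose[OF measurable_fst PF_measurable])
  note Pf = integral_kernel_prod_fst[OF Q_kernel not_empty P2]
  have ap: "integrable \<mu>2 (\<lambda>z. cmean Fs z * PF (fst z))" by (rule integrable_square_add(2)[OF am Pm a2 Pf(1)])
  have "(\<integral>z. cmean Fs z * PF (fst z) \<partial>\<mu>2) = (\<integral>x. (\<integral>A. cmean Fs (x, A) * PF x \<partial>Q x) \<partial>E)"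
    using integral_kernel_prod(3)[OF Q_sub not_empty ap] by simp
  also have "\<dots> = (\<integral>x. (PF x)\<^sup>2 \<partial>E)"
    by (intro Bochner_Integration.integral_cong) (simp_all add: PF_eq(2)[symmetric] power2_eq_square)
  finally have cross: "(\<integral>z. cmean Fs z * PF (fst z) \<partial>\<mu>2) = (\<integral>x. (PF x)\<^sup>2 \<partial>E)" .
  have eq: "(cmean Fs z - PF (fst z))\<^sup>2 = (cmean Fs z)\<^sup>2 + (PF (fst z))\<^sup>2 - 2 * (cmean Fs z * PF (fst z))" for z
    by (simp add: power2_diff)
  show "integrable \<mu>2 (\<lambda>z. (cmean Fs z - PF (fst z))\<^sup>2)" unfolding eq using a2 Pf(1) ap by simp
  show "(\<integral>z. (cmean Fs z - PF (fst z))\<^sup>2 \<partial>\<mu>2) = (\<integral>z. (cmean Fs z)\<^sup>2 \<partial>\<mu>2) - (\<integral>x. (PF x)\<^sup>2 \<partial>E)"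
    unfolding eq using a2 Pf ap cross by simp
qed

lemma sigma_sq_eq: "sigma_sq E (transition Q \<kappa>) F = (\<integral>z. (\<integral>y. (F y)\<^sup>2 \<partial>\<kappa>' z) \<partial>\<mu>2) - (\<integral>x. (PF x)\<^sup>2 \<partial>E)"
proof -
  have "sigma_sq E (transition Q \<kappa>) F = (\<integral>x. (F x)\<^sup>2 \<partial>E) - (\<integral>x. (PF x)\<^sup>2 \<partial>E)"
    unfolding sigma_sq_def PF_def[symmetric] by (rule Bochner_Integration.integral_diff[OF F_sq PF_square(1)])
  also have "(\<integral>x. (F x)\<^sup>2 \<partial>E) = (\<integral>z. (Fs z)\<^sup>2 \<partial>\<mu>3)"
    using integral_\<mu>3_snd(2)[of "\<lambda>x. (F x)\<^sup>2"] F by simp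
  also have "\<dots> = (\<integral>z. (\<integral>y. (F y)\<^sup>2 \<partial>\<kappa>' z) \<partial>\<mu>2)" using square_int_cond(3)[OF square_int_F] by simp
  finally show ?thesis .
qed

context
  fixes \<beta> :: "'a \<Rightarrow> 'a set \<Rightarrow> 'a \<Rightarrow> real"
  assumes cv: "control_variate E Q \<kappa> \<beta>"
begin

abbreviation b3 :: "('a \<times> 'a set) \<times> 'a \<Rightarrow> real" where "b3 \<equiv> \<lambda>z. \<beta> (fst (fst z)) (snd (fst z)) (snd z)"

lemma square_int_b3: "square_int b3"
  using cv by (simp add: control_variate_square_int)

text \<open>Each of the two averaged conditional variances is finite, so the iterated integral of
  their difference may be split over the joint law of state and proposal.\<close>

lemma sigma_correction:
  "(\<integral>x. (\<integral>A. var (\<kappa> x A) (\<lambda>y. \<beta> x A y - F y) - var (\<kappa> x A) F \<partial>Q x) \<partial>E)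
    = (\<integral>z. cvar (\<lambda>z. b3 z - Fs z) z \<partial>\<mu>2) - (\<integral>z. cvar Fs z \<partial>\<mu>2)"
proof -
  note c1 = square_int_cond(5)[OF square_int_diff[OF square_int_b3 square_int_F]] and c2 = square_int_cond(5)[OF square_int_F]
  have "(\<integral>z. cvar (\<lambda>z. b3 z - Fs z) z - cvar Fs z \<partial>\<mu>2)
    = (\<integral>x. (\<integral>A. cvar (\<lambda>z. b3 z - Fs z) (x, A) - cvar Fs (x, A) \<partial>Q x) \<partial>E)"
    by (rule integral_kernel_prod(3)[OF Q_sub not_empty Bochner_Integration.integrable_diff[OF c1 c2]])
  moreover have "(\<integral>z. cvar (\<lambda>z. b3 z - Fs z) z - cvar Fs z \<partial>\<mu>2) = (\<integral>z. cvar (\<lambda>z. b3 z - Fs z) z \<partial>\<mu>2) - (\<integral>z. cvar Fs z \<partial>\<mu>2)"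
    by (rule Bochner_Integration.integral_diff[OF c1 c2])
  moreover have "(\<integral>x. (\<integral>A. var (\<kappa> x A) (\<lambda>y. \<beta> x A y - F y) - var (\<kappa> x A) F \<partial>Q x) \<partial>E)
    = (\<integral>x. (\<integral>A. cvar (\<lambda>z. b3 z - Fs z) (x, A) - cvar Fs (x, A) \<partial>Q x) \<partial>E)"
    by (simp add: cvar_def \<kappa>'_def)
  ultimately show ?thesis by (simp only:)
qed

text \<open>The averaged conditional variance of \<open>F\<close> cancels against its second moment
  and leaves the squared conditional mean. In this form \<open>\<beta>\<close> enters through a
  single nonnegative term, which vanishes for \<open>\<beta> = F\<close>; minimality is then
  visible.\<close>

lemma sigma_sq_control_eq:
  "sigma_sq_control E Q \<kappa> F \<beta> = (\<integral>z. cvar (\<lambda>z. b3 z - Fs z) z \<partial>\<mu>2) + ((\<integral>z. (cmean Fs z)\<^sup>2 \<partial>\<mu>2) - (\<integral>x. (PF x)\<^sup>2 \<partial>E))"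
proof -
  note c = square_int_cond[OF square_int_F]
  have "(\<integral>z. cvar Fs z \<partial>\<mu>2) = (\<integral>z. (\<integral>y. (F y)\<^sup>2 \<partial>\<kappa>' z) - (cmean Fs z)\<^sup>2 \<partial>\<mu>2)"
    by (simp add: cvar_def var_def cmean_def)
  also have "\<dots> = (\<integral>z. (\<integral>y. (F y)\<^sup>2 \<partial>\<kappa>' z) \<partial>\<mu>2) - (\<integral>z. (cmean Fs z)\<^sup>2 \<partial>\<mu>2)"
    using c(2) c(4) by simp
  finally show ?thesis unfolding sigma_sq_control_def sigma_correction sigma_sq_eq by simp
qed

lemma cvar_integral_nonneg: "0 \<le> (\<integral>z. cvar (\<lambda>z. b3 z - Fs z) z \<partial>\<mu>2)"
  by (rule integral_nonneg_AE)
    (use square_int_cond(1)[OF square_int_diff[OF square_int_b3 square_int_F]] in \<open>auto elim: eventually_mono\<close>)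

definition increment :: "'a \<times> ('a set \<times> 'a) \<Rightarrow> real" where
  "increment z = F (snd (snd z)) - PF (fst z) + cmean b3 (fst z, fst (snd z)) - \<beta> (fst z) (fst (snd z)) (snd (snd z))"

lemma measurable_assoc: "(\<lambda>z. (fst (fst z), (snd (fst z), snd z))) \<in> \<mu>3 \<rightarrow>\<^sub>M E \<Otimes>\<^sub>M (FS \<Otimes>\<^sub>M E)"
  by (subst measurable_cong_sets[OF sets_\<mu>3 refl]) measurable

text \<open>Two nestings of one law: the limit theorems see a state and a mark
  \<open>(A, y)\<close>, the variance computation a conditioning pair \<open>(x, A)\<close> and a
  state.\<close>

lemma distr_assoc: "distr \<mu>3 (E \<Otimes>\<^sub>M (FS \<Otimes>\<^sub>M E)) (\<lambda>z. (fst (fst z), (snd (fst z), snd z))) = kernel_prod E (FS \<Otimes>\<^sub>M E) mark_law"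
proof (rule measure_eqI)
  note mlk = measurable_prob_algebraD[OF mark_law_kernel]
  have s: "sets (kernel_prod E (FS \<Otimes>\<^sub>M E) mark_law) = sets (E \<Otimes>\<^sub>M (FS \<Otimes>\<^sub>M E))" by (rule sets_kernel_prod[OF mlk not_empty])
  then show "sets (distr \<mu>3 (E \<Otimes>\<^sub>M (FS \<Otimes>\<^sub>M E)) (\<lambda>z. (fst (fst z), (snd (fst z), snd z)))) = sets (kernel_prod E (FS \<Otimes>\<^sub>M E) mark_law)"
    by simp
  fix U assume "U \<in> sets (distr \<mu>3 (E \<Otimes>\<^sub>M (FS \<Otimes>\<^sub>M E)) (\<lambda>z. (fst (fst z), (snd (fst z), snd z))))"
  then have U: "U \<in> sets (E \<Otimes>\<^sub>M (FS \<Otimes>\<^sub>M E))" by simp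
  have iU: "indicator U \<in> borel_measurable (E \<Otimes>\<^sub>M (FS \<Otimes>\<^sub>M E))" using U by simp
  have as: "(\<lambda>z. (fst (fst z), (snd (fst z), snd z))) \<in> (E \<Otimes>\<^sub>M FS) \<Otimes>\<^sub>M E \<rightarrow>\<^sub>M E \<Otimes>\<^sub>M (FS \<Otimes>\<^sub>M E)" by measurable
  have "emeasure (distr \<mu>3 (E \<Otimes>\<^sub>M (FS \<Otimes>\<^sub>M E)) (\<lambda>z. (fst (fst z), (snd (fst z), snd z)))) U
    = (\<integral>\<^sup>+z. indicator U z \<partial>distr \<mu>3 (E \<Otimes>\<^sub>M (FS \<Otimes>\<^sub>M E)) (\<lambda>z. (fst (fst z), (snd (fst z), snd z))))" using U by simp
  also have "\<dots> = (\<integral>\<^sup>+z. indicator U (fst (fst z), (snd (fst z), snd z)) \<partial>\<mu>3)"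
    by (rule nn_integral_distr[OF measurable_assoc]) (use iU in simp)
  also have "\<dots> = (\<integral>\<^sup>+x. (\<integral>\<^sup>+A. (\<integral>\<^sup>+y. indicator U (x, (A, y)) \<partial>\<kappa> x A) \<partial>Q x) \<partial>E)"
    by (subst nn_integral_\<mu>3[OF measurable_compose[OF as iU]]) simp
  also have "\<dots> = (\<integral>\<^sup>+x. (\<integral>\<^sup>+w. indicator U (x, w) \<partial>mark_law x) \<partial>E)"
    by (intro nn_integral_cong nn_integral_mark_law[symmetric] measurable_compose[OF measurable_Pair1' iU])
  also have "\<dots> = (\<integral>\<^sup>+z. indicator U z \<partial>kernel_prod E (FS \<Otimes>\<^sub>M E) mark_law)"
    by (rule nn_integral_kernel_prod[OF mlk iU, symmetric])
  also have "\<dots> = emeasure (kernel_prod E (FS \<Otimes>\<^sub>M E) mark_law) U" using U s by simp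
  finally show "emeasure (distr \<mu>3 (E \<Otimes>\<^sub>M (FS \<Otimes>\<^sub>M E)) (\<lambda>z. (fst (fst z), (snd (fst z), snd z)))) U = emeasure (kernel_prod E (FS \<Otimes>\<^sub>M E) mark_law) U" .
qed

lemma increment_measurable: "increment \<in> borel_measurable (E \<Otimes>\<^sub>M (FS \<Otimes>\<^sub>M E))"
proof -
  have m1: "(\<lambda>z. (fst z, fst (snd z))) \<in> E \<Otimes>\<^sub>M (FS \<Otimes>\<^sub>M E) \<rightarrow>\<^sub>M E \<Otimes>\<^sub>M FS" by measurable
  have m2: "(\<lambda>z. ((fst z, fst (snd z)), snd (snd z))) \<in> E \<Otimes>\<^sub>M (FS \<Otimes>\<^sub>M E) \<rightarrow>\<^sub>M (E \<Otimes>\<^sub>M FS) \<Otimes>\<^sub>M E" by measurable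
  have m3: "(\<lambda>z. snd (snd z)) \<in> E \<Otimes>\<^sub>M (FS \<Otimes>\<^sub>M E) \<rightarrow>\<^sub>M E" by measurable
  have bm: "b3 \<in> borel_measurable ((E \<Otimes>\<^sub>M FS) \<Otimes>\<^sub>M E)" using square_int_b3 by (simp add: square_int_def)
  show ?thesis
    unfolding increment_def[abs_def]
    using measurable_compose[OF m3 F] measurable_compose[OF measurable_fst PF_measurable]
      measurable_compose[OF m1 cmean_measurable[OF square_int_b3]] measurable_compose[OF m2 bm]
    by (intro borel_measurable_diff borel_measurable_add) auto
qed

lemma increment3: "increment (fst (fst z), (snd (fst z), snd z)) = (Fs z - PF (fst (fst z))) + (cmean b3 (fst z) - b3 z)"
  by (simp add: increment_def)

lemma square_int_increment: "square_int (\<lambda>z. increment (fst (fst z), (snd (fst z), snd z)))"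
proof -
  have 1: "square_int (\<lambda>z. cmean b3 (fst z))"
    by (rule square_int_fst[OF cmean_measurable square_int_cond(4)]; rule square_int_b3)
  have 2: "square_int (\<lambda>z. (\<lambda>u. PF (fst u)) (fst z))"
    by (rule square_int_fst[OF measurable_compose[OF measurable_fst PF_measurable]])
      (rule integral_kernel_prod_fst(1)[OF Q_kernel not_empty PF_square(1)])
  show ?thesis
    unfolding increment3
    by (rule square_int_add[OF square_int_diff[OF square_int_F 2] square_int_diff[OF 1 square_int_b3]])
qed

text \<open>Given \<open>(x, A)\<close> the increment is a constant minus
  \<open>\<beta> - F\<close>. Its conditional second moment is thus the conditional variance of
  \<open>\<beta> - F\<close> plus the square of its conditional mean, which is the conditional mean
  of \<open>F\<close> minus \<open>PF x\<close>.\<close>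

lemma increment_square:
  shows "integrable (kernel_prod E (FS \<Otimes>\<^sub>M E) mark_law) (\<lambda>z. (increment z)\<^sup>2)"
    and "(\<integral>z. (increment z)\<^sup>2 \<partial>kernel_prod E (FS \<Otimes>\<^sub>M E) mark_law) = sigma_sq_control E Q \<kappa> F \<beta>"
proof -
  let ?i3 = "\<lambda>z. increment (fst (fst z), (snd (fst z), snd z))"
  have m: "(\<lambda>z. (increment z)\<^sup>2) \<in> borel_measurable (E \<Otimes>\<^sub>M (FS \<Otimes>\<^sub>M E))" using increment_measurable by measurable
  show "integrable (kernel_prod E (FS \<Otimes>\<^sub>M E) mark_law) (\<lambda>z. (increment z)\<^sup>2)"
    unfolding distr_assoc[symmetric] integrable_distr_eq[OF measurable_assoc m]
    using square_int_increment by (simp add: square_int_def)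
  have d: "square_int (\<lambda>z. b3 z - Fs z)" by (rule square_int_diff[OF square_int_b3 square_int_F])
  have "(\<integral>z. (increment z)\<^sup>2 \<partial>kernel_prod E (FS \<Otimes>\<^sub>M E) mark_law) = (\<integral>z. (?i3 z)\<^sup>2 \<partial>\<mu>3)"
    unfolding distr_assoc[symmetric] by (rule integral_distr[OF measurable_assoc m])
  also have "\<dots> = (\<integral>z. (\<integral>y. (?i3 (z, y))\<^sup>2 \<partial>\<kappa>' z) \<partial>\<mu>2)" by (rule square_int_cond(3)[OF square_int_increment])
  also have "\<dots> = (\<integral>z. cvar (\<lambda>z. b3 z - Fs z) z + (cmean Fs z - PF (fst z))\<^sup>2 \<partial>\<mu>2)"
  proof (rule integral_cong_AE)
    show "(\<lambda>z. \<integral>y. (?i3 (z, y))\<^sup>2 \<partial>\<kappa>' z) \<in> borel_measurable \<mu>2"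
      using square_int_cond(2)[OF square_int_increment] by (rule borel_measurable_integrable)
    show "(\<lambda>z. cvar (\<lambda>z. b3 z - Fs z) z + (cmean Fs z - PF (fst z))\<^sup>2) \<in> borel_measurable \<mu>2"
      using square_int_cond(5)[OF d] PF_square(3) by (intro borel_measurable_add borel_measurable_integrable)
    show "AE z in \<mu>2. (\<integral>y. (?i3 (z, y))\<^sup>2 \<partial>\<kappa>' z) = cvar (\<lambda>z. b3 z - Fs z) z + (cmean Fs z - PF (fst z))\<^sup>2"
      using square_int_cond(1)[OF square_int_b3] square_int_cond(1)[OF square_int_F] square_int_cond(1)[OF d]
    proof eventually_elim
      case (elim z)
      interpret K: prob_space "\<kappa>' z" by (rule prob_space_\<kappa>') (use elim in simp)
      let ?D = "\<lambda>y. b3 (z, y) - F y"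
      let ?c = "cmean Fs z - PF (fst z)" and ?e = "cmean b3 z - cmean Fs z"
      have iD: "integrable (\<kappa>' z) ?D" "integrable (\<kappa>' z) (\<lambda>y. (?D y)\<^sup>2)" using elim by simp_all
      have mD: "(\<integral>y. ?D y \<partial>\<kappa>' z) = ?e" using elim by (simp add: cmean_def)
      \<comment> \<open>The sum of \<open>?e\<close> and \<open>?c\<close> is the conditional mean
        of \<open>\<beta>\<close> minus \<open>PF\<close>, the constant part of the
        increment.\<close>
      have eq: "(?i3 (z, y))\<^sup>2 = (?D y)\<^sup>2 + (?e + ?c)\<^sup>2 - 2 * (?e + ?c) * ?D y" for y
        unfolding increment3 by (simp add: power2_eq_square algebra_simps)
      have "(\<integral>y. (?i3 (z, y))\<^sup>2 \<partial>\<kappa>' z) = (\<integral>y. (?D y)\<^sup>2 \<partial>\<kappa>' z) + (?e + ?c)\<^sup>2 - 2 * (?e + ?c) * ?e"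
        unfolding eq using iD mD by (simp add: K.prob_space)
      also have "\<dots> = ((\<integral>y. (?D y)\<^sup>2 \<partial>\<kappa>' z) - ?e\<^sup>2) + ?c\<^sup>2" by (simp add: power2_eq_square algebra_simps)
      also have "(\<integral>y. (?D y)\<^sup>2 \<partial>\<kappa>' z) - ?e\<^sup>2 = cvar (\<lambda>z. b3 z - Fs z) z"
        unfolding cvar_def var_def mD[symmetric] by simp
      finally show ?case .
    qed
  qed
  also have "\<dots> = sigma_sq_control E Q \<kappa> F \<beta>"
    unfolding sigma_sq_control_eq using square_int_cond(5)[OF d] PF_square(2,3) by simp
  finally show "(\<integral>z. (increment z)\<^sup>2 \<partial>kernel_prod E (FS \<Otimes>\<^sub>M E) mark_law) = sigma_sq_control E Q \<kappa> F \<beta>" .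
qed

text \<open>Averaging over the selected state removes the control term and replaces \<open>F\<close>
  by its conditional mean; averaging over the proposal set then gives \<open>PF - PF\<close>. The
  argument reaches almost every \<open>x\<close>, as \<open>\<beta>\<close> is integrable under the
  selection laws only almost everywhere.\<close>

lemma increment_centred: "AE x in E. (\<integral>w. increment (x, w) \<partial>mark_law x) = 0"
proof -
  note mlk = measurable_prob_algebraD[OF mark_law_kernel]
  interpret mu: prob_space "kernel_prod E (FS \<Otimes>\<^sub>M E) mark_law" by (rule prob_space_kernel_prod[OF mark_law_kernel prob_space_axioms])
  have im: "increment \<in> borel_measurable (kernel_prod E (FS \<Otimes>\<^sub>M E) mark_law)"
    by (subst measurable_cong_sets[OF sets_kernel_prod[OF mlk not_empty] refl]) (rule increment_measurable)
  have i: "integrable (kernel_prod E (FS \<Otimes>\<^sub>M E) mark_law) increment"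
    by (rule mu.square_integral_le(1)[OF im increment_square(1)])
  have "AE z in \<mu>2. integrable (\<kappa>' z) (\<lambda>y. b3 (z, y)) \<and> integrable (\<kappa>' z) F"
    using square_int_cond(1)[OF square_int_b3] square_int_cond(1)[OF square_int_F] by eventually_elim simp
  from AE_kernel_prodD[OF Q_sub not_empty this] integral_kernel_prod(1)[OF mlk not_empty i] AE_space
  show ?thesis
  proof eventually_elim
    case (elim x)
    interpret Qx: prob_space "Q x" by (rule prob_space_Q[OF elim(3)])
    note K = integral_kernel_prod[OF \<kappa>_section_Q[OF elim(3)] Qx.not_empty elim(2)[unfolded mark_law_def]]
    note a = PF_eq[OF elim(3)]
    have "(\<integral>w. increment (x, w) \<partial>mark_law x) = (\<integral>A. (\<integral>y. increment (x, (A, y)) \<partial>\<kappa> x A) \<partial>Q x)"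
      unfolding mark_law_def by (rule K(3))
    also have "\<dots> = (\<integral>A. cmean Fs (x, A) - PF x \<partial>Q x)"
    proof (rule integral_cong_AE)
      show "(\<lambda>A. \<integral>y. increment (x, (A, y)) \<partial>\<kappa> x A) \<in> borel_measurable (Q x)" using K(2) by auto
      show "(\<lambda>A. cmean Fs (x, A) - PF x) \<in> borel_measurable (Q x)" using a(1) by auto
      show "AE A in Q x. (\<integral>y. increment (x, (A, y)) \<partial>\<kappa> x A) = cmean Fs (x, A) - PF x"
        using elim(1) AE_space
      proof eventually_elim
        case (elim A)
        have A: "A \<in> space FS" using elim(2) sets_eq_imp_space_eq[OF sets_Q[OF \<open>x \<in> space E\<close>]] by simp
        interpret K: prob_space "\<kappa> x A" by (rule prob_space_\<kappa>[OF \<open>x \<in> space E\<close> A])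
        have i1: "integrable (\<kappa> x A) (\<lambda>y. \<beta> x A y)" and i2: "integrable (\<kappa> x A) F"
          using elim(1) by (simp_all add: \<kappa>'_def)
        show ?case using i1 i2 by (simp add: increment_def cmean_def \<kappa>'_def K.prob_space)
      qed
    qed
    also have "\<dots> = 0" using a by (simp add: Qx.prob_space)
    finally show ?case .
  qed
qed

end

lemma control_variate_F: "control_variate E Q \<kappa> (\<lambda>x A y. F y)"
  using square_int_F by (simp add: control_variate_square_int)

lemma sigma_sq_control_F:
  "sigma_sq_control E Q \<kappa> F (\<lambda>x A y. F y) = (\<integral>z. (cmean Fs z)\<^sup>2 \<partial>\<mu>2) - (\<integral>x. (PF x)\<^sup>2 \<partial>E)"
  unfolding sigma_sq_control_eq[OF control_variate_F] by (simp add: cvar_def[abs_def] var_def)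

lemma sigma_sq_control_F_eq:
  "sigma_sq_control E Q \<kappa> F (\<lambda>x A y. F y) =
    (\<integral>x. (\<integral>A. (\<integral>y. F y \<partial>\<kappa> x A)\<^sup>2 \<partial>Q x) - (\<integral>A. (\<integral>y. F y \<partial>\<kappa> x A) \<partial>Q x)\<^sup>2 \<partial>E)"
proof -
  note K = integral_kernel_prod[OF Q_sub not_empty square_int_cond(4)[OF square_int_F]]
  have "(\<integral>x. (\<integral>A. (\<integral>y. F y \<partial>\<kappa> x A)\<^sup>2 \<partial>Q x) - (\<integral>A. (\<integral>y. F y \<partial>\<kappa> x A) \<partial>Q x)\<^sup>2 \<partial>E)
    = (\<integral>x. (\<integral>A. (cmean Fs (x, A))\<^sup>2 \<partial>Q x) - (PF x)\<^sup>2 \<partial>E)"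
    by (intro Bochner_Integration.integral_cong) (auto simp: PF_eq(2) cmean_def \<kappa>'_def)
  also have "\<dots> = (\<integral>x. (\<integral>A. (cmean Fs (x, A))\<^sup>2 \<partial>Q x) \<partial>E) - (\<integral>x. (PF x)\<^sup>2 \<partial>E)"
    by (rule Bochner_Integration.integral_diff[OF K(2) PF_square(1)])
  finally show ?thesis unfolding sigma_sq_control_F K(3) by simp
qed

lemma sigma_sq_control_F_le:
  assumes "control_variate E Q \<kappa> \<beta>"
  shows "sigma_sq_control E Q \<kappa> F (\<lambda>x A y. F y) \<le> sigma_sq_control E Q \<kappa> F \<beta>"
  unfolding sigma_sq_control_F sigma_sq_control_eq[OF assms] using cvar_integral_nonneg[OF assms] by simp

text \<open>Comparison with the zero control variate, for which the correction to
  \<open>sigma_sq\<close> vanishes.\<close>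

lemma sigma_sq_control_F_le_sigma_sq:
  "sigma_sq_control E Q \<kappa> F (\<lambda>x A y. F y) \<le> sigma_sq E (transition Q \<kappa>) F"
proof -
  have "(\<lambda>z. (0::real)) \<in> borel_measurable ((E \<Otimes>\<^sub>M FS) \<Otimes>\<^sub>M E)" by simp
  then have cv0: "control_variate E Q \<kappa> (\<lambda>x A y. 0)" by (simp add: control_variate_square_int square_int_def)
  have "sigma_sq_control E Q \<kappa> F (\<lambda>x A y. 0) = sigma_sq E (transition Q \<kappa>) F"
    by (simp add: sigma_sq_control_def var_def)
  then show ?thesis using sigma_sq_control_F_le[OF cv0] by simp
qed

end

section \<open>Identification of the centred estimator with a martingale sum plus boundary
  terms\<close>

section \<open>Law of large numbers and central limit theorem\<close>

theorem theorem3p4: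
  fixes \<pi> :: "'a measure"
    and Q :: "'a \<Rightarrow> 'a set measure"
    and \<kappa> :: "'a \<Rightarrow> 'a set \<Rightarrow> 'a measure"
    and M :: "'w measure"
    and X :: "nat \<Rightarrow> 'w \<Rightarrow> 'a"
    and A :: "nat \<Rightarrow> 'w \<Rightarrow> 'a set"
    and f F :: "'a \<Rightarrow> real"
    and \<beta> :: "'a \<Rightarrow> 'a set \<Rightarrow> 'a \<Rightarrow> real"
  assumes "prob_space \<pi>"
    and "\<forall>x\<in>space \<pi>. {x} \<in> sets \<pi>"
    and "proposition_kernel \<pi> Q"
    and "selection_kernel \<pi> \<kappa>"
    and "detailed_balance \<pi> Q \<kappa>"
    and "proposal_chain M \<pi> Q \<kappa> X A"
    and "harris_recurrent \<pi> (transition Q \<kappa>)"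
    and "f \<in> borel_measurable \<pi>"
    and "integrable \<pi> (\<lambda>x. (f x)\<^sup>2)"
    and "poisson_solution \<pi> (transition Q \<kappa>) f F"
    and "integrable \<pi> (\<lambda>x. (F x)\<^sup>2)"
    and "control_variate \<pi> Q \<kappa> \<beta>"
  shows
    "(AE \<omega> in M. (\<lambda>n. estimator \<kappa> X A f \<beta> n \<omega>) \<longlonglongrightarrow> (\<integral>x. f x \<partial>\<pi>)) \<and>
     (0 \<le> sigma_sq_control \<pi> Q \<kappa> F \<beta> \<and>
      converges_in_law M (\<lambda>n \<omega>. sqrt (real n) * (estimator \<kappa> X A f \<beta> n \<omega> - (\<integral>x. f x \<partial>\<pi>)))
        (centred_normal (sigma_sq_control \<pi> Q \<kappa> F \<beta>))) \<and>
     (control_variate \<pi> Q \<kappa> (\<lambda>x A y. F y) \<and>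
      (\<forall>\<beta>'. control_variate \<pi> Q \<kappa> \<beta>' \<longrightarrow>
         sigma_sq_control \<pi> Q \<kappa> F (\<lambda>x A y. F y) \<le> sigma_sq_control \<pi> Q \<kappa> F \<beta>') \<and>
      sigma_sq_control \<pi> Q \<kappa> F (\<lambda>x A y. F y) =
        (\<integral>x. (\<integral>A. (\<integral>y. F y \<partial>\<kappa> x A)\<^sup>2 \<partial>Q x) - (\<integral>A. (\<integral>y. F y \<partial>\<kappa> x A) \<partial>Q x)\<^sup>2 \<partial>\<pi>) \<and>
      sigma_sq_control \<pi> Q \<kappa> F (\<lambda>x A y. F y) \<le> sigma_sq \<pi> (transition Q \<kappa>) F)"
proof -
  have pF: "F \<in> borel_measurable \<pi>" "\<And>x. x \<in> space \<pi> \<Longrightarrow> integrable (transition Q \<kappa> x) F"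
    "\<And>x. x \<in> space \<pi> \<Longrightarrow> F x - (\<integral>y. F y \<partial>transition Q \<kappa> x) = f x - (\<integral>y. f y \<partial>\<pi>)"
    using assms(10) by (auto simp: poisson_solution_def)
  interpret S: poisson_setting \<pi> Q \<kappa> F
    by (intro poisson_setting.intro proposal_selection.intro poisson_setting_axioms.intro proposal_selection_axioms.intro)
      (use assms pF in auto)
  interpret H: harris_chain \<pi> S.FS S.mark_law M "\<lambda>n. history M \<pi> X A n n" X "\<lambda>n \<omega>. (A (Suc n) \<omega>, X (Suc n) \<omega>)" "transition Q \<kappa>"
    by (rule S.harris_chain_proposal_chain[OF assms(6,7)])
  note cv = assms(12)
  let ?g = "S.increment \<beta>"
  note ctx = S.increment_measurable[OF cv] S.increment_square(1)[OF cv] S.increment_centred[OF cv] S.PF_measurable S.PF_square(1)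
  define c where "c = (\<integral>x. f x \<partial>\<pi>)"
  define s where "s = sigma_sq_control \<pi> Q \<kappa> F \<beta>"
  define Y where "Y = H.path_sum ?g S.PF"
  have Ym: "Y n \<in> borel_measurable M" for n unfolding Y_def by (rule H.measurable_path_sum[OF ctx])
  have lln: "AE \<omega> in M. (\<lambda>n. Y n \<omega> / real n) \<longlonglongrightarrow> 0" unfolding Y_def by (rule H.path_sum_lln[OF ctx])
  have clt: "(\<lambda>n. \<integral>\<omega>. iexp (t / sqrt (real n) * Y n \<omega>) \<partial>M) \<longlonglongrightarrow> complex_of_real (exp (- t\<^sup>2 * (s / 2)))" for t
    unfolding Y_def s_def S.increment_square(2)[OF cv, symmetric] by (rule H.path_sum_clt[OF ctx])
  have s0: "0 \<le> s" unfolding s_def S.increment_square(2)[OF cv, symmetric] by simp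
  have An: "A (Suc n) \<in> M \<rightarrow>\<^sub>M S.FS" for n using assms(6) by (simp add: proposal_chain_def)
  have "\<forall>n. AE \<omega> in M. X n \<omega> \<in> A (Suc n) \<omega>" using assms(6) by (simp add: proposal_chain_def)
  then have "AE \<omega> in M. \<forall>n. X n \<omega> \<in> A (Suc n) \<omega>" unfolding AE_all_countable .
  \<comment> \<open>Multiplying by \<open>n\<close> instead of dividing makes the identity valid at
    \<open>n = 0\<close> as well. It holds almost surely, because a sum over a proposal set is
    identified with a conditional mean only when the current state belongs to that set.\<close>
  with AE_space have est: "AE \<omega> in M. \<forall>n. real n * (estimator \<kappa> X A f \<beta> n \<omega> - c) = Y n \<omega>"
  proof eventually_elim
    case (elim \<omega>)
    let ?b = "\<lambda>k. \<integral>y. \<beta> (X k \<omega>) (A (Suc k) \<omega>) y \<partial>\<kappa> (X k \<omega>) (A (Suc k) \<omega>)"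
    let ?d = "\<lambda>k. ?b k - \<beta> (X k \<omega>) (A (Suc k) \<omega>) (X (Suc k) \<omega>)"
    have Xs: "X k \<omega> \<in> space \<pi>" for k by (rule H.state_space[OF elim(1)])
    have As: "A (Suc k) \<omega> \<in> space S.FS" for k by (rule measurable_space[OF An elim(1)])
    have bm: "(\<lambda>y. \<beta> x B y) \<in> borel_measurable \<pi>" if "x \<in> space \<pi>" "B \<in> space S.FS" for x B
    proof -
      have "(\<lambda>(x, A, y). \<beta> x A y) \<in> borel_measurable (triple_space \<pi>)" using cv by (simp add: control_variate_def)
      from measurable_compose[OF measurable_Pair1'[OF that(2)] measurable_compose[OF measurable_Pair1'[OF that(1)] this]]
      show ?thesis by simp
    qed
    have sumk: "(\<Sum>z\<in>A (Suc k) \<omega>. measure (\<kappa> (X k \<omega>) (A (Suc k) \<omega>)) {z} * \<beta> (X k \<omega>) (A (Suc k) \<omega>) z) = ?b k" for k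
      using S.\<kappa>_integral_sum[OF As elim(2)[rule_format] bm[OF Xs As]] by simp
    \<comment> \<open>The Poisson equation is used at each new state; the values of
      \<open>PF\<close> at consecutive times telescope into the boundary terms.\<close>
    have Ysum: "Y n \<omega> = (\<Sum>k<n. f (X (Suc k) \<omega>) - c) + (\<Sum>k<n. ?d k)" for n
    proof (induction n)
      case 0 then show ?case by (simp add: Y_def H.path_sum_def[OF ctx])
    next
      case (Suc n)
      have "f (X (Suc n) \<omega>) - c = F (X (Suc n) \<omega>) - S.PF (X (Suc n) \<omega>)"
        using pF(3)[OF Xs[of "Suc n"]] by (simp add: c_def S.PF_def)
      moreover have "Y (Suc n) \<omega> = Y n \<omega> + ?g (X n \<omega>, (A (Suc n) \<omega>, X (Suc n) \<omega>)) + S.PF (X n \<omega>) - S.PF (X (Suc n) \<omega>)"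
        by (simp add: Y_def H.path_sum_def[OF ctx])
      moreover have "?g (X n \<omega>, (A (Suc n) \<omega>, X (Suc n) \<omega>)) = F (X (Suc n) \<omega>) - S.PF (X n \<omega>) + ?d n"
        by (simp add: S.increment_def[OF cv] S.cmean_def S.\<kappa>'_def)
      ultimately show ?case using Suc.IH by simp
    qed
    show ?case
    proof
      fix n
      show "real n * (estimator \<kappa> X A f \<beta> n \<omega> - c) = Y n \<omega>"
      proof (cases "n = 0")
        case True
        then show ?thesis using Ysum[of 0] by simp
      next
        case False
        have "(\<Sum>k=1..n. f (X k \<omega>)) = (\<Sum>k<n. f (X (Suc k) \<omega>))"
          using sum.shift_bounds_cl_Suc_ivl[of "\<lambda>k. f (X k \<omega>)" 0 "n - 1"] False by (simp add: lessThan_Suc_atMost[symmetric] atLeast0AtMost)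
        then have "estimator \<kappa> X A f \<beta> n \<omega> = 1 / real n * ((\<Sum>k<n. f (X (Suc k) \<omega>)) + (\<Sum>k<n. ?d k))"
          by (simp add: estimator_def empirical_mean_def correction_def sumk distrib_left)
        then show ?thesis using False by (simp add: Ysum sum_subtractf right_diff_distrib)
      qed
    qed
  qed
  have i: "AE \<omega> in M. (\<lambda>n. estimator \<kappa> X A f \<beta> n \<omega>) \<longlonglongrightarrow> c"
    using lln est
  proof eventually_elim
    case (elim \<omega>)
    have "(\<lambda>n. c + Y n \<omega> / real n) \<longlonglongrightarrow> c + 0" by (intro tendsto_add tendsto_const elim(1))
    then have "(\<lambda>n. c + Y n \<omega> / real n) \<longlonglongrightarrow> c" by simp
    then show ?case
    proof (rule Lim_transform_eventually)
      show "\<forall>\<^sub>F n in sequentially. c + Y n \<omega> / real n = estimator \<kappa> X A f \<beta> n \<omega>"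
        using eventually_gt_at_top[of 0]
      proof eventually_elim
        case (elim n)
        then show ?case using \<open>\<forall>n. _ n = Y n \<omega>\<close>[rule_format, of n, symmetric] by simp
      qed
    qed
  qed
  have ii: "converges_in_law M (\<lambda>n \<omega>. sqrt (real n) * (estimator \<kappa> X A f \<beta> n \<omega> - c)) (centred_normal s)"
    unfolding converges_in_law_def
  proof -
    have Zm: "(\<lambda>\<omega>. Y n \<omega> / sqrt (real n)) \<in> borel_measurable M" for n using Ym by measurable
    have Z: "AE \<omega> in M. sqrt (real n) * (estimator \<kappa> X A f \<beta> n \<omega> - c) = Y n \<omega> / sqrt (real n)" for n
      using est
    proof eventually_elim
      case (elim \<omega>)
      show ?case
      \<comment> \<open>At \<open>n = 0\<close> both sides are 0, by \<open>sqrt 0 = 0\<close> and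
        the convention for division by zero.\<close>
      proof (cases "n = 0")
        case False
        have "Y n \<omega> / sqrt (real n) = (sqrt (real n) * sqrt (real n)) * (estimator \<kappa> X A f \<beta> n \<omega> - c) / sqrt (real n)"
          using elim by simp
        also have "\<dots> = sqrt (real n) * (estimator \<kappa> X A f \<beta> n \<omega> - c)"
          using False by (simp del: real_sqrt_mult_self)
        finally show ?thesis by simp
      qed simp
    qed
    have "weak_conv_m (\<lambda>n. distr M borel (\<lambda>\<omega>. Y n \<omega> / sqrt (real n))) (centred_normal s)"
    proof (rule levy_continuity)
      show "real_distribution (distr M borel (\<lambda>\<omega>. Y n \<omega> / sqrt (real n)))" for n
        by (rule H.MP.real_distribution_distr[OF Zm])
      show "real_distribution (centred_normal s)" by (rule real_distribution_centred_normal[OF s0])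
      fix t
      have "char (distr M borel (\<lambda>\<omega>. Y n \<omega> / sqrt (real n))) t = (\<integral>\<omega>. iexp (t / sqrt (real n) * Y n \<omega>) \<partial>M)" for n
        unfolding char_def by (subst integral_distr[OF Zm]) auto
      then show "(\<lambda>n. char (distr M borel (\<lambda>\<omega>. Y n \<omega> / sqrt (real n))) t) \<longlonglongrightarrow> char (centred_normal s) t"
        using clt[of t] by (simp only: char_centred_normal[OF s0])
    qed
    \<comment> \<open>The estimator is known only to agree almost surely with a measurable variable,
      so its law is taken in the completion, where it is the law of
      \<open>Y n / sqrt n\<close>.\<close>
    then show "weak_conv_m (\<lambda>n. distr (completion M) borel (\<lambda>\<omega>. sqrt (real n) * (estimator \<kappa> X A f \<beta> n \<omega> - c))) (centred_normal s)"
      unfolding distr_completion_AE[OF Zm Z] .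
  qed
  show ?thesis
    using i ii s0 S.control_variate_F S.sigma_sq_control_F_le S.sigma_sq_control_F_eq S.sigma_sq_control_F_le_sigma_sq
    unfolding c_def s_def by blast
qed

end
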